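(* Let $k\ge 12$ be even and put $m=\lfloor\frac{k-4}{4}\rfloor$. Define $$R_{\mathrm{Lie}}=\Big\{(a_1,\dots,a_m)\in\mathbb{Q}^m \;:\; \sum_{i=1}^{m} a_i\{f_{2i+1},f_{k-2i-1}\}\in\mathfrak{ds}_k^3\Big\}$$ and $$R_{\zeta}=\Big\{(q_3,q_5,\dots,q_{k-3})\in\mathbb{Q}^{(k-4)/2} \;:\; \sum_{\substack{r=3\\ r\text{ odd}}}^{k-3} q_r\, Z(r,k-r)\in \mathbb{Q}\cdot Z(k)\ \text{in } \overline{\mathcal{FZ}}\Big\}.$$ Then there is a natural linear bijection $R_{\mathrm{Lie}}\to R_{\zeta}$, given as follows: to $(a_1,\dots,a_m)$ associate $P(X,Y)=\sum_{i=1}^{m}a_i\big(X^{2i}Y^{k-2-2i}-X^{k-2-2i}Y^{2i}\big)$, write $P(X+Y,Y)=\sum_{r=1}^{k-3}\binom{k-2}{r-1}q_{r}X^{r-1}Y^{k-r-1}$, and send $(a_i)$ to $(q_3,q_5,\dots,q_{k-3})$.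
   Context: Let $\mathbb{Q}\langle x,y\rangle$ be the free associative algebra on non-commuting $x,y$, and $\mathrm{Lie}[x,y]\subset\mathbb{Q}\langle x,y\rangle$ the free Lie algebra; $\mathrm{Lie}_{\ge 3}[x,y]$ is the span of its homogeneous parts of degree $\ge 3$. For a polynomial $f$ and a word $w$, $(f\mid w)$ denotes the coefficient of $w$ in $f$, extended linearly in $w$. Writing $y_i=x^{i-1}y$, the stuffle product of words ending in $y$ is defined recursively by $1*w=w*1=w$ and $y_iw*y_jw'=y_i(w*y_jw')+y_j(y_iw*w')+y_{i+j}(w*w')$. The double shuffle Lie algebra is $\mathfrak{ds}=\{f\in\mathrm{Lie}_{\ge3}[x,y]: (f\mid u*v)=0$ for all nonempty words $u,v$ ending in $y$ and not both powers of $y\}$. For $f\in\mathbb{Q}\langle x,y\rangle$, $D_f$ is the derivation with $D_f(x)=0$, $D_f(y)=[y,f]$, and the Poisson bracket is $\{f,g\}=[f,g]+D_f(g)-D_g(f)$; $\mathfrak{ds}$ is a Lie algebra under it. $\mathfrak{ds}_n$ is the part of homogeneous degree $n$; the depth of a polynomial is the minimal number of letters $y$ in a monomial with nonzero coefficient, and $\mathfrak{ds}_n^d$ is the subspace of elements of $\mathfrak{ds}_n$ of depth $\ge d$ (together with $0$). For each odd $n\ge3$ one fixes $f_n\in\mathfrak{ds}_n$ of depth $1$, normalized so that $(f_n\mid x^{n-1}y)=1$ (its depth-1 part is $\mathrm{ad}_x^{n-1}(y)$). Formal double zetas: call a word convergent if it has the form $xvy$ ($v$ any word). Let $\mathfrak{h}^0$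 be the span of the empty word and convergent words; it is a commutative algebra under the shuffle product $\sqcup\!\sqcup$ (recursively $w\sqcup\!\sqcup 1=1\sqcup\!\sqcup w=w$, $su\sqcup\!\sqcup tv=s(u\sqcup\!\sqcup tv)+t(su\sqcup\!\sqcup v)$ for letters $s,t$). Write $Z(w)$ for a word $w$ viewed in $\mathfrak{h}^0$, extended to all words by the unique shuffle-algebra homomorphism $\mathbb{Q}\langle x,y\rangle\to\mathfrak{h}^0$ which is the identity on $\mathfrak{h}^0$ and kills $x$ and $y$ (shuffle regularization). For convergent $w=x^{r_1-1}y\cdots x^{r_d-1}y$ write $Z(r_1,\dots,r_d)=Z(w)$; so $Z(k)=Z(x^{k-1}y)$. Define $Z^*(v)=Z(v)$ for convergent $v$, $\sum_{r\ge0}Z^*(\underbrace{1,\dots,1}_r)T^r=\exp\sum_{r\ge1}\frac{(-1)^{r-1}}{r}Z(x^{r-1}y)T^r$, and $Z^*(y^mv)=\sum_{r=0}^mZ^*(\underbrace{1,\dots,1}_r)Z(y^{m-r}v)$ for convergent $v$, extended linearly. The formal zeta space $\overline{\mathcal{FZ}}$ is the quotient of $\mathfrak{h}^0$ by the subspace spanned by all $Z^*(u)Z^*(v)-Z^*(u*v)$ (products computed by shuffle in $\mathfrak{h}^0$) for words $u,v$ ending in $y$; images are still denoted $Z(\cdot)$. *)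

theory Defs
  imports "HOL-Library.Poly_Mapping" "HOL-Computational_Algebra.Polynomial"
begin

section \<open>The free associative algebra on x, y\<close>

datatype letter = Lx | Ly

text \<open>Concatenation makes lists the free monoid, written additively because
  \<^theory>\<open>HOL-Library.Poly_Mapping\<close> builds its convolution product from an additive monoid of
  keys. Hence \<open>letter list \<Rightarrow>\<^sub>0 rat\<close>, with its ring structure, is the free associative algebra.\<close>

instantiation list :: (type) monoid_add
begin
definition zero_list :: "'a list" where "zero_list = []"
definition plus_list :: "'a list \<Rightarrow> 'a list \<Rightarrow> 'a list" where "plus_list u v = u @ v"
instance by standard (simp_all add: zero_list_def plus_list_def)
end

type_synonym qxy = "letter list \<Rightarrow>\<^sub>0 rat"

abbreviation mono_word :: "letter list \<Rightarrow> qxy" where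
  "mono_word w \<equiv> Poly_Mapping.single w 1"

abbreviation gx :: qxy where "gx \<equiv> mono_word [Lx]"
abbreviation gy :: qxy where "gy \<equiv> mono_word [Ly]"

definition qscale :: "rat \<Rightarrow> ('a \<Rightarrow>\<^sub>0 rat) \<Rightarrow> ('a \<Rightarrow>\<^sub>0 rat)" where
  "qscale c p = Poly_Mapping.map (\<lambda>t. c * t) p"

lemma lookup_qscale [simp]: "Poly_Mapping.lookup (qscale c p) i = c * Poly_Mapping.lookup p i"
  by (simp add: qscale_def map.rep_eq when_def)

global_interpretation qvec: vector_space "qscale :: rat \<Rightarrow> ('a \<Rightarrow>\<^sub>0 rat) \<Rightarrow> ('a \<Rightarrow>\<^sub>0 rat)"
  by standard (rule poly_mapping_eqI; simp add: lookup_add algebra_simps)+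

text \<open>Linear extension of a map given on basis elements.\<close>

definition lin_ext :: "('a \<Rightarrow> ('b \<Rightarrow>\<^sub>0 rat)) \<Rightarrow> ('a \<Rightarrow>\<^sub>0 rat) \<Rightarrow> ('b \<Rightarrow>\<^sub>0 rat)" where
  "lin_ext g p = (\<Sum>w\<in>Poly_Mapping.keys p. qscale (Poly_Mapping.lookup p w) (g w))"

text \<open>\<open>pairing f p\<close> is \<open>(f | p)\<close>: the coefficient in \<open>f\<close>, extended linearly in the second argument.\<close>

definition pairing :: "qxy \<Rightarrow> qxy \<Rightarrow> rat" where
  "pairing f p = (\<Sum>w\<in>Poly_Mapping.keys p. Poly_Mapping.lookup p w * Poly_Mapping.lookup f w)"

definition commutator :: "qxy \<Rightarrow> qxy \<Rightarrow> qxy" where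
  "commutator f g = f * g - g * f"

definition homog :: "nat \<Rightarrow> qxy set" where
  "homog n = {f. \<forall>w\<in>Poly_Mapping.keys f. length w = n}"

inductive_set Lie_xy :: "qxy set" where
  x: "gx \<in> Lie_xy"
| y: "gy \<in> Lie_xy"
| zero: "0 \<in> Lie_xy"
| add: "f \<in> Lie_xy \<Longrightarrow> g \<in> Lie_xy \<Longrightarrow> f + g \<in> Lie_xy"
| scale: "f \<in> Lie_xy \<Longrightarrow> qscale c f \<in> Lie_xy"
| bracket: "f \<in> Lie_xy \<Longrightarrow> g \<in> Lie_xy \<Longrightarrow> commutator f g \<in> Lie_xy"

definition Lie_ge3 :: "qxy set" where
  "Lie_ge3 = qvec.span (\<Union>n\<in>{3..}. Lie_xy \<inter> homog n)"


section \<open>Stuffle product and the double shuffle Lie algebra\<close>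

text \<open>A word ending in y is uniquely \<open>y\<^bsub>r1\<^esub> \<dots> y\<^bsub>rd\<^esub>\<close> with \<open>d \<ge> 1\<close> and all \<open>ri \<ge> 1\<close>, where
  \<open>y\<^bsub>r\<^esub> = x\<^bsup>r-1\<^esup> y\<close>. Such words are indexed by the lists \<open>[r1, \<dots>, rd]\<close>; the powers of y are the
  lists all of whose entries are 1.\<close>

definition y_word :: "nat \<Rightarrow> letter list" where
  "y_word r = replicate (r - 1) Lx @ [Ly]"

definition index_word :: "nat list \<Rightarrow> letter list" where
  "index_word rs = concat (map y_word rs)"

definition is_index :: "nat list \<Rightarrow> bool" where
  "is_index rs \<longleftrightarrow> rs \<noteq> [] \<and> (\<forall>r\<in>set rs. 1 \<le> r)"

fun stuffle :: "nat list \<Rightarrow> nat list \<Rightarrow> qxy" where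
  "stuffle [] ss = mono_word (index_word ss)"
| "stuffle rs [] = mono_word (index_word rs)"
| "stuffle (i # rs) (j # ss) =
     mono_word (y_word i) * stuffle rs (j # ss)
   + mono_word (y_word j) * stuffle (i # rs) ss
   + mono_word (y_word (i + j)) * stuffle rs ss"

definition ds :: "qxy set" where
  "ds = {f \<in> Lie_ge3. \<forall>rs ss. is_index rs \<longrightarrow> is_index ss \<longrightarrow>
           \<not> (set rs \<subseteq> {1} \<and> set ss \<subseteq> {1}) \<longrightarrow> pairing f (stuffle rs ss) = 0}"

definition ds_deg :: "nat \<Rightarrow> qxy set" where
  "ds_deg n = ds \<inter> homog n"

definition depth :: "qxy \<Rightarrow> nat" where
  "depth f = Min ((\<lambda>w. count_list w Ly) ` Poly_Mapping.keys f)"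

definition ds_deg_depth :: "nat \<Rightarrow> nat \<Rightarrow> qxy set" where
  "ds_deg_depth n d = {f \<in> ds_deg n. f = 0 \<or> d \<le> depth f}"

text \<open>\<open>D\<^bsub>f\<^esub>\<close> on words by the Leibniz rule from \<open>D\<^bsub>f\<^esub> x = 0\<close>, \<open>D\<^bsub>f\<^esub> y = [y, f]\<close>, then extended linearly.\<close>

fun deriv_word :: "qxy \<Rightarrow> letter list \<Rightarrow> qxy" where
  "deriv_word f [] = 0"
| "deriv_word f (Lx # w) = gx * deriv_word f w"
| "deriv_word f (Ly # w) = commutator gy f * mono_word w + gy * deriv_word f w"

definition Deriv :: "qxy \<Rightarrow> qxy \<Rightarrow> qxy" where
  "Deriv f = lin_ext (deriv_word f)"

definition poisson :: "qxy \<Rightarrow> qxy \<Rightarrow> qxy" where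
  "poisson f g = commutator f g + Deriv f g - Deriv g f"


section \<open>Formal zeta values\<close>

fun shuffle_word :: "letter list \<Rightarrow> letter list \<Rightarrow> qxy" where
  "shuffle_word [] v = mono_word v"
| "shuffle_word u [] = mono_word u"
| "shuffle_word (s # u) (t # v) =
     mono_word [s] * shuffle_word u (t # v) + mono_word [t] * shuffle_word (s # u) v"

definition shuffle :: "qxy \<Rightarrow> qxy \<Rightarrow> qxy" where
  "shuffle p q = lin_ext (\<lambda>u. lin_ext (shuffle_word u) q) p"

definition convergent_word :: "letter list \<Rightarrow> bool" where
  "convergent_word w \<longleftrightarrow> (\<exists>v. w = Lx # v @ [Ly])"

definition h0 :: "qxy set" where
  "h0 = qvec.span (mono_word ` ({[]} \<union> {w. convergent_word w}))"

text \<open>Shuffle regularization, characterised by its defining universal property. Preservation of the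
  unit is subsumed in being the identity on \<open>h0\<close>.\<close>

definition shuffle_reg :: "qxy \<Rightarrow> qxy" where
  "shuffle_reg = (THE \<phi>. Vector_Spaces.linear qscale qscale \<phi>
      \<and> (\<forall>p q. \<phi> (shuffle p q) = shuffle (\<phi> p) (\<phi> q))
      \<and> range \<phi> \<subseteq> h0 \<and> (\<forall>p\<in>h0. \<phi> p = p) \<and> \<phi> gx = 0 \<and> \<phi> gy = 0)"

definition Z_word :: "letter list \<Rightarrow> qxy" where
  "Z_word w = shuffle_reg (mono_word w)"

abbreviation Z :: "nat list \<Rightarrow> qxy" where
  "Z rs \<equiv> Z_word (index_word rs)"

text \<open>Power series in T with coefficients in the shuffle algebra, as coefficient sequences. As
  \<open>ser_exp\<close> is applied only to series without constant term, the j-th power contributes to degree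
  \<open>n\<close> only for \<open>j \<le> n\<close>.\<close>

definition ser_mult :: "(nat \<Rightarrow> qxy) \<Rightarrow> (nat \<Rightarrow> qxy) \<Rightarrow> (nat \<Rightarrow> qxy)" where
  "ser_mult A B n = (\<Sum>i\<le>n. shuffle (A i) (B (n - i)))"

definition ser_one :: "nat \<Rightarrow> qxy" where
  "ser_one n = (if n = 0 then 1 else 0)"

definition ser_exp :: "(nat \<Rightarrow> qxy) \<Rightarrow> (nat \<Rightarrow> qxy)" where
  "ser_exp A n = (\<Sum>j\<le>n. qscale (1 / fact j) ((ser_mult A ^^ j) ser_one n))"

definition Zstar_ones :: "nat \<Rightarrow> qxy" where
  "Zstar_ones = ser_exp (\<lambda>r. if r = 0 then 0 else qscale ((-1) ^ (r - 1) / of_nat r) (Z [r]))"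

text \<open>\<open>w = y\<^bsup>m\<^esup> v\<close> with \<open>v\<close> empty or starting with x (so convergent if \<open>w\<close> ends in y). For
  convergent \<open>w\<close> we have \<open>m = 0\<close> and the sum reduces to \<open>Z_word w\<close>.\<close>

definition Zstar_word :: "letter list \<Rightarrow> qxy" where
  "Zstar_word w =
     (let m = length (takeWhile (\<lambda>l. l = Ly) w); v = dropWhile (\<lambda>l. l = Ly) w
      in if v = [] then Zstar_ones m
         else \<Sum>r\<le>m. shuffle (Zstar_ones r) (Z_word (replicate (m - r) Ly @ v)))"

definition Zstar :: "qxy \<Rightarrow> qxy" where
  "Zstar = lin_ext Zstar_word"

text \<open>The formal zeta space is \<open>h0\<close> modulo \<open>fz_rel\<close>; \<open>fz_eq\<close> is equality of images in it.\<close>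

definition fz_rel :: "qxy set" where
  "fz_rel = qvec.span
     {shuffle (Zstar (mono_word (index_word rs))) (Zstar (mono_word (index_word ss)))
        - Zstar (stuffle rs ss) | rs ss. is_index rs \<and> is_index ss}"

definition fz_eq :: "qxy \<Rightarrow> qxy \<Rightarrow> bool" where
  "fz_eq p q \<longleftrightarrow> p \<in> h0 \<and> q \<in> h0 \<and> p - q \<in> fz_rel"


section \<open>The two spaces of relations\<close>

text \<open>Coordinate spaces \<open>\<rat>\<^bsup>I\<^esup>\<close> are rendered as finitely supported functions on \<open>nat\<close> with support
  in the index set \<open>I\<close>.\<close>

definition R_Lie :: "(nat \<Rightarrow> qxy) \<Rightarrow> nat \<Rightarrow> (nat \<Rightarrow>\<^sub>0 rat) set" where
  "R_Lie f k = {a. Poly_Mapping.keys a \<subseteq> {1..(k - 4) div 4} \<and>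
     (\<Sum>i = 1..(k - 4) div 4. qscale (Poly_Mapping.lookup a i) (poisson (f (2 * i + 1)) (f (k - 2 * i - 1))))
       \<in> ds_deg_depth k 3}"

definition R_zeta :: "nat \<Rightarrow> (nat \<Rightarrow>\<^sub>0 rat) set" where
  "R_zeta k = {q. Poly_Mapping.keys q \<subseteq> {r \<in> {3..k - 3}. odd r} \<and>
     (\<exists>c. fz_eq (\<Sum>r | r \<in> {3..k - 3} \<and> odd r. qscale (Poly_Mapping.lookup q r) (Z [r, k - r]))
                (qscale c (Z [k])))}"

text \<open>Two-variable polynomials over the rationals: \<open>polX\<close> is the outer and \<open>polY\<close> the inner
  variable.\<close>

abbreviation polX :: "rat poly poly" where "polX \<equiv> [:0, 1:]"
abbreviation polY :: "rat poly poly" where "polY \<equiv> [:[:0, 1:]:]"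
abbreviation polC :: "rat \<Rightarrow> rat poly poly" where "polC c \<equiv> [:[:c:]:]"

definition P_poly :: "nat \<Rightarrow> (nat \<Rightarrow>\<^sub>0 rat) \<Rightarrow> rat poly poly \<Rightarrow> rat poly poly \<Rightarrow> rat poly poly" where
  "P_poly k a U V = (\<Sum>i = 1..(k - 4) div 4. polC (Poly_Mapping.lookup a i) *
      (U ^ (2 * i) * V ^ (k - 2 - 2 * i) - U ^ (k - 2 - 2 * i) * V ^ (2 * i)))"

end

theory Submission
  imports Defs "HOL-Computational_Algebra.Computational_Algebra" "HOL-Library.Product_Plus"
begin

text \<open>A polynomial in three variables encodes the coefficients of an element in depth two. For
  \<open>{f\<^sub>a, f\<^sub>b}\<close> it depends only on the depth one parts \<open>ad\<^sub>x\<^sup>n\<^sup>-\<^sup>1 y\<close>, so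
  \<open>\<Sum> a\<^sub>i {f\<^sub>2\<^sub>i\<^sub>+\<^sub>1, f\<^sub>k\<^sub>-\<^sub>2\<^sub>i\<^sub>-\<^sub>1}\<close> has depth at least three iff
  \<open>P(X - Y, Y) + P(Y, X) - P(X - Y, X) = 0\<close>.

  For such a \<open>P\<close> a combination of double shuffle relations in depth two expresses three times
  the sum over odd \<open>r\<close> of \<open>q\<^sub>r Z(r, k - r)\<close> as the sum over even \<open>r\<close>, up to multiples of
  \<open>Z(k)\<close>, and the latter is a combination of the products \<open>Z(r) Z(k - r)\<close> with \<open>r\<close> even.
  These are multiples of \<open>Z(k)\<close> by the formal version of Euler's theorem. It comes from the
  antipode relation of the shuffle algebra, evaluated on generating series with geometric weights:
  this gives a three-term functional equation with a unique polynomial solution.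

  Conversely \<open>f\<^sub>a f\<^sub>b + D f\<^sub>b\<close> defines a functional on formal zeta values, because a double
  shuffle element acts by a coderivation of the stuffle coproduct; the same fact shows that the
  Poisson bracket preserves the double shuffle space. Pairing a relation among the
  \<open>Z(r, k - r)\<close> with these functionals shows that the defect of the identity for \<open>P\<close> is
  odd, antisymmetric and invariant under \<open>Y \<mapsto> X + Y\<close>, hence zero.\<close>

text \<open>The antipode relation runs over all words, whereas the stuffle product only knows words
  ending in y. Weights that depend on block lengths b through
  \<open>\<Sum> alpha q * u q ^ b\<close> bridge the gap: such a weight splits at every cut of a
  word into a sum over the labels q, and translating the labels so that the last one becomes zero
  removes all words ending in x. What remains is one power series per label. With three labels these
  series can be (1+aX)(1+bX)(1+cX)/((1+dX)(1+eX)); times its reflection this depends on squares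
  only, and for c = 0 the product separates into two factors. The words y^k leave one unknown
  constant, which is compared with the coefficients of X cot X. On the Lie side, \<open>ds\<close>
  says nothing about stuffle products of two powers of y. Adding (f | x^(n-1) y) / n times y^n to f
  repairs this, and the same correction comes out of the exponential in Z*. Odd degree makes f
  palindromic; together with the stuffle relations this gives a cyclic symmetry, which lets the
  coderivation vanish on y_0 = 1.\<close>

abbreviation lk :: "('a \<Rightarrow>\<^sub>0 'b::zero) \<Rightarrow> 'a \<Rightarrow> 'b" where "lk \<equiv> Poly_Mapping.lookup"
abbreviation mon :: "'a \<Rightarrow> ('a \<Rightarrow>\<^sub>0 rat)" where "mon w \<equiv> Poly_Mapping.single w 1"

section \<open>Free algebras: linear maps, homomorphisms and derivations\<close>

section \<open>Linear functionals on free modules\<close>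

definition ev :: "('a \<Rightarrow> rat) \<Rightarrow> ('a \<Rightarrow>\<^sub>0 rat) \<Rightarrow> rat" where
  "ev \<phi> p = (\<Sum>w\<in>Poly_Mapping.keys p. lk p w * \<phi> w)"

lemma ev_superset:
  assumes "finite A" "Poly_Mapping.keys p \<subseteq> A"
  shows "ev \<phi> p = (\<Sum>w\<in>A. lk p w * \<phi> w)"
  unfolding ev_def using assms
  by (intro sum.mono_neutral_left) (auto simp: in_keys_iff)

lemma ev_0 [simp]: "ev \<phi> 0 = 0" by (simp add: ev_def)

lemma ev_single [simp]: "ev \<phi> (Poly_Mapping.single w c) = c * \<phi> w"
  by (subst ev_superset[of "{w}"]) (auto simp: lookup_single)

lemma ev_one [simp]: "ev \<phi> 1 = \<phi> 0"
  by (metis ev_single mult_1 single_one)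

lemma ev_add [simp]: "ev \<phi> (p + q) = ev \<phi> p + ev \<phi> q"
proof -
  let ?A = "Poly_Mapping.keys p \<union> Poly_Mapping.keys q"
  have "ev \<phi> (p + q) = (\<Sum>w\<in>?A. lk (p + q) w * \<phi> w)"
    by (rule ev_superset) (use Poly_Mapping.keys_add[of p q] in auto)
  moreover have "ev \<phi> p = (\<Sum>w\<in>?A. lk p w * \<phi> w)" "ev \<phi> q = (\<Sum>w\<in>?A. lk q w * \<phi> w)"
    by (auto intro!: ev_superset)
  ultimately show ?thesis by (simp add: lookup_add algebra_simps sum.distrib)
qed

lemma ev_qscale [simp]: "ev \<phi> (qscale c p) = c * ev \<phi> p"
proof -
  have "ev \<phi> (qscale c p) = (\<Sum>w\<in>Poly_Mapping.keys p. lk (qscale c p) w * \<phi> w)"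
    by (rule ev_superset) (auto simp: in_keys_iff)
  then show ?thesis by (simp add: ev_def sum_distrib_left mult.assoc)
qed

lemma qscale_minus1: "qscale (-1) p = - p"
  by (rule poly_mapping_eqI) simp

lemma ev_uminus [simp]: "ev \<phi> (- p) = - ev \<phi> p"
  using ev_qscale[of \<phi> "-1" p] by (simp add: qscale_minus1)

lemma ev_diff [simp]: "ev \<phi> (p - q) = ev \<phi> p - ev \<phi> q"
  using ev_add[of \<phi> p "-q"] by simp

lemma ev_sum: "ev \<phi> (\<Sum>i\<in>A. f i) = (\<Sum>i\<in>A. ev \<phi> (f i))"
  by (induction A rule: infinite_finite_induct) auto

lemma ev_cong: "(\<And>w. w \<in> Poly_Mapping.keys p \<Longrightarrow> \<phi> w = \<psi> w) \<Longrightarrow> ev \<phi> p = ev \<psi> p"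
  unfolding ev_def by (rule sum.cong) auto

lemma ev_fun0 [simp]: "ev (\<lambda>w. 0) p = 0" by (simp add: ev_def)
lemma ev_fun_add: "ev (\<lambda>w. \<phi> w + \<psi> w) p = ev \<phi> p + ev \<psi> p"
  by (simp add: ev_def algebra_simps sum.distrib)
lemma ev_fun_cmult: "ev (\<lambda>w. c * \<phi> w) p = c * ev \<phi> p"
  by (simp add: ev_def sum_distrib_left mult.left_commute)
lemma ev_fun_multc: "ev (\<lambda>w. \<phi> w * c) p = ev \<phi> p * c"
  by (simp add: ev_def sum_distrib_right mult.assoc)
lemma ev_fun_sum: "ev (\<lambda>w. \<Sum>i\<in>A. \<phi> i w) p = (\<Sum>i\<in>A. ev (\<phi> i) p)"
  by (induction A rule: infinite_finite_induct) (simp_all add: ev_fun_add)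

lemma ev_delta: "ev (\<lambda>w. if w = v then c w else 0) p = lk p v * c v"
proof -
  have "ev (\<lambda>w. if w = v then c w else 0) p = (\<Sum>w\<in>insert v (Poly_Mapping.keys p). lk p w * (if w = v then c w else 0))"
    by (rule ev_superset) auto
  then show ?thesis by (simp add: if_distrib sum.If_cases sum.delta cong: if_cong)
qed

lemma lk_sum: "lk (\<Sum>i\<in>A. f i) w = (\<Sum>i\<in>A. lk (f i) w)"
  by (induction A rule: infinite_finite_induct) (auto simp: lookup_add)

lemma lk_lin_ext: "lk (lin_ext g p) v = ev (\<lambda>w. lk (g w) v) p"
  by (simp add: lin_ext_def ev_def lk_sum)

lemma ev_lin_ext: "ev \<phi> (lin_ext g p) = ev (\<lambda>w. ev \<phi> (g w)) p"
  by (simp add: lin_ext_def ev_sum) (simp add: ev_def)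

lemma pairing_ev: "pairing f p = ev (lk f) p"
  by (simp add: pairing_def ev_def)

lemma lin_ext_0 [simp]: "lin_ext g 0 = 0" by (simp add: lin_ext_def)
lemma lin_ext_add [simp]: "lin_ext g (p + q) = lin_ext g p + lin_ext g q"
  by (rule poly_mapping_eqI) (simp add: lk_lin_ext lookup_add)
lemma lin_ext_diff [simp]: "lin_ext g (p - q) = lin_ext g p - lin_ext g q"
  by (rule poly_mapping_eqI) (simp add: lk_lin_ext lookup_minus)
lemma lin_ext_uminus [simp]: "lin_ext g (- p) = - lin_ext g p"
  by (rule poly_mapping_eqI) (simp add: lk_lin_ext)
lemma lin_ext_qscale [simp]: "lin_ext g (qscale c p) = qscale c (lin_ext g p)"
  by (rule poly_mapping_eqI) (simp add: lk_lin_ext)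
lemma lin_ext_single [simp]: "lin_ext g (Poly_Mapping.single w c) = qscale c (g w)"
  by (rule poly_mapping_eqI) (simp add: lk_lin_ext)
lemma lin_ext_sum: "lin_ext g (\<Sum>i\<in>A. f i) = (\<Sum>i\<in>A. lin_ext g (f i))"
  by (induction A rule: infinite_finite_induct) auto

lemma qscale_1 [simp]: "qscale 1 p = p" by (rule poly_mapping_eqI) simp
lemma qscale_0 [simp]: "qscale 0 p = 0" "qscale c 0 = 0" by (rule poly_mapping_eqI; simp)+
lemma qscale_qscale [simp]: "qscale a (qscale b p) = qscale (a * b) p"
  by (rule poly_mapping_eqI) simp
lemma qscale_sum: "qscale a (\<Sum>i\<in>A. f i) = (\<Sum>i\<in>A. qscale a (f i))"
  by (rule poly_mapping_eqI) (simp add: lk_sum sum_distrib_left)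
lemma qscale_single: "qscale c (Poly_Mapping.single w d) = Poly_Mapping.single w (c * d)"
  by (rule poly_mapping_eqI) (simp add: lookup_single when_def)

lemma lin_ext_mon [simp]: "lin_ext mon p = p"
  by (rule poly_mapping_eqI) (simp add: lk_lin_ext lookup_single when_def ev_delta)

lemma linear_eq_lin_ext:
  assumes "\<And>p q. F (p + q) = F p + F q" "\<And>c p. F (qscale c p) = qscale c (F p)"
  shows "F p = lin_ext (\<lambda>w. F (mon w)) p"
proof -
  have 0: "F 0 = 0" using assms(2)[of 0 0] by simp
  have s: "F (\<Sum>i\<in>A. g i) = (\<Sum>i\<in>A. F (g i))" for A and g :: "'c \<Rightarrow> _"
    by (induction A rule: infinite_finite_induct) (simp_all add: 0 assms)
  have "F (lin_ext mon p) = lin_ext (\<lambda>w. F (mon w)) p"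
    unfolding lin_ext_def s assms(2) ..
  then show ?thesis by simp
qed

lemma linear_eqI:
  assumes "\<And>p q. F (p + q) = F p + F q" "\<And>c p. F (qscale c p) = qscale c (F p)"
    and "\<And>p q. G (p + q) = G p + G q" "\<And>c p. G (qscale c p) = qscale c (G p)"
    and "\<And>w. F (mon w) = G (mon w)"
  shows "F p = G p"
proof -
  have "F p = lin_ext (\<lambda>w. F (mon w)) p" by (rule linear_eq_lin_ext) (fact assms)+
  also have "\<dots> = lin_ext (\<lambda>w. G (mon w)) p" by (simp only: assms(5))
  also have "\<dots> = G p" by (rule linear_eq_lin_ext[symmetric]) (fact assms)+
  finally show ?thesis .
qed

lemma functional_eq_ev:
  assumes "\<And>p q. L (p + q) = L p + L q" "\<And>c p. L (qscale c p) = c * (L p :: rat)"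
  shows "L p = ev (\<lambda>w. L (mon w)) p"
proof -
  have 0: "L 0 = 0" using assms(2)[of 0 0] by simp
  have s: "L (\<Sum>i\<in>A. g i) = (\<Sum>i\<in>A. L (g i))" for A and g :: "'c \<Rightarrow> _"
    by (induction A rule: infinite_finite_induct) (simp_all add: 0 assms)
  have "L (lin_ext mon p) = ev (\<lambda>w. L (mon w)) p"
    unfolding lin_ext_def s assms(2) ev_def ..
  then show ?thesis by simp
qed

lemma mon_times: "mon u * mon v = mon (u + v)"
  by (simp add: Poly_Mapping.mult_single)

lemma pm_expand: "(\<Sum>w\<in>Poly_Mapping.keys p. Poly_Mapping.single w (lk p w)) = (p :: _ \<Rightarrow>\<^sub>0 rat)"
  using lin_ext_mon[of p] by (simp add: lin_ext_def qscale_single del: lin_ext_mon)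

lemma qscale_eq_mult: "qscale c p = Poly_Mapping.single 0 c * (p :: ('a::monoid_add) \<Rightarrow>\<^sub>0 rat)"
proof -
  have "Poly_Mapping.single 0 c * p = Poly_Mapping.single 0 c * (\<Sum>w\<in>Poly_Mapping.keys p. Poly_Mapping.single w (lk p w))"
    by (simp add: pm_expand)
  also have "\<dots> = qscale c (\<Sum>w\<in>Poly_Mapping.keys p. Poly_Mapping.single w (lk p w))"
    by (simp add: sum_distrib_left qscale_sum qscale_single Poly_Mapping.mult_single)
  finally show ?thesis by (simp add: pm_expand)
qed

lemma qscale_mult_left [simp]: "qscale c p * q = qscale c (p * (q :: ('a::monoid_add) \<Rightarrow>\<^sub>0 rat))"
  by (simp add: qscale_eq_mult mult.assoc)

lemma qscale_mult_right [simp]: "p * qscale c q = qscale c (p * (q :: ('a::monoid_add) \<Rightarrow>\<^sub>0 rat))"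
proof -
  have "p * Poly_Mapping.single 0 c = Poly_Mapping.single 0 c * p"
  proof -
    let ?s = "\<Sum>w\<in>Poly_Mapping.keys p. Poly_Mapping.single w (lk p w)"
    have "?s * Poly_Mapping.single 0 c = Poly_Mapping.single 0 c * ?s"
      by (simp add: sum_distrib_left sum_distrib_right Poly_Mapping.mult_single mult.commute)
    then show ?thesis by (simp add: pm_expand)
  qed
  then show ?thesis by (simp add: qscale_eq_mult flip: mult.assoc)
qed

lemma ev_mult: "ev \<phi> (p * q) = ev (\<lambda>u. ev (\<lambda>v. \<phi> (u + v)) q) (p :: ('a::monoid_add) \<Rightarrow>\<^sub>0 rat)"
proof -
  have "ev \<phi> ((\<Sum>w\<in>Poly_Mapping.keys p. Poly_Mapping.single w (lk p w)) * (\<Sum>w\<in>Poly_Mapping.keys q. Poly_Mapping.single w (lk q w)))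
      = ev (\<lambda>u. ev (\<lambda>v. \<phi> (u + v)) q) p"
    unfolding sum_distrib_left sum_distrib_right ev_sum Poly_Mapping.mult_single ev_single
    by (subst sum.swap) (simp add: ev_def sum_distrib_left mult.assoc)
  then show ?thesis by (simp only: pm_expand)
qed

lemma ev_mon_mult [simp]: "ev \<phi> (mon u * q) = ev (\<lambda>v. \<phi> (u @ v)) q"
  by (simp add: ev_mult plus_list_def)
lemma ev_mult_mon [simp]: "ev \<phi> (q * mon u) = ev (\<lambda>v. \<phi> (v @ u)) q"
  by (simp add: ev_mult plus_list_def)

lemma mon_Nil: "mon [] = 1" by (metis single_one zero_list_def)
lemma mon_append: "mon (u @ v) = mon u * mon v" by (simp add: mon_times plus_list_def)
lemma mon_Cons: "mon (a # w) = mon [a] * mon w" by (simp flip: mon_append)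

lemma lk_conv_ev: "lk p w = ev (\<lambda>v. if v = w then 1 else 0) p"
  by (simp add: ev_delta)
lemma lk_mon_mult_Cons: "lk (mon [a] * p) (b # v) = (if a = b then lk p v else 0)"
  unfolding lk_conv_ev ev_mon_mult by (auto intro!: ev_cong)
lemma lk_mon_mult_Nil: "lk (mon [a] * p) [] = 0"
  unfolding lk_conv_ev ev_mon_mult by simp
lemma lk_mult_mon_snoc: "lk (p * mon [a]) (v @ [b]) = (if a = b then lk p v else 0)"
  unfolding lk_conv_ev ev_mult_mon by (auto intro!: ev_cong)
lemma lk_mult_mon_Nil: "lk (p * mon [a]) [] = 0"
  unfolding lk_conv_ev ev_mult_mon by simp
lemma lk_one: "lk (1 :: 'a list \<Rightarrow>\<^sub>0 rat) w = (if w = [] then 1 else 0)"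
  unfolding mon_Nil[symmetric] by (auto simp: lookup_single when_def)

section \<open>Homomorphisms and derivations of free algebras\<close>

text \<open>The algebra homomorphism with prescribed values on letters; the coproducts
  \<open>Dsh\<close> and \<open>Dst\<close> and the maps \<open>kill0\<close> and
  \<open>iota\<close> are instances.\<close>

definition hm :: "('a \<Rightarrow> 'b::monoid_add \<Rightarrow>\<^sub>0 rat) \<Rightarrow> ('a list \<Rightarrow>\<^sub>0 rat) \<Rightarrow> ('b \<Rightarrow>\<^sub>0 rat)" where
  "hm h = lin_ext (\<lambda>w. prod_list (map h w))"

lemma hm_mult: "hm h (p * q) = hm h p * hm h q"
proof -
  have 1: "hm h (mon u * q) = hm h (mon u) * hm h q" for u
    by (rule linear_eqI[of "\<lambda>q. hm h (mon u * q)" "\<lambda>q. hm h (mon u) * hm h q"])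
       (simp_all add: hm_def algebra_simps flip: mon_append)
  show ?thesis
    by (rule linear_eqI[of "\<lambda>p. hm h (p * q)" "\<lambda>p. hm h p * hm h q"])
       (simp_all add: 1 , simp_all add: hm_def algebra_simps)
qed

lemma hm_lin [simp]:
  "hm h (p + q) = hm h p + hm h q" "hm h (p - q) = hm h p - hm h q" "hm h (- p) = - hm h p"
  "hm h (qscale c p) = qscale c (hm h p)" "hm h 0 = 0" "hm h (mon [a]) = h a" "hm h 1 = 1"
  "hm h (mon []) = 1"
proof -
  show "hm h (mon []) = 1" by (simp add: hm_def)
  then show "hm h 1 = 1" by (simp only: mon_Nil)
qed (simp_all add: hm_def)
lemma hm_mon: "hm h (mon w) = prod_list (map h w)" by (simp add: hm_def)
lemma hm_sum: "hm h (\<Sum>i\<in>A. f i) = (\<Sum>i\<in>A. hm h (f i))"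
  by (simp add: hm_def lin_ext_sum)
text \<open>With \<open>dv\<close> this gives the derivation with prescribed values on letters;
  \<open>DX\<close>, \<open>DD\<close>, \<open>del\<close>, \<open>dx\<close> and, by
  \<open>Deriv_dv\<close>, also \<open>Deriv f\<close> are instances.\<close>

fun dw :: "('a \<Rightarrow> 'a list \<Rightarrow>\<^sub>0 rat) \<Rightarrow> 'a list \<Rightarrow> ('a list \<Rightarrow>\<^sub>0 rat)" where
  "dw d [] = 0"
| "dw d (a # w) = d a * mon w + mon [a] * dw d w"

definition dv :: "('a \<Rightarrow> 'a list \<Rightarrow>\<^sub>0 rat) \<Rightarrow> ('a list \<Rightarrow>\<^sub>0 rat) \<Rightarrow> ('a list \<Rightarrow>\<^sub>0 rat)" where
  "dv d = lin_ext (dw d)"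

lemma dv_lin [simp]:
  "dv d (p + q) = dv d p + dv d q" "dv d (p - q) = dv d p - dv d q" "dv d (- p) = - dv d p"
  "dv d (qscale c p) = qscale c (dv d p)" "dv d 0 = 0" "dv d (mon [a]) = d a" "dv d 1 = 0"
proof -
  show "dv d 1 = 0" unfolding mon_Nil[symmetric] by (simp add: dv_def)
  show "dv d (mon [a]) = d a" by (simp add: dv_def mon_Nil)
qed (simp_all add: dv_def)
lemma dv_mon: "dv d (mon w) = dw d w" by (simp add: dv_def)
lemma dw_append: "dw d (u @ v) = dw d u * mon v + mon u * dw d v"
proof (induction u)
  case (Cons a u)
  then show ?case by (simp add: mon_Cons[of a u] mon_append algebra_simps)
qed (simp add: mon_Nil)

lemma dv_mult: "dv d (p * q) = dv d p * q + p * dv d q"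
proof -
  have 1: "dv d (mon u * q) = dv d (mon u) * q + mon u * dv d q" for u
    by (rule linear_eqI[of "\<lambda>q. dv d (mon u * q)" "\<lambda>q. dv d (mon u) * q + mon u * dv d q"])
       (simp_all add: algebra_simps qvec.scale_right_distrib, simp add: dv_mon dw_append flip: mon_append)
  show ?thesis
    by (rule linear_eqI[of "\<lambda>p. dv d (p * q)" "\<lambda>p. dv d p * q + p * dv d q"])
       (simp_all add: 1 algebra_simps qvec.scale_right_distrib)
qed

section \<open>Formal zeta values: shuffle algebra, regularization, antipode\<close>

section \<open>The shuffle algebra\<close>

lemma lin_ext_fun_add: "lin_ext (\<lambda>w. g w + h w) p = lin_ext g p + lin_ext h p"
  by (rule poly_mapping_eqI) (simp add: lk_lin_ext lookup_add ev_fun_add)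
lemma lin_ext_fun_qscale: "lin_ext (\<lambda>w. qscale c (g w)) p = qscale c (lin_ext g p)"
  by (rule poly_mapping_eqI) (simp add: lk_lin_ext ev_fun_cmult)
lemma lin_ext_fun_0 [simp]: "lin_ext (\<lambda>w. 0) p = 0"
  by (rule poly_mapping_eqI) (simp add: lk_lin_ext)

lemma shuffle_lin [simp]:
  "shuffle (p + p') q = shuffle p q + shuffle p' q" "shuffle p (q + q') = shuffle p q + shuffle p q'"
  "shuffle (qscale c p) q = qscale c (shuffle p q)" "shuffle p (qscale c q) = qscale c (shuffle p q)"
  "shuffle 0 q = 0" "shuffle p 0 = 0"
  by (simp_all add: shuffle_def lin_ext_fun_add lin_ext_fun_qscale)

lemma shuffle_mon: "shuffle (mon u) (mon v) = shuffle_word u v"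
  by (simp add: shuffle_def)

lemma shuffle_word_Nil2 [simp]: "shuffle_word u [] = mon u" by (cases u) auto

lemma shuffle_1 [simp]: "shuffle 1 q = q" "shuffle p 1 = p"
proof -
  have [simp]: "shuffle_word [] = mon" by (rule ext) simp
  show "shuffle 1 q = q" "shuffle p 1 = p"
    by (simp_all add: shuffle_def flip: mon_Nil)
qed

lemma shuffle_Cons: "shuffle (mon [s] * p) (mon [t] * q)
    = mon [s] * shuffle p (mon [t] * q) + mon [t] * shuffle (mon [s] * p) q"
proof -
  have 1: "shuffle (mon [s] * mon u) (mon [t] * q)
    = mon [s] * shuffle (mon u) (mon [t] * q) + mon [t] * shuffle (mon [s] * mon u) q" for u
    by (rule linear_eqI[of "\<lambda>q. shuffle (mon [s] * mon u) (mon [t] * q)"])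
       (simp_all add: algebra_simps qvec.scale_right_distrib shuffle_mon flip: mon_append)
  show ?thesis
    by (rule linear_eqI[of "\<lambda>p. shuffle (mon [s] * p) (mon [t] * q)"])
       (simp_all add: algebra_simps qvec.scale_right_distrib 1)
qed

lemma shuffle_word_commute: "shuffle_word u v = shuffle_word v u"
  by (induction u v rule: shuffle_word.induct) (simp_all add: add.commute)

lemma shuffle_commute: "shuffle p q = shuffle q p"
proof -
  have 1: "shuffle (mon u) q = shuffle q (mon u)" for u
    by (rule linear_eqI[of "\<lambda>q. shuffle (mon u) q"]) (simp_all add: shuffle_mon shuffle_word_commute)
  show ?thesis by (rule linear_eqI[of "\<lambda>p. shuffle p q"]) (simp_all add: 1)
qed

lemma shuffle_word_assoc:
  "length u + length v + length w = n \<Longrightarrow>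
   shuffle (shuffle_word u v) (mon w) = shuffle (mon u) (shuffle_word v w)"
proof (induction n arbitrary: u v w)
  case 0
  then show ?case by (simp add: mon_Nil)
next
  case (Suc n)
  show ?case
  proof (cases "u = [] \<or> v = [] \<or> w = []")
    case True
    then show ?thesis by (auto simp: mon_Nil shuffle_mon)
  next
    case False
    then obtain a u' b v' c w' where [simp]: "u = a # u'" "v = b # v'" "w = c # w'"
      by (metis neq_Nil_conv)
    have I: "shuffle (shuffle_word u' v) (mon w) = shuffle (mon u') (shuffle_word v w)"
      "shuffle (shuffle_word u v') (mon w) = shuffle (mon u) (shuffle_word v' w)"
      "shuffle (shuffle_word u v) (mon w') = shuffle (mon u) (shuffle_word v w')"
      using Suc.prems by (auto intro!: Suc.IH simp del: shuffle_word.simps)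
    have "shuffle (shuffle_word u v) (mon w) =
       mon [a] * shuffle (shuffle_word u' v) (mon w) + mon [b] * shuffle (shuffle_word u v') (mon w)
       + mon [c] * shuffle (shuffle_word u v) (mon w')"
      by (simp add: mon_Cons[of c w'] shuffle_Cons algebra_simps)
    also have "\<dots> = shuffle (mon u) (shuffle_word v w)"
      unfolding I by (simp add: mon_Cons[of a u'] shuffle_Cons algebra_simps)
    finally show ?thesis .
  qed
qed

lemma shuffle_assoc: "shuffle (shuffle p q) r = shuffle p (shuffle q r)"
proof -
  have 1: "shuffle (shuffle (mon u) (mon v)) r = shuffle (mon u) (shuffle (mon v) r)" for u v
    by (rule linear_eqI[of "\<lambda>r. shuffle (shuffle (mon u) (mon v)) r"]) (simp_all add: shuffle_mon shuffle_word_assoc)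
  have 2: "shuffle (shuffle (mon u) q) r = shuffle (mon u) (shuffle q r)" for u
    by (rule linear_eqI[of "\<lambda>q. shuffle (shuffle (mon u) q) r"]) (simp_all add: 1)
  show ?thesis by (rule linear_eqI[of "\<lambda>p. shuffle (shuffle p q) r"]) (simp_all add: 2)
qed

text \<open>A copy of \<open>qxy\<close> whose multiplication is the shuffle product, so that
  commutative ring reasoning applies; the product on \<open>qxy\<close> itself is
  concatenation.\<close>

typedef sha = "UNIV :: qxy set" morphisms unsh Sh ..

lemma Sh_inv [simp]: "unsh (Sh p) = p" "Sh (unsh a) = a"
  by (simp_all add: Sh_inverse unsh_inverse)
lemma Sh_inj [simp]: "Sh p = Sh q \<longleftrightarrow> p = q" by (metis Sh_inv(1))

instantiation sha :: comm_ring_1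
begin
definition "0 = Sh 0"
definition "1 = Sh 1"
definition "a + b = Sh (unsh a + unsh b)"
definition "a - b = Sh (unsh a - unsh b)"
definition "- a = Sh (- unsh a)"
definition "a * b = Sh (shuffle (unsh a) (unsh b))"
instance
  by standard
    (simp_all add: zero_sha_def one_sha_def plus_sha_def minus_sha_def uminus_sha_def times_sha_def
      shuffle_assoc algebra_simps, simp add: shuffle_commute)
end

definition sc :: "rat \<Rightarrow> sha \<Rightarrow> sha" where "sc c a = Sh (qscale c (unsh a))"

lemma Sh_hom: "Sh 0 = 0" "Sh 1 = 1" "Sh (p + q) = Sh p + Sh q" "Sh (p - q) = Sh p - Sh q"
  "Sh (- p) = - Sh p" "Sh (shuffle p q) = Sh p * Sh q" "Sh (qscale c p) = sc c (Sh p)"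
  by (simp_all add: zero_sha_def one_sha_def plus_sha_def minus_sha_def uminus_sha_def times_sha_def sc_def)
lemma unsh_hom: "unsh 0 = 0" "unsh 1 = 1" "unsh (a + b) = unsh a + unsh b" "unsh (a - b) = unsh a - unsh b"
  "unsh (- a) = - unsh a" "unsh (a * b) = shuffle (unsh a) (unsh b)" "unsh (sc c a) = qscale c (unsh a)"
  by (simp_all add: zero_sha_def one_sha_def plus_sha_def minus_sha_def uminus_sha_def times_sha_def sc_def)
lemma Sh_sum: "Sh (\<Sum>i\<in>A. f i) = (\<Sum>i\<in>A. Sh (f i))"
  by (induction A rule: infinite_finite_induct) (auto simp: Sh_hom)
lemma unsh_sum: "unsh (\<Sum>i\<in>A. f i) = (\<Sum>i\<in>A. unsh (f i))"
  by (induction A rule: infinite_finite_induct) (auto simp: unsh_hom)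

lemma sc_simps [simp]: "sc 0 a = 0" "sc 1 a = a" "sc c 0 = 0" "sc c (a + b) = sc c a + sc c b"
  "sc c (a - b) = sc c a - sc c b" "sc c (sc d a) = sc (c * d) a"
  "sc c a * b = sc c (a * b)" "a * sc c b = sc c (a * b)"
  by (simp_all add: sc_def zero_sha_def plus_sha_def minus_sha_def times_sha_def qvec.scale_right_distrib qvec.scale_right_diff_distrib)
lemma sc_minus: "sc (- c) a = - sc c a" "sc c (- a) = - sc c a"
  by (simp_all add: sc_def uminus_sha_def qvec.scale_minus_left qvec.scale_minus_right)
lemma sc_add_left: "sc (c + d) a = sc c a + sc d a"
  by (simp add: sc_def plus_sha_def qvec.scale_left_distrib)
lemma sc_sum: "sc c (\<Sum>i\<in>A. f i) = (\<Sum>i\<in>A. sc c (f i))"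
  by (induction A rule: infinite_finite_induct) auto
lemma sc_of_nat: "of_nat n * a = sc (of_nat n) a"
  by (induction n) (simp_all add: sc_add_left algebra_simps)

text \<open>Truncated Taylor operators: if \<open>d\<close> is a locally nilpotent derivation and \<open>d t = 1\<close>, then
  \<open>p \<mapsto> \<Sum>i. (-t)^i/i! d^i p\<close> is the projection onto \<open>ker d\<close> along the ideal of \<open>t\<close>.\<close>

locale taylor =
  fixes d :: "sha \<Rightarrow> sha" and t :: sha
  assumes d_add: "d (a + b) = d a + d b" and d_sc: "d (sc c a) = sc c (d a)"
    and d_mult: "d (a * b) = d a * b + a * d b" and d_t: "d t = 1"
begin

lemma d_0 [simp]: "d 0 = 0" using d_sc[of 0 0] by simp
lemma d_1 [simp]: "d 1 = 0" using d_mult[of 1 1] by simp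

lemma d_power: "d (t ^ Suc i) = of_nat (Suc i) * t ^ i"
  by (induction i) (simp_all add: d_mult d_t algebra_simps)

lemma d_funpow_0 [simp]: "(d ^^ i) 0 = 0" by (induction i) auto

definition tay :: "nat \<Rightarrow> sha \<Rightarrow> sha" where
  "tay N p = (\<Sum>i\<le>N. sc ((-1) ^ i / fact i) (t ^ i * (d ^^ i) p))"

text \<open>The Leibniz parts of consecutive summands cancel, so only the last one survives; it
  vanishes as soon as the (N+1)-st power of \<open>d\<close> kills \<open>p\<close>.\<close>

lemma d_tay: "d (tay N p) = sc ((-1) ^ N / fact N) (t ^ N * (d ^^ Suc N) p)"
proof (induction N)
  case 0
  then show ?case by (simp add: tay_def)
next
  case (Suc N)
  have e: "(- 1) ^ Suc N / fact (Suc N) * of_nat (Suc N) = - ((- 1) ^ N / fact N :: rat)"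
    by (simp add: fact_Suc field_simps del: of_nat_Suc)
  have "d (tay (Suc N) p) = d (tay N p) + sc ((-1) ^ Suc N / fact (Suc N)) (d (t ^ Suc N * (d ^^ Suc N) p))"
    by (simp add: tay_def d_add d_sc)
  also have "d (t ^ Suc N * (d ^^ Suc N) p) = sc (of_nat (Suc N)) (t ^ N * (d ^^ Suc N) p) + t ^ Suc N * (d ^^ Suc (Suc N)) p"
    by (simp add: d_mult d_power del: power_Suc of_nat_Suc) (simp add: sc_of_nat del: of_nat_Suc)
  finally show ?case
    unfolding Suc.IH sc_simps e by (simp add: sc_minus)
qed

lemma funpow_d_t_mult: "(d ^^ i) (t * p) = t * (d ^^ i) p + of_nat i * (d ^^ (i - 1)) p"
proof (induction i)
  case (Suc i)
  then show ?case
  proof (cases i)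
    case (Suc j)
    have "sc (of_nat (Suc i)) q = q + sc (of_nat i) q" for q
      using sc_add_left[of 1 "of_nat i" q] by (simp add: add.commute)
    with Suc.IH Suc show ?thesis
      by (simp add: d_add d_mult d_t sc_of_nat d_sc algebra_simps del: of_nat_Suc)
  qed (simp add: d_mult d_t)
qed simp

text \<open>Telescopes like \<open>d_tay\<close>; for large \<open>N\<close> it shows that the ideal
  of \<open>t\<close> is mapped to zero.\<close>

lemma tay_t_mult: "tay N (t * p) = sc ((-1) ^ N / fact N) (t ^ Suc N * (d ^^ N) p)"
proof (induction N)
  case (Suc N)
  have e: "(- 1) ^ Suc N / fact (Suc N) * of_nat (Suc N) = - ((- 1) ^ N / fact N :: rat)"
    by (simp add: fact_Suc field_simps del: of_nat_Suc)
  have "tay (Suc N) (t * p) = tay N (t * p) + sc ((-1) ^ Suc N / fact (Suc N)) (t ^ Suc N * (d ^^ Suc N) (t * p))"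
    by (simp add: tay_def)
  also have "t ^ Suc N * (d ^^ Suc N) (t * p) = t ^ Suc (Suc N) * (d ^^ Suc N) p + sc (of_nat (Suc N)) (t ^ Suc N * (d ^^ N) p)"
    unfolding funpow_d_t_mult sc_of_nat by (simp add: algebra_simps)
  finally show ?case
    unfolding Suc.IH sc_simps e by (simp add: sc_minus)
qed (simp add: tay_def)

lemma tay_ideal: "\<exists>q. p = tay N p + t * q"
proof (induction N)
  case 0
  have "p = tay 0 p + t * 0" by (simp add: tay_def)
  then show ?case by blast
next
  case (Suc N)
  then obtain q where q: "p = tay N p + t * q" by blast
  have "p = tay (Suc N) p + t * (q - sc ((-1) ^ Suc N / fact (Suc N)) (t ^ N * (d ^^ Suc N) p))"
    by (subst q) (simp add: tay_def algebra_simps del: funpow.simps)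
  then show ?case by blast
qed

lemma tay_closed: assumes "d p = 0" shows "tay N p = p"
proof (induction N)
  case (Suc N)
  have "(d ^^ Suc N) p = 0" using assms by (simp add: funpow_Suc_right del: funpow.simps)
  with Suc show ?case by (simp add: tay_def)
qed (simp add: tay_def)

end

section \<open>Shuffle regularization\<close>

definition DL :: "'a \<Rightarrow> ('a list \<Rightarrow>\<^sub>0 rat) \<Rightarrow> ('a list \<Rightarrow>\<^sub>0 rat)" where
  "DL l = lin_ext (\<lambda>w. case w of [] \<Rightarrow> 0 | a # w' \<Rightarrow> if a = l then mon w' else 0)"
definition DR :: "'a \<Rightarrow> ('a list \<Rightarrow>\<^sub>0 rat) \<Rightarrow> ('a list \<Rightarrow>\<^sub>0 rat)" where
  "DR l = lin_ext (\<lambda>w. if w \<noteq> [] \<and> last w = l then mon (butlast w) else 0)"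

lemma DL_lin [simp]: "DL l (p + q) = DL l p + DL l q" "DL l (p - q) = DL l p - DL l q"
   "DL l (qscale c p) = qscale c (DL l p)" "DL l 0 = 0" "DL l 1 = 0"
  by (simp_all add: DL_def flip: mon_Nil)
lemma DR_lin [simp]: "DR l (p + q) = DR l p + DR l q" "DR l (p - q) = DR l p - DR l q"
   "DR l (qscale c p) = qscale c (DR l p)" "DR l 0 = 0" "DR l 1 = 0"
  by (simp_all add: DR_def flip: mon_Nil)

lemma DL_Cons [simp]: "DL l (mon [a] * p) = (if a = l then p else 0)"
  by (rule linear_eqI[of "\<lambda>p. DL l (mon [a] * p)"])
     (simp_all add: algebra_simps flip: mon_append, simp add: DL_def)
lemma DR_snoc [simp]: "DR l (p * mon [a]) = (if a = l then p else 0)"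
  by (rule linear_eqI[of "\<lambda>p. DR l (p * mon [a])"])
     (simp_all add: algebra_simps flip: mon_append, simp add: DR_def)

lemma shuffle_word_snoc:
  "shuffle_word (u @ [s]) (v @ [t]) = shuffle_word u (v @ [t]) * mon [s] + shuffle_word (u @ [s]) v * mon [t]"
proof -
  have base: "shuffle_word [s] (v @ [t]) = mon (v @ [t]) * mon [s] + shuffle_word [s] v * mon [t]" for s t :: letter and v
  proof (induction v)
    case (Cons b v)
    then show ?case
      by (simp add: algebra_simps mon_append mon_Cons[of b v] mon_Cons[of b "v @ [t]"] del: mon_times)
  qed simp
  show ?thesis
  proof (induction u v rule: shuffle_word.induct)
    case (1 v) then show ?case by (simp add: base)
  next
    case (2 v va)
    have "shuffle_word (v # va @ [s]) [t] = mon (v # va @ [s]) * mon [t] + shuffle_word (v # va) [t] * mon [s]"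
      using base[of t "v # va" s] by (simp add: shuffle_word_commute)
    then show ?case by simp
  next
    case (3 s t u v)
    then show ?case by (simp add: algebra_simps)
  qed
qed

lemma DL_shuffle: "DL l (shuffle p q) = shuffle (DL l p) q + shuffle p (DL l q)"
proof -
  have D: "DL l (mon w) = (case w of [] \<Rightarrow> 0 | a # w' \<Rightarrow> if a = l then mon w' else 0)" for w :: "letter list"
    by (simp add: DL_def)
  have 0: "DL l (shuffle (mon u) (mon v)) = shuffle (DL l (mon u)) (mon v) + shuffle (mon u) (DL l (mon v))" for u v
    by (cases u; cases v) (auto simp: shuffle_mon mon_Nil D)
  have 1: "DL l (shuffle (mon u) q) = shuffle (DL l (mon u)) q + shuffle (mon u) (DL l q)" for u
    by (rule linear_eqI[of "\<lambda>q. DL l (shuffle (mon u) q)"])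
       (simp_all add: algebra_simps qvec.scale_right_distrib 0)
  show ?thesis
    by (rule linear_eqI[of "\<lambda>p. DL l (shuffle p q)"])
       (simp_all add: algebra_simps qvec.scale_right_distrib 1)
qed

lemma DR_shuffle: "DR l (shuffle p q) = shuffle (DR l p) q + shuffle p (DR l q)"
proof -
  have D: "DR l (mon w) = (if w \<noteq> [] \<and> last w = l then mon (butlast w) else 0)" for w :: "letter list"
    by (simp add: DR_def)
  have 0: "DR l (shuffle (mon u) (mon v)) = shuffle (DR l (mon u)) (mon v) + shuffle (mon u) (DR l (mon v))" for u v
    by (cases u rule: rev_cases; cases v rule: rev_cases) (auto simp: shuffle_mon mon_Nil D shuffle_word_snoc)
  have 1: "DR l (shuffle (mon u) q) = shuffle (DR l (mon u)) q + shuffle (mon u) (DR l q)" for u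
    by (rule linear_eqI[of "\<lambda>q. DR l (shuffle (mon u) q)"])
       (simp_all add: algebra_simps qvec.scale_right_distrib 0)
  show ?thesis
    by (rule linear_eqI[of "\<lambda>p. DR l (shuffle p q)"])
       (simp_all add: algebra_simps qvec.scale_right_distrib 1)
qed

lemma DL_DR: "DL a (DR b p) = DR b (DL a p)"
proof (rule linear_eqI[of "\<lambda>p. DL a (DR b p)"], goal_cases)
  case (5 w)
  consider "w = []" | c where "w = [c]" | c v e where "w = c # v @ [e]"
    by (metis append_butlast_last_id neq_Nil_conv)
  then show ?case
    by cases (auto simp: DL_def DR_def)
qed simp_all

lemma DL_length: "length w < i \<Longrightarrow> (DL l ^^ i) (mon w) = 0"
proof (induction w arbitrary: i)
  case Nil
  have z: "(DL l ^^ j) (0 :: 'a list \<Rightarrow>\<^sub>0 rat) = 0" for j by (induction j) auto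
  from Nil z show ?case by (cases i) (auto simp: funpow_Suc_right mon_Nil simp del: funpow.simps)
next
  case (Cons a w)
  have z: "(DL l ^^ j) (0 :: 'a list \<Rightarrow>\<^sub>0 rat) = 0" for j by (induction j) auto
  from Cons obtain j where [simp]: "i = Suc j" "length w < j" by (cases i) auto
  show ?case using Cons.IH[of j] z by (simp add: funpow_Suc_right mon_Cons[of a w] del: funpow.simps)
qed

lemma DR_length: "length w < i \<Longrightarrow> (DR l ^^ i) (mon w) = 0"
proof (induction w arbitrary: i rule: rev_induct)
  case Nil
  have z: "(DR l ^^ j) (0 :: 'a list \<Rightarrow>\<^sub>0 rat) = 0" for j by (induction j) auto
  from Nil z show ?case by (cases i) (auto simp: funpow_Suc_right mon_Nil simp del: funpow.simps)
next
  case (snoc a w)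
  have z: "(DR l ^^ j) (0 :: 'a list \<Rightarrow>\<^sub>0 rat) = 0" for j by (induction j) auto
  from snoc obtain j where [simp]: "i = Suc j" "length w < j" by (cases i) auto
  show ?case using snoc.IH[of j] z by (simp add: funpow_Suc_right mon_append del: funpow.simps)
qed

locale taylor_nil = taylor +
  assumes nil: "length w < i \<Longrightarrow> (d ^^ i) (Sh (mon w)) = 0"
begin

text \<open>Nilpotency is bounded by the word length, so the truncation order can be chosen word by
  word and one linear map results; on any element it equals \<open>tay N\<close> for large
  \<open>N\<close> (\<open>reg_tay\<close>).\<close>

definition reg :: "sha \<Rightarrow> sha" where
  "reg a = Sh (lin_ext (\<lambda>w. unsh (tay (length w) (Sh (mon w)))) (unsh a))"

lemma reg_lin: "reg (a + b) = reg a + reg b" "reg (sc c a) = sc c (reg a)" "reg (a - b) = reg a - reg b"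
  by (simp_all add: reg_def unsh_hom Sh_hom)

lemma funpow_lin: "(d ^^ i) (a + b) = (d ^^ i) a + (d ^^ i) b" "(d ^^ i) (sc c a) = sc c ((d ^^ i) a)"
  by (induction i) (simp_all add: d_add d_sc)

lemma tay_lin: "tay N (a + b) = tay N a + tay N b" "tay N (sc c a) = sc c (tay N a)"
  by (simp_all add: tay_def funpow_lin algebra_simps sum.distrib sc_sum mult.commute)

definition below :: "nat \<Rightarrow> sha \<Rightarrow> bool" where
  "below N a \<longleftrightarrow> (\<forall>w\<in>Poly_Mapping.keys (unsh a). length w \<le> N)"

lemma ex_below: "\<exists>N. \<forall>M\<ge>N. below M a"
proof -
  have "\<forall>w\<in>Poly_Mapping.keys (unsh a). length w \<le> Max (length ` Poly_Mapping.keys (unsh a))"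
    by (auto intro: Max_ge)
  then show ?thesis unfolding below_def using le_trans by blast
qed

lemma lin_ext_cong: "(\<And>w. w \<in> Poly_Mapping.keys p \<Longrightarrow> g w = h w) \<Longrightarrow> lin_ext g p = lin_ext h p"
  unfolding lin_ext_def by (rule sum.cong) auto

lemma below_nil: assumes "below N a" shows "(d ^^ Suc N) a = 0"
proof -
  have "unsh ((d ^^ Suc N) (Sh p)) = lin_ext (\<lambda>w. unsh ((d ^^ Suc N) (Sh (mon w)))) p" for p
    by (rule linear_eq_lin_ext) (simp_all add: Sh_hom unsh_hom funpow_lin del: funpow.simps)
  from this[of "unsh a"] have "unsh ((d ^^ Suc N) a) = lin_ext (\<lambda>w. unsh ((d ^^ Suc N) (Sh (mon w)))) (unsh a)"
    by simp
  also have "\<dots> = lin_ext (\<lambda>w. 0) (unsh a)"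
    by (rule lin_ext_cong) (use assms in \<open>auto simp: nil below_def unsh_hom simp del: funpow.simps\<close>)
  finally show ?thesis by (metis Sh_hom(1) Sh_inv(2) lin_ext_fun_0)
qed

lemma tay_stable: "length w \<le> N \<Longrightarrow> tay N (Sh (mon w)) = tay (length w) (Sh (mon w))"
proof (induction N)
  case (Suc N)
  show ?case
  proof (cases "length w = Suc N")
    case False
    with Suc.prems have "(d ^^ Suc N) (Sh (mon w)) = 0" by (intro nil) auto
    with False Suc show ?thesis by (simp add: tay_def)
  qed simp
qed simp

lemma reg_tay: assumes "below N a" shows "reg a = tay N a"
proof -
  have *: "unsh (tay N (Sh p)) = lin_ext (\<lambda>w. unsh (tay N (Sh (mon w)))) p" for p
    by (rule linear_eq_lin_ext) (simp_all add: Sh_hom unsh_hom tay_lin)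
  have "reg a = Sh (lin_ext (\<lambda>w. unsh (tay N (Sh (mon w)))) (unsh a))"
    unfolding reg_def by (intro arg_cong[of _ _ Sh] lin_ext_cong) (use assms in \<open>simp add: below_def tay_stable[of _ N]\<close>)
  also have "\<dots> = Sh (unsh (tay N (Sh (unsh a))))" by (rule arg_cong[where f = Sh, OF *[symmetric]])
  finally show ?thesis by (simp only: Sh_inv)
qed

lemma d_reg: "d (reg a) = 0"
proof -
  obtain N where "below N a" using ex_below by blast
  then show ?thesis by (simp add: reg_tay d_tay below_nil del: funpow.simps)
qed

lemma reg_closed: "d a = 0 \<Longrightarrow> reg a = a"
  by (metis ex_below order_refl reg_tay tay_closed)

lemma reg_ideal: "\<exists>q. a = reg a + t * q"
  by (metis ex_below order_refl reg_tay tay_ideal)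

lemma reg_t_mult: "reg (t * a) = 0"
proof -
  obtain N M where N: "below N a" "\<And>K. K \<ge> M \<Longrightarrow> below K (t * a)" using ex_below by (metis order_refl)
  let ?K = "max (Suc N) M"
  have "(d ^^ ?K) a = 0"
  proof -
    have "(d ^^ ?K) a = (d ^^ (?K - Suc N + Suc N)) a" by simp
    also have "\<dots> = 0" unfolding funpow_add o_def below_nil[OF N(1)] by simp
    finally show ?thesis .
  qed
  then show ?thesis using reg_tay[OF N(2)[of ?K]] by (simp add: tay_t_mult)
qed

text \<open>Modulo the ideal of \<open>t\<close> every element equals its regularization. The map
  \<open>reg\<close> kills this ideal and fixes the kernel of \<open>d\<close>, which is closed
  under products.\<close>

lemma reg_hom: "reg (a * b) = reg a * reg b"
proof -
  obtain p q where p: "a = reg a + t * p" and q: "b = reg b + t * q" using reg_ideal by blast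
  have "(reg a + t * p) * (reg b + t * q) = reg a * reg b + t * (p * (reg b + t * q) + reg a * q)"
    by (simp add: algebra_simps)
  then have "a * b = reg a * reg b + t * (p * b + reg a * q)"
    unfolding p[symmetric] q[symmetric] .
  then have "reg (a * b) = reg (reg a * reg b)" by (metis add.right_neutral reg_lin(1) reg_t_mult)
  also have "\<dots> = reg a * reg b" by (rule reg_closed) (simp add: d_mult d_reg)
  finally show ?thesis .
qed

end

definition dyS :: "sha \<Rightarrow> sha" where "dyS a = Sh (DL Ly (unsh a))"
definition rxS :: "sha \<Rightarrow> sha" where "rxS a = Sh (DR Lx (unsh a))"

lemma dyS_funpow: "(dyS ^^ i) (Sh p) = Sh ((DL Ly ^^ i) p)" by (induction i) (auto simp: dyS_def)
lemma rxS_funpow: "(rxS ^^ i) (Sh p) = Sh ((DR Lx ^^ i) p)" by (induction i) (auto simp: rxS_def)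

interpretation ty: taylor_nil dyS "Sh gy"
proof
  show "dyS (Sh gy) = 1" using DL_Cons[of Ly Ly 1] by (simp add: dyS_def Sh_hom)
  show "(dyS ^^ i) (Sh (mon w)) = 0" if "length w < i" for w i
    using DL_length[OF that] by (simp add: dyS_funpow Sh_hom)
qed (simp_all add: dyS_def unsh_hom Sh_hom DL_shuffle)

interpretation tx: taylor_nil rxS "Sh gx"
proof
  show "rxS (Sh gx) = 1" using DR_snoc[of Lx 1 Lx] by (simp add: rxS_def Sh_hom)
  show "(rxS ^^ i) (Sh (mon w)) = 0" if "length w < i" for w i
    using DR_length[OF that] by (simp add: rxS_funpow Sh_hom)
qed (simp_all add: rxS_def unsh_hom Sh_hom DR_shuffle)

definition rS :: "sha \<Rightarrow> sha" where "rS a = tx.reg (ty.reg a)"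

lemma rS_lin: "rS (a + b) = rS a + rS b" "rS (sc c a) = sc c (rS a)" "rS (a - b) = rS a - rS b"
  and rS_hom: "rS (a * b) = rS a * rS b"
  by (simp_all add: rS_def tx.reg_lin ty.reg_lin tx.reg_hom ty.reg_hom)

lemma dyS_gx [simp]: "dyS (Sh gx) = 0" using DL_Cons[of Ly Lx 1] by (simp add: dyS_def Sh_hom)
lemma rxS_gy [simp]: "rxS (Sh gy) = 0" using DR_snoc[of Lx 1 Ly] by (simp add: rxS_def Sh_hom)

lemma tx_reg_gy [simp]: "tx.reg (Sh gy) = Sh gy" by (rule tx.reg_closed) simp
lemma ty_reg_gx [simp]: "ty.reg (Sh gx) = Sh gx" by (rule ty.reg_closed) simp

lemma rS_gy [simp]: "rS (Sh gy * a) = 0" using ty.reg_t_mult[of a] tx.reg_lin(2)[of 0 0] by (simp add: rS_def)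
lemma rS_gx [simp]: "rS (Sh gx * a) = 0" by (simp add: rS_def ty.reg_hom tx.reg_t_mult)

lemma dyS_rxS: "dyS (rxS a) = rxS (dyS a)" by (simp add: dyS_def rxS_def DL_DR)

text \<open>The second regularization does not undo the first: \<open>dyS\<close> commutes with
  \<open>rxS\<close> and kills the letter x, hence passes through every term of
  \<open>tx.tay\<close>.\<close>

lemma dyS_rS: "dyS (rS a) = 0"
proof -
  have e: "dyS (tx.tay N p) = tx.tay N (dyS p)" for N p
  proof -
    have p: "dyS (Sh gx ^ i) = 0" for i
      by (induction i) (simp_all add: ty.d_mult)
    have f: "dyS ((rxS ^^ i) p) = (rxS ^^ i) (dyS p)" for i
      by (induction i) (simp_all add: dyS_rxS)
    have "dyS (\<Sum>i\<in>A. g i) = (\<Sum>i\<in>A. dyS (g i))" for A and g :: "nat \<Rightarrow> sha"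
      by (induction A rule: infinite_finite_induct) (simp_all add: ty.d_add)
    then show ?thesis by (simp add: tx.tay_def ty.d_sc ty.d_mult p f)
  qed
  obtain N where "tx.below N (ty.reg a)" using tx.ex_below by blast
  then have "rS a = tx.tay N (ty.reg a)" unfolding rS_def by (rule tx.reg_tay)
  moreover have "tx.tay N 0 = 0" by (simp add: tx.tay_def)
  ultimately show ?thesis using ty.d_reg[of a] by (simp add: e)
qed

lemma rxS_rS: "rxS (rS a) = 0" by (simp add: rS_def tx.d_reg)

lemma lk_DL: "lk (DL l p) w = lk p (l # w)"
proof -
  have "lk (DL l p) w = ev (\<lambda>v. if v = l # w then 1 else 0) p"
    unfolding DL_def lk_lin_ext by (rule ev_cong) (auto split: list.split simp: lookup_single when_def)
  then show ?thesis by (simp add: ev_delta)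
qed

lemma lk_DR: "lk (DR l p) w = lk p (w @ [l])"
proof -
  have "lk (DR l p) w = ev (\<lambda>v. if v = w @ [l] then 1 else 0) p"
    unfolding DR_def lk_lin_ext
    by (rule ev_cong) (auto simp: lookup_single when_def append_butlast_last_id dest: append_butlast_last_id)
  then show ?thesis by (simp add: ev_delta)
qed

lemma h0_iff: "p \<in> h0 \<longleftrightarrow> DL Ly p = 0 \<and> DR Lx p = 0"
proof
  assume "p \<in> h0"
  then show "DL Ly p = 0 \<and> DR Lx p = 0"
    unfolding h0_def
  proof (induction rule: qvec.span_induct_alt)
    case (step c x y)
    then have "x = mon [] \<or> (\<exists>v. x = mon (Lx # v @ [Ly]))" by (auto simp: convergent_word_def)
    then have "DL Ly x = 0 \<and> DR Lx x = 0" by (auto simp: mon_Nil DL_def DR_def simp flip: mon_Nil)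
    with step show ?case by simp
  qed simp
next
  assume a: "DL Ly p = 0 \<and> DR Lx p = 0"
  have "w = [] \<or> convergent_word w" if "w \<in> Poly_Mapping.keys p" for w
  proof -
    have n: "w \<noteq> Ly # v" "w \<noteq> v @ [Lx]" for v
      using that a lk_DL[of Ly p v] lk_DR[of Lx p v] by (auto simp: in_keys_iff)
    show ?thesis
    proof (cases w)
      case (Cons c u)
      with n(1) have c: "c = Lx" by (cases c) auto
      then obtain u' e where e: "u = u' @ [e]" using n(2)[of "[]"] Cons by (metis append_Nil rev_exhaust)
      then have "e = Ly" using n(2)[of "c # u'"] Cons by (cases e) auto
      then show ?thesis using Cons c e by (auto simp: convergent_word_def)
    qed simp
  qed
  then have "(\<Sum>w\<in>Poly_Mapping.keys p. qscale (lk p w) (mon w)) \<in> h0"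
    unfolding h0_def by (intro qvec.span_sum qvec.span_scale qvec.span_base) auto
  then show "p \<in> h0" using pm_expand[of p] by (simp add: qscale_single)
qed

lemma h0_rS: "unsh (rS a) \<in> h0"
  using dyS_rS[of a] rxS_rS[of a] unfolding h0_iff dyS_def rxS_def
  by (metis Sh_inv(1) unsh_hom(1))

lemma rS_h0: assumes "unsh a \<in> h0" shows "rS a = a"
proof -
  have "dyS a = 0" "rxS a = 0" using assms unfolding h0_iff by (auto simp: dyS_def rxS_def Sh_hom)
  then show ?thesis by (simp add: rS_def ty.reg_closed tx.reg_closed)
qed

text \<open>Uniqueness in the definite description: every element is its image under
  \<open>rS\<close> plus shuffle multiples of x and of y, and every candidate map kills these
  multiples and fixes the image.\<close>

theorem shuffle_reg_rS: "shuffle_reg p = unsh (rS (Sh p))"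
proof -
  let ?R = "\<lambda>p. unsh (rS (Sh p))"
  define Q where "Q \<phi> \<longleftrightarrow> (Vector_Spaces.linear qscale qscale \<phi>
      \<and> (\<forall>p q. \<phi> (shuffle p q) = shuffle (\<phi> p) (\<phi> q))
      \<and> range \<phi> \<subseteq> h0 \<and> (\<forall>p\<in>h0. \<phi> p = p) \<and> \<phi> gx = 0 \<and> \<phi> gy = 0)" for \<phi> :: "qxy \<Rightarrow> qxy"
  have "Q ?R"
    unfolding Q_def
  proof (intro conjI allI ballI)
    show "Vector_Spaces.linear qscale qscale ?R"
      by unfold_locales (simp_all add: Sh_hom rS_lin unsh_hom)
    show "range ?R \<subseteq> h0" using h0_rS by auto
    show "?R p = p" if "p \<in> h0" for p using rS_h0[of "Sh p"] that by simp
    show "?R gx = 0" "?R gy = 0" using rS_gx[of 1] rS_gy[of 1] by (simp_all add: unsh_hom)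
  qed (simp add: Sh_hom rS_hom unsh_hom)
  moreover have "\<phi> = ?R" if "Q \<phi>" for \<phi>
  proof
    fix p
    interpret Vector_Spaces.linear qscale qscale \<phi> using that by (simp add: Q_def)
    note q = that[unfolded Q_def]
    obtain a where a: "Sh p = ty.reg (Sh p) + Sh gy * a" using ty.reg_ideal by blast
    obtain b where b: "ty.reg (Sh p) = tx.reg (ty.reg (Sh p)) + Sh gx * b" using tx.reg_ideal by blast
    from a b have "Sh p = rS (Sh p) + Sh gx * b + Sh gy * a" by (simp add: rS_def)
    then have "p = ?R p + shuffle gx (unsh b) + shuffle gy (unsh a)"
      by (metis Sh_inv(1) unsh_hom(3,6))
    then have "\<phi> p = \<phi> (?R p) + \<phi> (shuffle gx (unsh b)) + \<phi> (shuffle gy (unsh a))"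
      by (metis add)
    with q show "\<phi> p = ?R p" using h0_rS by simp
  qed
  ultimately have "shuffle_reg = ?R" unfolding shuffle_reg_def Q_def[symmetric] by (rule the_equality)
  then show ?thesis by (rule fun_cong)
qed

section \<open>Regularized values of words\<close>

definition Zs :: "letter list \<Rightarrow> sha" where "Zs w = rS (Sh (mon w))"
definition gz :: "nat \<Rightarrow> sha" where "gz r = Sh (Zstar_ones r)"

lemma Z_word_Zs: "Z_word w = unsh (Zs w)"
  by (simp add: Z_word_def shuffle_reg_rS Zs_def)

lemma gz_0 [simp]: "gz 0 = 1"
  by (simp add: gz_def Zstar_ones_def ser_exp_def ser_one_def Sh_hom)

lemma rS_1 [simp]: "rS 1 = 1"
  using rS_h0[of 1] by (simp add: h0_iff unsh_hom)

lemma Zs_Nil [simp]: "Zs [] = 1" by (simp add: Zs_def mon_Nil Sh_hom)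

lemma rS_sum: "rS (\<Sum>i\<in>A. f i) = (\<Sum>i\<in>A. rS (f i))"
  by (induction A rule: infinite_finite_induct) (simp_all add: rS_lin rS_lin(2)[of 0 0, simplified])

text \<open>The case k = 0 is Z* on words. The offset k counts the letters y already stripped, which
  turns the defining sum over the number of leading y into a recursion.\<close>

fun zg :: "nat \<Rightarrow> letter list \<Rightarrow> sha" where
  "zg k [] = gz k"
| "zg k (Lx # w) = gz k * Zs (Lx # w)"
| "zg k (Ly # w) = gz k * Zs (Ly # w) + zg (Suc k) w"

abbreviation zz :: "letter list \<Rightarrow> sha" where "zz \<equiv> zg 0"

definition ZG :: "nat \<Rightarrow> qxy \<Rightarrow> sha" where
  "ZG k p = Sh (lin_ext (\<lambda>w. unsh (zg k w)) p)"

lemma ZG_lin [simp]: "ZG k (p + q) = ZG k p + ZG k q" "ZG k (qscale c p) = sc c (ZG k p)" "ZG k (mon w) = zg k w"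
  by (simp_all add: ZG_def Sh_hom)

lemma linear_sha_eqI:
  assumes "\<And>p q. F (p + q) = F p + F q" "\<And>c p. F (qscale c p) = sc c (F p)"
    and "\<And>p q. G (p + q) = G p + G q" "\<And>c p. G (qscale c p) = sc c (G p)"
    and "\<And>w. F (mon w) = G (mon w)"
  shows "F p = G p"
proof -
  have "unsh (F p) = unsh (G p)"
    by (rule linear_eqI[of "\<lambda>p. unsh (F p)"]) (simp_all add: assms unsh_hom)
  then show ?thesis by (metis Sh_inv(2))
qed

lemma ZG_Ly: "ZG k (gy * p) = gz k * rS (Sh (gy * p)) + ZG (Suc k) p"
  by (rule linear_sha_eqI[of "\<lambda>p. ZG k (gy * p)"])
    (simp_all add: algebra_simps Sh_hom rS_lin flip: mon_append, simp add: Zs_def)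

lemma ZG_Lx: "ZG k (gx * p) = gz k * rS (Sh (gx * p))"
  by (rule linear_sha_eqI[of "\<lambda>p. ZG k (gx * p)"])
    (simp_all add: algebra_simps Sh_hom rS_lin flip: mon_append, simp add: Zs_def)

lemma rS_shuffle_gx [simp]: "rS (Sh (shuffle gx p)) = 0" by (simp add: Sh_hom)
lemma rS_shuffle_gy [simp]: "rS (Sh (shuffle gy p)) = 0" by (simp add: Sh_hom)

lemma shuffle_letter_Cons: "shuffle (mon [l]) (mon (a # w)) = mon [l] * mon (a # w) + mon [a] * shuffle (mon [l]) (mon w)"
  by (simp add: shuffle_mon)

text \<open>Z* still vanishes on every shuffle with x, also for divergent words; this is the
  hypothesis of \<open>wsum_cw_reg\<close>. At a leading y the shuffle either starts with x or keeps
  the y, and in the second case the induction hypothesis for the next offset applies.\<close>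

lemma ZG_shuffle_gx: "ZG k (shuffle gx (mon w)) = 0"
proof (induction w arbitrary: k)
  case Nil
  have "ZG k (gx * 1) = 0" using rS_shuffle_gx[of 1] by (simp only: ZG_Lx) simp
  then show ?case by (simp add: mon_Nil)
next
  case (Cons a w)
  show ?case
  proof (cases a)
    case Lx
    have e: "shuffle gx (mon (a # w)) = gx * (mon (a # w) + shuffle gx (mon w))"
      unfolding shuffle_letter_Cons Lx by (simp add: algebra_simps)
    show ?thesis unfolding e ZG_Lx using rS_shuffle_gx[of "mon (a # w)"] e by simp
  next
    case Ly
    have "ZG k (shuffle gx (mon (a # w))) = gz k * rS (Sh (shuffle gx (mon (a # w))))"
      unfolding shuffle_letter_Cons Ly ZG_lin ZG_Ly ZG_Lx Sh_hom rS_lin Cons.IH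
      by (simp add: algebra_simps)
    then show ?thesis by simp
  qed
qed

lemma zg_sum: "zg k w = (\<Sum>r\<le>length (takeWhile (\<lambda>l. l = Ly) w). gz (k + r) * Zs (drop r w))"
proof (induction k w rule: zg.induct)
  case (3 k w)
  then show ?case by (simp add: sum.atMost_Suc_shift del: sum.atMost_Suc)
qed simp_all

lemma shuffle_y_replicate: "shuffle_word [Ly] (replicate n Ly) = qscale (of_nat (Suc n)) (mon (replicate (Suc n) Ly))"
proof (induction n)
  case (Suc n)
  let ?w = "replicate (Suc (Suc n)) Ly"
  have m: "gy * mon (replicate (Suc n) Ly) = mon ?w" by (simp flip: mon_append)
  have "shuffle_word [Ly] (replicate (Suc n) Ly) = mon ?w + gy * shuffle_word [Ly] (replicate n Ly)"
    by (simp flip: mon_append)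
  also have "\<dots> = qscale (1 + of_nat (Suc n)) (mon ?w)"
    unfolding Suc.IH qscale_mult_right m qvec.scale_left_distrib by simp
  finally show ?case by simp
qed simp

lemma Zs_replicate: "Zs (replicate (Suc n) Ly) = 0"
proof -
  have "sc (of_nat (Suc n)) (Zs (replicate (Suc n) Ly)) = rS (Sh (shuffle gy (mon (replicate n Ly))))"
    by (simp add: shuffle_mon shuffle_y_replicate Sh_hom rS_lin Zs_def del: of_nat_Suc)
  then have "sc (of_nat (Suc n)) (Zs (replicate (Suc n) Ly)) = 0" by simp
  then have "sc (1 / of_nat (Suc n)) (sc (of_nat (Suc n)) (Zs (replicate (Suc n) Ly))) = 0" by simp
  then show ?thesis by (simp del: of_nat_Suc)
qed

lemma zg_replicate: "zg k (replicate n Ly) = gz (k + n)"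
proof (induction n arbitrary: k)
  case (Suc n)
  show ?case using Suc.IH[of "Suc k"] Zs_replicate[of n] by simp
qed simp

lemma Zstar_word_zz: "Zstar_word w = unsh (zz w)"
proof -
  define m where "m = length (takeWhile (\<lambda>l. l = Ly) w)"
  define v where "v = dropWhile (\<lambda>l. l = Ly) w"
  have t: "takeWhile (\<lambda>l. l = Ly) w = replicate m Ly"
    unfolding m_def by (metis (full_types) replicate_length_same set_takeWhileD)
  then have w: "w = replicate m Ly @ v" using takeWhile_dropWhile_id[of "\<lambda>l. l = Ly" w] by (simp add: v_def)
  show ?thesis
  proof (cases "v = []")
    case True
    then show ?thesis using zg_replicate[of 0 m] w
      by (simp add: Zstar_word_def gz_def flip: m_def v_def)
  next
    case False
    have "drop r w = replicate (m - r) Ly @ v" if "r \<le> m" for r using that by (subst w) simp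
    with False show ?thesis
      unfolding zg_sum m_def[symmetric] Zstar_word_def v_def[symmetric] Let_def
      by (simp add: unsh_sum unsh_hom gz_def Z_word_Zs)
  qed
qed

lemma Zstar_ZG: "Zstar p = unsh (ZG 0 p)"
proof -
  have "Zstar_word = (\<lambda>w. unsh (zz w))" by (rule ext) (rule Zstar_word_zz)
  then show ?thesis by (simp add: Zstar_def ZG_def)
qed

lemma sum_atMost_rev: "(\<Sum>i\<le>(n::nat). f i) = (\<Sum>i\<le>n. f (n - i))"
  by (rule sum.reindex_bij_witness[of _ "\<lambda>i. n - i" "\<lambda>i. n - i"]) auto

text \<open>Convolution of F with G composed with the antipode of the shuffle algebra (signed
  reversal of words).\<close>

definition conv :: "(letter list \<Rightarrow> sha) \<Rightarrow> (letter list \<Rightarrow> sha) \<Rightarrow> letter list \<Rightarrow> sha" where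
  "conv F G w = (\<Sum>i\<le>length w. (-1) ^ (length w - i) * (F (take i w) * G (rev (drop i w))))"

lemma conv_rev: "conv F G (rev w) = (-1) ^ length w * conv G F w"
proof -
  let ?n = "length w"
  have "conv F G (rev w) = (\<Sum>i\<le>?n. (-1) ^ (?n - i) * (F (take i (rev w)) * G (rev (drop i (rev w)))))"
    by (simp add: conv_def)
  also have "\<dots> = (\<Sum>i\<le>?n. (-1) ^ i * (F (take (?n - i) (rev w)) * G (rev (drop (?n - i) (rev w)))))"
    by (subst sum_atMost_rev) (auto intro!: sum.cong)
  also have "\<dots> = (\<Sum>i\<le>?n. (-1) ^ ?n * ((-1) ^ (?n - i) * (G (take i w) * F (rev (drop i w)))))"
  proof (rule sum.cong[OF refl])
    fix i assume "i \<in> {..?n}"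
    then obtain j where j: "?n = i + j" using le_Suc_ex by auto
    have "(-1 :: sha) ^ j * (-1) ^ j = 1" by (simp flip: power_mult_distrib)
    then have "(-1 :: sha) ^ i = (-1) ^ ?n * (-1) ^ (?n - i)"
      unfolding j by (simp add: power_add mult.assoc)
    with \<open>i \<in> {..?n}\<close> show "(-1) ^ i * (F (take (?n - i) (rev w)) * G (rev (drop (?n - i) (rev w))))
        = (-1) ^ ?n * ((-1) ^ (?n - i) * (G (take i w) * F (rev (drop i w))))"
      by (simp add: take_rev drop_rev mult_ac)
  qed
  finally show ?thesis by (simp add: conv_def sum_distrib_left)
qed

text \<open>The first letter of each shuffle is the first or the last letter of w. Sorting by it
  leaves the same alternating sum for the two words that arise by removing the first or the last
  letter of w.\<close>

lemma shuffle_antipode: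
  "w \<noteq> [] \<Longrightarrow> (\<Sum>i\<le>length w. qscale ((-1) ^ (length w - i)) (shuffle_word (take i w) (rev (drop i w)))) = 0"
proof (induction "length w" arbitrary: w rule: less_induct)
  case less
  define A where "A w = (\<Sum>i\<le>length w. qscale ((-1) ^ (length w - i)) (shuffle_word (take i w) (rev (drop i w))))" for w
  obtain a m where am: "w = a # m" using less.prems by (cases w) auto
  obtain m' b where bm: "w = m' @ [b]" using less.prems by (cases w rule: rev_cases) auto
  let ?n = "length m"
  have l: "length m' = ?n" using am bm by (metis length_Cons length_append_singleton nat.inject)
  have t: "shuffle_word (take i w) (rev (drop i w)) =
      (if i = 0 then 0 else mon [a] * shuffle_word (take (i - 1) m) (rev (drop (i - 1) m)))
    + (if i = Suc ?n then 0 else mon [b] * shuffle_word (take i m') (rev (drop i m')))" if "i \<le> Suc ?n" for i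
  proof -
    have 1: "take i w = a # take (i - 1) m" "rev (drop i w) = rev (drop (i - 1) m)" if "i \<noteq> 0"
      using that am by (auto simp: take_Cons' drop_Cons')
    have 2: "take i w = take i m'" "rev (drop i w) = b # rev (drop i m')" if "i \<noteq> Suc ?n"
      using that \<open>i \<le> Suc ?n\<close> bm l by auto
    consider "i = 0" | "i = Suc ?n" | "i \<noteq> 0" "i \<noteq> Suc ?n" by blast
    then show ?thesis
    proof cases
      case 1
      have "rev w = b # rev m'" using bm by simp
      with 1 show ?thesis by (simp add: mon_Cons[of b "rev m'"])
    next
      case 2
      then show ?thesis by (simp add: am mon_Cons[of a m])
    next
      case 3
      define U V where "U = take (i - 1) m" and "V = rev (drop i m')"
      have "take i w = a # U" "rev (drop i w) = b # V" "rev (drop (i - 1) m) = b # V" "take i m' = a # U"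
        using 1 2 3 by (auto simp: U_def V_def)
      with 3 show ?thesis by (simp add: V_def[symmetric] U_def[symmetric] del: One_nat_def)
    qed
  qed
  have "A w = (\<Sum>i\<le>Suc ?n. qscale ((-1) ^ (Suc ?n - i)) (if i = 0 then 0 else mon [a] * shuffle_word (take (i - 1) m) (rev (drop (i - 1) m))))
     + (\<Sum>i\<le>Suc ?n. qscale ((-1) ^ (Suc ?n - i)) (if i = Suc ?n then 0 else mon [b] * shuffle_word (take i m') (rev (drop i m'))))"
  proof -
    have "length w = Suc ?n" using am by simp
    then show ?thesis
      unfolding A_def sum.distrib[symmetric] qvec.scale_right_distrib[symmetric]
      by (intro sum.cong) (simp_all only: t atMost_iff)
  qed
  also have "(\<Sum>i\<le>Suc ?n. qscale ((-1) ^ (Suc ?n - i)) (if i = 0 then 0 else mon [a] * shuffle_word (take (i - 1) m) (rev (drop (i - 1) m))))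
      = mon [a] * A m"
    by (subst sum.atMost_Suc_shift) (simp add: A_def sum_distrib_left)
  also have "(\<Sum>i\<le>Suc ?n. qscale ((-1) ^ (Suc ?n - i)) (if i = Suc ?n then 0 else mon [b] * shuffle_word (take i m') (rev (drop i m'))))
      = mon [b] * qscale (-1) (A m')"
  proof -
    have "(\<Sum>i\<le>Suc ?n. qscale ((-1) ^ (Suc ?n - i)) (if i = Suc ?n then 0 else mon [b] * shuffle_word (take i m') (rev (drop i m'))))
       = (\<Sum>i\<le>?n. qscale (-1) (mon [b] * qscale ((-1) ^ (?n - i)) (shuffle_word (take i m') (rev (drop i m')))))"
      by (simp, intro sum.cong) (auto simp: Suc_diff_le)
    then show ?thesis by (simp only: A_def l sum_distrib_left qscale_sum qscale_mult_right)
  qed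
  finally have e: "A w = mon [a] * A m - mon [b] * A m'" by (simp add: qscale_minus1)
  show ?case
  proof (cases "m = []")
    case True
    then have "m' = []" "a = b" using am bm by auto
    with e True show ?thesis by (simp add: A_def)
  next
    case False
    have "A m = 0" using less.hyps[of m] False am by (simp add: A_def)
    moreover have "m' \<noteq> []" using False l by auto
    then have "A m' = 0" using less.hyps[of m'] am l by (simp add: A_def)
    moreover note e
    ultimately show ?thesis by (simp add: A_def)
  qed
qed

lemma neg1_sc: "(-1) ^ n * a = sc ((-1) ^ n) a"
  by (induction n) (simp_all add: sc_minus)

lemma conv_Zs_Zs: "w \<noteq> [] \<Longrightarrow> conv Zs Zs w = 0"
proof -
  assume "w \<noteq> []"
  have "conv Zs Zs w = rS (Sh (\<Sum>i\<le>length w. qscale ((-1) ^ (length w - i)) (shuffle_word (take i w) (rev (drop i w)))))"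
    unfolding conv_def Sh_sum rS_sum neg1_sc
    by (simp add: Sh_hom rS_lin Zs_def rS_hom flip: shuffle_mon)
  also have "\<dots> = rS 0" unfolding shuffle_antipode[OF \<open>w \<noteq> []\<close>] by (simp add: Sh_hom)
  finally show ?thesis using rS_lin(2)[of 0 0] by simp
qed

text \<open>Each leading y splits off a multiple of a convolution of \<open>Zs\<close>, which is
  zero, and raises the offset; at the first x only such a multiple is left. For a power of y the
  recursion would end in \<open>gz\<close> instead, hence the condition on w.\<close>

lemma conv_zg:
  assumes "\<And>v. Lx \<in> set v \<Longrightarrow> conv Zs G v = 0"
  shows "Lx \<in> set w \<Longrightarrow> conv (zg k) G w = 0"
proof (induction w arbitrary: k)
  case (Cons a w)
  have sc': "gz k * conv Zs G (a # w) = (\<Sum>i\<le>Suc (length w). (-1) ^ (Suc (length w) - i) * (gz k * Zs (take i (a # w)) * G (rev (drop i (a # w)))))"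
    by (simp add: conv_def sum_distrib_left mult_ac del: sum.atMost_Suc)
  show ?case
  proof (cases a)
    case Lx
    have "zg k (take i (Lx # w)) = gz k * Zs (take i (Lx # w))" for i by (cases i) auto
    then have "conv (zg k) G (a # w) = gz k * conv Zs G (a # w)" unfolding sc' by (simp add: conv_def Lx)
    then show ?thesis using assms[of "a # w"] Lx by simp
  next
    case Ly
    have z: "zg k (take i (a # w)) = gz k * Zs (take i (a # w)) + (if i = 0 then 0 else zg (Suc k) (take (i - 1) w))" for i
      using Ly by (cases i) auto
    have "conv (zg k) G (a # w) = gz k * conv Zs G (a # w)
        + (\<Sum>i\<le>Suc (length w). (-1) ^ (Suc (length w) - i) * ((if i = 0 then 0 else zg (Suc k) (take (i - 1) w)) * G (rev (drop i (a # w)))))"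
      unfolding sc' sum.distrib[symmetric] by (simp add: conv_def z algebra_simps del: sum.atMost_Suc)
    also have "(\<Sum>i\<le>Suc (length w). (-1) ^ (Suc (length w) - i) * ((if i = 0 then 0 else zg (Suc k) (take (i - 1) w)) * G (rev (drop i (a # w)))))
        = conv (zg (Suc k)) G w"
      by (subst sum.atMost_Suc_shift) (simp add: conv_def)
    finally show ?thesis using Cons Ly assms[of "a # w"] by simp
  qed
qed simp

text \<open>\<open>conv_zg\<close> replaces \<open>Zs\<close> by \<open>zz\<close> in the left
  argument; \<open>conv_rev\<close> exchanges the arguments so that it can be used for both.\<close>

lemma conv_zz_zz: assumes "Lx \<in> set w" shows "conv zz zz w = 0"
proof (rule conv_zg[OF _ assms])
  fix v :: "letter list" assume v: "Lx \<in> set v"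
  have "conv zz Zs (rev v) = 0"
    by (rule conv_zg) (use v in \<open>auto intro!: conv_Zs_Zs\<close>)
  then have "(-1) ^ length v * conv Zs zz v = 0" by (simp add: conv_rev)
  then have "(-1) ^ length v * ((-1) ^ length v * conv Zs zz v) = 0" by simp
  then show "conv Zs zz v = 0" by (simp flip: mult.assoc power_mult_distrib)
qed

section \<open>Formal Euler theorem: weighted sums of the antipode relation\<close>

section \<open>Sums over words and over compositions\<close>

fun wsum :: "nat \<Rightarrow> (letter list \<Rightarrow> 'v::comm_monoid_add) \<Rightarrow> 'v" where
  "wsum 0 \<phi> = \<phi> []"
| "wsum (Suc n) \<phi> = wsum n (\<lambda>w. \<phi> (Lx # w)) + wsum n (\<lambda>w. \<phi> (Ly # w))"

lemma wsum_cong: "(\<And>w. length w = n \<Longrightarrow> \<phi> w = \<psi> w) \<Longrightarrow> wsum n \<phi> = wsum n \<psi>"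
proof (induction n arbitrary: \<phi> \<psi>)
  case (Suc n)
  have "wsum n (\<lambda>w. \<phi> (a # w)) = wsum n (\<lambda>w. \<psi> (a # w))" for a using Suc.prems by (intro Suc.IH) auto
  then show ?case by simp
qed simp

lemma wsum_0 [simp]: "wsum n (\<lambda>w. 0) = 0" by (induction n) auto
lemma wsum_add: "wsum n (\<lambda>w. \<phi> w + \<psi> w) = wsum n \<phi> + wsum n \<psi>"
  by (induction n arbitrary: \<phi> \<psi>) (auto simp: add_ac)
lemma wsum_mult_left: "wsum n (\<lambda>w. c * \<phi> w) = c * wsum n (\<phi> :: _ \<Rightarrow> 'v::comm_ring_1)"
  by (induction n arbitrary: \<phi>) (auto simp: algebra_simps)
lemma wsum_sum: "wsum n (\<lambda>w. \<Sum>i\<in>A. \<phi> i w) = (\<Sum>i\<in>A. wsum n (\<phi> i))"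
  by (induction A rule: infinite_finite_induct) (auto simp: wsum_add)
lemma wsum_hom: "h (0::'v::comm_monoid_add) = (0::'u::comm_monoid_add) \<Longrightarrow> (\<And>x y. h (x + y) = h x + h y) \<Longrightarrow> h (wsum n \<phi>) = wsum n (\<lambda>w. h (\<phi> w))"
  by (induction n arbitrary: \<phi>) auto
lemma wsum_append: "wsum (m + n) \<phi> = wsum m (\<lambda>u. wsum n (\<lambda>v. \<phi> (u @ v)))"
  by (induction m arbitrary: \<phi>) auto
lemma wsum_rev: "wsum n (\<lambda>w. \<phi> (rev w)) = wsum n \<phi>"
proof (induction n arbitrary: \<phi>)
  case (Suc n)
  have "wsum (n + 1) \<phi> = wsum n (\<lambda>u. \<phi> (u @ [Lx]) + \<phi> (u @ [Ly]))"
    by (subst wsum_append) simp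
  then show ?case using Suc.IH[of "\<lambda>u. \<phi> (u @ [Lx])"] Suc.IH[of "\<lambda>u. \<phi> (u @ [Ly])"] by (simp add: wsum_add)
qed simp
lemma wsum_replicate: "wsum n (\<lambda>w. if Lx \<in> set w then 0 else \<phi> w) = \<phi> (replicate n Ly)"
  by (induction n arbitrary: \<phi>) auto

text \<open>Sum over the compositions of k, peeled off by the first part. Compositions of k index
  the words of length k that are empty or end in y.\<close>

fun isum :: "nat \<Rightarrow> (nat list \<Rightarrow> 'v::comm_monoid_add) \<Rightarrow> 'v" where
  "isum 0 \<phi> = \<phi> []"
| "isum (Suc k) \<phi> = (\<Sum>m\<le>k. isum (k - m) (\<lambda>rs. \<phi> (Suc m # rs)))"

declare isum.simps(2) [simp del]

lemma isum_rec: "isum k \<phi> = (if k = 0 then \<phi> [] else 0) + (\<Sum>m\<in>{1..k}. isum (k - m) (\<lambda>rs. \<phi> (m # rs)))"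
proof (cases k)
  case (Suc j)
  have "(\<Sum>m\<in>{1..Suc j}. isum (Suc j - m) (\<lambda>rs. \<phi> (m # rs))) = (\<Sum>m\<le>j. isum (j - m) (\<lambda>rs. \<phi> (Suc m # rs)))"
    by (rule sum.reindex_bij_witness[of _ Suc "\<lambda>m. m - 1"]) auto
  with Suc show ?thesis by (simp add: isum.simps(2))
qed simp

lemma isum_cong:
  "(\<And>rs. sum_list rs = k \<Longrightarrow> \<forall>r\<in>set rs. 1 \<le> r \<Longrightarrow> \<phi> rs = \<psi> rs) \<Longrightarrow> isum k \<phi> = isum k \<psi>"
proof (induction k arbitrary: \<phi> \<psi> rule: less_induct)
  case (less k)
  have "isum (k - m) (\<lambda>rs. \<phi> (m # rs)) = isum (k - m) (\<lambda>rs. \<psi> (m # rs))" if "m \<in> {1..k}" for m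
    using that by (intro less.IH less.prems) auto
  then show ?case using less.prems[of "[]"] by (subst (1 2) isum_rec) (auto intro!: sum.cong)
qed

lemma isum_0 [simp]: "isum k (\<lambda>w. 0) = 0"
proof (induction k rule: less_induct)
  case (less k) then show ?case by (subst isum_rec) simp
qed
lemma isum_add: "isum k (\<lambda>w. \<phi> w + \<psi> w) = isum k \<phi> + isum k \<psi>"
proof (induction k arbitrary: \<phi> \<psi> rule: less_induct)
  case (less k) then show ?case by (subst (1 2 3) isum_rec) (simp add: sum.distrib add_ac)
qed
lemma isum_mult_left: "isum k (\<lambda>w. c * \<phi> w) = c * isum k (\<phi> :: _ \<Rightarrow> 'v::comm_ring_1)"
proof (induction k arbitrary: \<phi> rule: less_induct)
  case (less k) then show ?case by (subst (1 2) isum_rec) (simp add: sum_distrib_left algebra_simps)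
qed
lemma isum_sum: "isum k (\<lambda>w. \<Sum>i\<in>A. \<phi> i w) = (\<Sum>i\<in>A. isum k (\<phi> i))"
  by (induction A rule: infinite_finite_induct) (auto simp: isum_add)

definition psum :: "nat \<Rightarrow> (nat list \<Rightarrow> nat list \<Rightarrow> 'v::comm_monoid_add) \<Rightarrow> 'v" where
  "psum k \<psi> = (\<Sum>i\<le>k. isum i (\<lambda>rs. isum (k - i) (\<lambda>ss. \<psi> rs ss)))"

lemma psum_add: "psum k (\<lambda>rs ss. \<phi> rs ss + \<psi> rs ss) = psum k \<phi> + psum k \<psi>"
  by (simp add: psum_def isum_add sum.distrib)
lemma psum_mult_left: "psum k (\<lambda>rs ss. c * \<psi> rs ss) = c * psum k (\<psi> :: _ \<Rightarrow> _ \<Rightarrow> 'v::comm_ring_1)"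
  by (simp add: psum_def isum_mult_left sum_distrib_left)

lemma sum_triangle: "(\<Sum>i\<le>(k::nat). \<Sum>m\<in>{1..i}. h m (i - m) (k - i)) = (\<Sum>m\<in>{1..k}. \<Sum>i\<le>k - m. h m i (k - m - i))"
proof -
  have "(\<Sum>i\<le>k. \<Sum>m\<in>{1..i}. h m (i - m) (k - i)) = (\<Sum>(i, m)\<in>(SIGMA i:{..k}. {1..i}). h m (i - m) (k - i))"
    by (simp add: sum.Sigma)
  also have "\<dots> = (\<Sum>(m, i)\<in>(SIGMA m:{1..k}. {..k - m}). h m i (k - m - i))"
    by (rule sum.reindex_bij_witness[of _ "\<lambda>(m, i). (i + m, m)" "\<lambda>(i, m). (m, i - m)"]) auto
  finally show ?thesis by (simp add: sum.Sigma)
qed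

lemma psum_peel1: "psum k (\<lambda>rs ss. case rs of [] \<Rightarrow> 0 | m # rs' \<Rightarrow> f m rs' ss) = (\<Sum>m\<in>{1..k}. psum (k - m) (f m))"
proof -
  have *: "isum i (\<lambda>rs. isum (k - i) (\<lambda>ss. case rs of [] \<Rightarrow> 0 | m # rs' \<Rightarrow> f m rs' ss))
     = (\<Sum>m\<in>{1..i}. isum (i - m) (\<lambda>rs. isum (k - i) (\<lambda>ss. f m rs ss)))" for i
    by (subst isum_rec) simp
  show ?thesis
    unfolding psum_def * by (rule sum_triangle[of "\<lambda>m i j. isum i (\<lambda>rs. isum j (\<lambda>ss. f m rs ss))"])
qed

lemma isum_swap: "isum a (\<lambda>rs. isum b (\<lambda>ss. \<psi> rs ss)) = isum b (\<lambda>ss. isum a (\<lambda>rs. \<psi> rs ss))"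
proof (induction a arbitrary: \<psi> rule: less_induct)
  case (less a)
  have "isum a (\<lambda>rs. isum b (\<lambda>ss. \<psi> rs ss))
     = (if a = 0 then isum b (\<lambda>ss. \<psi> [] ss) else 0) + (\<Sum>m\<in>{1..a}. isum b (\<lambda>ss. isum (a - m) (\<lambda>rs. \<psi> (m # rs) ss)))"
    by (subst isum_rec) (auto intro!: sum.cong arg_cong2[of _ _ _ _ "(+)"] less)
  also have "\<dots> = isum b (\<lambda>ss. (if a = 0 then \<psi> [] ss else 0) + (\<Sum>m\<in>{1..a}. isum (a - m) (\<lambda>rs. \<psi> (m # rs) ss)))"
    by (simp add: isum_add isum_sum)
  also have "\<dots> = isum b (\<lambda>ss. isum a (\<lambda>rs. \<psi> rs ss))"
    by (subst (3) isum_rec) simp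
  finally show ?case .
qed

lemma psum_swap: "psum k (\<lambda>rs ss. \<psi> ss rs) = psum k \<psi>"
  unfolding psum_def
proof (subst sum_atMost_rev, rule sum.cong[OF refl])
  fix i assume "i \<in> {..k}"
  then have i: "k - (k - i) = i" by simp
  show "isum (k - i) (\<lambda>rs. isum (k - (k - i)) (\<lambda>ss. \<psi> ss rs)) = isum i (\<lambda>rs. isum (k - i) (\<psi> rs))"
    unfolding i by (rule isum_swap)
qed

lemma psum_peel2: "psum k (\<lambda>rs ss. case ss of [] \<Rightarrow> 0 | m # ss' \<Rightarrow> f m rs ss') = (\<Sum>m\<in>{1..k}. psum (k - m) (f m))"
  using psum_peel1[of k "\<lambda>m rs ss. f m ss rs"]
    psum_swap[of k "\<lambda>rs ss. case rs of [] \<Rightarrow> 0 | m # rs' \<Rightarrow> f m ss rs'"]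
  by (simp add: psum_swap[of _ "\<lambda>rs ss. f m rs ss" for m])

fun st :: "(nat list \<Rightarrow> 'v::comm_monoid_add) \<Rightarrow> nat list \<Rightarrow> nat list \<Rightarrow> 'v" where
  "st \<phi> [] ss = \<phi> ss"
| "st \<phi> rs [] = \<phi> rs"
| "st \<phi> (i # rs) (j # ss) = st (\<lambda>ts. \<phi> (i # ts)) rs (j # ss) + st (\<lambda>ts. \<phi> (j # ts)) (i # rs) ss
     + st (\<lambda>ts. \<phi> ((i + j) # ts)) rs ss"

lemma st_Nil2 [simp]: "st \<phi> rs [] = \<phi> rs" by (cases rs) auto

lemma ev_stuffle: "ev \<phi> (stuffle rs ss) = st (\<lambda>ts. \<phi> (index_word ts)) rs ss"
  by (induction rs ss arbitrary: \<phi> rule: stuffle.induct) (simp_all add: index_word_def)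

definition mlt :: "rat fps \<Rightarrow> nat list \<Rightarrow> rat" where "mlt R ts = prod_list (map (fps_nth R) ts)"
lemma mlt_simps [simp]: "mlt R [] = 1" "mlt R (t # ts) = fps_nth R t * mlt R ts"
  by (simp_all add: mlt_def)

lemma isum_psum_0: "psum k (\<lambda>rs ss. if rs = [] \<and> ss = [] then c rs ss else 0) = (if k = 0 then c [] [] else (0::rat))"
proof -
  have e: "isum j (\<lambda>ss. if ss = [] then d ss else (0::rat)) = (if j = 0 then d [] else 0)" for j and d :: "nat list \<Rightarrow> rat"
    by (subst isum_rec) simp
  have "isum i (\<lambda>rs. isum (k - i) (\<lambda>ss. if rs = [] \<and> ss = [] then c rs ss else 0)) = (if i = 0 \<and> k = 0 then c [] [] else 0)" if "i \<le> k" for i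
    using that by (subst isum_rec) (simp add: e)
  then show ?thesis by (simp add: psum_def)
qed

text \<open>Peel off the first letter m of the stuffle product. Its three origins carry the weights
  R_m, R'_m and the sum of R_i R'_(m-i) over 0 < i < m, which add up to the coefficient of R R'
  because both constant terms are 1.\<close>

theorem psum_st:
  assumes "fps_nth R 0 = 1" "fps_nth R' 0 = 1"
  shows "psum k (\<lambda>rs ss. mlt R rs * mlt R' ss * st \<phi> rs ss) = isum k (\<lambda>ts. mlt (R * R') ts * \<phi> ts)"
proof (induction k arbitrary: \<phi> rule: less_induct)
  case (less k)
  define g where "g \<phi> k = psum k (\<lambda>rs ss. mlt R rs * mlt R' ss * st \<phi> rs ss)" for \<phi> k
  let ?c = "\<lambda>m ts. \<phi> (m # ts)"
  have e: "mlt R rs * mlt R' ss * st \<phi> rs ss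
    = (if rs = [] \<and> ss = [] then \<phi> [] else 0)
    + (case rs of [] \<Rightarrow> 0 | i # rs' \<Rightarrow> fps_nth R i * (mlt R rs' * mlt R' ss * st (?c i) rs' ss))
    + (case ss of [] \<Rightarrow> 0 | j # ss' \<Rightarrow> fps_nth R' j * (mlt R rs * mlt R' ss' * st (?c j) rs ss'))
    + (case rs of [] \<Rightarrow> 0 | i # rs' \<Rightarrow> (case ss of [] \<Rightarrow> 0 | j # ss' \<Rightarrow>
        fps_nth R i * fps_nth R' j * (mlt R rs' * mlt R' ss' * st (?c (i + j)) rs' ss')))" for rs ss
    by (cases rs; cases ss) (simp_all add: algebra_simps)
  have p3: "psum k (\<lambda>rs ss. case rs of [] \<Rightarrow> 0 | i # rs' \<Rightarrow> (case ss of [] \<Rightarrow> 0 | j # ss' \<Rightarrow>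
        fps_nth R i * fps_nth R' j * (mlt R rs' * mlt R' ss' * st (?c (i + j)) rs' ss')))
     = (\<Sum>m\<in>{1..k}. (\<Sum>i\<in>{1..<m}. fps_nth R i * fps_nth R' (m - i)) * g (?c m) (k - m))"
  proof -
    have "psum k (\<lambda>rs ss. case rs of [] \<Rightarrow> 0 | i # rs' \<Rightarrow> (case ss of [] \<Rightarrow> 0 | j # ss' \<Rightarrow>
        fps_nth R i * fps_nth R' j * (mlt R rs' * mlt R' ss' * st (?c (i + j)) rs' ss')))
      = (\<Sum>i\<in>{1..k}. \<Sum>j\<in>{1..k - i}. fps_nth R i * fps_nth R' j * g (?c (i + j)) (k - i - j))"
      by (simp only: psum_peel1 psum_peel2 psum_mult_left g_def)
    also have "\<dots> = (\<Sum>(i, j)\<in>(SIGMA i:{1..k}. {1..k - i}). fps_nth R i * fps_nth R' j * g (?c (i + j)) (k - i - j))"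
      by (simp add: sum.Sigma)
    also have "\<dots> = (\<Sum>(m, i)\<in>(SIGMA m:{1..k}. {1..<m}). fps_nth R i * fps_nth R' (m - i) * g (?c m) (k - m))"
      by (rule sum.reindex_bij_witness[of _ "\<lambda>(m, i). (i, m - i)" "\<lambda>(i, j). (i + j, i)"]) auto
    finally show ?thesis by (simp add: sum.Sigma sum_distrib_right)
  qed
  have c: "fps_nth (R * R') m = fps_nth R m + fps_nth R' m + (\<Sum>i\<in>{1..<m}. fps_nth R i * fps_nth R' (m - i))" if "m \<ge> 1" for m
  proof -
    have "{0..m} = insert 0 (insert m {1..<m})" using that by auto
    then show ?thesis using that assms by (simp add: fps_mult_nth)
  qed
  have "g \<phi> k = (if k = 0 then \<phi> [] else 0) + (\<Sum>m\<in>{1..k}. fps_nth R m * g (?c m) (k - m))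
      + (\<Sum>m\<in>{1..k}. fps_nth R' m * g (?c m) (k - m))
      + (\<Sum>m\<in>{1..k}. (\<Sum>i\<in>{1..<m}. fps_nth R i * fps_nth R' (m - i)) * g (?c m) (k - m))"
    unfolding g_def[of \<phi>] e psum_add isum_psum_0 p3
    by (simp only: psum_peel1 psum_peel2 psum_mult_left g_def)
  also have "\<dots> = (if k = 0 then \<phi> [] else 0) + (\<Sum>m\<in>{1..k}. fps_nth (R * R') m * g (?c m) (k - m))"
    by (simp add: c distrib_right sum.distrib)
  also have "(\<Sum>m\<in>{1..k}. fps_nth (R * R') m * g (?c m) (k - m))
      = (\<Sum>m\<in>{1..k}. isum (k - m) (\<lambda>ts. mlt (R * R') (m # ts) * \<phi> (m # ts)))"
  proof (rule sum.cong[OF refl])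
    fix m assume "m \<in> {1..k}"
    then have "g (?c m) (k - m) = isum (k - m) (\<lambda>ts. mlt (R * R') ts * \<phi> (m # ts))"
      unfolding g_def by (intro less.IH) auto
    then show "fps_nth (R * R') m * g (?c m) (k - m) = isum (k - m) (\<lambda>ts. mlt (R * R') (m # ts) * \<phi> (m # ts))"
      by (simp add: mult.assoc isum_mult_left)
  qed
  also have "(if k = 0 then \<phi> [] else 0) + \<dots> = isum k (\<lambda>ts. mlt (R * R') ts * \<phi> ts)"
    by (subst (2) isum_rec) simp
  finally show ?case by (simp add: g_def)
qed

section \<open>Weights on words\<close>

text \<open>A block of b letters x closed by a y weighs \<open>T b\<close>, the open block at the
  end weighs \<open>l b\<close>; the number argument counts the x already read in the current
  block.\<close>

fun cw :: "(nat \<Rightarrow> 'v::comm_ring_1) \<Rightarrow> (nat \<Rightarrow> 'v) \<Rightarrow> nat \<Rightarrow> letter list \<Rightarrow> 'v" where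
  "cw T l b [] = l b"
| "cw T l b (Lx # w) = cw T l (Suc b) w"
| "cw T l b (Ly # w) = T b * cw T l 0 w"

lemma cw_append: "cw T l b (v @ w) = cw T (\<lambda>m. cw T l m w) b v"
  by (induction T l b v rule: cw.induct) auto
lemma cw_sum: "cw T (\<lambda>m. \<Sum>q\<in>A. g q m) b w = (\<Sum>q\<in>A. cw T (g q) b w)"
  by (induction w arbitrary: b rule: list.induct) (simp, rename_tac a w b, case_tac a, simp_all add: sum_distrib_left)
lemma cw_mult: "cw T (\<lambda>m. c * g m) b w = c * cw T g b w"
  by (induction w arbitrary: b rule: list.induct) (simp, rename_tac a w b, case_tac a, simp_all add: algebra_simps)
lemma cw_replicate: "cw T T 0 (replicate k Ly) = T 0 ^ Suc k"
  by (induction k) auto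

lemma cw_rev:
  fixes \<alpha> u :: "nat \<Rightarrow> 'v::comm_ring_1" and Q :: "nat set"
  defines "T \<equiv> \<lambda>b::nat. \<Sum>q\<in>Q. \<alpha> q * u q ^ b"
  shows "cw T (\<lambda>j. \<Sum>q\<in>Q. \<alpha> q * u q ^ (j + i)) m (rev v) = (\<Sum>q\<in>Q. \<alpha> q * u q ^ m * cw T (\<lambda>b. u q ^ b) i v)"
proof (induction v arbitrary: i m)
  case Nil
  then show ?case by (simp add: power_add mult.assoc)
next
  case (Cons a v)
  show ?case
  proof (cases a)
    case Lx
    then show ?thesis using Cons.IH[where i = "Suc i"] by (simp add: cw_append)
  next
    case Ly
    have "cw T (\<lambda>j. \<Sum>q\<in>Q. \<alpha> q * u q ^ (j + i)) m (rev (a # v)) = cw T (\<lambda>j. T i * T j) m (rev v)"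
      by (simp add: cw_append Ly) (simp add: T_def mult.commute)
    also have "\<dots> = T i * cw T T m (rev v)" by (rule cw_mult)
    also have "cw T T m (rev v) = (\<Sum>q\<in>Q. \<alpha> q * u q ^ m * cw T (\<lambda>b. u q ^ b) 0 v)"
      using Cons.IH[where i = 0 and m = m] by (simp add: T_def)
    finally show ?thesis by (simp add: Ly sum_distrib_left mult_ac)
  qed
qed

text \<open>This is why T is a sum of geometric sequences: the block across the cut has length i + j
  and weight \<Sum> alpha u^i u^j, so after fixing the label q the two sides of the cut are
  independent.\<close>

lemma cw_split:
  fixes \<alpha> u :: "nat \<Rightarrow> 'v::comm_ring_1" and Q :: "nat set"
  defines "T \<equiv> \<lambda>b::nat. \<Sum>q\<in>Q. \<alpha> q * u q ^ b"
  shows "cw T T 0 (v @ rev w) = (\<Sum>q\<in>Q. \<alpha> q * (cw T (\<lambda>b. u q ^ b) 0 v * cw T (\<lambda>b. u q ^ b) 0 w))"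
proof -
  have "cw T T m (rev w) = (\<Sum>q\<in>Q. \<alpha> q * cw T (\<lambda>b. u q ^ b) 0 w * u q ^ m)" for m
    using cw_rev[where i = 0 and m = m and Q = Q and \<alpha> = \<alpha> and u = u and v = w] by (simp add: T_def mult_ac)
  then have "cw T T 0 (v @ rev w) = (\<Sum>q\<in>Q. cw T (\<lambda>m. \<alpha> q * cw T (\<lambda>b. u q ^ b) 0 w * u q ^ m) 0 v)"
    by (simp add: cw_append cw_sum)
  also have "\<dots> = (\<Sum>q\<in>Q. (\<alpha> q * cw T (\<lambda>b. u q ^ b) 0 w) * cw T (\<lambda>b. u q ^ b) 0 v)"
    by (simp only: cw_mult)
  finally show ?thesis by (simp add: mult_ac)
qed

fun insx :: "(letter list \<Rightarrow> rat) \<Rightarrow> letter list \<Rightarrow> rat" where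
  "insx \<phi> [] = \<phi> [Lx]"
| "insx \<phi> (a # w) = \<phi> (Lx # a # w) + insx (\<lambda>v. \<phi> (a # v)) w"

lemma ev_shuffle_gx: "ev \<phi> (shuffle gx (mon w)) = insx \<phi> w"
  by (induction w arbitrary: \<phi>) (simp_all add: shuffle_mon flip: mon_append)

text \<open>The derivative lowers one block length b with factor b. Summed over all words this is
  the adjoint of inserting an x; the last term corrects for the b letters x of the initial block
  that do not belong to w.\<close>

lemma wsum_smult_cw:
  fixes T l :: "nat \<Rightarrow> rat poly"
  assumes dT: "\<And>b. pderiv (T b) = - (of_nat b * T (b - 1))" and dl: "\<And>b. pderiv (l b) = - (of_nat b * l (b - 1))"
  shows "wsum n (\<lambda>w. smult (\<phi> w) (pderiv (cw T l b w))) =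
     - (if n = 0 then 0 else wsum (n - 1) (\<lambda>w. smult (insx \<phi> w) (cw T l b w)))
     - of_nat b * wsum n (\<lambda>w. smult (\<phi> w) (cw T l (b - 1) w))"
proof (induction n arbitrary: b \<phi>)
  case 0
  then show ?case by (simp add: dl)
next
  case (Suc n)
  define N where "N n \<phi> b = (if n = 0 then 0 else wsum (n - 1) (\<lambda>w. smult (insx \<phi> w) (cw T l b w)))" for n \<phi> b
  define C where "C n \<phi> b = wsum n (\<lambda>w. smult (\<phi> w) (cw T l b w))" for n \<phi> b
  let ?x = "\<lambda>w. \<phi> (Lx # w)" and ?y = "\<lambda>w. \<phi> (Ly # w)"
  have ins: "N (Suc n) \<phi> b = C n ?x b + N n ?x (Suc b) + T b * N n ?y 0"
    by (cases n) (simp_all add: N_def C_def smult_add_left wsum_add wsum_mult_left[symmetric] mult_smult_right)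
  have b: "of_nat b * C n ?x b = of_nat b * wsum n (\<lambda>w. smult (?x w) (cw T l (b - 1) (Lx # w)))"
    by (cases b) (simp_all add: C_def)
  have "wsum (Suc n) (\<lambda>w. smult (\<phi> w) (pderiv (cw T l b w)))
    = wsum n (\<lambda>w. smult (?x w) (pderiv (cw T l (Suc b) w)))
      + (T b * wsum n (\<lambda>w. smult (?y w) (pderiv (cw T l 0 w))) + pderiv (T b) * C n ?y 0)"
  proof -
    have "wsum n (\<lambda>w. smult (?y w) (pderiv (T b * cw T l 0 w)))
      = T b * wsum n (\<lambda>w. smult (?y w) (pderiv (cw T l 0 w))) + pderiv (T b) * C n ?y 0"
      unfolding C_def wsum_mult_left[symmetric] wsum_add[symmetric]
      by (intro wsum_cong) (simp add: pderiv_mult smult_add_right mult.commute)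
    then show ?thesis by simp
  qed
  also have "\<dots> = - N n ?x (Suc b) - of_nat (Suc b) * C n ?x b + (T b * (- N n ?y 0) - of_nat b * T (b - 1) * C n ?y 0)"
    using Suc.IH[of ?x "Suc b"] Suc.IH[of ?y 0] by (simp add: N_def C_def dT del: of_nat_Suc)
  also have "\<dots> = - N (Suc n) \<phi> b - (of_nat b * C n ?x b + of_nat b * (T (b - 1) * C n ?y 0))"
    by (simp add: ins algebra_simps)
  also have "of_nat b * C n ?x b + of_nat b * (T (b - 1) * C n ?y 0) = of_nat b * C (Suc n) \<phi> (b - 1)"
    unfolding b by (simp add: C_def distrib_left wsum_mult_left[symmetric] mult_smult_right)
  finally show ?case by (simp add: N_def C_def)
qed

lemma wsum_cw_peel:
  "wsum n (\<lambda>w. cw T (\<lambda>b. if b = 0 then 1 else 0) b w * \<phi> w) =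
    (\<Sum>m<n. T (b + m) * wsum (n - 1 - m) (\<lambda>w. cw T (\<lambda>b. if b = 0 then 1 else 0) 0 w * \<phi> (replicate m Lx @ Ly # w)))
    + (if b + n = 0 then 1 else 0) * \<phi> (replicate n Lx)"
proof (induction n arbitrary: b \<phi>)
  case (Suc n)
  then show ?case
    using Suc.IH[of "Suc b" "\<lambda>w. \<phi> (Lx # w)"]
    by (simp add: sum.lessThan_Suc_shift wsum_mult_left mult.assoc del: sum.lessThan_Suc)
qed simp

lemma wsum_cw_isum:
  assumes "\<And>m. fps_nth R (Suc m) = T m"
  shows "wsum n (\<lambda>w. cw T (\<lambda>b. if b = 0 then 1 else 0) 0 w * \<phi> w) = isum n (\<lambda>rs. mlt R rs * \<phi> (index_word rs))"
proof (induction n arbitrary: \<phi> rule: less_induct)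
  case (less n)
  show ?case
  proof (cases n)
    case 0
    then show ?thesis by (simp add: index_word_def)
  next
    case (Suc k)
    have "wsum (Suc k) (\<lambda>w. cw T (\<lambda>b. if b = 0 then 1 else 0) 0 w * \<phi> w)
       = (\<Sum>m<Suc k. T (0 + m) * wsum (Suc k - 1 - m) (\<lambda>w. cw T (\<lambda>b. if b = 0 then 1 else 0) 0 w * \<phi> (replicate m Lx @ Ly # w)))"
      using wsum_cw_peel[of "Suc k" T 0 \<phi>] by (simp only:) simp
    also have "(\<Sum>m<Suc k. T (0 + m) * wsum (Suc k - 1 - m) (\<lambda>w. cw T (\<lambda>b. if b = 0 then 1 else 0) 0 w * \<phi> (replicate m Lx @ Ly # w)))
       = (\<Sum>m\<le>k. isum (k - m) (\<lambda>rs. mlt R (Suc m # rs) * \<phi> (index_word (Suc m # rs))))"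
    proof (rule sum.cong)
      fix m assume "m \<in> {..k}"
      then have "wsum (k - m) (\<lambda>w. cw T (\<lambda>b. if b = 0 then 1 else 0) 0 w * \<phi> (replicate m Lx @ Ly # w))
         = isum (k - m) (\<lambda>rs. mlt R rs * \<phi> (replicate m Lx @ Ly # index_word rs))"
        using Suc by (intro less.IH) auto
      then show "T (0 + m) * wsum (Suc k - 1 - m) (\<lambda>w. cw T (\<lambda>b. if b = 0 then 1 else 0) 0 w * \<phi> (replicate m Lx @ Ly # w))
        = isum (k - m) (\<lambda>rs. mlt R (Suc m # rs) * \<phi> (index_word (Suc m # rs)))"
        by (simp add: assms isum_mult_left mult.assoc index_word_def y_word_def)
    qed auto
    finally show ?thesis unfolding Suc isum.simps(2) .
  qed
qed

lemma pderiv_sum': "pderiv (\<Sum>i\<in>A. f i) = (\<Sum>i\<in>A. pderiv (f i))"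
  by (induction A rule: infinite_finite_induct) (simp_all add: pderiv_add)

text \<open>Translating all labels \<open>u q\<close> by a parameter does not change the weighted sum of a functional that
  vanishes on shuffles with x: its derivative in the parameter is such a shuffle. Translation by the
  label of the last block leaves only the words ending in y.\<close>

theorem wsum_cw_reg:
  fixes \<alpha> u :: "nat \<Rightarrow> rat" and Q :: "nat set"
  defines "T \<equiv> \<lambda>b::nat. \<Sum>q\<in>Q. \<alpha> q * u q ^ b"
  assumes ins: "\<And>w. insx \<phi> w = 0"
    and R: "\<And>m. fps_nth R (Suc m) = (\<Sum>p\<in>Q. \<alpha> p * (u p - v) ^ m)"
  shows "wsum n (\<lambda>w. cw T (\<lambda>b. v ^ b) 0 w * \<phi> w) = isum n (\<lambda>rs. mlt R rs * \<phi> (index_word rs))"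
proof -
  define Tp where "Tp b = (\<Sum>q\<in>Q. smult (\<alpha> q) ([:u q, -1:] ^ b))" for b
  define lp where "lp b = [:v, -1:] ^ b" for b
  define G where "G = wsum n (\<lambda>w. smult (\<phi> w) (cw Tp lp 0 w))"
  have pw: "pderiv ([:c, -1:] ^ b) = - (of_nat b * [:c, -1 :: rat:] ^ (b - 1))" for c b
    by (simp add: pderiv_power pderiv_pCons of_nat_poly)
  have "wsum n (\<lambda>w. smult (\<phi> w) (pderiv (cw Tp lp 0 w))) = 0"
    by (subst wsum_smult_cw) (simp_all add: ins lp_def Tp_def pw pderiv_sum' pderiv_smult sum_negf sum_distrib_left)
  moreover have "pderiv G = wsum n (\<lambda>w. pderiv (smult (\<phi> w) (cw Tp lp 0 w)))"
    unfolding G_def by (rule wsum_hom) (simp_all add: pderiv_add)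
  ultimately have "pderiv G = 0" by (simp add: pderiv_smult)
  then obtain g where g: "G = [:g:]" by (metis degree_eq_zeroE pderiv_eq_0_iff)
  have p: "poly (cw Tp lp b w) x = cw (\<lambda>b. poly (Tp b) x) (\<lambda>b. poly (lp b) x) b w" for b w x
    by (induction Tp lp b w rule: cw.induct) auto
  have "poly G x = wsum n (\<lambda>w. poly (smult (\<phi> w) (cw Tp lp 0 w)) x)" for x
    unfolding G_def by (rule wsum_hom) simp_all
  then have G: "poly G x = wsum n (\<lambda>w. cw (\<lambda>b. poly (Tp b) x) (\<lambda>b. poly (lp b) x) 0 w * \<phi> w)" for x
    by (simp add: p mult.commute)
  have "(\<lambda>b. poly (Tp b) 0) = T" "(\<lambda>b. poly (lp b) 0) = (\<lambda>b. v ^ b)"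
    by (simp_all add: fun_eq_iff Tp_def T_def lp_def poly_sum poly_power)
  then have "wsum n (\<lambda>w. cw T (\<lambda>b. v ^ b) 0 w * \<phi> w) = poly G 0" by (simp add: G)
  also have "\<dots> = poly G v" by (simp add: g)
  also have "\<dots> = isum n (\<lambda>rs. mlt R rs * \<phi> (index_word rs))"
  proof -
    have "(\<lambda>b. poly (lp b) v) = (\<lambda>b. if b = 0 then 1 else 0)" by (simp add: fun_eq_iff lp_def poly_power)
    then show ?thesis unfolding G
      by (simp, intro wsum_cw_isum) (simp add: R Tp_def poly_sum poly_power)
  qed
  finally show ?thesis .
qed

section \<open>Functionals killing the regularized double shuffle relations\<close>

text \<open>The series R(-X); it absorbs the signs of the antipode.\<close>

definition Rm :: "rat fps \<Rightarrow> rat fps" where "Rm R = Abs_fps (\<lambda>m. (-1) ^ m * fps_nth R m)"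

lemma mlt_Rm: "mlt (Rm R) ss = (-1) ^ sum_list ss * mlt R ss"
  by (induction ss) (simp_all add: Rm_def power_add)

lemma Rm_mult: "Rm (A * B) = Rm A * Rm B"
proof (rule fps_ext)
  fix n
  have *: "(-1) ^ n * (fps_nth A i * fps_nth B (n - i)) = ((-1) ^ i * fps_nth A i) * ((-1) ^ (n - i) * fps_nth B (n - i))"
    if i: "i \<in> {0..n}" for i
  proof -
    obtain j where "n = i + j" using i le_Suc_ex[of i n] by auto
    then show ?thesis by (simp add: power_add)
  qed
  show "fps_nth (Rm (A * B)) n = fps_nth (Rm A * Rm B) n"
    unfolding Rm_def fps_mult_nth fps_nth_Abs_fps sum_distrib_left
    by (rule sum.cong[OF refl]) (rule *)
qed

lemma isum_hom: "h (0::'v::comm_monoid_add) = (0::'u::comm_monoid_add) \<Longrightarrow> (\<And>x y. h (x + y) = h x + h y) \<Longrightarrow> h (isum n \<phi>) = isum n (\<lambda>w. h (\<phi> w))"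
proof (induction n arbitrary: \<phi> rule: less_induct)
  case (less n)
  have s: "h (\<Sum>i\<in>A. f i) = (\<Sum>i\<in>A. h (f i))" for A and f :: "nat \<Rightarrow> 'v"
    by (induction A rule: infinite_finite_induct) (auto simp: less.prems)
  show ?case by (subst (1 2) isum_rec) (simp add: less s)
qed

text \<open>The quotient space of formal zeta values is never formed; statements about it are tested
  on linear functionals that vanish on the defining relations.\<close>

locale fz_functional =
  fixes L :: "qxy \<Rightarrow> rat"
  assumes L_add: "L (p + q) = L p + L q" and L_sc: "L (qscale c p) = c * L p"
    and L_rel: "is_index rs \<Longrightarrow> is_index ss \<Longrightarrow>
      L (shuffle (Zstar (mono_word (index_word rs))) (Zstar (mono_word (index_word ss))) - Zstar (stuffle rs ss)) = 0"
begin

definition LS :: "sha \<Rightarrow> rat" where "LS a = L (unsh a)"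
lemma LS_lin: "LS (a + b) = LS a + LS b" "LS (sc c a) = c * LS a"
  by (simp_all add: LS_def unsh_hom L_add L_sc)
lemma LS_0 [simp]: "LS 0 = 0" using LS_lin(2)[of 0 0] by simp
lemma LS_diff: "LS (a - b) = LS a - LS b" using LS_lin(1)[of "a - b" b] by simp
lemma LS_sum: "LS (\<Sum>i\<in>A. f i) = (\<Sum>i\<in>A. LS (f i))"
  by (induction A rule: infinite_finite_induct) (auto simp: LS_lin)

definition lz :: "nat list \<Rightarrow> rat" where "lz ts = LS (zz (index_word ts))"

lemma ev_zz: "ev (\<lambda>u. LS (zz u * X)) p = LS (ZG 0 p * X)"
  using functional_eq_ev[of "\<lambda>p. LS (ZG 0 p * X)" p] by (simp add: algebra_simps LS_lin)

lemma insx_zz [simp]: "insx (\<lambda>u. LS (zz u * X)) w = 0"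
  by (simp add: ev_zz ZG_shuffle_gx flip: ev_shuffle_gx)

lemma LS_zz_zz:
  assumes "\<forall>r\<in>set rs. 1 \<le> r" "\<forall>r\<in>set ss. 1 \<le> r"
  shows "LS (zz (index_word rs) * zz (index_word ss)) = st lz rs ss"
proof (cases "rs = [] \<or> ss = []")
  case True
  then show ?thesis by (auto simp: lz_def index_word_def)
next
  case False
  have "LS (zz (index_word rs) * zz (index_word ss) - ZG 0 (stuffle rs ss)) = 0"
    using L_rel[of rs ss] False assms by (simp add: is_index_def LS_def unsh_hom Zstar_ZG)
  then have "LS (zz (index_word rs) * zz (index_word ss)) = ev (\<lambda>w. LS (zz w)) (stuffle rs ss)"
    using ev_zz[of 1] by (simp add: LS_diff)
  then show ?thesis by (simp add: ev_stuffle lz_def[abs_def])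
qed

text \<open>Sum \<open>conv zz zz\<close> over all words of length k with weight
  \<open>cw T T 0\<close>. Only the word y^k survives, which is the right side. On the left,
  \<open>cw_split\<close> separates the two sides of each cut, \<open>wsum_cw_reg\<close> reduces
  both to compositions, and \<open>psum_st\<close> multiplies their weights.\<close>

theorem weighted_antipode:
  fixes \<alpha> u :: "nat \<Rightarrow> rat" and R :: "nat \<Rightarrow> rat fps" and Q :: "nat set"
  assumes R: "\<And>q m. q \<in> Q \<Longrightarrow> fps_nth (R q) (Suc m) = (\<Sum>p\<in>Q. \<alpha> p * (u p - u q) ^ m)"
    and R0: "\<And>q. q \<in> Q \<Longrightarrow> fps_nth (R q) 0 = 1"
  shows "(\<Sum>q\<in>Q. \<alpha> q * isum k (\<lambda>ts. mlt (R q * Rm (R q)) ts * lz ts))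
    = LS (conv zz zz (replicate k Ly)) * (\<Sum>q\<in>Q. \<alpha> q) ^ Suc k"
proof -
  define T where "T b = (\<Sum>q\<in>Q. \<alpha> q * u q ^ b)" for b
  have T': "T = (\<lambda>b. \<Sum>q\<in>Q. \<alpha> q * u q ^ b)" by (rule ext) (rule T_def)
  define B where "B v w = LS (zz v * zz w)" for v w
  have one: "wsum k (\<lambda>w. cw T T 0 w * B (take i w) (rev (drop i w)))
     = (\<Sum>q\<in>Q. \<alpha> q * isum i (\<lambda>rs. isum (k - i) (\<lambda>ss. mlt (R q) rs * mlt (R q) ss * st lz rs ss)))" if "i \<le> k" for i
  proof -
    have "wsum k (\<lambda>w. cw T T 0 w * B (take i w) (rev (drop i w)))
      = wsum i (\<lambda>v. wsum (k - i) (\<lambda>w. cw T T 0 (v @ w) * B (take i (v @ w)) (rev (drop i (v @ w)))))"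
      using wsum_append[of i "k - i" "\<lambda>w. cw T T 0 w * B (take i w) (rev (drop i w))"] that
      by (simp only: le_add_diff_inverse)
    also have "\<dots> = wsum i (\<lambda>v. wsum (k - i) (\<lambda>w. cw T T 0 (v @ w) * B v (rev w)))"
      by (intro wsum_cong) simp
    also have "\<dots> = wsum i (\<lambda>v. wsum (k - i) (\<lambda>w. cw T T 0 (v @ rev w) * B v w))"
      by (subst wsum_rev[of _ "\<lambda>w. cw T T 0 (v @ rev w) * B v w" for v, symmetric]) simp
    also have "\<dots> = (\<Sum>q\<in>Q. \<alpha> q * wsum i (\<lambda>v. cw T (\<lambda>b. u q ^ b) 0 v * wsum (k - i) (\<lambda>w. cw T (\<lambda>b. u q ^ b) 0 w * B v w)))"
      unfolding T' cw_split
      by (simp add: sum_distrib_right wsum_sum wsum_mult_left mult.assoc)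
    also have "\<dots> = (\<Sum>q\<in>Q. \<alpha> q * isum i (\<lambda>rs. isum (k - i) (\<lambda>ss. mlt (R q) rs * mlt (R q) ss * st lz rs ss)))"
    proof (intro sum.cong refl arg_cong2[of _ _ _ _ "(*)"])
      fix q assume q: "q \<in> Q"
      \<comment> \<open>The factor right of the cut, already reduced to compositions, is packed into
        one element, so that the left factor can be reduced by the same argument.\<close>
      define X where "X = isum (k - i) (\<lambda>ss. sc (mlt (R q) ss) (zz (index_word ss)))"
      have X: "LS (a * X) = isum (k - i) (\<lambda>ss. mlt (R q) ss * LS (a * zz (index_word ss)))" for a
        unfolding X_def by (subst isum_hom[where h = "\<lambda>x. LS (a * x)"]) (simp_all add: algebra_simps LS_lin)
      have "wsum (k - i) (\<lambda>w. cw T (\<lambda>b. u q ^ b) 0 w * B v w) = LS (zz v * X)" for v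
      proof -
        have "wsum (k - i) (\<lambda>w. cw T (\<lambda>b. u q ^ b) 0 w * LS (zz w * zz v))
          = isum (k - i) (\<lambda>ss. mlt (R q) ss * LS (zz (index_word ss) * zz v))"
          unfolding T' by (rule wsum_cw_reg) (simp_all add: R q)
        then show ?thesis unfolding X B_def by (simp only: mult.commute[of _ "zz v"])
      qed
      then have "wsum i (\<lambda>v. cw T (\<lambda>b. u q ^ b) 0 v * wsum (k - i) (\<lambda>w. cw T (\<lambda>b. u q ^ b) 0 w * B v w))
        = wsum i (\<lambda>v. cw T (\<lambda>b. u q ^ b) 0 v * LS (zz v * X))" by simp
      also have "\<dots> = isum i (\<lambda>rs. mlt (R q) rs * LS (zz (index_word rs) * X))"
        unfolding T' by (rule wsum_cw_reg) (simp_all add: R q)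
      also have "\<dots> = isum i (\<lambda>rs. isum (k - i) (\<lambda>ss. mlt (R q) rs * mlt (R q) ss * st lz rs ss))"
        unfolding X isum_mult_left[symmetric] by (intro isum_cong) (simp add: LS_zz_zz mult.assoc)
      finally show "wsum i (\<lambda>v. cw T (\<lambda>b. u q ^ b) 0 v * wsum (k - i) (\<lambda>w. cw T (\<lambda>b. u q ^ b) 0 w * B v w))
        = isum i (\<lambda>rs. isum (k - i) (\<lambda>ss. mlt (R q) rs * mlt (R q) ss * st lz rs ss))" .
    qed
    finally show ?thesis .
  qed
  have "wsum k (\<lambda>w. cw T T 0 w * LS (conv zz zz w))
    = wsum k (\<lambda>w. if Lx \<in> set w then 0 else cw T T 0 w * LS (conv zz zz w))"
    by (intro wsum_cong) (simp add: conv_zz_zz)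
  then have "wsum k (\<lambda>w. cw T T 0 w * LS (conv zz zz w)) = T 0 ^ Suc k * LS (conv zz zz (replicate k Ly))"
    unfolding wsum_replicate cw_replicate .
  moreover have "wsum k (\<lambda>w. cw T T 0 w * LS (conv zz zz w))
    = (\<Sum>q\<in>Q. \<alpha> q * isum k (\<lambda>ts. mlt (R q * Rm (R q)) ts * lz ts))"
  proof -
    have "wsum k (\<lambda>w. cw T T 0 w * LS (conv zz zz w))
      = wsum k (\<lambda>w. \<Sum>i\<le>k. (-1) ^ (k - i) * (cw T T 0 w * B (take i w) (rev (drop i w))))"
      by (intro wsum_cong) (simp only: conv_def neg1_sc LS_sum LS_lin B_def sum_distrib_left sc_simps mult.left_commute[where 'a = rat])
    also have "\<dots> = (\<Sum>i\<le>k. (-1) ^ (k - i) * (\<Sum>q\<in>Q. \<alpha> q * isum i (\<lambda>rs. isum (k - i) (\<lambda>ss. mlt (R q) rs * mlt (R q) ss * st lz rs ss))))"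
      by (simp add: wsum_sum wsum_mult_left one)
    also have "\<dots> = (\<Sum>q\<in>Q. \<alpha> q * psum k (\<lambda>rs ss. mlt (R q) rs * mlt (Rm (R q)) ss * st lz rs ss))"
    proof -
      have "(-1) ^ (k - i) * isum i (\<lambda>rs. isum (k - i) (\<lambda>ss. mlt (R q) rs * mlt (R q) ss * st lz rs ss))
        = isum i (\<lambda>rs. isum (k - i) (\<lambda>ss. mlt (R q) rs * mlt (Rm (R q)) ss * st lz rs ss))" for i q
        unfolding isum_mult_left[symmetric] by (intro isum_cong) (simp add: mlt_Rm mult_ac)
      then show ?thesis unfolding psum_def sum_distrib_left
        by (subst sum.swap) (simp add: mult.left_commute)
    qed
    also have "\<dots> = (\<Sum>q\<in>Q. \<alpha> q * isum k (\<lambda>ts. mlt (R q * Rm (R q)) ts * lz ts))"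
      by (intro sum.cong refl arg_cong2[of _ _ _ _ "(*)"] psum_st) (simp_all add: R0 Rm_def)
    finally show ?thesis .
  qed
  ultimately show ?thesis by (simp add: T_def mult.commute)
qed

end

section \<open>Formal Euler theorem: the functional equation and its polynomial solutions\<close>

section \<open>The three-label equation\<close>

abbreviation K :: "rat \<Rightarrow> rat fps" where "K \<equiv> fps_const"

definition geo :: "rat \<Rightarrow> rat fps" where "geo v = Abs_fps (\<lambda>n. v ^ n)"
definition geo2 :: "rat \<Rightarrow> rat fps" where "geo2 v = Abs_fps (\<lambda>n. if even n then v ^ (n div 2) else 0)"

lemma geo: "geo v * (1 - K v * fps_X) = 1"
proof (rule fps_ext)
  fix n
  have e: "geo v * (1 - K v * fps_X) = geo v - K v * (fps_X * geo v)" by (simp add: algebra_simps)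
  show "fps_nth (geo v * (1 - K v * fps_X)) n = fps_nth 1 n"
    unfolding e by (cases n) (simp_all add: geo_def)
qed

lemma geo2: "geo2 v * (1 - K v * fps_X ^ 2) = 1"
proof (rule fps_ext)
  fix n
  have e: "geo2 v * (1 - K v * fps_X ^ 2) = geo2 v - K v * (fps_X ^ 2 * geo2 v)" by (simp add: algebra_simps)
  consider "n = 0" | "n = 1" | m where "n = Suc (Suc m)" by (metis One_nat_def not0_implies_Suc)
  then show "fps_nth (geo2 v * (1 - K v * fps_X ^ 2)) n = fps_nth 1 n"
    unfolding e by cases (simp_all add: geo2_def fps_X_power_mult_nth)
qed

definition PF :: "rat \<Rightarrow> rat \<Rightarrow> rat \<Rightarrow> rat \<Rightarrow> rat \<Rightarrow> rat fps" where
  "PF A B C D E = (1 - K A * fps_X ^ 2) * (1 - K B * fps_X ^ 2) * (1 - K C * fps_X ^ 2) * geo2 D * geo2 E"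

text \<open>\<open>al1\<close>, \<open>al2\<close>, \<open>al3\<close> are the partial fraction
  coefficients of (F - 1) / X with respect to 1, 1/(1+dX), 1/(1+eX), where F =
  (1+aX)(1+bX)(1+cX)/((1+dX)(1+eX)); \<open>SF\<close> is the resulting expansion of F.\<close>

definition al1 where "al1 a b c d e = a * b * c / (d * e)" for a b c d e :: rat
definition al2 where "al2 a b c d e = - ((a - d) * (b - d) * (c - d) / (d * (e - d)))" for a b c d e :: rat
definition al3 where "al3 a b c d e = (a - e) * (b - e) * (c - e) / (e * (e - d))" for a b c d e :: rat

definition SF :: "rat \<Rightarrow> rat \<Rightarrow> rat \<Rightarrow> rat \<Rightarrow> rat \<Rightarrow> rat fps" where
  "SF a b c d e = Abs_fps (\<lambda>m. if m = 0 then 1 else al1 a b c d e * 0 ^ (m - 1) + al2 a b c d e * (- d) ^ (m - 1) + al3 a b c d e * (- e) ^ (m - 1))"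

lemma al_sum:
  assumes "d \<noteq> 0" "e \<noteq> 0" "d \<noteq> e"
  shows "al1 a b c d e + al2 a b c d e + al3 a b c d e + d + e = a + b + c"
    and "al1 a b c d e * (d + e) + al2 a b c d e * e + al3 a b c d e * d + d * e = a * b + b * c + a * c"
    and "al1 a b c d e * (d * e) = a * b * c"
proof -
  have "e - d \<noteq> 0" using assms by simp
  with assms show "al1 a b c d e + al2 a b c d e + al3 a b c d e + d + e = a + b + c"
    "al1 a b c d e * (d + e) + al2 a b c d e * e + al3 a b c d e * d + d * e = a * b + b * c + a * c"
    unfolding al1_def al2_def al3_def by (simp_all add: divide_simps) (simp_all add: algebra_simps)
  show "al1 a b c d e * (d * e) = a * b * c" using assms by (simp add: al1_def)
qed

lemma SF_closed:
  assumes "d \<noteq> 0" "e \<noteq> 0" "d \<noteq> e"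
  shows "SF a b c d e * ((1 + K d * fps_X) * (1 + K e * fps_X)) = (1 + K a * fps_X) * (1 + K b * fps_X) * (1 + K c * fps_X)"
proof -
  let ?a1 = "al1 a b c d e" and ?a2 = "al2 a b c d e" and ?a3 = "al3 a b c d e"
  have S: "SF a b c d e = 1 + K ?a1 * fps_X + K ?a2 * fps_X * geo (- d) + K ?a3 * fps_X * geo (- e)"
  proof (rule fps_ext)
    fix n show "fps_nth (SF a b c d e) n = fps_nth (1 + K ?a1 * fps_X + K ?a2 * fps_X * geo (- d) + K ?a3 * fps_X * geo (- e)) n"
      by (cases n) (auto simp: SF_def geo_def mult.assoc fps_X_nth power_0_left)
  qed
  have g: "geo (- d) * (1 + K d * fps_X) = 1" "geo (- e) * (1 + K e * fps_X) = 1"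
    using geo[of "- d"] geo[of "- e"] by (simp_all flip: fps_const_neg)
  have "SF a b c d e * ((1 + K d * fps_X) * (1 + K e * fps_X))
    = (1 + K ?a1 * fps_X) * ((1 + K d * fps_X) * (1 + K e * fps_X))
      + K ?a2 * fps_X * (geo (- d) * (1 + K d * fps_X)) * (1 + K e * fps_X)
      + K ?a3 * fps_X * (geo (- e) * (1 + K e * fps_X)) * (1 + K d * fps_X)"
    unfolding S by (simp add: algebra_simps del: fps_const_add fps_const_mult)
  also have "\<dots> = 1 + (K ?a1 + K ?a2 + K ?a3 + K d + K e) * fps_X
     + (K ?a1 * (K d + K e) + K ?a2 * K e + K ?a3 * K d + K d * K e) * fps_X ^ 2 + K ?a1 * (K d * K e) * fps_X ^ 3"
    unfolding g by (simp add: algebra_simps power2_eq_square power3_eq_cube del: fps_const_add fps_const_mult)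
  also have "\<dots> = 1 + (K a + K b + K c) * fps_X + (K a * K b + K b * K c + K a * K c) * fps_X ^ 2 + K a * K b * K c * fps_X ^ 3"
    using al_sum[OF assms, of a b c] by simp
  also have "\<dots> = (1 + K a * fps_X) * (1 + K b * fps_X) * (1 + K c * fps_X)"
    by (simp add: algebra_simps power2_eq_square power3_eq_cube del: fps_const_add fps_const_mult)
  finally show ?thesis .
qed

lemma SF_PF:
  assumes "d \<noteq> 0" "e \<noteq> 0" "d \<noteq> e"
  shows "SF a b c d e * Rm (SF a b c d e) = PF (a\<^sup>2) (b\<^sup>2) (c\<^sup>2) (d\<^sup>2) (e\<^sup>2)"
proof -
  have r: "Rm (1 + K t * fps_X) = 1 - K t * fps_X" for t
  proof (rule fps_ext)
    fix n show "fps_nth (Rm (1 + K t * fps_X)) n = fps_nth (1 - K t * fps_X) n"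
      by (cases n) (auto simp: Rm_def fps_X_nth)
  qed
  have sq: "(1 + K t * fps_X) * (1 - K t * fps_X) = 1 - K (t\<^sup>2) * fps_X ^ 2" for t
    by (simp add: algebra_simps power2_eq_square flip: fps_const_mult)
  let ?S = "SF a b c d e"
  have "?S * Rm ?S * ((1 - K (d\<^sup>2) * fps_X ^ 2) * (1 - K (e\<^sup>2) * fps_X ^ 2))
    = (?S * ((1 + K d * fps_X) * (1 + K e * fps_X))) * Rm (?S * ((1 + K d * fps_X) * (1 + K e * fps_X)))"
    unfolding Rm_mult r sq[symmetric] by (simp only: mult_ac)
  also have "\<dots> = (1 - K (a\<^sup>2) * fps_X ^ 2) * (1 - K (b\<^sup>2) * fps_X ^ 2) * (1 - K (c\<^sup>2) * fps_X ^ 2)"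
    unfolding SF_closed[OF assms] Rm_mult r sq[symmetric] by (simp only: mult_ac)
  finally have "?S * Rm ?S * ((1 - K (d\<^sup>2) * fps_X ^ 2) * (1 - K (e\<^sup>2) * fps_X ^ 2)) * (geo2 (d\<^sup>2) * geo2 (e\<^sup>2))
    = PF (a\<^sup>2) (b\<^sup>2) (c\<^sup>2) (d\<^sup>2) (e\<^sup>2)" by (simp add: PF_def mult_ac)
  moreover have "?S * Rm ?S * ((1 - K (d\<^sup>2) * fps_X ^ 2) * (1 - K (e\<^sup>2) * fps_X ^ 2)) * (geo2 (d\<^sup>2) * geo2 (e\<^sup>2))
     = ?S * Rm ?S * (geo2 (d\<^sup>2) * (1 - K (d\<^sup>2) * fps_X ^ 2)) * (geo2 (e\<^sup>2) * (1 - K (e\<^sup>2) * fps_X ^ 2))"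
    by (simp only: mult_ac)
  ultimately show ?thesis by (simp add: geo2)
qed

context fz_functional
begin

definition PP :: "nat \<Rightarrow> rat \<Rightarrow> rat \<Rightarrow> rat \<Rightarrow> rat \<Rightarrow> rat \<Rightarrow> rat" where
  "PP k A B C D E = isum k (\<lambda>ts. mlt (PF A B C D E) ts * lz ts)"

definition kap :: "nat \<Rightarrow> rat" where "kap k = LS (conv zz zz (replicate k Ly))"

text \<open>\<open>weighted_antipode\<close> with labels 0, -d, -e. Taking another label as origin
  subtracts d or e from a, b, c and permutes the three weights, so every term is the same function
  at shifted arguments.\<close>

theorem three_label:
  assumes "d \<noteq> 0" "e \<noteq> 0" "d \<noteq> e"
  shows "al1 a b c d e * PP k (a\<^sup>2) (b\<^sup>2) (c\<^sup>2) (d\<^sup>2) (e\<^sup>2)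
     + al2 a b c d e * PP k ((a - d)\<^sup>2) ((b - d)\<^sup>2) ((c - d)\<^sup>2) (d\<^sup>2) ((e - d)\<^sup>2)
     + al3 a b c d e * PP k ((a - e)\<^sup>2) ((b - e)\<^sup>2) ((c - e)\<^sup>2) (e\<^sup>2) ((e - d)\<^sup>2)
    = kap k * (a + b + c - d - e) ^ Suc k"
proof -
  let ?a1 = "al1 a b c d e" and ?a2 = "al2 a b c d e" and ?a3 = "al3 a b c d e"
  define \<alpha> where "\<alpha> q = (if q = 0 then ?a1 else if q = Suc 0 then ?a2 else ?a3)" for q :: nat
  define u where "u q = (if q = 0 then 0 else if q = Suc 0 then - d else - e)" for q :: nat
  define R where "R q = (if q = 0 then SF a b c d e else if q = Suc 0 then SF (a - d) (b - d) (c - d) (- d) (e - d)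
     else SF (a - e) (b - e) (c - e) (- e) (d - e))" for q :: nat
  have Q: "{..<3::nat} = {0, Suc 0, 2}" by auto
  have ed: "e - d \<noteq> 0" "d - e \<noteq> 0" using assms by auto
  have sh: "x - d - - d = x" "x - d - (e - d) = x - e" for x
    by simp_all
  have n: "(-d) * (e - d) = - (d * (e - d))" "(-d) * e = - (d * e)" "(e - d) * e = e * (e - d)"
    by (simp_all add: algebra_simps)
  have al': "al1 (a - d) (b - d) (c - d) (- d) (e - d) = ?a2" "al2 (a - d) (b - d) (c - d) (- d) (e - d) = ?a1"
    "al3 (a - d) (b - d) (c - d) (- d) (e - d) = ?a3"
    unfolding al1_def al2_def al3_def sh n by simp_all
  have n': "(-e) * (d - e) = e * (e - d)" "(d - e) * (d - e - - e) = - (d * (e - d))" "(- e) * (d - e - - e) = - (d * e)" "(d - e) * d = - (d * (e - d))"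
    "x - e - - e = x" "x - e - (d - e) = x - d" for x
    by (simp_all add: algebra_simps)
  have al'': "al1 (a - e) (b - e) (c - e) (- e) (d - e) = ?a3" "al2 (a - e) (b - e) (c - e) (- e) (d - e) = ?a1"
    "al3 (a - e) (b - e) (c - e) (- e) (d - e) = ?a2"
    unfolding al1_def al2_def al3_def n' by simp_all
  have "(\<Sum>q\<in>{..<3}. \<alpha> q * isum k (\<lambda>ts. mlt (R q * Rm (R q)) ts * lz ts))
    = LS (conv zz zz (replicate k Ly)) * (\<Sum>q\<in>{..<3}. \<alpha> q) ^ Suc k"
  proof (rule weighted_antipode)
    fix q m :: nat assume "q \<in> {..<3}"
    then consider "q = 0" | "q = Suc 0" | "q = 2" by (auto simp: Q)
    then show "fps_nth (R q) (Suc m) = (\<Sum>p\<in>{..<3}. \<alpha> p * (u p - u q) ^ m)"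
      by cases (simp_all add: Q R_def u_def \<alpha>_def SF_def al' al'')
  qed (auto simp: R_def SF_def)
  moreover have "(\<Sum>q\<in>{..<3}. \<alpha> q) = a + b + c - d - e"
    using al_sum(1)[OF assms, of a b c] by (simp add: Q \<alpha>_def)
  moreover have "(d - e)\<^sup>2 = (e - d)\<^sup>2" by (simp add: power2_commute)
  ultimately show ?thesis
    using assms by (simp add: Q \<alpha>_def R_def SF_PF kap_def PP_def add.assoc)
qed

end

section \<open>Uniqueness for the three-label equation\<close>

text \<open>Polynomial identities in several rational variables are proved one variable at a time,
  so a predicate on functions of a single variable suffices.\<close>

definition polyfun :: "(rat \<Rightarrow> rat) \<Rightarrow> bool" where "polyfun f \<longleftrightarrow> (\<exists>p. \<forall>x. f x = poly p x)"

lemma polyfun_const [simp, intro]: "polyfun (\<lambda>x. c)" unfolding polyfun_def by (rule exI[of _ "[:c:]"]) simp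
lemma polyfun_id [simp, intro]: "polyfun (\<lambda>x. x)" unfolding polyfun_def by (rule exI[of _ "[:0, 1:]"]) simp
lemma polyfun_add [intro]: "polyfun f \<Longrightarrow> polyfun g \<Longrightarrow> polyfun (\<lambda>x. f x + g x)"
  unfolding polyfun_def by (metis poly_add)
lemma polyfun_diff [intro]: "polyfun f \<Longrightarrow> polyfun g \<Longrightarrow> polyfun (\<lambda>x. f x - g x)"
  unfolding polyfun_def by (metis poly_diff)
lemma polyfun_minus [intro]: "polyfun f \<Longrightarrow> polyfun (\<lambda>x. - f x)"
  unfolding polyfun_def by (metis poly_minus)
lemma polyfun_mult [intro]: "polyfun f \<Longrightarrow> polyfun g \<Longrightarrow> polyfun (\<lambda>x. f x * g x)"
  unfolding polyfun_def by (metis poly_mult)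
lemma polyfun_divide [intro]: "polyfun f \<Longrightarrow> polyfun (\<lambda>x. f x / c)"
  using polyfun_mult[of f "\<lambda>x. 1 / c"] by simp
lemma polyfun_power [intro]: "polyfun f \<Longrightarrow> polyfun (\<lambda>x. f x ^ n)"
  by (induction n) auto
lemma polyfun_sum [intro]: "(\<And>i. i \<in> A \<Longrightarrow> polyfun (f i)) \<Longrightarrow> polyfun (\<lambda>x. \<Sum>i\<in>A. f i x)"
  by (induction A rule: infinite_finite_induct) auto

lemma polyfun_zero:
  assumes "polyfun f" "infinite S" "\<And>x. x \<in> S \<Longrightarrow> f x = 0"
  shows "f x = 0"
proof -
  obtain p where p: "\<And>x. f x = poly p x" using assms(1) by (auto simp: polyfun_def)
  have "S \<subseteq> {x. poly p x = 0}" using assms(3) p by auto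
  then have "p = 0" using assms(2) finite_subset poly_roots_finite by blast
  then show ?thesis by (simp add: p)
qed

lemma infinite_multiples: "(c::rat) \<noteq> 0 \<Longrightarrow> infinite ((\<lambda>n. of_nat (Suc n) * c) ` UNIV)"
  by (intro range_inj_infinite injI) (auto simp del: of_nat_Suc)

lemma polyfun_zero_squares:
  assumes "polyfun f" "\<And>a. a \<noteq> 0 \<Longrightarrow> f (a\<^sup>2) = 0" shows "f x = 0"
proof (rule polyfun_zero[OF assms(1)])
  show "infinite (range (\<lambda>n. (of_nat (Suc n))\<^sup>2 :: rat))"
    by (intro range_inj_infinite injI) (auto simp: power2_eq_iff_nonneg simp del: of_nat_Suc)
qed (use assms(2) in auto)

lemma polyfun_isum [intro]: "(\<And>rs. polyfun (f rs)) \<Longrightarrow> polyfun (\<lambda>x. isum k (\<lambda>rs. f rs x))"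
proof (induction k arbitrary: f rule: less_induct)
  case (less k)
  have "polyfun (\<lambda>x. if k = 0 then f [] x else 0)" by (cases "k = 0") (auto intro: less.prems)
  then show ?case by (subst isum_rec) (auto intro!: polyfun_add polyfun_sum less)
qed

lemma polyfun_mlt [intro]: "(\<And>n. polyfun (\<lambda>x. fps_nth (R x) n)) \<Longrightarrow> polyfun (\<lambda>x. mlt (R x) rs)"
  by (induction rs) auto

lemma polyfun_fps_mult [intro]:
  "(\<And>n. polyfun (\<lambda>x. fps_nth (R x) n)) \<Longrightarrow> (\<And>n. polyfun (\<lambda>x. fps_nth (R' x) n)) \<Longrightarrow> polyfun (\<lambda>x. fps_nth (R x * R' x) n)"
  unfolding fps_mult_nth by (intro polyfun_sum polyfun_mult)

lemma polyfun_factor [intro]: "polyfun A \<Longrightarrow> polyfun (\<lambda>x. fps_nth (1 - K (A x) * fps_X ^ 2) n)"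
  by (auto simp: fps_X_power_nth)

lemma polyfun_geo2 [intro]: "polyfun A \<Longrightarrow> polyfun (\<lambda>x. fps_nth (geo2 (A x)) n)"
  by (cases "even n") (auto simp: geo2_def)

lemma polyfun_PF: "polyfun A \<Longrightarrow> polyfun B \<Longrightarrow> polyfun C \<Longrightarrow> polyfun D \<Longrightarrow> polyfun E \<Longrightarrow>
   polyfun (\<lambda>x. fps_nth (PF (A x) (B x) (C x) (D x) (E x)) n)"
  unfolding PF_def by (intro polyfun_fps_mult polyfun_factor polyfun_geo2)

lemma poly_coeffs_zero:
  assumes "\<And>x::rat. (\<Sum>j\<le>(k::nat). c j * x ^ j) = 0" "j \<le> k" shows "c j = 0"
proof -
  have "poly (\<Sum>j\<le>k. monom (c j) j) x = 0" for x using assms(1)[of x] by (simp add: poly_sum poly_monom)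
  then have "(\<Sum>j\<le>k. monom (c j) j) = 0" using poly_all_0_iff_0 by blast
  then have "coeff (\<Sum>j\<le>k. monom (c j) j) j = 0" by simp
  with assms(2) show ?thesis by (simp add: coeff_sum)
qed

definition RF1 :: "rat \<Rightarrow> rat \<Rightarrow> rat fps" where "RF1 A D = (1 - K A * fps_X ^ 2) * geo2 D"

lemma RF1_nth: "fps_nth (RF1 A D) m = (if m = 0 then 1 else if even m then (D - A) * D ^ (m div 2 - 1) else 0)"
proof -
  have e: "RF1 A D = geo2 D - K A * (fps_X ^ 2 * geo2 D)" by (simp add: RF1_def algebra_simps)
  consider "m = 0" | "m = 1" | n where "m = Suc (Suc n)" by (metis One_nat_def not0_implies_Suc)
  then show ?thesis unfolding e by cases (simp_all add: geo2_def fps_X_power_mult_nth algebra_simps)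
qed

definition wt :: "rat \<Rightarrow> nat list \<Rightarrow> rat" where
  "wt D rs = prod_list (map (\<lambda>m. if even m then D ^ (m div 2 - 1) else 0) rs)"

text \<open>Every part contributes one factor D - A, so the number of parts can be read off as an
  exponent; \<open>psum_coeff1\<close> uses this to isolate one-part compositions.\<close>

lemma mlt_RF1: "\<forall>r\<in>set rs. 1 \<le> r \<Longrightarrow> mlt (RF1 A D) rs = (D - A) ^ length rs * wt D rs"
  by (induction rs) (auto simp: RF1_nth wt_def)

lemma length_le_sum_list: "\<forall>r\<in>set rs. 1 \<le> (r::nat) \<Longrightarrow> length rs \<le> sum_list rs"
  by (induction rs) auto

lemma isum_by_length: "isum k (\<lambda>rs. x ^ length rs * c rs) = (\<Sum>j\<le>k. isum k (\<lambda>rs. if length rs = j then c rs else 0) * (x::rat) ^ j)"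
proof -
  have "isum k (\<lambda>rs. x ^ length rs * c rs) = isum k (\<lambda>rs. \<Sum>j\<le>k. x ^ j * (if length rs = j then c rs else 0))"
  proof (rule isum_cong)
    fix rs assume "sum_list rs = k" "\<forall>r\<in>set rs. 1 \<le> r"
    then have "length rs \<le> k" using length_le_sum_list by blast
    then show "x ^ length rs * c rs = (\<Sum>j\<le>k. x ^ j * (if length rs = j then c rs else 0))"
      by (simp add: if_distrib cong: if_cong)
  qed
  then show ?thesis by (simp add: isum_sum isum_mult_left mult.commute)
qed

lemma isum_length_0: "isum k (\<lambda>rs. if rs = [] then c rs else (0::rat)) = (if k = 0 then c [] else 0)"
  by (subst isum_rec) simp

lemma isum_length_1: "isum k (\<lambda>rs. if length rs = Suc 0 then c rs else (0::rat)) = (if k = 0 then 0 else c [k])"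
proof -
  have "isum (k - m) (\<lambda>rs. if length (m # rs) = Suc 0 then c (m # rs) else (0::rat)) = (if m = k then c [k] else 0)" if "m \<in> {1..k}" for m
    using isum_length_0[of "k - m" "\<lambda>rs. c (m # rs)"] that by auto
  then show ?thesis by (subst isum_rec) (simp del: length_Cons)
qed

lemma psum_coeff1:
  assumes "\<And>x. psum k (\<lambda>rs ss. x ^ length rs * c rs ss) = (0::rat)"
  shows "psum k (\<lambda>rs ss. if length rs = Suc 0 then c rs ss else 0) = 0"
proof (cases "k = 0")
  case True
  then show ?thesis by (simp add: psum_def)
next
  case False
  define d where "d j = psum k (\<lambda>rs ss. if length rs = j then c rs ss else 0)" for j
  have "psum k (\<lambda>rs ss. x ^ length rs * c rs ss) = (\<Sum>j\<le>k. d j * x ^ j)" for x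
  proof -
    have "psum k (\<lambda>rs ss. x ^ length rs * c rs ss)
      = (\<Sum>i\<le>k. isum i (\<lambda>rs. \<Sum>j\<le>k. x ^ j * (if length rs = j then isum (k - i) (c rs) else 0)))"
      unfolding psum_def
    proof (intro sum.cong refl isum_cong)
      fix i rs assume "i \<in> {..k}" "sum_list rs = i" "\<forall>r\<in>set rs. 1 \<le> r"
      then have "length rs \<le> k" using length_le_sum_list[of rs] by auto
      then show "isum (k - i) (\<lambda>ss. x ^ length rs * c rs ss) = (\<Sum>j\<le>k. x ^ j * (if length rs = j then isum (k - i) (c rs) else 0))"
        by (simp add: if_distrib isum_mult_left cong: if_cong)
    qed
    also have "\<dots> = (\<Sum>i\<le>k. \<Sum>j\<le>k. x ^ j * isum i (\<lambda>rs. isum (k - i) (\<lambda>ss. if length rs = j then c rs ss else 0)))"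
    proof -
      have "(if length rs = j then isum (k - i) (c rs) else 0) = isum (k - i) (\<lambda>ss. if length rs = j then c rs ss else 0)" for i j rs
        by simp
      then show ?thesis by (simp only: isum_sum isum_mult_left)
    qed
    also have "\<dots> = (\<Sum>j\<le>k. d j * x ^ j)"
      by (subst sum.swap) (simp add: d_def psum_def sum_distrib_left mult.commute)
    finally show ?thesis .
  qed
  then show ?thesis using poly_coeffs_zero[of d k "Suc 0"] assms False by (simp add: d_def)
qed

context fz_functional
begin

lemma polyfun_PP: "polyfun A \<Longrightarrow> polyfun B \<Longrightarrow> polyfun C \<Longrightarrow> polyfun D \<Longrightarrow> polyfun E \<Longrightarrow>
   polyfun (\<lambda>x. PP k (A x) (B x) (C x) (D x) (E x))"
  unfolding PP_def by (intro polyfun_isum polyfun_mult polyfun_mlt polyfun_PF polyfun_const)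

text \<open>The factor a b c is the numerator of \<open>al1\<close>; it makes the function odd in
  each of a, b, c and absorbs the numerators of all three terms.\<close>

definition FF :: "nat \<Rightarrow> rat \<Rightarrow> rat \<Rightarrow> rat \<Rightarrow> rat \<Rightarrow> rat \<Rightarrow> rat" where
  "FF k a b c d e = a * b * c * PP k (a\<^sup>2) (b\<^sup>2) (c\<^sup>2) (d\<^sup>2) (e\<^sup>2)"

lemma FF_odd: "FF k (- a) b c d e = - FF k a b c d e" "FF k a (- b) c d e = - FF k a b c d e"
  by (simp_all add: FF_def)

lemma polyfun_FF: "polyfun A \<Longrightarrow> polyfun B \<Longrightarrow> polyfun C \<Longrightarrow> polyfun D \<Longrightarrow> polyfun E \<Longrightarrow>
   polyfun (\<lambda>x. FF k (A x) (B x) (C x) (D x) (E x))"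
  unfolding FF_def by (intro polyfun_mult polyfun_PP polyfun_power)

text \<open>\<open>three_label\<close> with d = x and e = x + f, multiplied by the common
  denominator x e f.\<close>

lemma FF_eq:
  assumes "kap k = 0" "x \<noteq> 0" "f \<noteq> 0" "x + f \<noteq> 0"
  shows "f * FF k a b c x (x + f) - (x + f) * FF k (a - x) (b - x) (c - x) x f
     + x * FF k (a - (x + f)) (b - (x + f)) (c - (x + f)) (x + f) f = 0"
proof -
  define e where "e = x + f"
  have e: "e = x + f" "e \<noteq> 0" "x \<noteq> e" "e - x = f" using assms by (auto simp: e_def)
  note t = three_label[OF assms(2) e(2,3), of a b c k, unfolded e(4) assms(1)]
  have m: "al1 a b c x e * (x * e * f) = f * (a * b * c)"
    "al2 a b c x e * (x * e * f) = - (e * ((a - x) * (b - x) * (c - x)))"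
    "al3 a b c x e * (x * e * f) = x * ((a - e) * (b - e) * (c - e))"
    unfolding al1_def al2_def al3_def e(4) using assms e(2) by simp_all
  have "(A * q) * P1 + (B * q) * P2 + (C * q) * P3 = (A * P1 + B * P2 + C * P3) * q" for A B C P1 P2 P3 q :: rat
    by (simp add: algebra_simps)
  from this[where q = "x * e * f"]
  have "(al1 a b c x e * (x * e * f)) * PP k (a\<^sup>2) (b\<^sup>2) (c\<^sup>2) (x\<^sup>2) (e\<^sup>2)
     + (al2 a b c x e * (x * e * f)) * PP k ((a - x)\<^sup>2) ((b - x)\<^sup>2) ((c - x)\<^sup>2) (x\<^sup>2) (f\<^sup>2)
     + (al3 a b c x e * (x * e * f)) * PP k ((a - e)\<^sup>2) ((b - e)\<^sup>2) ((c - e)\<^sup>2) (e\<^sup>2) (f\<^sup>2)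
     = 0 * (x * e * f)"
    using t by (simp only: mult_zero_left)
  then show ?thesis unfolding m e(1)[symmetric] by (simp add: FF_def mult.assoc)
qed

lemma FF_zero:
  assumes "kap k = 0" "d \<noteq> 0" "f \<noteq> 0"
  shows "FF k a b c d f = 0"
proof -
  \<comment> \<open>Adding the instances of \<open>FF_eq\<close> for a and for -a cancels the first
    term, which is odd in a. The other two terms combine to \<open>M\<close> at x and at x +
    f.\<close>
  define M where "M a b c x = FF k (a - x) (b - x) (c - x) x f - FF k (a + x) (b - x) (c - x) x f" for a b c x
  have step: "(x + f) * M a b c x = x * M a b c (x + f)" if "x \<noteq> 0" "x + f \<noteq> 0" for a b c x
  proof -
    have o: "FF k (- a - y) (b - y) (c - y) z f = - FF k (a + y) (b - y) (c - y) z f" for y z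
      using FF_odd(1)[of k "a + y" "b - y" "c - y" z f] by (simp add: algebra_simps)
    have "f * FF k (- a) b c x (x + f) = - (f * FF k a b c x (x + f))" by (simp add: FF_odd)
    with FF_eq[OF assms(1) that(1) assms(3) that(2), of a b c] FF_eq[OF assms(1) that(1) assms(3) that(2), of "- a" b c]
    show ?thesis unfolding M_def o by (simp add: algebra_simps)
  qed
  define m where "m a b c = M a b c f / f" for a b c
  \<comment> \<open>By \<open>step\<close>, M(x) / x does not change under x -> x + f as long as no
    argument is zero; a polynomial with this property along f, 2f, 3f, ... is linear in x.\<close>
  have lin: "M a b c x = x * m a b c" for a b c x
  proof -
    have n: "M a b c (of_nat (Suc n) * f) = of_nat (Suc n) * M a b c f" for n
    proof (induction n)
      case (Suc n)
      define y where "y = (of_nat (Suc n) :: rat)"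
      have y: "y > 0" "of_nat (Suc (Suc n)) = y + 1" by (simp_all add: y_def)
      have "(y * f + f) * M a b c (y * f) = y * f * M a b c (y * f + f)"
      proof (rule step)
        have "y * f + f = (y + 1) * f" by (simp add: algebra_simps)
        then show "y * f + f \<noteq> 0" using y assms(3) by simp
      qed (use y assms(3) in simp)
      then have "y * f * ((y + 1) * M a b c f) = y * f * M a b c ((y + 1) * f)"
        using Suc.IH by (simp add: y_def[symmetric] algebra_simps del: of_nat_Suc)
      then have "M a b c ((y + 1) * f) = (y + 1) * M a b c f" using y(1) assms(3) by simp
      then show ?case unfolding y(2) .
    qed simp
    have "M a b c x - x * m a b c = 0"
    proof (rule polyfun_zero[of "\<lambda>x. M a b c x - x * m a b c", OF _ infinite_multiples[OF assms(3)]])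
      show "polyfun (\<lambda>x. M a b c x - x * m a b c)"
        unfolding M_def by (intro polyfun_diff polyfun_FF polyfun_mult polyfun_add polyfun_const polyfun_id)
    qed (use n assms(3) in \<open>auto simp: m_def simp del: of_nat_Suc\<close>)
    then show ?thesis by simp
  qed
  \<comment> \<open>The midpoint x of b and b' makes b' - x and b - x opposite, and
    \<open>FF\<close> is odd in its second argument.\<close>
  have mb: "m a b' c = - m a b c" if "b' \<noteq> - b" for a b b' c
  proof -
    define x where "x = (b + b') / 2"
    have x: "x \<noteq> 0" "b' - x = - (b - x)" using that by (auto simp: x_def field_simps)
    have "M a b' c x = - M a b c x" unfolding M_def x(2) FF_odd by simp
    then have "x * m a b' c = x * (- m a b c)" by (simp add: lin)
    then show ?thesis using x(1) mult_left_cancel by blast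
  qed
  have "m a b c = 0" for a b c
  proof -
    \<comment> \<open>Three values of which no two are opposite: any two of the values m(b), m(b2),
      m(b3) are then negatives of each other, so all are zero.\<close>
    define b2 b3 where "b2 = \<bar>b\<bar> + 1" and "b3 = \<bar>b\<bar> + 2"
    have ne: "b2 \<noteq> - b" "b3 \<noteq> - b" "b3 \<noteq> - b2" unfolding b2_def b3_def by linarith+
    show ?thesis using mb[OF ne(1), of a c] mb[OF ne(2), of a c] mb[OF ne(3), of a c] by linarith
  qed
  then have M0: "M a b c x = 0" for a b c x by (simp add: lin)
  \<comment> \<open>Vanishing of \<open>M\<close> at x = d, with all arguments shifted by d, is a
    period 2d in a; since \<open>FF\<close> vanishes at a = 0, it has infinitely many zeros.\<close>
  have per: "FF k (a + 2 * d) b c d f = FF k a b c d f" for a b c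
    using M0[of "a + d" "b + d" "c + d" d] by (simp add: M_def algebra_simps)
  show ?thesis
  proof (rule polyfun_zero[of "\<lambda>a. FF k a b c d f", OF _ infinite_multiples[of "2 * d"]])
    show "polyfun (\<lambda>a. FF k a b c d f)" by (intro polyfun_FF polyfun_const polyfun_id)
    have "FF k (of_nat n * (2 * d)) b c d f = 0" for n
    proof (induction n)
      case (Suc n)
      then show ?case using per[of "of_nat n * (2 * d)" b c] by (simp add: algebra_simps)
    qed (simp add: FF_def)
    then show "FF k x b c d f = 0" if "x \<in> range (\<lambda>n. of_nat (Suc n) * (2 * d))" for x using that by blast
  qed (use assms in simp)
qed

lemma PP_zero: assumes "kap k = 0" shows "PP k A B C D E = 0"
proof -
  note pf = polyfun_PP polyfun_const polyfun_id
  have 0: "PP k (a\<^sup>2) (b\<^sup>2) (c\<^sup>2) (d\<^sup>2) (e\<^sup>2) = 0" if "a \<noteq> 0" "b \<noteq> 0" "c \<noteq> 0" "d \<noteq> 0" "e \<noteq> 0" for a b c d e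
    using FF_zero[OF assms that(4,5), of a b c] that by (simp add: FF_def)
  have 1: "PP k A (b\<^sup>2) (c\<^sup>2) (d\<^sup>2) (e\<^sup>2) = 0" if "b \<noteq> 0" "c \<noteq> 0" "d \<noteq> 0" "e \<noteq> 0" for A b c d e
    by (rule polyfun_zero_squares[of "\<lambda>A. PP k A (b\<^sup>2) (c\<^sup>2) (d\<^sup>2) (e\<^sup>2)"]) (intro pf, use 0 that in blast)
  have 2: "PP k A B (c\<^sup>2) (d\<^sup>2) (e\<^sup>2) = 0" if "c \<noteq> 0" "d \<noteq> 0" "e \<noteq> 0" for A B c d e
    by (rule polyfun_zero_squares[of "\<lambda>B. PP k A B (c\<^sup>2) (d\<^sup>2) (e\<^sup>2)"]) (intro pf, use 1 that in blast)
  have 3: "PP k A B C (d\<^sup>2) (e\<^sup>2) = 0" if "d \<noteq> 0" "e \<noteq> 0" for A B C d e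
    by (rule polyfun_zero_squares[of "\<lambda>C. PP k A B C (d\<^sup>2) (e\<^sup>2)"]) (intro pf, use 2 that in blast)
  have 4: "PP k A B C D (e\<^sup>2) = 0" if "e \<noteq> 0" for A B C D e
    by (rule polyfun_zero_squares[of "\<lambda>D. PP k A B C D (e\<^sup>2)"]) (intro pf, use 3 that in blast)
  show ?thesis
    by (rule polyfun_zero_squares[of "\<lambda>E. PP k A B C D E"]) (intro pf, use 4 in blast)
qed

text \<open>For C = 0 the series \<open>PF\<close> is a product of two series \<open>RF1\<close>, so
  \<open>psum_st\<close> undoes the multiplication. The terms linear in both s = D - A and t = E - B
  are the stuffle products of two single letters with even indices, and the powers of D tell them
  apart.\<close>

lemma st_zero:
  assumes "kap k = 0" "even k" "even r" "0 < r" "r < k"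
  shows "st lz [r] [k - r] = 0"
proof -
  have PF0: "PF A B 0 D E = RF1 A D * RF1 B E" for A B D E by (simp add: PF_def RF1_def mult_ac)
  have 1: "psum k (\<lambda>rs ss. s ^ length rs * (t ^ length ss * (wt D rs * wt E ss * st lz rs ss))) = 0" for s t D E
  proof -
    have "psum k (\<lambda>rs ss. mlt (RF1 (D - s) D) rs * mlt (RF1 (E - t) E) ss * st lz rs ss) = PP k (D - s) (E - t) 0 D E"
      unfolding PP_def PF0 by (rule psum_st) (simp_all add: RF1_nth)
    then have "psum k (\<lambda>rs ss. mlt (RF1 (D - s) D) rs * mlt (RF1 (E - t) E) ss * st lz rs ss) = 0"
      using PP_zero[OF assms(1)] by simp
    moreover have "psum k (\<lambda>rs ss. mlt (RF1 (D - s) D) rs * mlt (RF1 (E - t) E) ss * st lz rs ss)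
      = psum k (\<lambda>rs ss. s ^ length rs * (t ^ length ss * (wt D rs * wt E ss * st lz rs ss)))"
      unfolding psum_def by (intro sum.cong refl isum_cong) (simp add: mlt_RF1)
    ultimately show ?thesis by simp
  qed
  have 2: "psum k (\<lambda>rs ss. t ^ length ss * (if length rs = Suc 0 then wt D rs * wt E ss * st lz rs ss else 0)) = 0" for t D E
    using psum_coeff1[OF 1, of t D E] by (simp add: if_distrib cong: if_cong)
  have 3: "psum k (\<lambda>rs ss. if length ss = Suc 0 then if length rs = Suc 0 then wt D rs * wt E ss * st lz rs ss else 0 else 0) = 0" for D E
  proof -
    have "psum k (\<lambda>ss rs. t ^ length ss * (if length rs = Suc 0 then wt D rs * wt E ss * st lz rs ss else 0)) = 0" for t
      using 2[of t D E] psum_swap[of k "\<lambda>rs ss. t ^ length ss * (if length rs = Suc 0 then wt D rs * wt E ss * st lz rs ss else 0)"] by simp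
    from psum_coeff1[OF this] show ?thesis
      using psum_swap[of k "\<lambda>ss rs. if length ss = Suc 0 then if length rs = Suc 0 then wt D rs * wt E ss * st lz rs ss else 0 else 0"] by simp
  qed
  \<comment> \<open>The ends i = 0 and i = k have an empty list on one side. Setting
    \<open>g\<close> to zero there also separates i = 0 from i = 2, which share the exponent
    0.\<close>
  define g where "g i = (if i = 0 \<or> i = k then 0 else (if even i then st lz [i] [k - i] else 0))" for i
  have 4: "(\<Sum>i\<le>k. g i * D ^ (i div 2 - 1)) = 0" for D
  proof -
    have inner: "isum (k - i) (\<lambda>ss. if length ss = Suc 0 then if length rs = Suc 0 then wt D rs * wt 1 ss * st lz rs ss else 0 else 0)
      = (if length rs = Suc 0 then if k - i = 0 then 0 else wt D rs * wt 1 [k - i] * st lz rs [k - i] else 0)" for i rs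
      by (subst isum_length_1) simp
    have "(\<Sum>i\<le>k. g i * D ^ (i div 2 - 1)) = psum k (\<lambda>rs ss. if length ss = Suc 0 then if length rs = Suc 0 then wt D rs * wt 1 ss * st lz rs ss else 0 else 0)"
      unfolding psum_def inner unfolding isum_length_1
      using assms(2) by (intro sum.cong) (auto simp: g_def wt_def)
    then show ?thesis using 3 by simp
  qed
  define p where "p = (\<Sum>i\<le>k. monom (g i) (i div 2 - 1))"
  have "poly p D = 0" for D using 4[of D] by (simp add: p_def poly_sum poly_monom)
  then have "p = 0" using poly_all_0_iff_0 by blast
  then have "0 = coeff p (r div 2 - 1)" by simp
  also have "\<dots> = (\<Sum>i\<le>k. if i div 2 - 1 = r div 2 - 1 then g i else 0)" by (simp add: p_def coeff_sum)
  also have "\<dots> = (\<Sum>i\<le>k. if i = r then g i else 0)"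
  proof (intro sum.cong refl)
    fix i
    have "g i = 0" if "i \<noteq> r" "i div 2 - 1 = r div 2 - 1"
    proof (rule ccontr)
      assume "g i \<noteq> 0"
      then have "even i" "i \<noteq> 0" by (auto simp: g_def split: if_splits)
      then obtain i' r' where "i = 2 * Suc i'" "r = 2 * Suc r'" using assms(3,4) by (metis evenE mult_0_right not0_implies_Suc not_gr_zero)
      then show False using that by simp
    qed
    then show "(if i div 2 - 1 = r div 2 - 1 then g i else 0) = (if i = r then g i else 0)" by auto
  qed
  also have "\<dots> = st lz [r] [k - r]" using assms by (simp add: g_def)
  finally show ?thesis by simp
qed

end

section \<open>The inhomogeneous term\<close>

text \<open>\<open>Sn a\<close> is sin(aX)/X, and \<open>Tn b\<close> is sin(bX)/(bX), which stays
  meaningful for b = 0.\<close>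

definition Sn :: "rat \<Rightarrow> rat fps" where "Sn a = Abs_fps (\<lambda>m. fps_nth (fps_sin a) (Suc m))"
definition Tn :: "rat \<Rightarrow> rat fps" where "Tn b = Abs_fps (\<lambda>m. if even m then (-1) ^ (m div 2) * b ^ m / fact (Suc m) else 0)"

lemma X_Sn: "fps_X * Sn a = fps_sin a"
proof (rule fps_ext)
  fix n show "fps_nth (fps_X * Sn a) n = fps_nth (fps_sin a) n" by (cases n) (simp_all add: Sn_def fps_sin_def)
qed

lemma Sn_nth: "fps_nth (Sn a) m = (if even m then (-1) ^ (m div 2) * a ^ Suc m / fact (Suc m) else 0)"
  by (simp add: Sn_def fps_sin_def ring_distribs)

lemma Sn_Tn: "Sn b = K b * Tn b"
proof (rule fps_ext)
  fix m show "fps_nth (Sn b) m = fps_nth (K b * Tn b) m"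
    by (cases "even m") (simp_all only: Sn_nth Tn_def fps_nth_Abs_fps fps_mult_left_const_nth
        if_True if_False power_Suc times_divide_eq_right mult_zero_right mult.left_commute)
qed

lemma Sn_1_0: "fps_nth (Sn 1) 0 = 1" by (simp add: Sn_nth)

text \<open>A product-to-sum identity for the sine, divided by X^2; it supplies the explicit
  solution \<open>g0\<close> of the difference equation in \<open>kap_zero\<close>.\<close>

lemma Sn_diff: "Sn a * Sn b - Sn (a - 1) * Sn (b - 1) = Sn (a + b - 1) * Sn 1"
proof -
  define s c sa ca sb cb where "s = fps_sin (1::rat)" and "c = fps_cos (1::rat)" and "sa = fps_sin a" and "ca = fps_cos a"
    and "sb = fps_sin b" and "cb = fps_cos b"
  have sc: "c * c + s * s = 1" using fps_sin_cos_sum_of_squares[of "1::rat"] by (simp add: s_def c_def power2_eq_square)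
  have sm: "fps_sin (x - 1) = fps_sin x * c - fps_cos x * s" for x
    using fps_sin_add[of x "-1"] by (simp add: s_def c_def fps_sin_even fps_cos_odd)
  have 1: "fps_sin (a - 1) = sa * c - ca * s" "fps_sin (b - 1) = sb * c - cb * s"
    by (simp_all add: sm sa_def ca_def sb_def cb_def)
  have 2: "fps_sin (a + b - 1) = (sa * cb + ca * sb) * c - (ca * cb - sa * sb) * s"
    unfolding sm[of "a + b"] fps_sin_add fps_cos_add by (simp add: sa_def ca_def sb_def cb_def)
  have "sa * sb - (sa * c - ca * s) * (sb * c - cb * s) = ((sa * cb + ca * sb) * c - (ca * cb - sa * sb) * s) * s"
  proof -
    have "sa * sb - (sa * c - ca * s) * (sb * c - cb * s) - ((sa * cb + ca * sb) * c - (ca * cb - sa * sb) * s) * s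
      = sa * sb * (1 - (c * c + s * s))" by (simp add: algebra_simps)
    then show ?thesis by (simp add: sc)
  qed
  then have "fps_X * Sn a * (fps_X * Sn b) - fps_X * Sn (a - 1) * (fps_X * Sn (b - 1)) = fps_X * Sn (a + b - 1) * (fps_X * Sn 1)"
    unfolding X_Sn 1 2 by (simp add: sa_def sb_def s_def)
  then have "(fps_X * fps_X) * (Sn a * Sn b - Sn (a - 1) * Sn (b - 1)) = (fps_X * fps_X) * (Sn (a + b - 1) * Sn 1)"
    by (simp add: algebra_simps)
  then show ?thesis by simp
qed

text \<open>The series t = 1 - X cot X satisfies X t' + t = X^2 + t^2. The resulting recursion has
  only nonnegative contributions, and those for even degree are positive, starting from the X^2
  term.\<close>

lemma Xcot_nonzero:
  assumes "even k" "2 \<le> k" shows "fps_nth (fps_cos 1 * inverse (Sn 1)) k \<noteq> 0"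
proof -
  define S C I W t where "S = Sn 1" and "C = fps_cos (1::rat)" and "I = inverse S" and "W = C * I" and "t = 1 - W"
  have SI: "S * I = 1" unfolding I_def S_def by (rule inverse_mult_eq_1') (simp add: Sn_1_0)
  have S': "S + fps_X * fps_deriv S = C"
    using arg_cong[OF X_Sn[of 1], of fps_deriv] by (simp add: S_def C_def fps_sin_deriv add.commute)
  have C': "fps_deriv C = - (fps_X * S)" by (simp add: C_def fps_cos_deriv S_def X_Sn flip: fps_const_neg)
  have I': "fps_X * fps_deriv I = I - C * (I * I)"
  proof -
    have "fps_deriv (S * I) = 0" by (simp add: SI)
    then have "S * fps_deriv I = - (fps_deriv S * I)" by (simp add: eq_neg_iff_add_eq_0 add.commute)
    then have "I * (S * fps_deriv I) = - (fps_deriv S * (I * I))" by (simp add: mult_ac)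
    moreover have "fps_deriv I = (S * I) * fps_deriv I" by (simp add: SI)
    moreover have "\<dots> = I * (S * fps_deriv I)" by (simp only: mult_ac)
    ultimately have "fps_deriv I = - (fps_deriv S * (I * I))" by simp
    then have "fps_X * fps_deriv I = - ((fps_X * fps_deriv S) * (I * I))" by (simp add: mult_ac)
    also have "fps_X * fps_deriv S = C - S" using S' by (simp add: algebra_simps)
    also have "- ((C - S) * (I * I)) = (S * I) * I - C * (I * I)" by (simp add: algebra_simps)
    finally show ?thesis by (simp add: SI)
  qed
  have W': "fps_X * fps_deriv W = W - fps_X * fps_X - W * W"
  proof -
    have "fps_X * fps_deriv W = - (fps_X * fps_X * (S * I)) + C * (fps_X * fps_deriv I)"
      by (simp add: W_def C' algebra_simps)
    also have "\<dots> = W - fps_X * fps_X - W * W" unfolding I' SI by (simp add: W_def algebra_simps)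
    finally show ?thesis .
  qed
  have "fps_X * fps_deriv t + t = fps_X ^ 2 + t * t"
    using W' by (simp add: t_def algebra_simps power2_eq_square)
  then have "fps_nth (fps_X * fps_deriv t + t) m = fps_nth (fps_X ^ 2 + t * t) m" for m by (rule arg_cong)
  then have "fps_nth (fps_X * fps_deriv t) m + fps_nth t m = (if m = 2 then 1 else 0) + fps_nth (t * t) m" for m
    by (simp only: fps_add_nth fps_X_power_nth)
  moreover have "fps_nth (fps_X * fps_deriv t) m = of_nat m * fps_nth t m" for m
    by (cases m) simp_all
  ultimately have rec: "of_nat (Suc m) * fps_nth t m = (if m = 2 then 1 else 0) + fps_nth (t * t) m" for m
    by (simp add: algebra_simps)
  have t0: "fps_nth t 0 = 0" by (simp add: t_def W_def C_def I_def S_def Sn_1_0)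
  have pos: "fps_nth t m \<ge> 0 \<and> (even m \<longrightarrow> 2 \<le> m \<longrightarrow> fps_nth t m > 0)" for m
  proof (induction m rule: less_induct)
    case (less m)
    have nn: "fps_nth t i * fps_nth t (m - i) \<ge> 0" if "i \<in> {0..m}" for i
    proof (cases "i = 0 \<or> i = m")
      case False
      then have "i < m" "m - i < m" using that by auto
      then show ?thesis using less by simp
    qed (auto simp: t0)
    then have sq: "fps_nth (t * t) m \<ge> 0" unfolding fps_mult_nth by (rule sum_nonneg)
    have "fps_nth t m = ((if m = 2 then 1 else 0) + fps_nth (t * t) m) / of_nat (Suc m)"
      using rec[of m] by (simp add: field_simps del: of_nat_Suc)
    moreover have "(if m = 2 then 1 else 0) + fps_nth (t * t) m > 0" if "even m" "2 \<le> m"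
    proof (cases "m = 2")
      case False
      with that have m: "2 < m" "even (m - 2)" "2 \<le> m - 2" by auto
      have "0 < fps_nth t 2 * fps_nth t (m - 2)" using less[of 2] less[of "m - 2"] m by simp
      also have "\<dots> \<le> fps_nth (t * t) m" unfolding fps_mult_nth
        by (rule member_le_sum[of 2 _ "\<lambda>i. fps_nth t i * fps_nth t (m - i)"]) (use nn m in auto)
      finally show ?thesis using False by simp
    qed (use sq in simp)
    ultimately show ?case using sq by (simp del: of_nat_Suc)
  qed
  have "fps_nth W k = - fps_nth t k" using assms by (simp add: t_def)
  then show ?thesis using pos[of k] assms by (simp add: W_def C_def I_def S_def)
qed

context fz_functional
begin

text \<open>Specializing \<open>three_label\<close> to a difference equation determines a
  two-variable function up to the factor \<open>kap k\<close> as a coefficient of sin(aX) sin(bX) /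
  (X sin X). At b = 0, after division by b, the condition on \<open>lz [k]\<close> forces a double
  zero at a = 1, while the derivative of the explicit solution there is a coefficient of X cot
  X.\<close>

theorem kap_zero:
  assumes k: "even k" "2 \<le> k" and l: "lz [k] = 0"
  shows "kap k = 0"
proof -
  define P2 where "P2 A B = isum k (\<lambda>ts. mlt ((1 - K A * fps_X ^ 2) * (1 - K B * fps_X ^ 2) * geo2 1) ts * lz ts)" for A B
  have PP2: "PP k A B C 1 C = P2 A B" "PP k A B 1 1 1 = P2 A B" for A B C
  proof -
    have "PF A B C 1 C = (1 - K A * fps_X ^ 2) * (1 - K B * fps_X ^ 2) * geo2 1 * (geo2 C * (1 - K C * fps_X ^ 2))" for C
      by (simp only: PF_def mult_ac)
    then show "PP k A B C 1 C = P2 A B" for C unfolding PP_def P2_def geo2 by simp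
    then show "PP k A B 1 1 1 = P2 A B" .
  qed
  define g where "g a b = a * b * P2 (a\<^sup>2) (b\<^sup>2)" for a b
  \<comment> \<open>The choice c = e = 2, d = 1 annihilates \<open>al3\<close>, and in both
    remaining terms one numerator factor of \<open>PF\<close> cancels a denominator factor, so the
    same two-variable function appears.\<close>
  have g: "g a b - g (a - 1) (b - 1) = kap k * (a + b - 1) ^ Suc k" for a b
  proof -
    have "PP k (a\<^sup>2) (b\<^sup>2) (2\<^sup>2) (1\<^sup>2) (2\<^sup>2) = P2 (a\<^sup>2) (b\<^sup>2)" using PP2(1) by simp
    moreover have "PP k ((a - 1)\<^sup>2) ((b - 1)\<^sup>2) ((2 - 1)\<^sup>2) (1\<^sup>2) ((2 - 1)\<^sup>2) = P2 ((a - 1)\<^sup>2) ((b - 1)\<^sup>2)" using PP2(2) by simp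
    moreover have "al1 a b 2 1 2 = a * b" "al2 a b 2 1 2 = - ((a - 1) * (b - 1))" "al3 a b 2 1 2 = 0"
      by (simp_all add: al1_def al2_def al3_def)
    moreover have "a + b + 2 - 1 - 2 = a + b - (1::rat)" by simp
    ultimately show ?thesis using three_label[of 1 2 a b 2 k] by (simp add: g_def)
  qed
  define I where "I = inverse (Sn 1)"
  have SI: "Sn 1 * I = 1" unfolding I_def by (rule inverse_mult_eq_1') (simp add: Sn_1_0)
  define g0 where "g0 a b = fps_nth (Sn a * Sn b * I) k" for a b
  define k0 where "k0 = (-1) ^ (k div 2) / (fact (Suc k) :: rat)"
  have k0: "k0 \<noteq> 0" by (simp add: k0_def)
  have g0: "g0 a b - g0 (a - 1) (b - 1) = k0 * (a + b - 1) ^ Suc k" for a b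
  proof -
    have "g0 a b - g0 (a - 1) (b - 1) = fps_nth ((Sn a * Sn b - Sn (a - 1) * Sn (b - 1)) * I) k"
      by (simp add: g0_def left_diff_distrib)
    also have "(Sn a * Sn b - Sn (a - 1) * Sn (b - 1)) * I = Sn (a + b - 1)"
      unfolding Sn_diff mult.assoc SI by simp
    finally show ?thesis using k by (simp add: Sn_nth k0_def)
  qed
  have pf_g: "polyfun (\<lambda>x. g (A x) (B x))" if "polyfun A" "polyfun B" for A B
    unfolding g_def PP2(2)[symmetric] by (intro polyfun_mult polyfun_PP polyfun_power polyfun_const that)
  have pf_S: "polyfun (\<lambda>x. fps_nth (Sn (A x)) n)" if "polyfun A" for A n
  proof (cases "even n")
    case True
    have "polyfun (\<lambda>x. (-1) ^ (n div 2) * A x ^ Suc n / fact (Suc n))"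
      by (intro polyfun_divide polyfun_mult polyfun_power polyfun_const that)
    with True show ?thesis by (simp only: Sn_nth if_True)
  next
    case False
    then have "(\<lambda>x. fps_nth (Sn (A x)) n) = (\<lambda>x. 0)" by (simp only: Sn_nth if_False)
    then show ?thesis by simp
  qed
  have pf_g0: "polyfun (\<lambda>x. g0 (A x) (B x))" if "polyfun A" "polyfun B" for A B
    unfolding g0_def by (intro polyfun_fps_mult pf_S that polyfun_const)
  \<comment> \<open>Both sides solve the same difference equation. Their difference is polynomial
    and invariant under a simultaneous shift of a and b by 1, hence by any amount, and it vanishes
    at a = 0.\<close>
  have eq: "k0 * g a b = kap k * g0 a b" for a b
  proof -
    define h where "h a b = k0 * g a b - kap k * g0 a b" for a b
    have h1: "h a b = h (a - 1) (b - 1)" for a b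
    proof -
      have "k0 * (g a b - g (a - 1) (b - 1)) = kap k * (g0 a b - g0 (a - 1) (b - 1))" unfolding g g0 by simp
      then show ?thesis by (simp add: h_def algebra_simps)
    qed
    have hn: "h (a + of_nat n) (b + of_nat n) = h a b" for n
    proof (induction n)
      case (Suc n)
      then show ?case using h1[of "a + of_nat (Suc n)" "b + of_nat (Suc n)"] by (simp add: algebra_simps)
    qed simp
    have "h (a + (- a)) (b + (- a)) - h a b = 0"
    proof (rule polyfun_zero[of "\<lambda>t. h (a + t) (b + t) - h a b"])
      show "polyfun (\<lambda>t. h (a + t) (b + t) - h a b)"
        unfolding h_def by (intro polyfun_diff polyfun_mult pf_g pf_g0 polyfun_add polyfun_const polyfun_id)
      show "infinite (range (of_nat :: nat \<Rightarrow> rat))" by (intro range_inj_infinite inj_of_nat)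
    qed (auto simp: hn)
    moreover have "h 0 c = 0" for c
    proof -
      have "Sn 0 = 0" by (rule fps_ext) (simp add: Sn_nth)
      then show ?thesis by (simp add: h_def g_def g0_def)
    qed
    ultimately show ?thesis by (simp add: h_def)
  qed
  \<comment> \<open>Both sides of \<open>eq\<close> are divisible by b; after the division b is set
    to 0.\<close>
  have eq0: "k0 * (a * P2 (a\<^sup>2) 0) = kap k * fps_nth (Sn a * I) k" for a
  proof -
    have "k0 * (a * P2 (a\<^sup>2) (0\<^sup>2)) - kap k * fps_nth (Sn a * Tn 0 * I) k = 0"
    proof (rule polyfun_zero[of "\<lambda>b. k0 * (a * P2 (a\<^sup>2) (b\<^sup>2)) - kap k * fps_nth (Sn a * Tn b * I) k"])
      have "polyfun (\<lambda>x. fps_nth (Tn x) n)" for n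
      proof (cases "even n")
        case True
        have "polyfun (\<lambda>x. (-1) ^ (n div 2) * x ^ n / fact (Suc n))"
          by (intro polyfun_divide polyfun_mult polyfun_power polyfun_const polyfun_id)
        with True show ?thesis by (simp only: Tn_def fps_nth_Abs_fps if_True)
      qed (simp add: Tn_def)
      then show "polyfun (\<lambda>b. k0 * (a * P2 (a\<^sup>2) (b\<^sup>2)) - kap k * fps_nth (Sn a * Tn b * I) k)"
        unfolding PP2(2)[symmetric]
        by (intro polyfun_diff polyfun_mult polyfun_PP polyfun_power polyfun_fps_mult polyfun_const polyfun_id)
      show "infinite (range (\<lambda>n. of_nat (Suc n) * (1::rat)))" by (rule infinite_multiples) simp
      fix b :: rat assume "b \<in> range (\<lambda>n. of_nat (Suc n) * (1::rat))"
      then have "b \<noteq> 0" by (auto simp del: of_nat_Suc)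
      have "fps_nth (Sn a * Sn b * I) k = b * fps_nth (Sn a * Tn b * I) k"
        using fps_mult_left_const_nth[of b "Sn a * Tn b * I" k] by (simp add: Sn_Tn[of b] mult_ac)
      then have "b * (k0 * (a * P2 (a\<^sup>2) (b\<^sup>2))) = b * (kap k * fps_nth (Sn a * Tn b * I) k)"
        using eq[of a b] by (simp add: g_def g0_def mult_ac)
      then show "k0 * (a * P2 (a\<^sup>2) (b\<^sup>2)) - kap k * fps_nth (Sn a * Tn b * I) k = 0" using \<open>b \<noteq> 0\<close> by simp
    qed
    moreover have "Tn 0 = 1" by (rule fps_ext) (auto simp: Tn_def power_0_left)
    ultimately show ?thesis by simp
  qed
  define c where "c j = isum k (\<lambda>rs. if length rs = j then wt 1 rs * lz rs else 0)" for j
  have c: "c 0 = 0" "c (Suc 0) = 0"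
    using isum_length_0[of k "\<lambda>rs. wt 1 rs * lz rs"] isum_length_1[of k "\<lambda>rs. wt 1 rs * lz rs"] k l
    by (simp_all add: c_def)
  define q where "q = (\<Sum>j\<le>k. smult (c j) ([:1, 0, -1:] ^ j))"
  have q: "P2 (a\<^sup>2) 0 = poly q a" for a
  proof -
    have "P2 (a\<^sup>2) 0 = isum k (\<lambda>ts. (1 - a\<^sup>2) ^ length ts * (wt 1 ts * lz ts))"
      unfolding P2_def by (intro isum_cong) (simp add: mlt_RF1 flip: RF1_def)
    then show ?thesis unfolding isum_by_length
      by (simp add: q_def poly_sum poly_power c_def power2_eq_square)
  qed
  define r where "r = (\<Sum>j\<le>k. monom ((if even j then (-1) ^ (j div 2) / fact (Suc j) else 0) * fps_nth I (k - j)) (Suc j))"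
  have r: "fps_nth (Sn a * I) k = poly r a" for a
    unfolding fps_mult_nth r_def poly_sum poly_monom atMost_atLeast0 by (intro sum.cong) (auto simp: Sn_nth)
  have "poly (smult k0 ([:0, 1:] * q)) a = poly (smult (kap k) r) a" for a
    using eq0[of a] unfolding q r by (simp add: mult.left_commute)
  then have "smult k0 ([:0, 1:] * q) = smult (kap k) r" using poly_eq_poly_eq_iff by blast
  then have "poly (pderiv (smult k0 ([:0, 1:] * q))) 1 = poly (pderiv (smult (kap k) r)) 1" by simp
  moreover have "poly (pderiv r) 1 = fps_nth (fps_cos 1 * I) k"
  proof -
    have "(of_nat (Suc j) :: rat) * (x / fact (Suc j)) = x / fact j" for j x
      by (simp add: fact_Suc del: of_nat_Suc)
    then show ?thesis unfolding r_def pderiv_sum' pderiv_monom poly_sum poly_monom fps_mult_nth atMost_atLeast0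
      by (intro sum.cong refl) (auto simp: fps_cos_def mult.assoc[symmetric] simp del: of_nat_Suc fact_Suc)
  qed
  \<comment> \<open>\<open>q\<close> is a combination of the powers (1 - a^2)^j with j at least 2,
    since \<open>c 1\<close> is a multiple of \<open>lz [k]\<close> and \<open>c 0\<close> is zero
    for k > 0; so a = 1 is a double zero.\<close>
  moreover have "poly (pderiv ([:0, 1:] * q)) 1 = 0"
  proof -
    have z: "c j * 0 ^ j = 0" for j using c by (cases j) auto
    have z': "c j * (of_nat j * 0 ^ (j - Suc 0)) = 0" for j
    proof -
      consider "j = 0" | "j = Suc 0" | i where "j = Suc (Suc i)" by (metis not0_implies_Suc)
      then show ?thesis by cases (use c in auto)
    qed
    have q1: "poly q 1 = 0" unfolding q_def by (simp add: poly_sum poly_power z)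
    have "poly (pderiv q) 1 = (\<Sum>j\<le>k. c j * (of_nat j * 0 ^ (j - Suc 0)) * (-2))"
      unfolding q_def pderiv_sum' poly_sum
      by (intro sum.cong refl) (simp add: pderiv_smult pderiv_power pderiv_pCons poly_power)
    then have "poly (pderiv q) 1 = 0" unfolding z' by simp
    with q1 show ?thesis by (simp add: pderiv_mult pderiv_pCons)
  qed
  ultimately have "kap k * fps_nth (fps_cos 1 * I) k = 0" by (metis pderiv_smult poly_smult mult_zero_right)
  then show ?thesis using Xcot_nonzero[OF k] by (simp add: I_def)
qed

theorem euler:
  assumes "even k" "lz [k] = 0" "even r" "0 < r" "r < k"
  shows "LS (zz (index_word [r]) * zz (index_word [k - r])) = 0"
proof -
  have "2 \<le> k" using assms by presburger
  then have "kap k = 0" by (intro kap_zero assms)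
  then have "st lz [r] [k - r] = 0" by (intro st_zero assms)
  then show ?thesis using assms by (simp add: LS_zz_zz)
qed

end

section \<open>Lie side: coproducts and symmetries of double shuffle elements\<close>

section \<open>Tensor squares and coproducts\<close>

type_synonym 'a tens = "('a list \<times> 'a list) \<Rightarrow>\<^sub>0 rat"

definition inl :: "('a list \<Rightarrow>\<^sub>0 rat) \<Rightarrow> 'a tens" where "inl = lin_ext (\<lambda>u. mon (u, []))"
definition inr :: "('a list \<Rightarrow>\<^sub>0 rat) \<Rightarrow> 'a tens" where "inr = lin_ext (\<lambda>u. mon ([], u))"

lemma inl_lin [simp]: "inl (p + q) = inl p + inl q" "inl (p - q) = inl p - inl q" "inl (- p) = - inl p"
   "inl (qscale c p) = qscale c (inl p)" "inl 0 = 0" "inl (mon u) = mon (u, [])"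
  by (simp_all add: inl_def)
lemma inr_lin [simp]: "inr (p + q) = inr p + inr q" "inr (p - q) = inr p - inr q" "inr (- p) = - inr p"
   "inr (qscale c p) = qscale c (inr p)" "inr 0 = 0" "inr (mon u) = mon ([], u)"
  by (simp_all add: inr_def)
lemma inl_sum: "inl (\<Sum>i\<in>A. f i) = (\<Sum>i\<in>A. inl (f i))" by (simp add: inl_def lin_ext_sum)
lemma inr_sum: "inr (\<Sum>i\<in>A. f i) = (\<Sum>i\<in>A. inr (f i))" by (simp add: inr_def lin_ext_sum)

lemma mon_pair: "mon (u, v) * mon (u', v') = mon (u @ u', v @ v')"
  by (simp add: mon_times plus_list_def)

lemma mon_pair_Nil: "mon ([], []) = 1" by (metis single_one zero_list_def zero_prod_def)

lemma inl_1 [simp]: "inl 1 = 1" using inl_lin(6)[of "[]"] by (simp only: mon_Nil mon_pair_Nil)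
lemma inr_1 [simp]: "inr 1 = 1" using inr_lin(6)[of "[]"] by (simp only: mon_Nil mon_pair_Nil)

lemma bilinear_eqI:
  assumes "\<And>p p' q. F (p + p') q = F p q + F p' q" "\<And>c p q. F (qscale c p) q = qscale c (F p q)"
    "\<And>p q q'. F p (q + q') = F p q + F p q'" "\<And>c p q. F p (qscale c q) = qscale c (F p q)"
    "\<And>p p' q. G (p + p') q = G p q + G p' q" "\<And>c p q. G (qscale c p) q = qscale c (G p q)"
    "\<And>p q q'. G p (q + q') = G p q + G p q'" "\<And>c p q. G p (qscale c q) = qscale c (G p q)"
    "\<And>u v. F (mon u) (mon v) = G (mon u) (mon v)"
  shows "F p q = G p q"
proof -
  have 1: "F (mon u) q = G (mon u) q" for u
    by (rule linear_eqI[of "\<lambda>q. F (mon u) q"]) (fact assms)+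
  show ?thesis by (rule linear_eqI[of "\<lambda>p. F p q"]) (fact assms 1)+
qed

lemma inl_mult: "inl (p * q) = inl p * inl q"
  by (rule bilinear_eqI[of "\<lambda>p q. inl (p * q)"]) (simp_all add: algebra_simps mon_pair flip: mon_append)
lemma inr_mult: "inr (p * q) = inr p * inr q"
  by (rule bilinear_eqI[of "\<lambda>p q. inr (p * q)"]) (simp_all add: algebra_simps mon_pair flip: mon_append)
lemma inr_inl: "inr q * inl p = inl p * inr q"
  by (rule bilinear_eqI[of "\<lambda>q p. inr q * inl p"]) (simp_all add: algebra_simps mon_pair)

lemma lk_inl_inr: "lk (inl p * inr q) (u, v) = lk p u * lk q v"
proof -
  have 1: "ev (\<lambda>w. if w = (u, v) then 1 else 0) (inl p * inr q) = ev (\<lambda>a. ev (\<lambda>b. if a = u \<and> b = v then 1 else 0) q) p"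
    unfolding inl_def inr_def ev_mult ev_lin_ext by (simp add: plus_list_def)
  have "ev (\<lambda>b. if a = u \<and> b = v then 1 else 0) q = (if a = u then lk q v else 0)" for a
    by (cases "a = u") (simp_all add: ev_delta)
  with 1 show ?thesis by (simp add: ev_delta)
qed
lemma lk_inl: "lk (inl p) (u, v) = (if v = [] then lk p u else 0)"
  using lk_inl_inr[of p 1 u v] by (simp add: lk_one)
lemma lk_inr: "lk (inr p) (u, v) = (if u = [] then lk p v else 0)"
  using lk_inl_inr[of 1 p u v] by (simp add: lk_one)

lemma ev_mon_pair: "ev \<phi> (mon (a, b) * X) = ev (\<lambda>(c, d). \<phi> (a @ c, b @ d)) X"
  by (simp add: ev_mult plus_list_def split_def) (auto intro!: ev_cong simp: plus_prod_def plus_list_def)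

lemma lk_pair_left: "lk (mon ([l], []) * X) (u, v) = (case u of [] \<Rightarrow> 0 | h # u' \<Rightarrow> if h = l then lk X (u', v) else 0)"
  unfolding lk_conv_ev ev_mon_pair by (cases u) (auto intro!: ev_cong trans[OF ev_cong ev_fun0] split: if_splits)
lemma lk_pair_right: "lk (mon ([], [l]) * X) (u, v) = (case v of [] \<Rightarrow> 0 | h # v' \<Rightarrow> if h = l then lk X (u, v') else 0)"
  unfolding lk_conv_ev ev_mon_pair by (cases v) (auto intro!: ev_cong trans[OF ev_cong ev_fun0] split: if_splits)
lemma lk_pair_both: "lk (mon ([l], [m]) * X) (u, v) = (case u of [] \<Rightarrow> 0 | h # u' \<Rightarrow> (case v of [] \<Rightarrow> 0 | g # v' \<Rightarrow> if h = l \<and> g = m then lk X (u', v') else 0))"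
proof -
  have "mon ([l], [m]) * X = mon ([l], []) * (mon ([], [m]) * X)" by (simp add: mon_pair flip: mult.assoc)
  then show ?thesis by (auto simp: lk_pair_left lk_pair_right split: list.split)
qed

text \<open>The coproduct with primitive letters; \<open>lk_shuffle_word\<close> says that it is
  dual to the shuffle product.\<close>

definition Dsh :: "qxy \<Rightarrow> letter tens" where "Dsh = hm (\<lambda>l. inl (mon [l]) + inr (mon [l]))"

lemma lk_shuffle_word: "lk (shuffle_word u v) w = lk (Dsh (mon w)) (u, v)"
proof (induction w arbitrary: u v)
  case Nil
  have "lk (shuffle_word u v) [] = (if u = [] \<and> v = [] then 1 else 0)"
    by (cases u; cases v) (auto simp: lookup_add lk_mon_mult_Nil lookup_single when_def)
  then show ?case by (simp add: Dsh_def lookup_single when_def flip: mon_pair_Nil)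
next
  case (Cons l w)
  have "Dsh (mon (l # w)) = mon ([l], []) * Dsh (mon w) + mon ([], [l]) * Dsh (mon w)"
    by (simp add: Dsh_def hm_mon distrib_right)
  then show ?case
    by (cases u; cases v) (auto simp: lookup_add lk_pair_left lk_pair_right lk_mon_mult_Cons Cons.IH[symmetric] lookup_single when_def)
qed

lemma ev_lk_commute: "ev (lk p) q = ev (lk q) p"
proof -
  let ?A = "Poly_Mapping.keys p \<union> Poly_Mapping.keys q"
  have "ev (lk p) q = (\<Sum>w\<in>?A. lk q w * lk p w)" "ev (lk q) p = (\<Sum>w\<in>?A. lk p w * lk q w)"
    by (auto intro!: ev_superset)
  then show ?thesis by (simp add: mult.commute)
qed

lemma ev_shuffle_word: "ev (lk p) (shuffle_word u v) = lk (Dsh p) (u, v)"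
proof -
  have "lk (Dsh p) (u, v) = ev (\<lambda>w. lk (Dsh (mon w)) (u, v)) p"
    by (rule functional_eq_ev) (simp_all add: Dsh_def lookup_add)
  also have "\<dots> = ev (\<lambda>w. lk (shuffle_word u v) w) p" by (simp add: lk_shuffle_word)
  finally show ?thesis by (simp add: ev_lk_commute)
qed

lemma Dsh_diff: "Dsh (p - q) = Dsh p - Dsh q" "Dsh (p + q) = Dsh p + Dsh q" by (simp_all add: Dsh_def)
lemma Dsh_mult: "Dsh (p * q) = Dsh p * Dsh q" by (simp add: Dsh_def hm_mult)

text \<open>The easy direction of Friedrichs' criterion: primitive elements are closed under
  commutators, because the two tensor factors commute.\<close>

lemma Lie_prim: "f \<in> Lie_xy \<Longrightarrow> Dsh f = inl f + inr f"
proof (induction rule: Lie_xy.induct)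
  case (bracket f g)
  have "Dsh (commutator f g) = (inl f + inr f) * (inl g + inr g) - (inl g + inr g) * (inl f + inr f)"
    by (simp only: commutator_def Dsh_diff Dsh_mult bracket.IH)
  then show ?case by (simp add: commutator_def inl_mult inr_mult algebra_simps inr_inl)
qed (simp_all add: Dsh_def qvec.scale_right_distrib)

text \<open>The antipode of the concatenation algebra.\<close>

definition Sa :: "qxy \<Rightarrow> qxy" where "Sa = lin_ext (\<lambda>w. qscale ((-1) ^ length w) (mon (rev w)))"

lemma Sa_lin [simp]: "Sa (p + q) = Sa p + Sa q" "Sa (p - q) = Sa p - Sa q" "Sa (qscale c p) = qscale c (Sa p)" "Sa 0 = 0"
  by (simp_all add: Sa_def)
lemma Sa_mult: "Sa (p * q) = Sa q * Sa p"
  by (rule bilinear_eqI[of "\<lambda>p q. Sa (p * q)"])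
     (simp_all add: algebra_simps, simp add: Sa_def power_add mult.commute flip: mon_append)
lemma Lie_Sa: "f \<in> Lie_xy \<Longrightarrow> Sa f = - f"
proof (induction rule: Lie_xy.induct)
  case (bracket f g)
  then show ?case by (simp add: commutator_def Sa_mult)
qed (simp_all add: Sa_def qscale_minus1 qvec.scale_minus_right)

lemma lk_Sa: "lk (Sa p) w = (-1) ^ length w * lk p (rev w)"
proof -
  have "lk (Sa p) w = ev (\<lambda>v. if v = rev w then (-1) ^ length w else 0) p"
    unfolding Sa_def lk_lin_ext by (rule ev_cong) (auto simp: lookup_single when_def)
  then show ?thesis by (simp add: ev_delta)
qed

lemma Lie_ge3_Lie: "f \<in> Lie_ge3 \<Longrightarrow> f \<in> Lie_xy"
  unfolding Lie_ge3_def
proof (induction rule: qvec.span_induct_alt)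
  case base show ?case by (rule Lie_xy.zero)
next
  case (step c x y) then show ?case by (auto intro: Lie_xy.add Lie_xy.scale)
qed

section \<open>Insertion operators\<close>

abbreviation xs :: "nat \<Rightarrow> letter list" where "xs j \<equiv> replicate j Lx"

lemma insx_add: "insx (\<lambda>w. \<phi> w + \<psi> w) w = insx \<phi> w + insx \<psi> w"
  by (induction w arbitrary: \<phi> \<psi>) auto

fun insy :: "(letter list \<Rightarrow> rat) \<Rightarrow> letter list \<Rightarrow> rat" where
  "insy \<phi> [] = \<phi> [Ly]"
| "insy \<phi> (a # w) = \<phi> (Ly # a # w) + insy (\<lambda>v. \<phi> (a # v)) w"

lemma ev_shuffle_gy: "ev \<phi> (shuffle gy (mon w)) = insy \<phi> w"
  by (induction w arbitrary: \<phi>) (simp_all add: shuffle_mon flip: mon_append)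

text \<open>As \<open>insx\<close>, but without the insertion after the last letter; this is what
  the left part of a concatenation contributes.\<close>

fun pinsx :: "(letter list \<Rightarrow> rat) \<Rightarrow> letter list \<Rightarrow> rat" where
  "pinsx \<phi> [] = 0"
| "pinsx \<phi> (a # w) = \<phi> (Lx # a # w) + pinsx (\<lambda>v. \<phi> (a # v)) w"

lemma insx_append: "insx \<phi> (u @ v) = pinsx (\<lambda>z. \<phi> (z @ v)) u + insx (\<lambda>z. \<phi> (u @ z)) v"
  by (induction u arbitrary: \<phi>) auto
lemma insx_xs: "insx \<phi> (xs j) = of_nat (Suc j) * \<phi> (xs (Suc j))"
  by (induction j arbitrary: \<phi>) (auto simp: algebra_simps)
lemma pinsx_xs_y: "pinsx \<phi> (xs j @ [Ly]) = of_nat (Suc j) * \<phi> (xs (Suc j) @ [Ly])"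
  by (induction j arbitrary: \<phi>) (auto simp: algebra_simps)
lemma pinsx_zero: "(\<And>v. Lx \<in> set v \<Longrightarrow> \<phi> (v @ [Ly]) = 0) \<Longrightarrow> pinsx \<phi> (u @ [Ly]) = 0"
proof (induction u arbitrary: \<phi>)
  case Nil then show ?case using Nil[of "[Lx]"] by simp
next
  case (Cons a u)
  have "\<phi> (Lx # a # u @ [Ly]) = 0" using Cons.prems[of "Lx # a # u"] by simp
  moreover have "pinsx (\<lambda>v. \<phi> (a # v)) (u @ [Ly]) = 0"
    by (rule Cons.IH) (use Cons.prems[of "a # v" for v] in auto)
  ultimately show ?case by simp
qed

text \<open>\<open>KK \<phi> m w\<close> is \<open>\<phi> (K\<^sub>m w)\<close> for the operator that extends the stuffle product with \<open>y\<^sub>m\<close> to all words.\<close>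

fun RR :: "(letter list \<Rightarrow> rat) \<Rightarrow> nat \<Rightarrow> letter list \<Rightarrow> rat" where
  "RR \<phi> m [] = 0"
| "RR \<phi> m (Lx # u) = RR (\<lambda>v. \<phi> (Lx # v)) m u"
| "RR \<phi> m (Ly # u) = \<phi> (xs m @ Ly # u) + \<phi> (Ly # xs (m - 1) @ Ly # u) + RR (\<lambda>v. \<phi> (Ly # v)) m u"

definition KK where "KK \<phi> m w = \<phi> (xs (m - 1) @ Ly # w) + RR \<phi> m w"

lemma RR_add: "RR (\<lambda>w. \<phi> w + \<psi> w) m w = RR \<phi> m w + RR \<psi> m w"
  by (induction \<phi> m w arbitrary: \<psi> rule: RR.induct) auto
lemma RR_0 [simp]: "RR (\<lambda>w. 0) m w = 0"
  by (induction "\<lambda>w::letter list. 0::rat" m w rule: RR.induct) auto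

lemma insx_block: "m \<ge> 1 \<Longrightarrow> insx \<phi> (xs (m - 1) @ Ly # w) = of_nat m * \<phi> (xs m @ Ly # w) + insx (\<lambda>z. \<phi> (xs (m - 1) @ Ly # z)) w"
  using insx_append[of \<phi> "xs (m - 1) @ [Ly]" w] by (simp add: pinsx_xs_y)

lemma RR_insx: "m \<ge> 1 \<Longrightarrow> RR (insx \<phi>) m w = insx (RR \<phi> m) w + of_nat m * RR \<phi> (Suc m) w"
proof (induction w arbitrary: \<phi>)
  case (Cons a u)
  show ?case
  proof (cases a)
    case Lx
    show ?thesis using Cons.IH[OF Cons.prems, of "\<lambda>v. \<phi> (Lx # v)"] by (simp add: Lx RR_add)
  next
    case Ly
    have 1: "insx \<phi> (xs m @ Ly # u) = of_nat (Suc m) * \<phi> (xs (Suc m) @ Ly # u) + insx (\<lambda>z. \<phi> (xs m @ Ly # z)) u"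
      using insx_block[of "Suc m" \<phi> u] by simp
    show ?thesis
      using Cons.IH[OF Cons.prems, of "\<lambda>v. \<phi> (Ly # v)"] insx_block[OF Cons.prems, of "\<lambda>v. \<phi> (Ly # v)" u] 1
      by (simp add: Ly RR_add insx_add algebra_simps)
  qed
qed simp

text \<open>Inserting an x after K_m differs from inserting it before by m K_(m+1): the surplus
  insertions are those into the block that K_m has created. This carries stuffle relations over to
  words with trailing x.\<close>

lemma KK_insx: "m \<ge> 1 \<Longrightarrow> KK (insx \<phi>) m w = insx (KK \<phi> m) w + of_nat m * KK \<phi> (Suc m) w"
  using RR_insx[of m \<phi> w] insx_block[of m \<phi> w]
  by (simp add: KK_def[abs_def] insx_add algebra_simps)

lemma RR_xs: "RR \<phi> m (xs j @ w) = RR (\<lambda>v. \<phi> (xs j @ v)) m w"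
  by (induction j arbitrary: \<phi>) auto

lemma y_word_Suc: "1 \<le> r \<Longrightarrow> y_word r @ w = xs (r - 1) @ Ly # w" by (simp add: y_word_def)

lemma KK_index: "1 \<le> m \<Longrightarrow> \<forall>r\<in>set ss. 1 \<le> r \<Longrightarrow> KK \<phi> m (index_word ss) = st (\<lambda>ts. \<phi> (index_word ts)) [m] ss"
proof (induction ss arbitrary: \<phi>)
  case Nil
  then show ?case by (simp add: KK_def index_word_def y_word_def)
next
  case (Cons j ss)
  have i: "index_word (a # ts) = y_word a @ index_word ts" for a ts by (simp add: index_word_def)
  have w: "xs (j - 1) @ xs m @ Ly # u = y_word (m + j) @ u" for u
  proof -
    have "j - 1 + m = m + j - 1" using Cons.prems by auto
    then have "xs (m + j - 1) = xs (j - 1) @ xs m" by (metis replicate_add)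
    then show ?thesis by (simp add: y_word_def)
  qed
  have "KK \<phi> m (index_word (j # ss)) = \<phi> (y_word m @ y_word j @ index_word ss) + RR (\<lambda>v. \<phi> (xs (j - 1) @ v)) m (Ly # index_word ss)"
    using Cons.prems by (simp add: KK_def i y_word_Suc RR_xs)
  also have "RR (\<lambda>v. \<phi> (xs (j - 1) @ v)) m (Ly # index_word ss)
     = \<phi> (xs (j - 1) @ xs m @ Ly # index_word ss) + KK (\<lambda>v. \<phi> (xs (j - 1) @ Ly # v)) m (index_word ss)"
    by (simp only: RR.simps KK_def add.assoc)
  also have "(\<lambda>v. \<phi> (xs (j - 1) @ Ly # v)) = (\<lambda>v. \<phi> (y_word j @ v))" by (simp add: y_word_def)
  also have "xs (j - 1) @ xs m @ Ly # index_word ss = y_word (m + j) @ index_word ss" by (rule w)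
  finally show ?case using Cons.IH[of "\<lambda>v. \<phi> (y_word j @ v)"] Cons.prems by (simp add: i)
qed

lemma ends_y_index: "\<exists>ss. v @ [Ly] = index_word ss \<and> ss \<noteq> [] \<and> (\<forall>r\<in>set ss. 1 \<le> r) \<and> (Lx \<in> set v \<longrightarrow> \<not> set ss \<subseteq> {1})"
proof (induction v)
  case Nil
  show ?case by (rule exI[of _ "[1]"]) (simp add: index_word_def y_word_def)
next
  case (Cons a v)
  then obtain ss where s: "v @ [Ly] = index_word ss" "ss \<noteq> []" "\<forall>r\<in>set ss. 1 \<le> r" "Lx \<in> set v \<longrightarrow> \<not> set ss \<subseteq> {1}" by blast
  show ?case
  proof (cases a)
    case Ly
    then show ?thesis using s by (intro exI[of _ "1 # ss"]) (auto simp: index_word_def y_word_def)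
  next
    case Lx
    obtain r rs where r: "ss = r # rs" using s(2) by (cases ss) auto
    then show ?thesis using s Lx
      by (intro exI[of _ "Suc r # rs"]) (cases r, auto simp: index_word_def y_word_def)
  qed
qed

text \<open>The adjoint of the derivation x -> -xy, y -> xy.\<close>

fun dH :: "(letter list \<Rightarrow> rat) \<Rightarrow> letter list \<Rightarrow> rat" where
  "dH \<phi> [] = 0"
| "dH \<phi> (Lx # u) = - \<phi> (Lx # Ly # u) + dH (\<lambda>v. \<phi> (Lx # v)) u"
| "dH \<phi> (Ly # u) = \<phi> (Lx # Ly # u) + dH (\<lambda>v. \<phi> (Ly # v)) u"

lemma KK_dH: "KK \<phi> 1 w = dH \<phi> w + insy \<phi> w"
proof (induction \<phi> w rule: dH.induct)
  case (2 \<phi> u) then show ?case by (cases u) (auto simp: KK_def)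
next
  case (3 \<phi> u) then show ?case by (cases u) (auto simp: KK_def)
qed (simp add: KK_def)

lemma dH_snoc: "dH \<phi> (w @ [Lx]) = dH (\<lambda>z. \<phi> (z @ [Lx])) w - \<phi> (w @ [Lx, Ly])"
  "dH \<phi> (w @ [Ly]) = dH (\<lambda>z. \<phi> (z @ [Ly])) w + \<phi> (w @ [Lx, Ly])"
  by (induction \<phi> w rule: dH.induct) auto

text \<open>Conjugation by reversal gives the derivation x -> -yx, y -> yx; the difference of the
  two derivations is the inner derivation w -> (x+y)w - w(x+y).\<close>

lemma dH_rev: "dH \<phi> w - dH (\<lambda>z. \<phi> (rev z)) (rev w) = \<phi> (Lx # w) + \<phi> (Ly # w) - \<phi> (w @ [Lx]) - \<phi> (w @ [Ly])"
  by (induction \<phi> w rule: dH.induct) (simp_all add: dH_snoc)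

section \<open>Double shuffle elements of odd degree\<close>

locale odd_ds =
  fixes f :: qxy and n :: nat
  assumes f_ds: "f \<in> ds_deg n" and n_odd: "odd n" and n3: "3 \<le> n"
begin

lemma f_Lie: "f \<in> Lie_xy" using f_ds by (auto simp: ds_deg_def ds_def intro: Lie_ge3_Lie)
lemma f_len: "length w \<noteq> n \<Longrightarrow> lk f w = 0"
  using f_ds by (auto simp: ds_deg_def homog_def in_keys_iff)
text \<open>The antipode acts on Lie elements as -1, and on words of odd length it is minus the
  reversal.\<close>

lemma f_rev: "lk f (rev w) = lk f w"
proof (cases "length w = n")
  case True
  have "lk (Sa f) w = - lk f w" by (simp add: Lie_Sa[OF f_Lie])
  then show ?thesis using True n_odd by (simp add: lk_Sa)
qed (simp add: f_len)
lemma f_shuffle: "u \<noteq> [] \<Longrightarrow> v \<noteq> [] \<Longrightarrow> ev (lk f) (shuffle_word u v) = 0"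
  by (simp add: ev_shuffle_word Lie_prim[OF f_Lie] lookup_add lk_inl lk_inr)
lemma f_st: "is_index rs \<Longrightarrow> is_index ss \<Longrightarrow> \<not> (set rs \<subseteq> {1} \<and> set ss \<subseteq> {1}) \<Longrightarrow> st (\<lambda>ts. lk f (index_word ts)) rs ss = 0"
  using f_ds by (auto simp: ds_deg_def ds_def pairing_ev simp flip: ev_stuffle)
lemma f_insx: "insx (lk f) w = 0"
proof (cases w)
  case Nil then show ?thesis using n3 f_len by simp
next
  case (Cons a u) then show ?thesis using f_shuffle[of "[Lx]" w] by (simp add: shuffle_mon flip: ev_shuffle_gx)
qed
lemma f_insy: "insy (lk f) w = 0"
proof (cases w)
  case Nil then show ?thesis using n3 f_len by simp
next
  case (Cons a u) then show ?thesis using f_shuffle[of "[Ly]" w] by (simp add: shuffle_mon flip: ev_shuffle_gy)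
qed

text \<open>For j = 0 this is the stuffle relation with y_m. One more trailing x is reached through
  \<open>KK_insx\<close>, at the price of raising m; insertions further left are covered by the
  induction hypothesis. The only case left out is m = 1 on a power of y, as in
  \<open>ds\<close>.\<close>

lemma f_KK: "1 \<le> m \<Longrightarrow> 2 \<le> m \<or> Lx \<in> set v \<or> 1 \<le> j \<Longrightarrow> KK (lk f) m (v @ Ly # xs j) = 0"
proof (induction j arbitrary: m v)
  case 0
  obtain ss where s: "v @ [Ly] = index_word ss" "ss \<noteq> []" "\<forall>r\<in>set ss. 1 \<le> r" "Lx \<in> set v \<longrightarrow> \<not> set ss \<subseteq> {1}"
    using ends_y_index by blast
  have "KK (lk f) m (index_word ss) = st (\<lambda>ts. lk f (index_word ts)) [m] ss" using 0 s by (intro KK_index) auto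
  also have "\<dots> = 0" using 0 s by (intro f_st) (auto simp: is_index_def)
  finally show ?case using s by simp
next
  case (Suc j)
  have "KK (insx (lk f)) m (v @ Ly # xs j) = 0"
    using f_insx by (simp add: KK_def f_insx[abs_def])
  then have "insx (KK (lk f) m) ((v @ [Ly]) @ xs j) = - of_nat m * KK (lk f) (Suc m) (v @ Ly # xs j)"
    using KK_insx[OF Suc.prems(1), of "lk f"] by simp
  also have "\<dots> = 0" using Suc.IH[of "Suc m" v] Suc.prems by simp
  finally have "pinsx (\<lambda>z. KK (lk f) m (z @ xs j)) (v @ [Ly]) + of_nat (Suc j) * KK (lk f) m (v @ Ly # xs (Suc j)) = 0"
    unfolding insx_append insx_xs by simp
  moreover have "pinsx (\<lambda>z. KK (lk f) m (z @ xs j)) (v @ [Ly]) = 0"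
    by (rule pinsx_zero) (use Suc.IH[OF Suc.prems(1)] in simp)
  ultimately show ?case by (simp del: of_nat_Suc)
qed

lemma f_dH: "Lx \<in> set w \<Longrightarrow> Ly \<in> set w \<Longrightarrow> dH (lk f) w = 0"
proof -
  assume a: "Lx \<in> set w" "Ly \<in> set w"
  obtain v z where w: "w = v @ Ly # z" "Ly \<notin> set z" using split_list_last[OF a(2)] by blast
  have "z = xs (length z)" using w(2) by (metis (full_types) letter.exhaust replicate_eqI)
  then obtain j where j: "z = xs j" by blast
  have "Lx \<in> set v \<or> 1 \<le> j" using a(1) w j by (cases j) auto
  then have "KK (lk f) 1 w = 0" unfolding w(1) j by (intro f_KK) auto
  then show ?thesis using KK_dH[of "lk f" w] f_insy[of w] by simp
qed

text \<open>On words with both letters, \<open>dH\<close> kills f for the word and for its reversal,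
  so \<open>dH_rev\<close> and the palindromic symmetry apply. A word in a single letter is its own
  reversal.\<close>

lemma f_cyc: "lk f (Lx # w) + lk f (Ly # w) = lk f (w @ [Lx]) + lk f (w @ [Ly])"
proof (cases "Lx \<in> set w \<and> Ly \<in> set w")
  case True
  then have "dH (lk f) w = 0" "dH (lk f) (rev w) = 0" by (auto intro!: f_dH)
  then show ?thesis using dH_rev[of "lk f" w] by (simp add: f_rev)
next
  case False
  then have "\<exists>a. w = replicate (length w) a" by (metis (full_types) letter.exhaust replicate_eqI)
  then have "rev w = w" by (metis rev_replicate)
  then show ?thesis using f_rev[of "Lx # w"] f_rev[of "Ly # w"] by simp
qed

end

section \<open>The stuffle coproduct\<close>

abbreviation yl :: "nat \<Rightarrow> nat list" where "yl m \<equiv> (if m = 0 then [] else [m])"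
abbreviation pos :: "nat list \<Rightarrow> bool" where "pos w \<equiv> (\<forall>r\<in>set w. 1 \<le> r)"

text \<open>Dual to the stuffle product on lists of positive entries (\<open>lk_Dst\<close>). The
  letter 0 plays the part of the unit: it is sent to 1, because \<open>yl 0\<close> is the empty
  list.\<close>

definition Dst :: "(nat list \<Rightarrow>\<^sub>0 rat) \<Rightarrow> nat tens" where
  "Dst = hm (\<lambda>m. \<Sum>b\<le>m. mon (yl (m - b), yl b))"

lemma Dst_lin [simp]: "Dst (p + q) = Dst p + Dst q" "Dst (p - q) = Dst p - Dst q" "Dst (qscale c p) = qscale c (Dst p)"
   "Dst 0 = 0" "Dst 1 = 1" by (simp_all add: Dst_def)
lemma Dst_mult: "Dst (p * q) = Dst p * Dst q" by (simp add: Dst_def hm_mult)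
lemma Dst_sum: "Dst (\<Sum>i\<in>A. f i) = (\<Sum>i\<in>A. Dst (f i))" by (simp add: Dst_def hm_sum)

lemma Dst_letter: "1 \<le> m \<Longrightarrow> Dst (mon [m]) = mon ([m], []) + mon ([], [m]) + (\<Sum>b\<in>{1..<m}. mon ([m - b], [b]))"
proof -
  assume m: "1 \<le> m"
  have "{..m} = insert 0 (insert m {1..<m})" using m by auto
  then show ?thesis using m by (simp add: Dst_def add.assoc)
qed

lemma st_add: "st (\<lambda>w. \<phi> w + \<psi> w) rs ss = st \<phi> rs ss + st \<psi> rs ss"
proof (induction \<phi> rs ss arbitrary: \<psi> rule: st.induct)
  case (3 \<phi> i rs j ss)
  show ?case by (simp only: st.simps 3) (simp only: add_ac)
qed simp_all
lemma st_0 [simp]: "st (\<lambda>w. 0) rs ss = 0"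
  by (induction "\<lambda>w::nat list. 0::'a" rs ss rule: st.induct) simp_all
lemma st_cmult: "st (\<lambda>w. c * \<phi> w) rs ss = c * st \<phi> rs ss" for c :: rat
  by (induction \<phi> rs ss rule: st.induct) (simp_all add: algebra_simps)

lemma st_cong:
  "pos rs \<Longrightarrow> pos ss \<Longrightarrow> (\<And>w. pos w \<Longrightarrow> sum_list w = sum_list rs + sum_list ss \<Longrightarrow> \<phi> w = \<psi> w) \<Longrightarrow> st \<phi> rs ss = st \<psi> rs ss"
proof (induction \<phi> rs ss arbitrary: \<psi> rule: st.induct)
  case (3 \<phi> i rs j ss)
  have "st (\<lambda>ts. \<phi> (i # ts)) rs (j # ss) = st (\<lambda>ts. \<psi> (i # ts)) rs (j # ss)"
    using 3(4,5,6) by (intro 3(1)) auto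
  moreover have "st (\<lambda>ts. \<phi> (j # ts)) (i # rs) ss = st (\<lambda>ts. \<psi> (j # ts)) (i # rs) ss"
    using 3(4,5,6) by (intro 3(2)) auto
  moreover have "st (\<lambda>ts. \<phi> ((i + j) # ts)) rs ss = st (\<lambda>ts. \<psi> ((i + j) # ts)) rs ss"
    using 3(4,5,6) by (intro 3(3)) auto
  ultimately show ?case by simp
qed auto

abbreviation dl :: "'a \<Rightarrow> 'a \<Rightarrow> rat" where "dl w z \<equiv> (if z = w then 1 else 0)"

lemma st_dl_Cons: "st (\<lambda>z. dl (m # ts) (i # z)) rs ss = (if i = m then st (dl ts) rs ss else 0)"
  by (cases "i = m") simp_all

lemma lk_Dst_step:
  assumes "1 \<le> m"
  shows "lk (Dst (mon (m # ts))) (rs, ss) =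
     (case rs of [] \<Rightarrow> 0 | i # rs' \<Rightarrow> if i = m then lk (Dst (mon ts)) (rs', ss) else 0)
   + (case ss of [] \<Rightarrow> 0 | j # ss' \<Rightarrow> if j = m then lk (Dst (mon ts)) (rs, ss') else 0)
   + (case rs of [] \<Rightarrow> 0 | i # rs' \<Rightarrow> (case ss of [] \<Rightarrow> 0 | j # ss' \<Rightarrow>
        if 1 \<le> i \<and> 1 \<le> j \<and> i + j = m then lk (Dst (mon ts)) (rs', ss') else 0))"
proof -
  let ?X = "Dst (mon ts)"
  have "Dst (mon (m # ts)) = Dst (mon [m]) * ?X" by (simp add: mon_Cons[of m ts] Dst_mult)
  then have "lk (Dst (mon (m # ts))) (rs, ss) = lk (mon ([m], []) * ?X) (rs, ss) + lk (mon ([], [m]) * ?X) (rs, ss)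
     + (\<Sum>b\<in>{1..<m}. lk (mon ([m - b], [b]) * ?X) (rs, ss))"
    by (simp add: Dst_letter[OF assms] distrib_right sum_distrib_right lookup_add lk_sum)
  moreover have "(\<Sum>b\<in>{1..<m}. lk (mon ([m - b], [b]) * ?X) (rs, ss)) =
     (case rs of [] \<Rightarrow> 0 | i # rs' \<Rightarrow> (case ss of [] \<Rightarrow> 0 | j # ss' \<Rightarrow>
        if 1 \<le> i \<and> 1 \<le> j \<and> i + j = m then lk (Dst (mon ts)) (rs', ss') else 0))"
  proof (cases "rs = [] \<or> ss = []")
    case False
    then obtain i rs' j ss' where [simp]: "rs = i # rs'" "ss = j # ss'" by (metis neq_Nil_conv)
    have "(\<Sum>b\<in>{1..<m}. lk (mon ([m - b], [b]) * ?X) (rs, ss)) = (\<Sum>b\<in>{1..<m}. if j = b then (if i = m - b then lk ?X (rs', ss') else 0) else 0)"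
      by (intro sum.cong) (auto simp: lk_pair_both)
    also have "\<dots> = (if 1 \<le> i \<and> 1 \<le> j \<and> i + j = m then lk ?X (rs', ss') else 0)"
      by (subst sum.delta') auto
    finally show ?thesis by simp
  qed (auto simp: lk_pair_both split: list.split)
  ultimately show ?thesis by (simp add: lk_pair_left lk_pair_right)
qed

lemma lk_Dst_mon: "pos ts \<Longrightarrow> pos rs \<Longrightarrow> pos ss \<Longrightarrow> lk (Dst (mon ts)) (rs, ss) = st (dl ts) rs ss"
proof (induction ts arbitrary: rs ss)
  case Nil
  then show ?case
    by (cases rs; cases ss) (simp_all add: mon_Nil lookup_single when_def flip: mon_pair_Nil)
next
  case (Cons m ts)
  have m: "1 \<le> m" "pos ts" using Cons.prems by auto
  have I: "pos rs \<Longrightarrow> pos ss \<Longrightarrow> lk (Dst (mon ts)) (rs, ss) = st (dl ts) rs ss" for rs ss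
    using Cons.IH m by blast
  show ?case
    unfolding lk_Dst_step[OF m(1)] using Cons.prems m
    by (cases rs; cases ss) (auto simp: st_dl_Cons I)
qed

lemma lk_Dst_notpos: "pos ts \<Longrightarrow> \<not> (pos rs \<and> pos ss) \<Longrightarrow> lk (Dst (mon ts)) (rs, ss) = 0"
proof (induction ts arbitrary: rs ss)
  case Nil
  then show ?case by (auto simp: mon_Nil lookup_single when_def simp flip: mon_pair_Nil)
next
  case (Cons m ts)
  have m: "1 \<le> m" "pos ts" using Cons.prems by auto
  have I: "\<not> (pos rs \<and> pos ss) \<Longrightarrow> lk (Dst (mon ts)) (rs, ss) = 0" for rs ss
    using Cons.IH m by blast
  show ?case
    unfolding lk_Dst_step[OF m(1)] using Cons.prems(2) m
    by (cases rs; cases ss) (auto simp: I)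
qed

text \<open>Projection onto the lists without entry 0; the elements fixed by it
  (\<open>posp\<close>) are those whose \<open>Dst\<close> is described by stuffle products.\<close>

definition kill0 :: "(nat list \<Rightarrow>\<^sub>0 rat) \<Rightarrow> (nat list \<Rightarrow>\<^sub>0 rat)" where
  "kill0 = hm (\<lambda>m. if m = 0 then 0 else mon [m])"

lemma kill0_lin [simp]: "kill0 (p + q) = kill0 p + kill0 q" "kill0 (p - q) = kill0 p - kill0 q" "kill0 (qscale c p) = qscale c (kill0 p)"
   "kill0 0 = 0" "kill0 1 = 1" by (simp_all add: kill0_def)
lemma kill0_mult: "kill0 (p * q) = kill0 p * kill0 q" by (simp add: kill0_def hm_mult)
lemma kill0_sum: "kill0 (\<Sum>i\<in>A. f i) = (\<Sum>i\<in>A. kill0 (f i))" by (simp add: kill0_def hm_sum)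
lemma kill0_mon: "kill0 (mon w) = (if pos w then mon w else 0)"
proof (induction w)
  case (Cons m w)
  then show ?case by (auto simp: mon_Cons[of m w] kill0_mult) (auto simp: kill0_def)
qed (simp add: mon_Nil)
lemma lk_kill0: "lk (kill0 p) w = (if pos w then lk p w else 0)"
proof -
  have "lk (kill0 p) w = ev (\<lambda>v. lk (kill0 (mon v)) w) p"
    by (rule functional_eq_ev) (simp_all add: lookup_add)
  also have "\<dots> = ev (\<lambda>v. if v = w then (if pos w then 1 else 0) else 0) p"
    by (rule ev_cong) (auto simp: kill0_mon lookup_single when_def)
  finally show ?thesis by (simp add: ev_delta)
qed

definition posp where "posp p \<longleftrightarrow> kill0 p = p"
lemma posp_lk: "posp p \<Longrightarrow> \<not> pos w \<Longrightarrow> lk p w = 0" by (metis posp_def lk_kill0)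
lemma pospI: "(\<And>w. \<not> pos w \<Longrightarrow> lk p w = 0) \<Longrightarrow> posp p"
  unfolding posp_def by (rule poly_mapping_eqI) (simp add: lk_kill0)
lemma posp_keys: "posp p \<Longrightarrow> w \<in> Poly_Mapping.keys p \<Longrightarrow> pos w" using posp_lk by (fastforce simp: in_keys_iff)

lemma lk_Dst: assumes "posp p" shows "lk (Dst p) (rs, ss) = (if pos rs \<and> pos ss then st (lk p) rs ss else 0)"
proof -
  have 1: "lk (Dst p) (rs, ss) = ev (\<lambda>w. lk (Dst (mon w)) (rs, ss)) p"
    by (rule functional_eq_ev) (simp_all add: lookup_add)
  have 2: "st (lk p) rs ss = ev (\<lambda>w. st (lk (mon w)) rs ss) p"
    by (rule functional_eq_ev) (simp_all add: lookup_add st_add st_cmult)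
  have 3: "lk (mon w) = dl w" for w :: "nat list" by (auto simp: lookup_single when_def)
  show ?thesis
  proof (cases "pos rs \<and> pos ss")
    case True
    then show ?thesis unfolding 1 2 3 by (auto intro!: ev_cong lk_Dst_mon dest: posp_keys[OF assms])
  next
    case False
    have "ev (\<lambda>w. lk (Dst (mon w)) (rs, ss)) p = ev (\<lambda>w. 0) p"
      by (rule ev_cong) (use False posp_keys[OF assms] lk_Dst_notpos in blast)
    then show ?thesis unfolding if_not_P[OF False] 1 by simp
  qed
qed

lemma Dst_primI:
  assumes "posp p" "lk p [] = 0" "\<And>rs ss. rs \<noteq> [] \<Longrightarrow> ss \<noteq> [] \<Longrightarrow> pos rs \<Longrightarrow> pos ss \<Longrightarrow> st (lk p) rs ss = 0"
  shows "Dst p = inl p + inr p"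
proof (rule poly_mapping_eqI)
  fix x :: "nat list \<times> nat list"
  obtain rs ss where x: "x = (rs, ss)" by (cases x)
  show "lk (Dst p) x = lk (inl p + inr p) x"
    using assms posp_lk[OF assms(1)]
    by (cases "rs = []"; cases "ss = []") (auto simp: x lk_Dst lookup_add lk_inl lk_inr)
qed

section \<open>Coderivations\<close>

text \<open>The operator d (x) 1 + 1 (x) d on the tensor square.\<close>

definition D2 :: "(('a list \<Rightarrow>\<^sub>0 rat) \<Rightarrow> ('a list \<Rightarrow>\<^sub>0 rat)) \<Rightarrow> 'a tens \<Rightarrow> 'a tens" where
  "D2 d = lin_ext (\<lambda>(r, s). inl (d (mon r)) * inr (mon s) + inl (mon r) * inr (d (mon s)))"

lemma D2_lin [simp]: "D2 d (X + Y) = D2 d X + D2 d Y" "D2 d (X - Y) = D2 d X - D2 d Y" "D2 d (qscale c X) = qscale c (D2 d X)"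
  "D2 d 0 = 0" by (simp_all add: D2_def)
lemma D2_sum: "D2 d (\<Sum>i\<in>A. f i) = (\<Sum>i\<in>A. D2 d (f i))" by (simp add: D2_def lin_ext_sum)

lemma inr_inl2: "inr q * (inl p * X) = inl p * (inr q * X)" by (simp add: inr_inl flip: mult.assoc)

lemma D2_inl_inr: "D2 (dv D) (inl p * inr q) = inl (dv D p) * inr q + inl p * inr (dv D q)"
  by (rule bilinear_eqI[of "\<lambda>p q. D2 (dv D) (inl p * inr q)"])
     (simp_all add: algebra_simps qvec.scale_right_distrib, simp add: mon_pair D2_def)

lemma D2_inl: "D2 (dv D) (inl p) = inl (dv D p)" and D2_inr: "D2 (dv D) (inr p) = inr (dv D p)"
  using D2_inl_inr[of D p 1] D2_inl_inr[of D 1 p] by simp_all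

lemma D2_mult: "D2 (dv D) (X * Y) = D2 (dv D) X * Y + X * D2 (dv D) Y"
proof (rule bilinear_eqI[of "\<lambda>X Y. D2 (dv D) (X * Y)"], goal_cases)
  case (9 u v)
  obtain a b a' b' where [simp]: "u = (a, b)" "v = (a', b')" by (cases u; cases v)
  have m: "mon (c, e) = inl (mon c) * inr (mon e)" for c e :: "'a list" by (simp add: mon_pair)
  have "mon u * mon v = inl (mon a * mon a') * inr (mon b * mon b')" 
    by (simp only: \<open>u = (a, b)\<close> \<open>v = (a', b')\<close> m inl_mult inr_mult inr_inl2 inr_inl mult.assoc)
  then have "D2 (dv D) (mon u * mon v) = inl (dv D (mon a) * mon a' + mon a * dv D (mon a')) * inr (mon b * mon b')
      + inl (mon a * mon a') * inr (dv D (mon b) * mon b' + mon b * dv D (mon b'))"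
    by (simp only: D2_inl_inr dv_mult)
  also have "\<dots> = D2 (dv D) (mon u) * mon v + mon u * D2 (dv D) (mon v)"
    by (simp only: \<open>u = (a, b)\<close> \<open>v = (a', b')\<close> m D2_inl_inr)
       (simp only: inl_mult inr_mult inl_lin(1) inr_lin(1) distrib_left distrib_right mult.assoc inr_inl2 inr_inl add_ac)
  finally show ?case .
qed (simp_all add: algebra_simps qvec.scale_right_distrib)

lemma D2_1 [simp]: "D2 (dv D) 1 = 0" using D2_inl[of D 1] by simp

lemma Dst_coder:
  assumes "\<And>m. Dst (D m) = D2 (dv D) (Dst (mon [m]))"
  shows "Dst (dv D p) = D2 (dv D) (Dst p)"
proof (rule linear_eqI[of "\<lambda>p. Dst (dv D p)"], goal_cases)
  case (5 w)
  show ?case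
  proof (induction w)
    case (Cons m w)
    then show ?case by (simp add: mon_Cons[of m w] dv_mult Dst_mult D2_mult assms)
  qed (simp add: mon_Nil)
qed simp_all

text \<open>Letters indexed by integers, with y_0 = 1 and zero for negative index: the coproduct
  becomes an unrestricted convolution and index shifts need no case distinctions.\<close>

definition Yz :: "int \<Rightarrow> (nat list \<Rightarrow>\<^sub>0 rat)" where "Yz z = (if z < 0 then 0 else mon (yl (nat z)))"

lemma Yz_simps [simp]: "Yz 0 = 1" "z < 0 \<Longrightarrow> Yz z = 0" "kill0 (Yz z) = Yz z"
  by (auto simp: Yz_def mon_Nil kill0_mon)
lemma Yz_nat: "1 \<le> m \<Longrightarrow> Yz (int m) = mon [m]" by (simp add: Yz_def)

lemma Dst_Yz: assumes "z \<le> int B" shows "Dst (Yz z) = (\<Sum>b\<le>B. inl (Yz (z - int b)) * inr (Yz (int b)))"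
proof (cases "z < 0")
  case False
  then obtain m where z: "z = int m" by (metis nat_eq_iff2 not_less)
  have t: "inl (Yz (int m - int b)) * inr (Yz (int b)) = (if b \<le> m then mon (yl (m - b), yl b) else 0)" for b
    by (auto simp: Yz_def mon_pair nat_diff_distrib' simp flip: of_nat_diff)
  have "Dst (Yz z) = (\<Sum>b\<le>m. mon (yl (m - b), yl b))"
    by (cases "m = 0") (auto simp: z Dst_def Yz_def mon_Nil mon_pair_Nil)
  also have "\<dots> = (\<Sum>b\<le>B. if b \<le> m then mon (yl (m - b), yl b) else 0)"
    using assms z by (intro sum.mono_neutral_cong_left) auto
  finally show ?thesis by (simp only: z t)
qed simp

lemma Dst_Yz': assumes "z \<le> int B" shows "Dst (Yz z) = (\<Sum>b\<le>B. inl (Yz (int b)) * inr (Yz (z - int b)))"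
proof (cases "z < 0")
  case False
  then obtain m where z: "z = int m" by (metis nat_eq_iff2 not_less)
  have "Dst (Yz z) = (\<Sum>b\<le>m. inl (Yz (int m - int b)) * inr (Yz (int b)))" using Dst_Yz[of z m] z by simp
  also have "\<dots> = (\<Sum>b\<le>m. inl (Yz (int b)) * inr (Yz (int m - int b)))"
    by (subst sum_atMost_rev) (intro sum.cong, auto simp: of_nat_diff)
  also have "\<dots> = (\<Sum>b\<le>B. inl (Yz (int b)) * inr (Yz (z - int b)))"
    using assms z by (intro sum.mono_neutral_cong_left) auto
  finally show ?thesis .
qed simp

lemma Dst_letter_Yz: "Dst (mon [m]) = (\<Sum>b\<le>m. inl (Yz (int m - int b)) * inr (Yz (int b)))"
proof (cases "m = 0")
  case True
  then show ?thesis by (simp add: Dst_def mon_pair_Nil)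
next
  case False
  then show ?thesis using Dst_Yz[of "int m" m] by (simp add: Yz_def)
qed

text \<open>The derivation with x -> 1, y -> 0, read in the letters y_m = x^(m-1) y; see
  \<open>DX_iota\<close>.\<close>

abbreviation DD :: "(nat list \<Rightarrow>\<^sub>0 rat) \<Rightarrow> (nat list \<Rightarrow>\<^sub>0 rat)" where
  "DD \<equiv> dv (\<lambda>m. qscale (of_nat m - 1) (Yz (int m - 1)))"

lemma DD_Yz: "DD (Yz z) = qscale (of_int z - 1) (Yz (z - 1))"
proof -
  consider "z < 0" | "z = 0" | m where "z = int m" "1 \<le> m" by (metis One_nat_def int_one_le_iff_zero_less linorder_neqE_linordered_idom of_nat_1 of_nat_le_iff zero_less_imp_eq_int)
  then show ?thesis by cases (auto simp: Yz_nat)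
qed

text \<open>After shifting the index in the second sum, the coefficients (m - 1) - b and b add up to
  m - 1 for every b.\<close>

lemma Dst_DD: "Dst (DD p) = D2 DD (Dst p)"
proof (rule Dst_coder)
  fix m
  show "Dst (qscale (of_nat m - 1) (Yz (int m - 1))) = D2 DD (Dst (mon [m]))"
  proof (cases m)
    case 0
    then show ?thesis by (simp add: Dst_letter_Yz)
  next
    case (Suc j)
    have L: "Dst (qscale (of_nat m - 1) (Yz (int m - 1))) = (\<Sum>b\<le>j. qscale (of_nat j) (inl (Yz (int j - int b)) * inr (Yz (int b))))"
      using Dst_Yz[of "int j" j] Suc by (simp add: qscale_sum)
    have "D2 DD (Dst (mon [m])) = (\<Sum>b\<le>Suc j. qscale (of_nat m - of_nat b - 1) (inl (Yz (int m - int b - 1)) * inr (Yz (int b))))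
      + (\<Sum>b\<le>Suc j. qscale (of_nat b - 1) (inl (Yz (int m - int b)) * inr (Yz (int b - 1))))"
      unfolding Dst_letter_Yz D2_sum D2_inl_inr DD_Yz Suc by (simp add: sum.distrib)
    also have "(\<Sum>b\<le>Suc j. qscale (of_nat m - of_nat b - 1) (inl (Yz (int m - int b - 1)) * inr (Yz (int b))))
      = (\<Sum>b\<le>j. qscale (of_nat j - of_nat b) (inl (Yz (int j - int b)) * inr (Yz (int b))))"
      using Suc by (simp add: algebra_simps)
    also have "(\<Sum>b\<le>Suc j. qscale (of_nat b - 1) (inl (Yz (int m - int b)) * inr (Yz (int b - 1))))
      = (\<Sum>b\<le>j. qscale (of_nat b) (inl (Yz (int j - int b)) * inr (Yz (int b))))"
      unfolding sum.atMost_Suc_shift using Suc by simp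
    finally show ?thesis unfolding L sum.distrib[symmetric] by (simp flip: qvec.scale_left_distrib)
  qed
qed

lemma kill0_dv:
  assumes "\<And>m. kill0 (D m) = D m" "D 0 = 0"
  shows "kill0 (dv D p) = dv D (kill0 p)"
proof (rule linear_eqI[of "\<lambda>p. kill0 (dv D p)"], goal_cases)
  case (5 w)
  show ?case
  proof (induction w)
    case (Cons m w)
    have k: "kill0 (mon [j]) = (if j = 0 then 0 else mon [j])" for j by (simp add: kill0_def)
    show ?case unfolding mon_Cons[of m w] dv_mult
      by (cases "m = 0") (simp_all add: dv_mult kill0_mult k assms Cons)
  qed (simp add: mon_Nil)
qed simp_all

lemma kill0_DD: "kill0 (DD p) = DD (kill0 p)"
  by (rule kill0_dv) auto

definition rv :: "('a list \<Rightarrow>\<^sub>0 rat) \<Rightarrow> ('a list \<Rightarrow>\<^sub>0 rat)" where "rv = lin_ext (\<lambda>w. mon (rev w))"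
lemma rv_lin [simp]: "rv (p + q) = rv p + rv q" "rv (p - q) = rv p - rv q" "rv (qscale c p) = qscale c (rv p)" "rv 0 = 0"
  "rv (mon w) = mon (rev w)" "rv 1 = 1" by (simp_all add: rv_def flip: mon_Nil)
lemma rv_sum: "rv (\<Sum>i\<in>A. f i) = (\<Sum>i\<in>A. rv (f i))" by (simp add: rv_def lin_ext_sum)
lemma rv_mult: "rv (p * q) = rv q * rv p"
  by (rule bilinear_eqI[of "\<lambda>p q. rv (p * q)"]) (simp_all add: algebra_simps flip: mon_append)
lemma lk_rv: "lk (rv p) w = lk p (rev w)"
proof -
  have "lk (rv p) w = ev (\<lambda>v. if v = rev w then 1 else 0) p"
    unfolding rv_def lk_lin_ext by (rule ev_cong) (auto simp: lookup_single when_def)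
  then show ?thesis by (simp add: ev_delta)
qed
lemma rv_Yz [simp]: "rv (Yz z) = Yz z" by (simp add: Yz_def)

text \<open>Reversing both tensor factors is an anti-automorphism fixing \<open>Dst\<close> of a
  letter, so it commutes with reversal under \<open>Dst\<close>. This settles indicator functions;
  on the finitely many lists of the relevant weight every function is a combination of
  these.\<close>

lemma st_rev: fixes \<phi> :: "nat list \<Rightarrow> rat" assumes "pos rs" "pos ss" shows "st (\<lambda>w. \<phi> (rev w)) (rev rs) (rev ss) = st \<phi> rs ss"
proof -
  define RV where "RV = lin_ext (\<lambda>(r, s). mon (rev r, rev s) :: nat tens)"
  have RVm: "RV (X * Y) = RV Y * RV X" for X Y
    by (rule bilinear_eqI[of "\<lambda>X Y. RV (X * Y)"]) (simp_all add: RV_def algebra_simps mon_times split_def plus_list_def plus_prod_def)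
  have lkRV: "lk (RV X) (r, s) = lk X (rev r, rev s)" for X r s
  proof -
    have "lk (RV X) (r, s) = ev (\<lambda>v. if v = (rev r, rev s) then 1 else 0) X"
      unfolding RV_def lk_lin_ext by (rule ev_cong) (auto simp: lookup_single when_def split: if_splits)
    then show ?thesis by (simp add: ev_delta)
  qed
  have "RV (Dst (mon w)) = Dst (mon (rev w))" for w
  proof (induction w)
    case Nil
    then show ?case by (simp add: mon_Nil RV_def flip: mon_pair_Nil)
  next
    case (Cons m w)
    have "RV (Dst (mon [m])) = Dst (mon [m])" by (auto simp: Dst_def RV_def lin_ext_sum intro!: sum.cong)
    then show ?case using Cons by (simp add: mon_Cons[of m w] mon_append Dst_mult RVm)
  qed
  then have d: "st (dl (rev w)) (rev rs) (rev ss) = st (dl w) rs ss" if "pos w" for w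
    using lk_Dst_mon[of w rs ss] lk_Dst_mon[of "rev w" "rev rs" "rev ss"] that assms lkRV[of "Dst (mon w)" "rev rs" "rev ss"] by simp
  have fin: "finite {w. set w \<subseteq> {1..N} \<and> length w \<le> N}" for N :: nat by (rule finite_lists_length_le) simp
  define N where "N = sum_list rs + sum_list ss"
  define A where "A = {w. set w \<subseteq> {1..N} \<and> length w \<le> N}"
  have inA: "w \<in> A" if "pos w" "sum_list w = N" for w
  proof -
    have "length w \<le> sum_list w" using that(1) by (induction w) auto
    moreover have "r \<le> sum_list w" if "r \<in> set w" for r using that by (induction w) auto
    ultimately show ?thesis using that by (auto simp: A_def)
  qed
  have fA: "finite A" unfolding A_def by (rule fin)
  have sumst: "st (\<lambda>z. \<Sum>w\<in>A. c w * e w z) r s = (\<Sum>w\<in>A. c w * st (e w) r s)" for c and e :: "nat list \<Rightarrow> nat list \<Rightarrow> rat" and r s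
    using fA by (induction A rule: finite_induct) (simp_all add: st_add st_cmult)
  have delta: "(\<Sum>v\<in>A. \<phi> v * dl v w) = \<phi> w" if "w \<in> A" for w
  proof -
    have "(\<Sum>v\<in>A. \<phi> v * dl v w) = (\<Sum>v\<in>A. if v = w then \<phi> w else 0)" by (intro sum.cong) auto
    then show ?thesis using fA that by simp
  qed
  have "st \<phi> rs ss = st (\<lambda>z. \<Sum>w\<in>A. \<phi> w * dl w z) rs ss"
    by (rule st_cong[OF assms]) (simp add: delta inA N_def)
  also have "\<dots> = (\<Sum>w\<in>A. \<phi> w * st (dl w) rs ss)" by (rule sumst)
  also have "\<dots> = (\<Sum>w\<in>A. \<phi> w * st (dl (rev w)) (rev rs) (rev ss))"
    by (intro sum.cong refl) (simp add: d A_def subset_iff)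
  also have "\<dots> = st (\<lambda>z. \<Sum>w\<in>A. \<phi> w * dl (rev w) z) (rev rs) (rev ss)" by (rule sumst[symmetric])
  also have "\<dots> = st (\<lambda>w. \<phi> (rev w)) (rev rs) (rev ss)"
  proof (rule st_cong)
    fix z assume z: "pos z" "sum_list z = sum_list (rev rs) + sum_list (rev ss)"
    have "(\<Sum>w\<in>A. \<phi> w * dl (rev w) z) = (\<Sum>w\<in>A. if w = rev z then \<phi> (rev z) else 0)"
      by (intro sum.cong) auto
    also have "\<dots> = \<phi> (rev z)" using fA inA[of "rev z"] z by (simp add: N_def)
    finally show "(\<Sum>w\<in>A. \<phi> w * dl (rev w) z) = \<phi> (rev z)" .
  qed (use assms in auto)
  finally show ?thesis by simp
qed

lemma DD_rv: "DD (rv p) = rv (DD p)"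
proof (rule linear_eqI[of "\<lambda>p. DD (rv p)"], goal_cases)
  case (5 w)
  show ?case
  proof (induction w)
    case (Cons m w)
    then show ?case by (simp only: mon_Cons[of m w] rv_mult dv_mult rv_lin(1)) (simp add: add.commute)
  qed (simp add: mon_Nil)
qed simp_all

section \<open>Nilpotency\<close>

lemma funpow_nil:
  fixes F :: "('a \<Rightarrow>\<^sub>0 rat) \<Rightarrow> ('a \<Rightarrow>\<^sub>0 rat)" and \<mu> :: "'a \<Rightarrow> nat"
  assumes lin: "\<And>p q. F (p + q) = F p + F q" "\<And>c p. F (qscale c p) = qscale c (F p)"
    and mu: "\<And>w v. lk (F (mon w)) v \<noteq> 0 \<Longrightarrow> \<mu> v < \<mu> w"
  shows "(\<And>w. lk p w \<noteq> 0 \<Longrightarrow> \<mu> w < i) \<Longrightarrow> (F ^^ i) p = 0"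
proof (induction i arbitrary: p)
  case 0
  then show ?case by (intro poly_mapping_eqI) auto
next
  case (Suc i)
  have e: "lk (F p) v = ev (\<lambda>w. lk (F (mon w)) v) p" for v
    by (rule functional_eq_ev) (simp_all add: lin lookup_add)
  have "\<mu> v < i" if "lk (F p) v \<noteq> 0" for v
  proof (rule ccontr)
    assume n: "\<not> \<mu> v < i"
    have "ev (\<lambda>w. lk (F (mon w)) v) p = ev (\<lambda>w. 0) p"
    proof (rule ev_cong)
      fix w assume "w \<in> Poly_Mapping.keys p"
      then have "\<mu> w < Suc i" using Suc.prems by (auto simp: in_keys_iff)
      then show "lk (F (mon w)) v = 0" using mu[of w v] n by fastforce
    qed
    then show False using that e by simp
  qed
  then show ?case using Suc.IH[of "F p"] by (simp add: funpow_Suc_right del: funpow.simps)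
qed

definition DX :: "qxy \<Rightarrow> qxy" where "DX = dv (\<lambda>l. if l = Lx then 1 else 0)"

lemma lk_DX: "lk (DX p) w = insx (lk p) w"
proof -
  have w: "lk (DX (mon v)) w = insx (dl v) w" for v w
  proof (induction v arbitrary: w)
    case Nil
    have "insx (dl []) w = 0"
    proof (cases w)
      case (Cons a u)
      have "insx (\<lambda>z. dl [] (a # z)) u = insx (\<lambda>z. 0) u" by simp
      moreover have "insx (\<lambda>z. 0) u = 0" by (induction u) auto
      ultimately show ?thesis using Cons by simp
    qed simp
    then show ?case by (simp add: DX_def mon_Nil)
  next
    case (Cons a v)
    have i0: "insx (\<lambda>z. 0) u = 0" for u by (induction u) auto
    have "DX (mon (a # v)) = (if a = Lx then mon v else 0) + mon [a] * DX (mon v)"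
      by (simp add: mon_Cons[of a v] DX_def dv_mult)
    then have "lk (DX (mon (a # v))) w = (if a = Lx \<and> w = v then 1 else 0) + (case w of [] \<Rightarrow> 0 | b # u \<Rightarrow> if a = b then insx (dl v) u else 0)"
      by (cases w) (auto simp: lookup_add lookup_single when_def lk_mon_mult_Nil lk_mon_mult_Cons Cons.IH)
    also have "\<dots> = insx (dl (a # v)) w"
    proof (cases w)
      case (Cons b u)
      then show ?thesis by (cases "a = b") (auto simp: i0)
    qed auto
    finally show ?case .
  qed
  have "insx (lk p) w = ev (\<lambda>v. insx (lk (mon v)) w) p"
  proof (rule functional_eq_ev)
    have "insx (\<lambda>z. c * \<phi> z) w = c * insx \<phi> w" for c \<phi> by (induction w arbitrary: \<phi>) (auto simp: algebra_simps)
    moreover have "lk (qscale c q) = (\<lambda>z. c * lk q z)" for c and q :: qxy by (rule ext) simp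
    ultimately show "insx (lk (qscale c q)) w = c * insx (lk q) w" for c q by simp
    have "lk (q + q') = (\<lambda>z. lk q z + lk q' z)" for q q' :: qxy by (rule ext) (simp add: lookup_add)
    then show "insx (lk (q + q')) w = insx (lk q) w + insx (lk q') w" for q q' by (simp add: insx_add)
  qed
  moreover have "lk (DX p) w = ev (\<lambda>v. lk (DX (mon v)) w) p"
    by (rule functional_eq_ev) (simp_all add: DX_def lookup_add)
  moreover have "lk (mon v) = dl v" for v :: "letter list" by (auto simp: lookup_single when_def)
  ultimately show ?thesis by (simp add: w)
qed

lemma DX_nil: "(\<And>w. lk p w \<noteq> 0 \<Longrightarrow> length w < i) \<Longrightarrow> (DX ^^ i) p = 0"
proof (rule funpow_nil[where \<mu> = length])
  have "length v < length w" if "lk (DX (mon w)) v \<noteq> 0" for v w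
    using that
  proof (induction w arbitrary: v)
    case (Cons a w)
    have D: "DX (mon (a # w)) = (if a = Lx then mon w else 0) + mon [a] * DX (mon w)"
      unfolding mon_Cons[of a w] DX_def dv_mult by simp
    from Cons.prems have "v = w \<or> (\<exists>u. v = a # u \<and> lk (DX (mon w)) u \<noteq> 0)"
      unfolding D by (cases v) (auto simp: lookup_add lookup_single when_def lk_mon_mult_Nil lk_mon_mult_Cons split: if_splits)
    then show ?case using Cons.IH by auto
  qed (simp add: DX_def mon_Nil)
  then show "\<And>w v. lk (DX (mon w)) v \<noteq> 0 \<Longrightarrow> length v < length w" by blast
qed (simp_all add: DX_def)

lemma DD_nil: "(\<And>w. lk p w \<noteq> 0 \<Longrightarrow> sum_list w < i) \<Longrightarrow> (DD ^^ i) p = 0"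
proof (rule funpow_nil[where \<mu> = sum_list])
  have "sum_list v < sum_list w" if "lk (DD (mon w)) v \<noteq> 0" for v w
    using that
  proof (induction w arbitrary: v)
    case (Cons m w)
    have D: "DD (mon (m # w)) = (if m \<le> 1 then 0 else qscale (of_nat m - 1) (mon ((m - 1) # w))) + mon [m] * DD (mon w)"
    proof -
      have "qscale (of_nat m - 1) (Yz (int m - 1)) = (if m \<le> 1 then 0 else qscale (of_nat m - 1) (mon [m - 1]))"
        using Yz_nat[of "m - 1"] by (cases "m = 0"; cases "m = 1") (auto simp: of_nat_diff)
      then show ?thesis unfolding mon_Cons[of m w] dv_mult mon_Cons[of "m - 1" w] by simp
    qed
    then have "(v = (m - 1) # w \<and> 1 < m) \<or> (\<exists>u. v = m # u \<and> lk (DD (mon w)) u \<noteq> 0)"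
      using Cons.prems by (cases v) (auto simp: lookup_add lookup_single when_def lk_mon_mult_Nil lk_mon_mult_Cons split: if_splits)
    then show ?case using Cons.IH by auto
  qed (simp add: mon_Nil)
  then show "\<And>w v. lk (DD (mon w)) v \<noteq> 0 \<Longrightarrow> sum_list v < sum_list w" by blast
qed simp_all

section \<open>Associativity and insertion for the stuffle product\<close>

lemma st_assoc: "st (\<lambda>z. st \<phi> [m] z) u v = st (\<lambda>t. st \<phi> t v) [m] u" for \<phi> :: "nat list \<Rightarrow> rat"
proof (induction \<phi> u v rule: st.induct)
  case (3 \<phi> i u j v)
  show ?case using 3 by (simp add: st_add add.assoc add.commute add.left_commute)
qed simp_all

definition Ins :: "(nat list \<Rightarrow> rat) \<Rightarrow> nat \<Rightarrow> nat \<Rightarrow> rat" where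
  "Ins \<phi> i j = (\<Sum>a\<le>j. \<phi> (replicate a 1 @ i # replicate (j - a) 1))"

lemma Ins_Suc: "Ins \<phi> i (Suc j) = \<phi> (i # replicate (Suc j) 1) + Ins (\<lambda>z. \<phi> (1 # z)) i j"
  by (simp add: Ins_def sum.atMost_Suc_shift del: sum.atMost_Suc)

lemma st_ones: "st \<phi> [i] (replicate j 1) = Ins \<phi> i j + (if j = 0 then 0 else Ins \<phi> (Suc i) (j - 1))"
proof (induction j arbitrary: \<phi>)
  case 0
  then show ?case by (simp add: Ins_def)
next
  case (Suc j)
  have "st \<phi> [i] (replicate (Suc j) 1) = \<phi> (i # replicate (Suc j) 1) + st (\<lambda>z. \<phi> (1 # z)) [i] (replicate j 1) + \<phi> (Suc i # replicate j 1)"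
    by simp
  also have "\<dots> = Ins \<phi> i (Suc j) + (\<phi> (Suc i # replicate j 1) + (if j = 0 then 0 else Ins (\<lambda>z. \<phi> (1 # z)) (Suc i) (j - 1)))"
    unfolding Ins_Suc Suc.IH by simp
  also have "\<phi> (Suc i # replicate j 1) + (if j = 0 then 0 else Ins (\<lambda>z. \<phi> (1 # z)) (Suc i) (j - 1)) = Ins \<phi> (Suc i) j"
    by (cases j) (simp_all add: Ins_Suc, simp add: Ins_def)
  finally show ?case by simp
qed

lemma st_dl_ones: "set w \<subseteq> {1} \<Longrightarrow> pos rs \<Longrightarrow> pos ss \<Longrightarrow> \<not> (set rs \<subseteq> {1} \<and> set ss \<subseteq> {1}) \<Longrightarrow> st (dl w) rs ss = 0"
proof (induction "dl w" rs ss arbitrary: w rule: st.induct)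
  case (3 i rs j ss)
  show ?case
  proof (cases w)
    case (Cons m w')
    then have m: "m = 1" "set w' \<subseteq> {1}" using 3(4) by auto
    have "i + j \<noteq> 1" using 3(5,6) by auto
    moreover have "st (dl w') rs (j # ss) = 0" if "i = 1"
      using 3(5-) m that by (intro 3(1)) (auto simp: Cons fun_eq_iff)
    moreover have "st (dl w') (i # rs) ss = 0" if "j = 1"
      using 3(5-) m that by (intro 3(2)) (auto simp: Cons fun_eq_iff)
    moreover have "st (dl (1 # w')) (i # rs) (j # ss) = (if i = 1 then st (dl w') rs (j # ss) else 0)
      + (if j = 1 then st (dl w') (i # rs) ss else 0) + (if i + j = 1 then st (dl w') rs ss else 0)"
      by (simp only: st.simps st_dl_Cons)
    ultimately show ?thesis unfolding Cons m(1) by simp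
  qed simp
qed auto

section \<open>A double shuffle element as a coderivation of the stuffle coproduct\<close>

section \<open>The primitive element attached to a double shuffle element\<close>

text \<open>For m = 0 the inverse of \<open>index_word\<close> on words ending in y; m counts the x
  already read.\<close>

fun idx :: "nat \<Rightarrow> letter list \<Rightarrow> nat list" where
  "idx m [] = []"
| "idx m (Lx # w) = idx (Suc m) w"
| "idx m (Ly # w) = Suc m # idx 0 w"

lemma index_Cons: "index_word (m # ts) = y_word m @ index_word ts" and index_Nil [simp]: "index_word [] = []"
  by (simp_all add: index_word_def)

lemma index_idx: "w \<noteq> [] \<Longrightarrow> last w = Ly \<Longrightarrow> index_word (idx m w) = xs m @ w"
proof (induction m w rule: idx.induct)
  case (2 m w)
  then have "w \<noteq> []" by auto
  then show ?case using 2 by (simp add: replicate_app_Cons_same)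
next
  case (3 m w)
  then show ?case by (cases "w = []") (simp_all add: index_Cons y_word_def)
qed simp

lemma pos_idx: "pos (idx m w)" by (induction m w rule: idx.induct) auto

lemma idx_xs: "idx m (xs j @ w) = idx (m + j) w" by (induction j arbitrary: m) auto
lemma idx_index: "pos ts \<Longrightarrow> idx 0 (index_word ts) = ts"
  by (induction ts) (auto simp: index_Cons y_word_def idx_xs)
lemma index_inj: "pos ts \<Longrightarrow> pos ts' \<Longrightarrow> index_word ts = index_word ts' \<longleftrightarrow> ts = ts'"
  by (metis idx_index)
lemma index_snoc: "ts \<noteq> [] \<Longrightarrow> \<exists>v. index_word ts = v @ [Ly]"
proof (induction ts)
  case (Cons m ts)
  then show ?case by (cases "ts = []") (auto simp: index_Cons y_word_def)
qed simp
lemma index_ones: "index_word (replicate n (Suc 0)) = replicate n Ly"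
  by (induction n) (simp_all add: index_Cons y_word_def)
lemma length_index: "pos ts \<Longrightarrow> length (index_word ts) = sum_list ts"
  by (induction ts) (auto simp: index_Cons y_word_def)

definition iota :: "(nat list \<Rightarrow>\<^sub>0 rat) \<Rightarrow> qxy" where "iota = hm (\<lambda>m. mon (y_word m))"

lemma iota_lin [simp]: "iota (p + q) = iota p + iota q" "iota (p - q) = iota p - iota q" "iota (qscale c p) = qscale c (iota p)"
  "iota 0 = 0" "iota 1 = 1" "iota (mon [m]) = mon (y_word m)" by (simp_all add: iota_def)
lemma iota_mult: "iota (p * q) = iota p * iota q" by (simp add: iota_def hm_mult)
lemma iota_sum: "iota (\<Sum>i\<in>A. f i) = (\<Sum>i\<in>A. iota (f i))" by (simp add: iota_def hm_sum)
lemma iota_mon: "iota (mon w) = mon (index_word w)"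
proof (induction w)
  case (Cons m w)
  then show ?case by (simp only: mon_Cons[of m w] iota_mult index_Cons mon_append iota_lin)
qed (simp add: mon_Nil)

lemma lk_iota: assumes "posp p" "pos ts" shows "lk (iota p) (index_word ts) = lk p ts"
proof -
  have "lk (iota p) (index_word ts) = ev (\<lambda>w. lk (iota (mon w)) (index_word ts)) p"
    by (rule functional_eq_ev) (simp_all add: lookup_add)
  also have "\<dots> = ev (\<lambda>w. if w = ts then 1 else 0) p"
    by (rule ev_cong) (use posp_keys[OF assms(1)] index_inj assms(2) in \<open>auto simp: iota_mon lookup_single when_def\<close>)
  finally show ?thesis by (simp add: ev_delta)
qed

lemma lk_iota_x: "lk (iota p) (v @ [Lx]) = 0"
proof -
  have "index_word w \<noteq> v @ [Lx]" for w using index_snoc[of w] by (cases "w = []") auto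
  then have "lk (iota (mon w)) (v @ [Lx]) = 0" for w by (simp add: iota_mon lookup_single when_def)
  moreover have "lk (iota p) (v @ [Lx]) = ev (\<lambda>w. lk (iota (mon w)) (v @ [Lx])) p"
    by (rule functional_eq_ev) (simp_all add: lookup_add)
  ultimately show ?thesis by simp
qed

lemma gx_power: "gx ^ i = mon (xs i)" by (induction i) (simp_all add: mon_Nil flip: mon_append)

lemma DX_lin [simp]: "DX (p + q) = DX p + DX q" "DX (p - q) = DX p - DX q" "DX (qscale c p) = qscale c (DX p)" "DX 0 = 0"
  by (simp_all add: DX_def)
lemma DX_mult: "DX (p * q) = DX p * q + p * DX q" by (simp add: DX_def dv_mult)
lemma DX_letters [simp]: "DX gx = 1" "DX gy = 0" "DX 1 = 0" by (simp_all add: DX_def)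

lemma DX_power: "DX (gx ^ Suc i) = qscale (of_nat (Suc i)) (gx ^ i)"
proof (induction i)
  case (Suc i)
  have "DX (gx ^ Suc (Suc i)) = gx ^ Suc i + gx * DX (gx ^ Suc i)" by (subst power_Suc) (simp only: DX_mult DX_letters mult_1)
  also have "gx * DX (gx ^ Suc i) = qscale (of_nat (Suc i)) (gx ^ Suc i)" unfolding Suc.IH by simp
  also have "gx ^ Suc i + qscale (of_nat (Suc i)) (gx ^ Suc i) = qscale (1 + of_nat (Suc i)) (gx ^ Suc i)"
    by (simp only: qvec.scale_left_distrib qscale_1)
  finally show ?case by simp
qed (simp add: DX_mult)

lemma Yz_Suc: "Yz (int (Suc j)) = mon [Suc j]" using Yz_nat[of "Suc j"] by simp

lemma DX_iota: "DX (iota p) = iota (DD p)"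
proof (rule linear_eqI[of "\<lambda>p. DX (iota p)"], goal_cases)
  case (5 w)
  have l: "DX (mon (y_word m)) = iota (qscale (of_nat m - 1) (Yz (int m - 1)))" for m
  proof -
    consider "m = 0" | "m = 1" | j where "m = Suc (Suc j)" by (metis One_nat_def not0_implies_Suc)
    then show ?thesis
    proof cases
      case 3
      have y: "y_word m = xs (Suc j) @ [Ly]" "y_word (Suc j) = xs j @ [Ly]" by (simp_all add: y_word_def 3)
      have "DX (mon (y_word m)) = DX (gx ^ Suc j) * gy" unfolding y mon_append gx_power[symmetric] DX_mult by simp
      also have "\<dots> = qscale (of_nat (Suc j)) (mon (y_word (Suc j)))"
        unfolding DX_power y mon_append gx_power[symmetric] by simp
      finally show ?thesis using Yz_Suc[of j] 3 by simp
    qed (simp_all add: y_word_def)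
  qed
  show ?case
  proof (induction w)
    case (Cons m w)
    then show ?case by (simp only: mon_Cons[of m w] iota_mult DX_mult dv_mult iota_lin) (simp add: l)
  qed (simp add: mon_Nil)
qed simp_all

text \<open>Repeated differentiation gives (j+1) D^j q = - (D^(j+1) q) x. Since some power of D
  kills q, descending induction reaches j = 0.\<close>

lemma DX_zero: assumes "DX (q * gx) = 0" shows "q = 0"
proof -
  have s: "qscale (of_nat (Suc j)) ((DX ^^ j) q) = - ((DX ^^ Suc j) q * gx)" for j
  proof (induction j)
    case 0
    then show ?case using assms by (simp add: DX_mult eq_neg_iff_add_eq_0 add.commute)
  next
    case (Suc j)
    have "DX (qscale (of_nat (Suc j)) ((DX ^^ j) q)) = DX (- ((DX ^^ Suc j) q * gx))" by (simp only: Suc.IH)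
    then have "qscale (of_nat (Suc j)) ((DX ^^ Suc j) q) = - (DX ((DX ^^ Suc j) q * gx))"
      using DX_lin(3)[of "-1"] by (simp add: qscale_minus1 del: of_nat_Suc)
    then have "qscale (of_nat (Suc j)) ((DX ^^ Suc j) q) + (DX ^^ Suc j) q = - ((DX ^^ Suc (Suc j)) q * gx)"
      by (simp add: DX_mult del: of_nat_Suc)
    moreover have "qscale (of_nat (Suc (Suc j))) ((DX ^^ Suc j) q) = qscale (of_nat (Suc j)) ((DX ^^ Suc j) q) + (DX ^^ Suc j) q"
      using qvec.scale_left_distrib[of "of_nat (Suc j)" 1 "(DX ^^ Suc j) q"] by (simp only: qscale_1 of_nat_Suc add.commute)
    ultimately show ?case by simp
  qed
  define N where "N = Suc (Max (length ` Poly_Mapping.keys q))"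
  have N: "(DX ^^ N) q = 0"
    by (rule DX_nil) (auto simp: N_def in_keys_iff less_Suc_eq_le intro!: Max_ge)
  have "(DX ^^ j) q = 0" if "j \<le> N" for j
    using that
  proof (induction rule: inc_induct)
    case (step j)
    then have "qscale (of_nat (Suc j)) ((DX ^^ j) q) = 0" using s[of j] by simp
    then have "qscale (1 / of_nat (Suc j)) (qscale (of_nat (Suc j)) ((DX ^^ j) q)) = 0" by simp
    then show ?case by (simp del: of_nat_Suc)
  qed (rule N)
  from this[of 0] show ?thesis by simp
qed

text \<open>Reversing a word letter by letter moves the y of each block from its end to its start;
  one extra y on the outside compensates.\<close>

lemma gy_iota_rv: "gy * iota (rv q) = rv (iota q) * gy"
proof (rule linear_eqI[of "\<lambda>q. gy * iota (rv q)"], goal_cases)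
  case (5 w)
  have "Ly # index_word (rev w) = rev (index_word w) @ [Ly]"
  proof (induction w)
    case (Cons m w)
    have a: "index_word (u @ v) = index_word u @ index_word v" for u v by (simp add: index_word_def)
    have "Ly # index_word (rev (m # w)) = (Ly # index_word (rev w)) @ y_word m" by (simp add: a index_Cons)
    then show ?case unfolding Cons by (simp add: index_Cons y_word_def)
  qed simp
  then show ?case by (simp add: iota_mon flip: mon_append)
qed (simp_all add: algebra_simps)

lemma lk_mon_mult_gen: "lk (mon u * p) w = (if take (length u) w = u then lk p (drop (length u) w) else 0)"
proof -
  have "lk (mon u * p) w = ev (\<lambda>v. if u @ v = w then 1 else 0) p"
    unfolding lk_conv_ev ev_mon_mult ..
  also have "\<dots> = ev (\<lambda>v. if v = drop (length u) w then (if take (length u) w = u then 1 else 0) else 0) p"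
    by (rule ev_cong) (auto simp: append_eq_conv_conj[symmetric] , metis append_take_drop_id)
  finally show ?thesis by (simp add: ev_delta)
qed

lemma onesD: "set w \<subseteq> {1 :: nat} \<Longrightarrow> w = replicate (length w) 1"
  by (rule replicate_eqI) auto

context odd_ds
begin

abbreviation "fI ts \<equiv> lk f (index_word ts)"
text \<open>\<open>pf\<close> is the part of f ending in y, written in the letters y_m, plus the
  correction that makes all stuffle relations hold; \<open>ft\<close> adds the same correction to f.
  The usual sign (-1)^(n-1) of the correction is 1, as n is odd.\<close>

definition "cc = fI [n] / of_nat n"
definition "pf = lin_ext (\<lambda>w. if w \<noteq> [] \<and> last w = Ly then mon (idx 0 w) else 0) f + qscale cc (mon (replicate n 1))"
definition "ft = f + qscale cc (mon (replicate n Ly))"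

lemma posp_pf: "posp pf"
  unfolding pf_def posp_def kill0_lin
proof (intro arg_cong2[of _ _ _ _ "(+)"])
  have k: "kill0 (mon (idx 0 w)) = mon (idx 0 w)" for w by (subst kill0_mon, rule if_P, rule pos_idx)
  have "kill0 (lin_ext (\<lambda>w. if w \<noteq> [] \<and> last w = Ly then mon (idx 0 w) else 0) q) = lin_ext (\<lambda>w. if w \<noteq> [] \<and> last w = Ly then mon (idx 0 w) else 0) q" for q
    by (rule linear_eqI[of "\<lambda>q. kill0 (lin_ext (\<lambda>w. if w \<noteq> [] \<and> last w = Ly then mon (idx 0 w) else 0) q)"])
       (simp_all add: k)
  then show "kill0 (lin_ext (\<lambda>w. if w \<noteq> [] \<and> last w = Ly then mon (idx 0 w) else 0) f) = lin_ext (\<lambda>w. if w \<noteq> [] \<and> last w = Ly then mon (idx 0 w) else 0) f" .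
qed (simp add: kill0_mon)

lemma lk_pf: assumes "pos ts" shows "lk pf ts = lk ft (index_word ts)"
proof -
  have "lk (lin_ext (\<lambda>w. if w \<noteq> [] \<and> last w = Ly then mon (idx 0 w) else 0) f) ts
     = ev (\<lambda>w. if w = index_word ts then (if ts = [] then 0 else 1) else 0) f"
    unfolding lk_lin_ext
  proof (rule ev_cong)
    fix w
    have "w \<noteq> [] \<and> last w = Ly \<and> idx 0 w = ts \<longleftrightarrow> w = index_word ts \<and> ts \<noteq> []"
    proof
      assume a: "w \<noteq> [] \<and> last w = Ly \<and> idx 0 w = ts"
      then have "index_word ts = w" using index_idx[of w 0] by simp
      with a show "w = index_word ts \<and> ts \<noteq> []" by auto
    next
      assume a: "w = index_word ts \<and> ts \<noteq> []"
      then obtain v where "w = v @ [Ly]" using index_snoc by blast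
      moreover have "idx 0 w = ts" using a idx_index[OF assms] by simp
      ultimately show "w \<noteq> [] \<and> last w = Ly \<and> idx 0 w = ts" by simp
    qed
    then show "lk (if w \<noteq> [] \<and> last w = Ly then mon (idx 0 w) else 0) ts = (if w = index_word ts then (if ts = [] then 0 else 1) else 0)"
      by (auto simp: lookup_single when_def)
  qed
  also have "\<dots> = fI ts" using f_len[of "[]"] n3 by (simp add: ev_delta)
  finally show ?thesis
    using index_inj[OF assms, of "replicate n 1"] by (auto simp: pf_def ft_def lookup_add lookup_single when_def index_ones)
qed

lemma ft_index: "pos ts \<Longrightarrow> lk ft (index_word ts) = fI ts + cc * dl (replicate n 1) ts"
  using index_inj[of ts "replicate n 1"] by (auto simp: ft_def lookup_add lookup_single when_def index_ones)

lemma f_yn: "lk f (replicate n Ly) = 0"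
proof -
  have i: "insy \<phi> (replicate j Ly) = of_nat (Suc j) * \<phi> (replicate (Suc j) Ly)" for \<phi> j
    by (induction j arbitrary: \<phi>) (auto simp: algebra_simps)
  obtain j where "n = Suc j" using n3 by (cases n) auto
  then show ?thesis using f_insy[of "replicate j Ly"] i[of "lk f" j] by (simp del: of_nat_Suc)
qed

text \<open>Only products of two powers of y are not covered by \<open>ds\<close>. Associativity
  reduces them to y times a power of y, and the vanishing of this one product is what determines
  \<open>cc\<close>.\<close>

lemma st_pf:
  assumes "rs \<noteq> []" "ss \<noteq> []" "pos rs" "pos ss"
  shows "st (lk pf) rs ss = 0"
proof -
  define \<phi> where "\<phi> ts = fI ts + cc * dl (replicate n 1) ts" for ts
  have pp: "lk pf w = \<phi> w" if "pos w" for w by (simp add: lk_pf[OF that] ft_index[OF that] \<phi>_def)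
  have A: "st \<phi> rs ss = 0" if "rs \<noteq> []" "ss \<noteq> []" "pos rs" "pos ss" "\<not> (set rs \<subseteq> {1} \<and> set ss \<subseteq> {1})" for rs ss
  proof -
    have "st \<phi> rs ss = st fI rs ss + cc * st (dl (replicate n 1)) rs ss"
      unfolding \<phi>_def[abs_def] st_add st_cmult ..
    moreover have "st (dl (replicate n 1)) rs ss = 0" by (rule st_dl_ones) (use that in auto)
    ultimately show ?thesis using f_st[of rs ss] that by (simp add: is_index_def)
  qed
  have deg: "\<phi> w = 0" if "pos w" "sum_list w \<noteq> n" for w
    using f_len[of "index_word w"] length_index[OF that(1)] that(2) by (auto simp: \<phi>_def sum_list_replicate)
  \<comment> \<open>The relation of y_i with y^j says that inserting y_i into y^j and inserting
    y_(i+1) into y^(j-1) give opposite values; iterating leads from y_n down to y_2.\<close>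
  have chain: "Ins fI (n - j) j = (-1) ^ j * fI [n]" if "j \<le> n - 2" for j
    using that
  proof (induction j)
    case 0
    then show ?case by (simp add: Ins_def)
  next
    case (Suc j)
    have "st fI [n - Suc j] (replicate (Suc j) 1) = 0"
      by (rule f_st) (use Suc.prems in \<open>auto simp: is_index_def\<close>)
    then have "Ins fI (n - Suc j) (Suc j) = - Ins fI (Suc (n - Suc j)) j" using st_ones[of fI "n - Suc j" "Suc j"] by (simp del: replicate_Suc)
    moreover have "Suc (n - Suc j) = n - j" using Suc.prems by simp
    ultimately show ?case using Suc by simp
  qed
  \<comment> \<open>The n insertions of y_1 contribute n \<open>cc\<close>, which is f at y_n; the
    insertions of y_2 contribute (-1)^(n-2) times the same value. They cancel because n is
    odd.\<close>
  have T1: "st \<phi> [1] (replicate (n - 1) 1) = 0"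
  proof -
    have r: "replicate a 1 @ 1 # replicate (n - 1 - a) 1 = replicate n (1::nat)" if "a \<le> n - 1" for a
    proof -
      have "replicate a 1 @ 1 # replicate (n - 1 - a) 1 = replicate (a + Suc (n - 1 - a)) (1::nat)" by (simp only: replicate_add replicate_Suc)
      then show ?thesis using that n3 by (simp add: Suc_diff_le)
    qed
    have "Ins \<phi> 1 (n - 1) = (\<Sum>a\<le>n - 1. cc)"
      unfolding Ins_def by (intro sum.cong) (simp_all only: r atMost_iff, simp add: \<phi>_def index_ones f_yn)
    then have 1: "Ins \<phi> 1 (n - 1) = fI [n]" using n3 by (simp add: cc_def of_nat_diff)
    have "Ins \<phi> 2 (n - 2) = Ins fI 2 (n - 2)"
      unfolding Ins_def
    proof (intro sum.cong refl)
      fix a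
      have "2 \<in> set (replicate a 1 @ 2 # replicate (n - 2 - a) (1::nat))" by simp
      then have "replicate a 1 @ 2 # replicate (n - 2 - a) 1 \<noteq> replicate n (1::nat)" by (metis in_set_replicate numeral_eq_one_iff semiring_norm(85))
      then show "\<phi> (replicate a 1 @ 2 # replicate (n - 2 - a) 1) = fI (replicate a 1 @ 2 # replicate (n - 2 - a) 1)" by (simp add: \<phi>_def)
    qed
    moreover have "Ins fI 2 (n - 2) = - fI [n]"
      using chain[of "n - 2"] n3 n_odd by simp
    moreover have "n - 1 \<noteq> 0" "n - 1 - 1 = n - 2" using n3 by auto
    ultimately show ?thesis using 1 st_ones[of \<phi> 1 "n - 1"] by (simp add: numeral_2_eq_2)
  qed
  have T: "st \<phi> [1] z = 0" if "pos z" "sum_list z = n - 1" for z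
  proof (cases "set z \<subseteq> {1}")
    case True
    then have z: "z = replicate (length z) 1" by (rule onesD)
    have "sum_list z = length z" by (subst z) (simp add: sum_list_replicate)
    then have lz: "length z = n - 1" using that(2) by simp
    show ?thesis using T1 z unfolding lz by metis
  next
    case False
    moreover have "z \<noteq> []" using that n3 by auto
    ultimately show ?thesis by (intro A) (use that in auto)
  qed
  have "st \<phi> rs ss = 0"
  proof (cases "set rs \<subseteq> {1} \<and> set ss \<subseteq> {1}")
    case False
    then show ?thesis by (intro A assms)
  next
    case True
    obtain a where rs: "rs = replicate (Suc a) 1" using True assms(1) onesD[of rs] by (cases rs) auto
    have sum: "sum_list rs = Suc a" by (simp add: rs sum_list_replicate)
    show ?thesis
    proof (cases "sum_list rs + sum_list ss = n")
      case F: False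
      have "st \<phi> rs ss = st (\<lambda>w. 0) rs ss" by (rule st_cong) (use assms deg F in auto)
      then show ?thesis by simp
    next
      case t: True
      show ?thesis
      proof (cases "a = 0")
        case a0: True
        then show ?thesis using T[OF assms(4)] t by (simp add: rs)
      next
        case a: False
        \<comment> \<open>y * y^a is (a+1) y^(a+1) plus words containing y_2, whose products with
          \<open>ss\<close> are covered by \<open>A\<close>. So y^(a+1) * ss is a multiple of y *
          (y^a * ss), which vanishes by \<open>T\<close>.\<close>
        define \<chi> where "\<chi> u = st \<phi> u ss" for u
        have pa: "pos (replicate a 1)" by simp
        have "st (\<lambda>z. st \<phi> [1] z) (replicate a 1) ss = st (\<lambda>z. 0) (replicate a 1) ss"
          by (rule st_cong[OF pa assms(4)]) (use T t sum in \<open>auto simp: sum_list_replicate\<close>)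
        then have "st \<chi> [1] (replicate a 1) = 0" unfolding st_assoc \<chi>_def by simp
        then have "Ins \<chi> 1 a + Ins \<chi> 2 (a - 1) = 0" using a st_ones[of \<chi> 1 a] by (simp add: numeral_2_eq_2)
        moreover have "Ins \<chi> 2 (a - 1) = 0"
          unfolding Ins_def \<chi>_def by (intro sum.neutral ballI A) (use assms in auto)
        moreover have "Ins \<chi> 1 a = of_nat (Suc a) * \<chi> (replicate (Suc a) 1)"
        proof -
          have r: "replicate b 1 @ 1 # replicate (a - b) 1 = replicate (Suc a) (1::nat)" if "b \<le> a" for b
          proof -
            have "replicate b 1 @ 1 # replicate (a - b) 1 = replicate (b + Suc (a - b)) (1::nat)" by (simp only: replicate_add replicate_Suc)
            then show ?thesis using that by simp
          qed
          have "Ins \<chi> 1 a = (\<Sum>b\<le>a. \<chi> (replicate (Suc a) 1))"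
            unfolding Ins_def by (intro sum.cong) (simp_all only: r atMost_iff)
          then show ?thesis by simp
        qed
        ultimately show ?thesis by (simp add: \<chi>_def rs del: replicate_Suc of_nat_Suc)
      qed
    qed
  qed
  moreover have "st (lk pf) rs ss = st \<phi> rs ss" by (rule st_cong) (use assms pp in auto)
  ultimately show ?thesis by simp
qed

lemma pf_Nil: "lk pf [] = 0" using lk_pf[of "[]"] f_len[of "[]"] n3 by (simp add: ft_def lookup_add lookup_single when_def)

lemma Dst_pf: "Dst pf = inl pf + inr pf" by (rule Dst_primI[OF posp_pf pf_Nil st_pf])

lemma posp_rv: "posp p \<Longrightarrow> posp (rv p)"
  by (rule pospI) (simp add: lk_rv posp_lk)

lemma Dst_rv_pf: "Dst (rv pf) = inl (rv pf) + inr (rv pf)"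
proof (rule Dst_primI[OF posp_rv[OF posp_pf]])
  fix rs ss assume a: "rs \<noteq> []" "ss \<noteq> []" "pos rs" "pos ss"
  have "lk (rv pf) = (\<lambda>w. lk pf (rev w))" by (rule ext) (rule lk_rv)
  then have "st (lk (rv pf)) rs ss = st (\<lambda>w. lk pf (rev w)) (rev (rev rs)) (rev (rev ss))" by simp
  also have "\<dots> = st (lk pf) (rev rs) (rev ss)" by (rule st_rev) (use a in auto)
  also have "\<dots> = 0" by (rule st_pf) (use a in auto)
  finally show "st (lk (rv pf)) rs ss = 0" .
qed (simp add: lk_rv pf_Nil)

definition "P i = (DD ^^ i) pf"

lemma P_0 [simp]: "P 0 = pf" and P_Suc: "DD (P i) = P (Suc i)" by (simp_all add: P_def)
lemma posp_P: "posp (P i)"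
proof (induction i)
  case (Suc i)
  then show ?case unfolding posp_def P_Suc[symmetric] kill0_DD by (simp only:)
qed (simp add: posp_pf)
lemma Dst_P: "Dst (P i) = inl (P i) + inr (P i)"
proof (induction i)
  case (Suc i)
  then show ?case unfolding P_Suc[symmetric] Dst_DD by (simp only: D2_lin D2_inl D2_inr)
qed (simp add: Dst_pf)
lemma Dst_rv_P: "Dst (rv (P i)) = inl (rv (P i)) + inr (rv (P i))"
proof (induction i)
  case (Suc i)
  then show ?case unfolding P_Suc[symmetric] DD_rv[symmetric] Dst_DD by (simp only: D2_lin D2_inl D2_inr)
qed (simp add: Dst_rv_pf)
lemma P_end: "P (Suc n) = 0"
  unfolding P_def
proof (rule DD_nil)
  fix w assume w: "lk pf w \<noteq> 0"
  then have p: "pos w" using posp_lk[OF posp_pf] by blast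
  then have "fI w \<noteq> 0 \<or> w = replicate n 1" using w by (auto simp: lk_pf ft_index split: if_splits)
  then show "sum_list w < Suc n" using f_len[of "index_word w"] length_index[OF p] by (auto simp: sum_list_replicate)
qed

definition "ak i = (-1) ^ i / (fact i :: rat)"
lemma ak_Suc: "ak i = - (of_nat (Suc i) * ak (Suc i))" by (simp add: ak_def fact_Suc field_simps del: of_nat_Suc)

text \<open>A Taylor sum in concatenation powers of x on the right: it extends
  \<open>iota pf\<close> to an element killed by \<open>DX\<close> without changing the coefficients
  of words ending in y.\<close>

definition "AA = (\<Sum>i\<le>n. qscale (ak i) (iota (P i) * gx ^ i))"

lemma DX_AA: "DX AA = 0"
proof -
  have "DX (\<Sum>i\<le>N. qscale (ak i) (iota (P i) * gx ^ i)) = qscale (ak N) (iota (P (Suc N)) * gx ^ N)" for N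
  proof (induction N)
    case 0
    then show ?case by (simp add: DX_iota P_Suc[of 0, simplified])
  next
    case (Suc N)
    have "qscale (ak N) X + qscale (ak (Suc N)) (qscale (of_nat (Suc N)) X) = 0" for X :: qxy
      unfolding qscale_qscale qvec.scale_left_distrib[symmetric] by (subst ak_Suc) (simp del: of_nat_Suc add: mult.commute)
    then show ?case
      by (simp add: Suc DX_mult DX_iota P_Suc qvec.scale_right_distrib DX_power del: power_Suc of_nat_Suc)
  qed
  from this[of n] show ?thesis by (simp add: AA_def P_end)
qed

lemma DX_ft: "DX ft = 0"
proof -
  have "DX (mon (replicate j Ly)) = 0" for j
  proof (induction j)
    case (Suc j)
    have "mon (replicate (Suc j) Ly) = gy * mon (replicate j Ly)" by (simp flip: mon_append)
    then show ?case using Suc by (simp only: DX_mult DX_letters) simp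
  qed (simp add: mon_Nil)
  moreover have "DX f = 0" by (rule poly_mapping_eqI) (simp add: lk_DX f_insx)
  ultimately show ?thesis by (simp add: ft_def)
qed

lemma AA_shift: "AA = iota pf + (\<Sum>i<n. qscale (ak (Suc i)) (iota (P (Suc i)) * gx ^ i)) * gx"
proof -
  have "gx ^ i * gx = gx ^ Suc i" for i by (simp add: power_commutes)
  then show ?thesis unfolding AA_def sum.atMost_shift by (simp add: ak_def sum_distrib_right mult.assoc)
qed

lemma lk_ft_iota: "lk (iota pf) (v @ [Ly]) = lk ft (v @ [Ly])" "lk (iota pf) [] = 0" "lk ft [] = 0"
proof -
  obtain ss where s: "v @ [Ly] = index_word ss" "pos ss" using ends_y_index[of v] by blast
  show "lk (iota pf) (v @ [Ly]) = lk ft (v @ [Ly])" unfolding s(1) by (simp add: lk_iota[OF posp_pf s(2)] lk_pf[OF s(2)])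
  show "lk (iota pf) [] = 0" using lk_iota[OF posp_pf, of "[]"] by (simp add: pf_Nil)
  show "lk ft [] = 0" using lk_pf[of "[]"] by (simp add: pf_Nil)
qed

text \<open>Both elements are killed by \<open>DX\<close> and agree on words ending in y, so their
  difference has the form q x, and \<open>DX_zero\<close> applies. Thus f is determined by its part
  ending in y.\<close>

lemma ft_AA: "ft = AA"
proof -
  define h where "h = ft - AA"
  have hx: "h = DR Lx h * gx"
  proof (rule poly_mapping_eqI)
    fix w show "lk h w = lk (DR Lx h * gx) w"
    proof (cases w rule: rev_cases)
      case Nil
      then show ?thesis by (simp add: h_def AA_shift lookup_minus lookup_add lk_mult_mon_Nil lk_ft_iota)
    next
      case (snoc v a)
      show ?thesis
        by (cases a) (simp_all add: snoc lk_mult_mon_snoc lk_DR, simp add: h_def AA_shift lookup_minus lookup_add lk_mult_mon_snoc lk_ft_iota)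
    qed
  qed
  have "DX h = 0" by (simp add: h_def DX_ft DX_AA)
  then have "DX (DR Lx h * gx) = 0" by (metis hx)
  then have "DR Lx h = 0" by (rule DX_zero)
  then have "h = 0" by (metis hx mult_zero_left)
  then show ?thesis by (simp add: h_def)
qed

lemma rv_ft: "rv ft = ft"
proof (rule poly_mapping_eqI)
  fix w
  have "replicate n Ly = rev w \<longleftrightarrow> replicate n Ly = w" by (metis rev_replicate rev_rev_ident)
  then show "lk (rv ft) w = lk ft w" by (simp add: lk_rv ft_def lookup_add f_rev lookup_single when_def)
qed

text \<open>For positive index m this is \<open>ft\<close> times y_m, where the trailing x of
  \<open>ft\<close> are absorbed into the next block. The formula makes sense for every integer
  index, as the coproduct computation requires.\<close>

definition "EE z = (\<Sum>i\<le>n. qscale (ak i) (P i * Yz (z + int i)))"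
definition "ee z = EE z - rv (EE z)"

lemma rv_EE: "rv (EE z) = (\<Sum>i\<le>n. qscale (ak i) (Yz (z + int i) * rv (P i)))"
  by (simp add: EE_def rv_sum rv_mult)

lemma posp_ee: "kill0 (ee z) = ee z"
proof -
  have "kill0 (P i) = P i" "kill0 (rv (P i)) = rv (P i)" for i
    using posp_P[of i] posp_rv[OF posp_P[of i]] by (simp_all add: posp_def)
  then show ?thesis unfolding ee_def rv_EE by (simp add: EE_def kill0_sum kill0_mult)
qed

text \<open>The letter y_(m+i) is read once as x^i y_m and once as x^(m-1) x^i y, which gives the
  two terms; the second one uses that \<open>ft\<close> is palindromic.\<close>

lemma iota_ee:
  assumes "1 \<le> m" shows "iota (ee (int m)) = ft * mon (y_word m) - mon (xs (m - 1)) * ft * gy"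
proof -
  have y: "iota (Yz (int m + int i)) = gx ^ i * mon (y_word m)" "iota (Yz (int m + int i)) = mon (xs (m - 1)) * (gx ^ i * gy)" for i
  proof -
    have e1: "m + i - 1 = i + (m - 1)" and e2: "m + i - 1 = (m - 1) + i" using assms by auto
    have y1: "y_word (m + i) = xs i @ y_word m" by (simp only: y_word_def e1 replicate_add append_assoc)
    have y2: "y_word (m + i) = xs (m - 1) @ xs i @ [Ly]" by (simp only: y_word_def e2 replicate_add append_assoc)
    have b: "iota (Yz (int m + int i)) = mon (y_word (m + i))" using Yz_nat[of "m + i"] assms by simp
    show "iota (Yz (int m + int i)) = gx ^ i * mon (y_word m)" unfolding b y1 mon_append gx_power ..
    show "iota (Yz (int m + int i)) = mon (xs (m - 1)) * (gx ^ i * gy)" unfolding b y2 mon_append gx_power ..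
  qed
  have 1: "iota (EE (int m)) = AA * mon (y_word m)"
    by (simp add: EE_def iota_sum iota_mult y(1) AA_def sum_distrib_right mult.assoc)
  have "iota (rv (EE (int m))) = mon (xs (m - 1)) * rv AA * gy"
    by (simp add: rv_EE iota_sum iota_mult y(2) AA_def rv_sum rv_mult sum_distrib_right sum_distrib_left mult.assoc gy_iota_rv gx_power)
  then show ?thesis using 1 by (simp add: ee_def rv_ft flip: ft_AA)
qed

lemma ft_cyc: "lk ft (Lx # w) + lk ft (Ly # w) = lk ft (w @ [Lx]) + lk ft (w @ [Ly])"
proof -
  have r: "v = replicate n Ly \<longleftrightarrow> length v = n \<and> (\<forall>x\<in>set v. x = Ly)" for v by (auto intro: replicate_eqI)
  have l: "lk (mon (replicate n Ly)) v = (if length v = n \<and> (\<forall>x\<in>set v. x = Ly) then 1 else 0)" for v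
    unfolding r[symmetric] by (auto simp: lookup_single when_def)
  have "lk (mon (replicate n Ly)) (w @ [Ly]) = lk (mon (replicate n Ly)) (Ly # w)" unfolding l by auto
  moreover have "lk (mon (replicate n Ly)) (w @ [Lx]) = 0" "lk (mon (replicate n Ly)) (Lx # w) = 0" unfolding l by auto
  ultimately show ?thesis using f_cyc[of w] by (simp add: ft_def lookup_add)
qed

text \<open>At a word v y the coefficient is ft(vy) + ft(vx) - ft(yv) - ft(xv), which is zero by the
  cyclic symmetry \<open>ft_cyc\<close>.\<close>

lemma ee_0: "ee 0 = 0"
proof -
  define A1 where "A1 = (\<Sum>i<n. qscale (ak (Suc i)) (iota (P (Suc i)) * gx ^ i))"
  have y: "iota (Yz (0 + int (Suc i))) = gx ^ i * gy" for i
  proof -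
    have "y_word (Suc i) = xs i @ [Ly]" by (simp add: y_word_def)
    then show ?thesis using Yz_Suc[of i] by (simp only: add_0 iota_lin gx_power mon_append)
  qed
  have a0: "ak 0 = 1" by (simp add: ak_def)
  have 1: "iota (EE 0) = iota pf + A1 * gy"
    unfolding EE_def sum.atMost_shift A1_def iota_lin iota_sum iota_mult y by (simp add: a0 sum_distrib_right mult.assoc)
  have 2: "iota (rv (EE 0)) = iota (rv pf) + rv A1 * gy"
    unfolding rv_EE sum.atMost_shift A1_def iota_lin iota_sum iota_mult y rv_sum rv_lin rv_mult mult.assoc gy_iota_rv
    by (simp add: a0 sum_distrib_right mult.assoc gx_power)
  have ft: "ft = iota pf + A1 * gx" unfolding A1_def using ft_AA AA_shift by simp
  have A1: "lk A1 v = lk ft (v @ [Lx])" for v by (simp add: ft lookup_add lk_iota_x lk_mult_mon_snoc)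
  have rp: "lk (iota (rv pf)) (v @ [Ly]) = lk ft (Ly # v)" for v
  proof -
    have "lk (iota (rv pf)) (v @ [Ly]) = lk (gy * iota (rv pf)) (Ly # (v @ [Ly]))" by (simp only: lk_mon_mult_Cons refl if_True)
    also have "\<dots> = lk (rv (iota pf) * gy) ((Ly # v) @ [Ly])" by (simp add: gy_iota_rv)
    also have "\<dots> = lk (iota pf) (rev v @ [Ly])" by (simp only: lk_mult_mon_snoc refl if_True lk_rv) simp
    also have "\<dots> = lk ft (rev (Ly # v))" by (simp add: lk_ft_iota)
    also have "\<dots> = lk ft (Ly # v)" using lk_rv[of ft "Ly # v"] by (simp only: rv_ft)
    finally show ?thesis .
  qed
  have z: "lk (iota (ee 0)) (v @ [Ly]) = 0" for v
  proof -
    have "lk (iota (ee 0)) (v @ [Ly]) = (lk ft (v @ [Ly]) + lk ft (v @ [Lx])) - (lk ft (Ly # v) + lk ft (rev v @ [Lx]))"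
      by (simp add: ee_def 1 2 lookup_minus lookup_add lk_mult_mon_snoc lk_ft_iota rp lk_rv A1)
    moreover have "lk ft (rev v @ [Lx]) = lk ft (Lx # v)" using lk_rv[of ft "Lx # v"] by (simp add: rv_ft)
    ultimately show ?thesis using ft_cyc[of v] by simp
  qed
  have pe: "posp (ee 0)" by (simp add: posp_def posp_ee)
  show ?thesis
  proof (rule poly_mapping_eqI)
    fix ts
    consider "\<not> pos ts" | "ts = []" | "pos ts" "ts \<noteq> []" by blast
    then show "lk (ee 0) ts = lk 0 ts"
    proof cases
      case 1 then show ?thesis using posp_lk[OF pe] by simp
    next
      case 2
      have "lk (iota (rv pf)) [] = 0" using lk_iota[OF posp_rv[OF posp_pf], of "[]"] by (simp add: lk_rv pf_Nil)
      then have "lk (iota (ee 0)) [] = 0" by (simp add: ee_def 1 \<open>iota (rv (EE 0)) = _\<close> lookup_minus lookup_add lk_mult_mon_Nil lk_ft_iota)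
      moreover have "lk (iota (ee 0)) [] = lk (ee 0) []" using lk_iota[OF pe, of "[]"] by simp
      ultimately show ?thesis by (simp add: \<open>ts = []\<close>)
    next
      case 3
      then obtain v where "index_word ts = v @ [Ly]" using index_snoc by blast
      then show ?thesis using z[of v] lk_iota[OF pe 3(1)] by simp
    qed
  qed
qed

lemma DD_ee: "DD (ee z) = qscale (of_int z - 1) (ee (z - 1))"
proof -
  have "DD (\<Sum>i\<le>N. qscale (ak i) (P i * Yz (z + int i)))
    = qscale (of_int z - 1) (\<Sum>i\<le>N. qscale (ak i) (P i * Yz (z - 1 + int i))) + qscale (ak N) (P (Suc N) * Yz (z + int N))" for N
  proof (induction N)
    case 0
    then show ?case by (simp add: dv_mult DD_Yz P_Suc[of 0, simplified] ak_def add.commute)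
  next
    case (Suc N)
    let ?X = "P (Suc N) * Yz (z + int N)"
    have i: "z + int (Suc N) - 1 = z + int N" "z - 1 + int (Suc N) = z + int N" by simp_all
    have "ak N + ak (Suc N) * (of_int (z + int (Suc N)) - 1) = (of_int z - 1) * ak (Suc N)"
      by (subst ak_Suc) (simp add: algebra_simps)
    then have "qscale (ak N) ?X + qscale (ak (Suc N)) (qscale (of_int (z + int (Suc N)) - 1) ?X) = qscale (of_int z - 1) (qscale (ak (Suc N)) ?X)"
      by (simp only: qscale_qscale flip: qvec.scale_left_distrib)
    then show ?case
      unfolding sum.atMost_Suc dv_lin(1) Suc.IH dv_lin(4) dv_mult DD_Yz P_Suc i qvec.scale_right_distrib qscale_mult_right
      by (simp add: add_ac)
  qed
  from this[of n] have "DD (EE z) = qscale (of_int z - 1) (EE (z - 1))" by (simp add: EE_def P_end)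
  then show ?thesis by (simp add: ee_def DD_rv qvec.scale_right_diff_distrib)
qed

text \<open>Starting from \<open>ee_0\<close>, the derivation \<open>DD\<close> lowers the index
  with factor z - 1, which is nonzero for z at most 0.\<close>

lemma ee_nonpos: "z \<le> 0 \<Longrightarrow> ee z = 0"
proof -
  have "ee (- int j) = 0" for j
  proof (induction j)
    case (Suc j)
    have "qscale (of_int (- int j) - 1) (ee (- int j - 1)) = 0" using DD_ee[of "- int j"] Suc by simp
    then have "qscale (1 / (of_int (- int j) - 1)) (qscale (of_int (- int j) - 1) (ee (- int j - 1))) = 0" by simp
    moreover have "of_int (- int j) - 1 < (0::rat)" by simp
    then have "of_int (- int j) - 1 \<noteq> (0::rat)" by simp
    ultimately have "ee (- int j - 1) = 0" by (simp only: qscale_qscale) simp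
    moreover have "- int j - 1 = - int (Suc j)" by simp
    ultimately show ?case by (simp only:)
  qed (simp add: ee_0)
  from this[of "nat (- z)"] show "z \<le> 0 \<Longrightarrow> ee z = 0" by simp
qed

text \<open>The elements \<open>P i\<close> and their reversals are primitive and the letters split
  by convolution; the bound B only has to be large enough for all indices z + i.\<close>

lemma Dst_ee: assumes "z + int n \<le> int B"
  shows "Dst (ee z) = (\<Sum>b\<le>B. inl (ee (z - int b)) * inr (Yz (int b))) + (\<Sum>b\<le>B. inl (Yz (int b)) * inr (ee (z - int b)))"
proof -
  have sh: "z + int i - int b = z - int b + int i" for i b by simp
  have ib: "z + int i \<le> int B" if "i \<le> n" for i using assms that by simp
  have E: "Dst (EE z) = (\<Sum>b\<le>B. inl (EE (z - int b)) * inr (Yz (int b))) + (\<Sum>b\<le>B. inl (Yz (int b)) * inr (EE (z - int b)))"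
  proof -
    have "Dst (EE z) = (\<Sum>i\<le>n. qscale (ak i) (inl (P i) * Dst (Yz (z + int i)) + inr (P i) * Dst (Yz (z + int i))))"
      by (simp add: EE_def Dst_sum Dst_mult Dst_P distrib_right)
    also have "\<dots> = (\<Sum>i\<le>n. qscale (ak i) ((\<Sum>b\<le>B. inl (P i * Yz (z - int b + int i)) * inr (Yz (int b)))
       + (\<Sum>b\<le>B. inl (Yz (int b)) * inr (P i * Yz (z - int b + int i)))))"
    proof (intro sum.cong refl arg_cong[of _ _ "qscale _"] arg_cong2[of _ _ _ _ "(+)"])
      fix i assume "i \<in> {..n}"
      then have b: "z + int i \<le> int B" using ib by simp
      show "inl (P i) * Dst (Yz (z + int i)) = (\<Sum>b\<le>B. inl (P i * Yz (z - int b + int i)) * inr (Yz (int b)))"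
        unfolding Dst_Yz[OF b] sh by (simp add: sum_distrib_left inl_mult mult.assoc)
      show "inr (P i) * Dst (Yz (z + int i)) = (\<Sum>b\<le>B. inl (Yz (int b)) * inr (P i * Yz (z - int b + int i)))"
        unfolding Dst_Yz'[OF b] sh by (simp add: sum_distrib_left inr_mult inr_inl2)
    qed
    also have "\<dots> = (\<Sum>b\<le>B. inl (EE (z - int b)) * inr (Yz (int b))) + (\<Sum>b\<le>B. inl (Yz (int b)) * inr (EE (z - int b)))"
      unfolding EE_def inl_sum inr_sum inl_lin inr_lin sum_distrib_left sum_distrib_right qvec.scale_right_distrib qscale_sum sum.distrib qscale_mult_left qscale_mult_right
      by (intro arg_cong2[of _ _ _ _ "(+)"] sum.swap)
    finally show ?thesis .
  qed
  have R: "Dst (rv (EE z)) = (\<Sum>b\<le>B. inl (rv (EE (z - int b))) * inr (Yz (int b))) + (\<Sum>b\<le>B. inl (Yz (int b)) * inr (rv (EE (z - int b))))"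
  proof -
    have "Dst (rv (EE z)) = (\<Sum>i\<le>n. qscale (ak i) (Dst (Yz (z + int i)) * inl (rv (P i)) + Dst (Yz (z + int i)) * inr (rv (P i))))"
      by (simp add: rv_EE Dst_sum Dst_mult Dst_rv_P distrib_left)
    also have "\<dots> = (\<Sum>i\<le>n. qscale (ak i) ((\<Sum>b\<le>B. inl (Yz (z - int b + int i) * rv (P i)) * inr (Yz (int b)))
       + (\<Sum>b\<le>B. inl (Yz (int b)) * inr (Yz (z - int b + int i) * rv (P i)))))"
    proof (intro sum.cong refl arg_cong[of _ _ "qscale _"] arg_cong2[of _ _ _ _ "(+)"])
      fix i assume "i \<in> {..n}"
      then have b: "z + int i \<le> int B" using ib by simp
      show "Dst (Yz (z + int i)) * inl (rv (P i)) = (\<Sum>b\<le>B. inl (Yz (z - int b + int i) * rv (P i)) * inr (Yz (int b)))"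
        unfolding Dst_Yz[OF b] sh by (simp add: sum_distrib_right inl_mult inr_inl mult.assoc)
      show "Dst (Yz (z + int i)) * inr (rv (P i)) = (\<Sum>b\<le>B. inl (Yz (int b)) * inr (Yz (z - int b + int i) * rv (P i)))"
        unfolding Dst_Yz'[OF b] sh by (simp add: sum_distrib_right inr_mult mult.assoc)
    qed
    also have "\<dots> = (\<Sum>b\<le>B. inl (rv (EE (z - int b))) * inr (Yz (int b))) + (\<Sum>b\<le>B. inl (Yz (int b)) * inr (rv (EE (z - int b))))"
      unfolding rv_EE inl_sum inr_sum inl_lin inr_lin sum_distrib_left sum_distrib_right qvec.scale_right_distrib qscale_sum sum.distrib qscale_mult_left qscale_mult_right
      by (intro arg_cong2[of _ _ _ _ "(+)"] sum.swap)
    finally show ?thesis .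
  qed
  show ?thesis unfolding ee_def Dst_lin E R
    by (simp add: left_diff_distrib right_diff_distrib sum_subtractf)
qed

abbreviation "del \<equiv> dv (\<lambda>m. ee (int m))"

lemma del_Yz: "del (Yz z) = ee z"
proof (cases "z \<le> 0")
  case True
  then show ?thesis by (cases "z = 0") (auto simp: ee_nonpos)
next
  case False
  then obtain m where "z = int m" "1 \<le> m" by (intro that[of "nat z"]) auto
  then show ?thesis by (simp add: Yz_nat)
qed

text \<open>Since \<open>ee\<close> vanishes at nonpositive indices, the sums of
  \<open>Dst_ee\<close> stop at b = m, and then they are the Leibniz terms of \<open>D2\<close> on
  the coproduct of a letter.\<close>

lemma Dst_del: "Dst (del p) = D2 del (Dst p)"
proof (rule Dst_coder)
  fix m
  have z: "ee (int m - int b) = 0" if "\<not> b \<le> m" for b using that by (intro ee_nonpos) simp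
  have "Dst (ee (int m)) = (\<Sum>b\<le>m + n. inl (ee (int m - int b)) * inr (Yz (int b))) + (\<Sum>b\<le>m + n. inl (Yz (int b)) * inr (ee (int m - int b)))"
    by (rule Dst_ee) simp
  also have "(\<Sum>b\<le>m + n. inl (ee (int m - int b)) * inr (Yz (int b))) = (\<Sum>b\<le>m. inl (ee (int m - int b)) * inr (Yz (int b)))"
    by (rule sum.mono_neutral_right) (auto simp: z)
  also have "(\<Sum>b\<le>m + n. inl (Yz (int b)) * inr (ee (int m - int b))) = (\<Sum>b\<le>m. inl (Yz (int b)) * inr (ee (int m - int b)))"
    by (rule sum.mono_neutral_right) (auto simp: z)
  also have "(\<Sum>b\<le>m. inl (Yz (int b)) * inr (ee (int m - int b))) = (\<Sum>b\<le>m. inl (Yz (int m - int b)) * inr (ee (int b)))"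
    by (subst sum_atMost_rev) (intro sum.cong, auto simp: of_nat_diff)
  finally show "Dst (ee (int m)) = D2 del (Dst (mon [m]))"
    unfolding Dst_letter_Yz D2_sum D2_inl_inr del_Yz sum.distrib .
qed

lemma posp_del: "posp p \<Longrightarrow> posp (del p)"
  unfolding posp_def using kill0_dv[of "\<lambda>m. ee (int m)" p] by (simp add: posp_ee ee_0)

abbreviation "dx \<equiv> dv (\<lambda>l. if l = Lx then ft * gx - gx * ft else 0)"

lemma dx_power: "dx (gx ^ j) = ft * gx ^ j - gx ^ j * ft"
proof (induction j)
  case (Suc j)
  have "dx (gx ^ Suc j) = (ft * gx - gx * ft) * gx ^ j + gx * dx (gx ^ j)" by (simp add: dv_mult)
  then show ?case unfolding Suc by (simp add: algebra_simps)
qed simp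

text \<open>\<open>dx\<close> kills y and acts on powers of x as the commutator with
  \<open>ft\<close>, so it sends x^(m-1) y to the element computed in
  \<open>iota_ee\<close>.\<close>

lemma iota_del: "iota (del p) = dx (iota p)"
proof (rule linear_eqI[of "\<lambda>p. iota (del p)"], goal_cases)
  case (5 w)
  have l: "iota (ee (int m)) = dx (mon (y_word m))" for m
  proof (cases "m = 0")
    case True
    then show ?thesis by (simp add: ee_0 y_word_def)
  next
    case False
    have "mon (y_word m) = gx ^ (m - 1) * gy" by (simp only: y_word_def mon_append gx_power)
    then show ?thesis using iota_ee[of m] False by (simp add: dv_mult dx_power algebra_simps flip: gx_power)
  qed
  show ?case
  proof (induction w)
    case (Cons m w)
    then show ?case by (simp only: mon_Cons[of m w] dv_mult iota_mult iota_lin dv_lin l)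
  qed (simp add: mon_Nil)
qed simp_all

end

section \<open>The Poisson bracket and functionals on formal zeta values\<close>

section \<open>The Poisson bracket of two double shuffle elements\<close>

lemma Deriv_dv: "Deriv f = dv (\<lambda>l. if l = Lx then 0 else commutator gy f)"
proof -
  have "deriv_word f w = dw (\<lambda>l. if l = Lx then 0 else commutator gy f) w" for w
    by (induction f w rule: deriv_word.induct) simp_all
  then have "deriv_word f = dw (\<lambda>l. if l = Lx then 0 else commutator gy f)" by (rule ext)
  then show ?thesis by (simp add: Deriv_def dv_def)
qed

lemma Deriv_mult: "Deriv f (p * q) = Deriv f p * q + p * Deriv f q" by (simp add: Deriv_dv dv_mult)
lemma Deriv_lin [simp]: "Deriv f (p + q) = Deriv f p + Deriv f q" "Deriv f (p - q) = Deriv f p - Deriv f q"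
  "Deriv f (qscale c p) = qscale c (Deriv f p)" "Deriv f 0 = 0" "Deriv f 1 = 0" "Deriv f gx = 0" "Deriv f gy = commutator gy f"
  by (simp_all add: Deriv_dv)

lemma Lie_diff: "f \<in> Lie_xy \<Longrightarrow> g \<in> Lie_xy \<Longrightarrow> f - g \<in> Lie_xy"
  using Lie_xy.add[of f "qscale (-1) g"] Lie_xy.scale[of g "-1"] by (simp add: qscale_minus1)

lemma Lie_Deriv: assumes f: "f \<in> Lie_xy" shows "g \<in> Lie_xy \<Longrightarrow> Deriv f g \<in> Lie_xy"
proof (induction rule: Lie_xy.induct)
  case y
  show ?case using Lie_xy.bracket[OF Lie_xy.y f] by simp
next
  case (bracket a b)
  have "Deriv f (commutator a b) = commutator (Deriv f a) b + commutator a (Deriv f b)"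
    by (simp add: commutator_def Deriv_mult algebra_simps)
  then show ?case using bracket by (auto intro: Lie_xy.intros)
qed (auto intro: Lie_xy.intros)

lemma homogD: "f \<in> homog n \<Longrightarrow> lk f w \<noteq> 0 \<Longrightarrow> length w = n" by (auto simp: homog_def in_keys_iff)
lemma homogI: "(\<And>w. lk f w \<noteq> 0 \<Longrightarrow> length w = n) \<Longrightarrow> f \<in> homog n" by (auto simp: homog_def in_keys_iff)
lemma homog_add: "f \<in> homog n \<Longrightarrow> g \<in> homog n \<Longrightarrow> f + g \<in> homog n"
proof (rule homogI)
  fix w assume a: "f \<in> homog n" "g \<in> homog n" "lk (f + g) w \<noteq> 0"
  then have "lk f w \<noteq> 0 \<or> lk g w \<noteq> 0" by (auto simp: lookup_add)
  then show "length w = n" using a homogD by blast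
qed
lemma homog_qscale: "f \<in> homog n \<Longrightarrow> qscale c f \<in> homog n"
  by (rule homogI) (auto dest: homogD)
lemma homog_diff: "f \<in> homog n \<Longrightarrow> g \<in> homog n \<Longrightarrow> f - g \<in> homog n"
  using homog_add[of f n "qscale (-1) g"] homog_qscale[of g n "-1"] by (simp add: qscale_minus1)
lemma homog_0 [simp]: "0 \<in> homog n" by (rule homogI) simp
lemma homog_mon: "mon w \<in> homog (length w)" by (rule homogI) (auto simp: lookup_single when_def split: if_splits)
lemma homog_mult: "f \<in> homog a \<Longrightarrow> g \<in> homog b \<Longrightarrow> f * g \<in> homog (a + b)"
  unfolding homog_def using Poly_Mapping.keys_mult[of f g] by (fastforce simp: plus_list_def)
lemma homog_sum: "(\<And>i. i \<in> A \<Longrightarrow> f i \<in> homog n) \<Longrightarrow> (\<Sum>i\<in>A. f i) \<in> homog n"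
  by (induction A rule: infinite_finite_induct) (auto intro: homog_add)

lemma homog_Deriv: assumes f: "f \<in> homog a" and g: "g \<in> homog b" shows "Deriv f g \<in> homog (a + b)"
proof -
  have c: "commutator gy f \<in> homog (Suc a)"
    using homog_mult[OF homog_mon[of "[Ly]"] f] homog_mult[OF f homog_mon[of "[Ly]"]] by (simp add: commutator_def homog_diff)
  have w: "Deriv f (mon w) \<in> homog (a + length w)" for w
  proof (induction w)
    case (Cons l w)
    have "Deriv f (mon [l]) * mon w \<in> homog (Suc a + length w)"
      using homog_mult[OF c homog_mon[of w]] by (cases l) auto
    moreover have "mon [l] * Deriv f (mon w) \<in> homog (Suc a + length w)"
      using homog_mult[OF homog_mon[of "[l]"] Cons] by simp
    ultimately show ?case by (simp add: mon_Cons[of l w] Deriv_mult homog_add)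
  qed (simp add: mon_Nil)
  have "Deriv f g = (\<Sum>w\<in>Poly_Mapping.keys g. qscale (lk g w) (Deriv f (mon w)))"
    using linear_eq_lin_ext[of "Deriv f" g] by (simp add: lin_ext_def)
  also have "\<dots> \<in> homog (a + b)"
  proof (rule homog_sum)
    fix w assume "w \<in> Poly_Mapping.keys g"
    then have "length w = b" using g by (auto simp: homog_def)
    then show "qscale (lk g w) (Deriv f (mon w)) \<in> homog (a + b)" using w[of w] by (simp add: homog_qscale)
  qed
  finally show ?thesis .
qed

lemma ds_degD: "f \<in> ds_deg n \<Longrightarrow> f \<in> homog n" "f \<in> ds_deg n \<Longrightarrow> f \<in> Lie_xy"
  by (auto simp: ds_deg_def ds_def intro: Lie_ge3_Lie)

text \<open>Antisymmetrization gives the Poisson bracket (\<open>poisson_sf\<close>). For Lie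
  elements, \<open>sf f g\<close> is f g plus a Lie element, which controls its coproduct.\<close>

definition sf :: "qxy \<Rightarrow> qxy \<Rightarrow> qxy" where "sf f g = f * g + Deriv f g"

lemma poisson_sf: "poisson f g = sf f g - sf g f"
  by (simp add: poisson_def sf_def commutator_def algebra_simps)

locale two_ds = F: odd_ds f n + G: odd_ds g m for f n g m
begin

text \<open>\<open>sf f g\<close> with the corrections by powers of y chosen so that
  \<open>VV\<close> equals \<open>F.dx G.ft + G.ft * F.ft\<close>; \<open>UU\<close> is its part
  ending in y in the letters y_m.\<close>

definition "VV = sf f g + qscale F.cc (mon (replicate n Ly) * g) + qscale G.cc (mon (replicate m Ly) * f)
   + qscale (F.cc * G.cc) (mon (replicate (n + m) Ly))"

definition "UU = F.del G.pf + G.pf * F.pf"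

lemma Dst_UU: "Dst UU = inl UU + inr UU + inl G.pf * inr F.pf + inl F.pf * inr G.pf"
proof -
  have "Dst UU = (inl (F.del G.pf) + inr (F.del G.pf)) + (inl G.pf + inr G.pf) * (inl F.pf + inr F.pf)"
    by (simp add: UU_def Dst_mult F.Dst_del F.Dst_pf G.Dst_pf D2_inl D2_inr)
  also have "\<dots> = inl UU + inr UU + inl G.pf * inr F.pf + inl F.pf * inr G.pf"
    by (simp add: UU_def inl_mult inr_mult distrib_left distrib_right inr_inl add_ac)
  finally show ?thesis .
qed

lemma posp_UU: "posp UU"
  using F.posp_del[OF G.posp_pf] F.posp_pf G.posp_pf by (simp add: UU_def posp_def kill0_mult)

lemma st_UU:
  assumes "rs \<noteq> []" "ss \<noteq> []" "pos rs" "pos ss"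
  shows "st (lk UU) rs ss = lk G.pf rs * lk F.pf ss + lk F.pf rs * lk G.pf ss"
  using lk_Dst[OF posp_UU, of rs ss] assms by (simp add: Dst_UU lookup_add lk_inl lk_inr lk_inl_inr)

text \<open>\<open>F.dx\<close> and \<open>Deriv f\<close> plus the commutator with
  \<open>F.ft\<close> are derivations that agree on both letters; on y this holds because the
  correction, a power of y, commutes with y.\<close>

lemma dx_sf: "F.dx q + q * F.ft = sf f q + qscale F.cc (mon (replicate n Ly) * q)"
proof -
  let ?y = "mon (replicate n Ly)"
  have yy: "?y * gy = gy * ?y"
    by (simp only: flip: mon_append) (simp add: replicate_append_same)
  have "F.dx q = Deriv f q + (F.ft * q - q * F.ft)"
  proof (rule linear_eqI[of F.dx], goal_cases)
    case (5 w)
    show ?case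
    proof (induction w)
      case (Cons l w)
      have "F.dx (mon [l]) = Deriv f (mon [l]) + (F.ft * mon [l] - mon [l] * F.ft)"
        by (cases l) (simp_all add: F.ft_def commutator_def algebra_simps yy)
      show ?case unfolding mon_Cons[of l w] dv_mult Deriv_mult Cons \<open>F.dx (mon [l]) = _\<close> by (simp add: algebra_simps)
    qed (simp add: mon_Nil)
  qed (simp_all add: algebra_simps qvec.scale_right_distrib qvec.scale_right_diff_distrib)
  then show ?thesis by (simp add: F.ft_def sf_def algebra_simps)
qed

text \<open>Writing \<open>G.ft\<close> = iota pf + b x, the second summand contributes only words
  ending in x: the terms b (ft x - x ft) and b x ft combine to b ft x.\<close>

lemma lk_UU: assumes "pos ts" "ts \<noteq> []" shows "lk UU ts = lk VV (index_word ts)"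
proof -
  obtain v where v: "index_word ts = v @ [Ly]" using index_snoc[OF assms(2)] by blast
  define ax where "ax = (\<Sum>i<n. qscale (F.ak (Suc i)) (iota (F.P (Suc i)) * gx ^ i))"
  define bx where "bx = (\<Sum>i<m. qscale (G.ak (Suc i)) (iota (G.P (Suc i)) * gx ^ i))"
  have fa: "F.ft = iota F.pf + ax * gx" unfolding ax_def using F.ft_AA F.AA_shift by simp
  have gb: "G.ft = iota G.pf + bx * gx" unfolding bx_def using G.ft_AA G.AA_shift by simp
  have "F.dx G.ft + G.ft * F.ft = F.dx (iota G.pf) + iota G.pf * F.ft + (F.dx bx * gx + bx * (F.ft * gx - gx * F.ft) + bx * gx * F.ft)"
    unfolding gb by (simp add: dv_mult algebra_simps)
  also have "\<dots> = F.dx (iota G.pf) + iota G.pf * (iota F.pf + ax * gx) + (F.dx bx * gx + bx * F.ft * gx)"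
    using fa by (simp add: algebra_simps)
  also have "\<dots> = iota UU + (iota G.pf * ax + F.dx bx + bx * F.ft) * gx"
    by (simp add: UU_def iota_mult F.iota_del algebra_simps)
  finally have e: "F.dx G.ft + G.ft * F.ft = iota UU + (iota G.pf * ax + F.dx bx + bx * F.ft) * gx" .
  have "VV = F.dx G.ft + G.ft * F.ft"
  proof -
    have "F.dx (mon (replicate j Ly)) = 0" for j
    proof (induction j)
      case (Suc j)
      have "mon (replicate (Suc j) Ly) = gy * mon (replicate j Ly)" by (simp flip: mon_append)
      then show ?case using Suc by (simp only: dv_mult) simp
    qed (simp add: mon_Nil)
    then have "F.dx G.ft = F.dx g" by (simp add: G.ft_def)
    then have "F.dx G.ft + G.ft * F.ft = (F.dx g + g * F.ft) + qscale G.cc (mon (replicate m Ly) * F.ft)"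
      by (simp add: G.ft_def distrib_right)
    also have "F.dx g + g * F.ft = sf f g + qscale F.cc (mon (replicate n Ly) * g)" by (rule dx_sf)
    also have "mon (replicate m Ly) * F.ft = mon (replicate m Ly) * f + qscale F.cc (mon (replicate (n + m) Ly))"
      by (simp add: F.ft_def distrib_left replicate_add[symmetric] add.commute flip: mon_append)
    finally have X: "F.dx G.ft + G.ft * F.ft = sf f g + qscale F.cc (mon (replicate n Ly) * g)
        + qscale G.cc (mon (replicate m Ly) * f + qscale F.cc (mon (replicate (n + m) Ly)))" .
    show ?thesis unfolding X by (simp add: VV_def qvec.scale_right_distrib mult.commute add_ac)
  qed
  then have "lk VV (v @ [Ly]) = lk (iota UU) (v @ [Ly])" unfolding e by (simp add: lookup_add lk_mult_mon_snoc)
  then show ?thesis using lk_iota[OF posp_UU assms(1)] v by simp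
qed

theorem st_VV:
  assumes "rs \<noteq> []" "ss \<noteq> []" "pos rs" "pos ss"
  shows "st (\<lambda>ts. lk VV (index_word ts)) rs ss
    = lk G.ft (index_word rs) * lk F.ft (index_word ss) + lk F.ft (index_word rs) * lk G.ft (index_word ss)"
proof -
  have "sum_list rs > 0" using assms by (cases rs) auto
  have "st (\<lambda>ts. lk VV (index_word ts)) rs ss = st (lk UU) rs ss"
  proof (rule st_cong[OF assms(3,4)])
    fix w assume w: "pos w" "sum_list w = sum_list rs + sum_list ss"
    have "sum_list w > 0" using w(2) \<open>sum_list rs > 0\<close> by linarith
    then have "w \<noteq> []" by (cases w) auto
    then show "lk VV (index_word w) = lk UU w" using lk_UU[OF w(1)] by simp
  qed
  then show ?thesis using st_UU[OF assms] assms by (simp add: F.lk_pf G.lk_pf)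
qed

end

text \<open>The corrections in \<open>VV\<close> and the right side of \<open>st_VV\<close> are
  symmetric in f and g, so both cancel when the roles of f and g are exchanged and the difference is
  taken.\<close>

theorem poisson_ds:
  assumes "odd_ds f n" "odd_ds g m"
  shows "poisson f g \<in> ds_deg (n + m)"
proof -
  interpret A: two_ds f n g m using assms by (simp add: two_ds_def)
  interpret B: two_ds g m f n using assms by (simp add: two_ds_def)
  have h: "poisson f g \<in> homog (n + m)"
    using homog_mult[OF ds_degD(1)[OF A.F.f_ds] ds_degD(1)[OF A.G.f_ds]] homog_Deriv[OF ds_degD(1)[OF A.F.f_ds] ds_degD(1)[OF A.G.f_ds]]
      homog_mult[OF ds_degD(1)[OF A.G.f_ds] ds_degD(1)[OF A.F.f_ds]] homog_Deriv[OF ds_degD(1)[OF A.G.f_ds] ds_degD(1)[OF A.F.f_ds]]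
    by (auto simp: poisson_sf sf_def add.commute intro!: homog_diff homog_add)
  have l: "poisson f g \<in> Lie_xy"
    unfolding poisson_def by (intro Lie_diff Lie_xy.add Lie_xy.bracket Lie_Deriv A.F.f_Lie A.G.f_Lie)
  have "3 \<le> n + m" using A.F.n3 by simp
  with h l have "poisson f g \<in> Lie_ge3" unfolding Lie_ge3_def by (intro qvec.span_base) auto
  moreover have "poisson f g = A.VV - B.VV"
    by (simp add: poisson_sf A.VV_def B.VV_def add.commute mult.commute)
  then have e: "lk (poisson f g) = (\<lambda>w. lk A.VV w + (-1) * lk B.VV w)" by (simp add: lookup_minus fun_eq_iff)
  have "pairing (poisson f g) (stuffle rs ss) = 0" if "is_index rs" "is_index ss" for rs ss
  proof -
    have i: "rs \<noteq> []" "ss \<noteq> []" "pos rs" "pos ss" using that by (auto simp: is_index_def)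
    show ?thesis unfolding pairing_ev ev_stuffle e st_add st_cmult A.st_VV[OF i] B.st_VV[OF i] by simp
  qed
  ultimately show ?thesis using h by (simp add: ds_deg_def ds_def)
qed

section \<open>The associated functional on formal zeta values\<close>

definition LP :: "qxy \<Rightarrow> sha \<Rightarrow> rat" where "LP p a = ev (lk p) (unsh a)"
definition aug :: "sha \<Rightarrow> rat" where "aug a = lk (unsh a) []"

lemma LP_lin [simp]: "LP p (a + b) = LP p a + LP p b" "LP p (a - b) = LP p a - LP p b" "LP p (sc c a) = c * LP p a" "LP p 0 = 0"
  "LP p 1 = lk p []"
  by (simp_all add: LP_def unsh_hom zero_list_def)
lemma aug_lin [simp]: "aug (a + b) = aug a + aug b" "aug (a - b) = aug a - aug b" "aug (sc c a) = c * aug a" "aug 0 = 0" "aug 1 = 1"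
  by (simp_all add: aug_def unsh_hom lookup_add lookup_minus lk_one)
lemma LP_sum: "LP p (\<Sum>i\<in>A. h i) = (\<Sum>i\<in>A. LP p (h i))" by (induction A rule: infinite_finite_induct) auto
lemma aug_sum: "aug (\<Sum>i\<in>A. h i) = (\<Sum>i\<in>A. aug (h i))" by (induction A rule: infinite_finite_induct) auto
lemma LP_mon [simp]: "LP p (Sh (mon w)) = lk p w" by (simp add: LP_def)
lemma aug_mon [simp]: "aug (Sh (mon w)) = (if w = [] then 1 else 0)" by (simp add: aug_def lookup_single when_def)

lemma ev_shuffle: "ev (lk p) (shuffle q r) = ev (\<lambda>u. ev (\<lambda>v. lk (Dsh p) (u, v)) r) q"
  by (simp add: shuffle_def ev_lin_ext ev_shuffle_word)

lemma LP_mult_gen: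
  assumes "Dsh p = (\<Sum>i\<in>A. inl (a i) * inr (b i))"
  shows "LP p (x * y) = (\<Sum>i\<in>A. LP (a i) x * LP (b i) y)"
  by (simp add: LP_def unsh_hom ev_shuffle assms lk_sum lk_inl_inr ev_fun_sum ev_fun_cmult ev_fun_multc)

lemma LP_one: "LP 1 a = aug a"
proof -
  have "lk (1 :: qxy) = dl []" by (simp add: fun_eq_iff lk_one)
  then show ?thesis by (simp add: LP_def aug_def ev_delta[where c = "\<lambda>_. 1", simplified])
qed

lemma aug_mult: "aug (x * y) = aug x * aug y"
  using LP_mult_gen[where p = 1 and A = "{0::nat}" and a = "\<lambda>_. 1" and b = "\<lambda>_. 1" and x = x and y = y] by (simp add: LP_one Dsh_def)

lemma LP_prim: "Dsh p = inl p + inr p \<Longrightarrow> LP p (x * y) = LP p x * aug y + aug x * LP p y"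
  using LP_mult_gen[where p = p and A = "{0, 1::nat}" and a = "\<lambda>i. if i = 0 then p else 1" and b = "\<lambda>i. if i = 0 then 1 else p" and x = x and y = y] by (simp add: LP_one)

text \<open>The case w = f g + Lie element, with f and g primitive; applied to
  \<open>sf f g\<close>.\<close>

lemma LP_two:
  assumes "Dsh f = inl f + inr f" "Dsh g = inl g + inr g" "Dsh (w - f * g) = inl (w - f * g) + inr (w - f * g)"
  shows "LP w (x * y) = LP w x * aug y + aug x * LP w y + LP f x * LP g y + LP g x * LP f y"
proof -
  have "Dsh w = Dsh (w - f * g) + Dsh f * Dsh g" by (simp add: Dsh_diff Dsh_mult)
  also have "\<dots> = inl w * inr 1 + inl 1 * inr w + inl f * inr g + inl g * inr f"
    unfolding assms by (simp add: inl_mult inr_mult algebra_simps inr_inl)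
  finally have "Dsh w = (\<Sum>i\<in>{0, 1, 2, 3::nat}. inl (if i = 0 then w else if i = 1 then 1 else if i = 2 then f else g)
     * inr (if i = 0 then 1 else if i = 1 then w else if i = 2 then g else f))" by simp
  from LP_mult_gen[OF this, of x y] show ?thesis by (simp add: LP_one)
qed

text \<open>Regularization changes an element only by shuffle multiples of letters, so functionals
  killing these multiples do not see it.\<close>

lemma LP_rS:
  assumes "\<And>l q. LP p (Sh (mon [l]) * q) = 0" shows "LP p (rS a) = LP p a"
proof -
  obtain q where q: "a = ty.reg a + Sh gy * q" using ty.reg_ideal by blast
  obtain r where r: "ty.reg a = tx.reg (ty.reg a) + Sh gx * r" using tx.reg_ideal by blast
  have "LP p a = LP p (ty.reg a)" by (subst q) (simp add: assms)
  also have "\<dots> = LP p (rS a)" by (subst r) (simp add: assms rS_def)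
  finally show ?thesis by simp
qed

lemma aug_rS: "aug (rS a) = aug a"
  using LP_rS[of 1] by (simp add: LP_one aug_mult)

lemma aug_Zs: "aug (Zs w) = (if w = [] then 1 else 0)" by (simp add: Zs_def aug_rS)

definition Ah :: "nat \<Rightarrow> sha" where "Ah r = (if r = 0 then 0 else sc ((-1) ^ (r - 1) / of_nat r) (Zs (index_word [r])))"
fun pw :: "nat \<Rightarrow> nat \<Rightarrow> sha" where
  "pw 0 r = (if r = 0 then 1 else 0)"
| "pw (Suc j) r = (\<Sum>i\<le>r. Ah i * pw j (r - i))"

lemma gz_pw: "gz r = (\<Sum>j\<le>r. sc (1 / fact j) (pw j r))"
proof -
  define A where "A r = (if r = 0 then 0 else qscale ((-1) ^ (r - 1) / of_nat r) (Z [r]))" for r :: nat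
  have A: "Sh (A r) = Ah r" for r by (simp add: A_def Ah_def Sh_hom Z_word_Zs)
  have "Sh ((ser_mult A ^^ j) ser_one r) = pw j r" for j r
  proof (induction j arbitrary: r)
    case 0
    then show ?case by (simp add: ser_one_def Sh_hom)
  next
    case (Suc j)
    then show ?case by (simp add: ser_mult_def[of A "(ser_mult A ^^ j) ser_one"] Sh_sum Sh_hom A)
  qed
  then show ?thesis
    by (simp add: gz_def Zstar_ones_def ser_exp_def Sh_sum Sh_hom flip: A_def[abs_def])
qed

lemma index_1_ne: "index_word [r] \<noteq> []" by (simp add: index_word_def y_word_def)
lemma aug_Ah [simp]: "aug (Ah i) = 0" by (simp add: Ah_def aug_Zs index_1_ne)
lemma aug_pw: "aug (pw j r) = (if j = 0 \<and> r = 0 then 1 else 0)" by (cases j) (simp_all add: aug_sum aug_mult)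
lemma aug_gz: "aug (gz r) = (if r = 0 then 1 else 0)"
  by (cases r) (simp_all add: gz_pw aug_sum aug_pw del: sum.atMost_Suc)

lemma pw_1: "pw (Suc 0) r = Ah r"
proof -
  have "(\<Sum>i\<le>r. Ah i * pw 0 (r - i)) = (\<Sum>i\<le>r. if i = r then Ah r else 0)" by (intro sum.cong) auto
  then show ?thesis by simp
qed

lemma takeWhile_Ly: "length (takeWhile (\<lambda>l. l = Ly) w) \<ge> j \<longleftrightarrow> take j w = replicate j Ly"
proof (induction j arbitrary: w)
  case (Suc j) then show ?case by (cases w) auto
qed simp

context odd_ds
begin

lemma LP_f_mult: "LP f (x * y) = LP f x * aug y + aug x * LP f y"
  by (rule LP_prim[OF Lie_prim[OF f_Lie]])
lemma LP_f_Zs: "LP f (Zs w) = lk f w"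
  unfolding Zs_def by (subst LP_rS) (use f_len n3 in \<open>simp_all add: LP_f_mult\<close>)
lemma LP_f_Ah: "LP f (Ah i) = (if i = n then cc else 0)"
proof (cases "i = 0")
  case False
  have "length (index_word [i]) = i" using False by (simp add: index_word_def y_word_def)
  then have "fI [i] = 0" if "i \<noteq> n" using f_len[of "index_word [i]"] that by simp
  then show ?thesis using False n_odd by (auto simp: Ah_def LP_f_Zs cc_def)
qed (use n3 in \<open>simp add: Ah_def\<close>)
lemma LP_f_pw: "LP f (pw j i) = (if j = Suc 0 then LP f (Ah i) else 0)"
proof (cases j)
  case 0
  then show ?thesis using f_len[of "[]"] n3 by simp
next
  case (Suc j')
  have "LP f (pw (Suc j') i) = 0" if j: "j' \<noteq> 0"
  proof -
    obtain j'' where "j' = Suc j''" using j not0_implies_Suc by blast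
    then show ?thesis unfolding pw.simps(2)[of j'] LP_sum
      by (intro sum.neutral ballI) (simp add: LP_f_mult aug_pw del: pw.simps(2))
  qed
  then show ?thesis using Suc pw_1 by (cases "j' = 0") auto
qed
lemma LP_f_gz: "LP f (gz r) = (if r = n then cc else 0)"
proof -
  have "LP f (gz r) = (\<Sum>j\<le>r. if j = Suc 0 then LP f (Ah r) else 0)"
    unfolding gz_pw LP_sum by (intro sum.cong) (auto simp: LP_f_pw)
  then show ?thesis using n3 by (cases r) (auto simp: LP_f_Ah)
qed
text \<open>A primitive f sees only the linear term of the exponential in \<open>gz\<close>; this
  term contributes precisely the correction that turns f into \<open>ft\<close>.\<close>

lemma LP_f_zz: assumes "w \<noteq> []" shows "LP f (zz w) = lk ft w"
proof -
  let ?t = "length (takeWhile (\<lambda>l. l = Ly) w)"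
  have "LP f (zz w) = (\<Sum>r\<le>?t. (if drop r w = [] then LP f (gz r) else 0) + (if r = 0 then lk f w else 0))"
    unfolding zg_sum LP_sum by (intro sum.cong refl) (auto simp: LP_f_mult aug_Zs aug_gz LP_f_Zs)
  also have "\<dots> = (\<Sum>r\<le>?t. if r = length w then (if r = n then cc else 0) else 0) + lk f w"
  proof -
    have "(if drop r w = [] then LP f (gz r) else 0) = (if r = length w then (if r = n then cc else 0) else 0)" if "r \<le> ?t" for r
      using that length_takeWhile_le[of "\<lambda>l. l = Ly" w] by (auto simp: LP_f_gz)
    then have "(\<Sum>r\<le>?t. if drop r w = [] then LP f (gz r) else 0) = (\<Sum>r\<le>?t. if r = length w then (if r = n then cc else 0) else 0)"
      by (intro sum.cong) auto
    then show ?thesis by (simp add: sum.distrib)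
  qed
  also have "\<dots> = (if length w \<le> ?t \<and> length w = n then cc else 0) + lk f w" by (simp add: sum.delta)
  also have "\<dots> = lk ft w"
    using takeWhile_Ly[of "length w" w] by (auto simp: ft_def lookup_add lookup_single when_def)
  finally show ?thesis .
qed

end

text \<open>\<open>dpt d p\<close>: every monomial of \<open>p\<close> has at least \<open>d\<close> letters y.\<close>

definition dpt :: "nat \<Rightarrow> qxy \<Rightarrow> bool" where "dpt d p \<longleftrightarrow> (\<forall>w. lk p w \<noteq> 0 \<longrightarrow> d \<le> count_list w Ly)"

lemma dpt_mult: assumes "dpt a p" "dpt b q" shows "dpt (a + b) (p * q)"
  unfolding dpt_def
proof (intro allI impI)
  fix w assume "lk (p * q) w \<noteq> 0"
  then have "w \<in> Poly_Mapping.keys (p * q)" by (simp add: in_keys_iff)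
  then obtain u v where "w = u + v" "u \<in> Poly_Mapping.keys p" "v \<in> Poly_Mapping.keys q"
    using Poly_Mapping.keys_mult[of p q] by blast
  then show "a + b \<le> count_list w Ly"
    using assms by (auto simp: dpt_def in_keys_iff plus_list_def count_list_append intro: add_mono)
qed
lemma dpt_add: "dpt a p \<Longrightarrow> dpt a q \<Longrightarrow> dpt a (p + q)"
  unfolding dpt_def lookup_add by (metis add_cancel_right_left)
lemma dpt_qscale: "dpt a p \<Longrightarrow> dpt a (qscale c p)" by (auto simp: dpt_def)
lemma dpt_diff: "dpt a p \<Longrightarrow> dpt a q \<Longrightarrow> dpt a (p - q)"
  using dpt_add[of a p "qscale (-1) q"] dpt_qscale[of a q "-1"] by (simp add: qscale_minus1)
lemma dpt_0 [simp]: "dpt a 0" by (simp add: dpt_def)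
lemma dpt_sum: "(\<And>i. i \<in> A \<Longrightarrow> dpt a (h i)) \<Longrightarrow> dpt a (\<Sum>i\<in>A. h i)"
  by (induction A rule: infinite_finite_induct) (auto intro: dpt_add)
lemma dpt_mon: "a \<le> count_list w Ly \<Longrightarrow> dpt a (mon w)"
  by (auto simp: dpt_def lookup_single when_def)

lemma dpt_Deriv: assumes f: "dpt 1 f" and g: "dpt b g" shows "dpt (Suc b) (Deriv f g)"
proof -
  have c: "dpt 2 (commutator gy f)"
    using dpt_mult[OF dpt_mon[of 1 "[Ly]"] f] dpt_mult[OF f dpt_mon[of 1 "[Ly]"]] by (simp add: commutator_def dpt_diff numeral_2_eq_2)
  have w: "dpt (Suc (count_list w Ly)) (Deriv f (mon w))" for w
  proof (induction w)
    case (Cons l w)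
    show ?case
    proof (cases l)
      case Lx
      then show ?thesis using dpt_mult[OF dpt_mon[of 0 "[Lx]"] Cons] by (simp add: mon_Cons[of Lx w] Deriv_mult)
    next
      case Ly
      have "dpt (2 + count_list w Ly) (commutator gy f * mon w)" by (rule dpt_mult[OF c dpt_mon]) simp
      moreover have "dpt (1 + Suc (count_list w Ly)) (gy * Deriv f (mon w))" by (rule dpt_mult[OF dpt_mon Cons]) simp
      ultimately show ?thesis by (simp add: Ly mon_Cons[of Ly w] Deriv_mult dpt_add)
    qed
  qed (simp add: mon_Nil)
  have "Deriv f g = (\<Sum>w\<in>Poly_Mapping.keys g. qscale (lk g w) (Deriv f (mon w)))"
    using linear_eq_lin_ext[of "Deriv f" g] by (simp add: lin_ext_def)
  moreover have "dpt (Suc b) (qscale (lk g w) (Deriv f (mon w)))" if "w \<in> Poly_Mapping.keys g" for w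
  proof -
    have "b \<le> count_list w Ly" using that g by (auto simp: dpt_def in_keys_iff)
    then show ?thesis using w[of w] by (auto simp: dpt_def)
  qed
  ultimately show ?thesis by (simp add: dpt_sum)
qed

lemma (in odd_ds) dpt_f: "dpt 1 f"
  unfolding dpt_def
proof (intro allI impI)
  fix w assume w: "lk f w \<noteq> 0"
  have "\<exists>v. w = xs v" if "count_list w Ly = 0"
  proof -
    have "\<forall>l\<in>set w. l = Lx" using that count_list_0_iff[of w Ly] by (metis letter.exhaust)
    then show ?thesis by (metis replicate_eqI)
  qed
  moreover have "lk f (xs v) = 0" for v
  proof (cases v)
    case 0 then show ?thesis using f_len[of "[]"] n3 by simp
  next
    case (Suc j)
    then show ?thesis using f_insx[of "xs j"] by (simp add: insx_xs del: of_nat_Suc)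
  qed
  ultimately show "1 \<le> count_list w Ly" using w by (metis One_nat_def Suc_leI not_gr_zero)
qed

lemma sf_dpt: "odd_ds f n \<Longrightarrow> odd_ds g m \<Longrightarrow> dpt 2 (sf f g)"
  using dpt_mult[OF odd_ds.dpt_f odd_ds.dpt_f] dpt_Deriv[OF odd_ds.dpt_f odd_ds.dpt_f]
  by (auto simp: sf_def numeral_2_eq_2 intro: dpt_add)

context two_ds
begin

abbreviation "W \<equiv> sf f g"

lemma W_homog: "W \<in> homog (n + m)"
  unfolding sf_def using homog_mult[OF ds_degD(1)[OF F.f_ds] ds_degD(1)[OF G.f_ds]] homog_Deriv[OF ds_degD(1)[OF F.f_ds] ds_degD(1)[OF G.f_ds]]
  by (rule homog_add)
lemma W_len: "length w \<noteq> n + m \<Longrightarrow> lk W w = 0" using homogD[OF W_homog] by blast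
lemma W_depth: "count_list w Ly < 2 \<Longrightarrow> lk W w = 0"
  using sf_dpt[OF F.odd_ds_axioms G.odd_ds_axioms] by (fastforce simp: dpt_def)

lemma LP_W_mult: "LP W (x * y) = LP W x * aug y + aug x * LP W y + LP f x * LP g y + LP g x * LP f y"
  by (rule LP_two) (use Lie_prim[OF F.f_Lie] Lie_prim[OF G.f_Lie] Lie_prim[OF Lie_Deriv[OF F.f_Lie G.f_Lie]] in \<open>simp_all add: sf_def\<close>)
lemma LP_W_Zs: "LP W (Zs w) = lk W w"
  unfolding Zs_def
  by (subst LP_rS) (use F.f_len G.f_len W_len F.n3 G.n3 in \<open>simp_all add: LP_W_mult\<close>)
lemma LP_W_Ah: "LP W (Ah i) = 0"
  by (simp add: Ah_def LP_W_Zs W_depth index_word_def y_word_def count_list_append)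

text \<open>Only the quadratic term of the exponential counts: f is evaluated on one factor and g on
  the other, in two orders, which cancels the factor 1/2!.\<close>

lemma LP_W_gz: "LP W (gz r) = (if r = n + m then F.cc * G.cc else 0)"
proof -
  have 2: "LP W (pw (Suc (Suc 0)) r) = (if r = n + m then 2 * (F.cc * G.cc) else 0)"
  proof -
    have "LP W (pw (Suc (Suc 0)) r) = (\<Sum>i\<le>r. (if i = n then if r - n = m then F.cc * G.cc else 0 else 0) + (if i = m then if r - m = n then F.cc * G.cc else 0 else 0))"
      unfolding pw.simps(2)[of "Suc 0"] pw_1 LP_sum
      by (intro sum.cong refl) (auto simp: LP_W_mult F.LP_f_Ah G.LP_f_Ah)
    also have "\<dots> = (if n \<le> r \<and> r - n = m then F.cc * G.cc else 0) + (if m \<le> r \<and> r - m = n then F.cc * G.cc else 0)"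
      by (simp add: sum.distrib)
    also have "\<dots> = (if r = n + m then 2 * (F.cc * G.cc) else 0)" by auto
    finally show ?thesis .
  qed
  have 3: "LP W (pw (Suc (Suc (Suc j))) r) = 0" for j
    unfolding pw.simps(2)[of "Suc (Suc j)"] LP_sum
    by (intro sum.neutral ballI) (simp only: LP_W_mult F.LP_f_pw G.LP_f_pw aug_pw aug_Ah, simp)
  have "LP W (pw j r) = (if j = Suc (Suc 0) then (if r = n + m then 2 * (F.cc * G.cc) else 0) else 0)" for j
  proof -
    consider "j = 0" | "j = Suc 0" | "j = Suc (Suc 0)" | i where "j = Suc (Suc (Suc i))" by (metis not0_implies_Suc)
    then show ?thesis using W_len[of "[]"] F.n3 by cases (auto simp: 2 3 pw_1 LP_W_Ah simp del: pw.simps(2))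
  qed
  then have "LP W (gz r) = (\<Sum>j\<le>r. if j = Suc (Suc 0) then (if r = n + m then F.cc * G.cc else 0) else 0)"
    unfolding gz_pw LP_sum by (intro sum.cong) (auto simp: fact_numeral)
  then show ?thesis using F.n3 by simp
qed

lemma LP_W_zz: assumes "w \<noteq> []" shows "LP W (zz w) = lk VV w"
proof -
  let ?t = "length (takeWhile (\<lambda>l. l = Ly) w)"
  have tl: "?t \<le> length w" by (rule length_takeWhile_le)
  have "LP W (zz w) = (\<Sum>r\<le>?t. (if r = length w then (if r = n + m then F.cc * G.cc else 0) else 0) + (if r = 0 then lk W w else 0)
     + (if r = n then F.cc * lk g (drop n w) else 0) + (if r = m then G.cc * lk f (drop m w) else 0))"
    unfolding zg_sum LP_sum
  proof (intro sum.cong refl)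
    fix r assume "r \<in> {..?t}"
    then have d: "drop r w = [] \<longleftrightarrow> r = length w" and rl: "r \<le> length w" using tl by auto
    show "LP W (gz (0 + r) * Zs (drop r w)) = (if r = length w then (if r = n + m then F.cc * G.cc else 0) else 0) + (if r = 0 then lk W w else 0)
     + (if r = n then F.cc * lk g (drop n w) else 0) + (if r = m then G.cc * lk f (drop m w) else 0)"
      using assms rl F.n3 G.n3 by (auto simp: LP_W_mult LP_W_gz aug_Zs d aug_gz LP_W_Zs F.LP_f_gz G.LP_f_gz F.LP_f_Zs G.LP_f_Zs)
  qed
  also have "\<dots> = (if length w \<le> ?t \<and> length w = n + m then F.cc * G.cc else 0) + lk W w
     + (if n \<le> ?t then F.cc * lk g (drop n w) else 0) + (if m \<le> ?t then G.cc * lk f (drop m w) else 0)"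
    by (simp add: sum.distrib)
  also have "\<dots> = lk VV w"
    unfolding takeWhile_Ly VV_def lookup_add lookup_qscale lk_mon_mult_gen length_replicate
    by (auto simp: lookup_single when_def)
  finally show ?thesis .
qed

lemma aug_zz: "w \<noteq> [] \<Longrightarrow> aug (zz w) = 0"
  unfolding zg_sum aug_sum by (intro sum.neutral) (auto simp: aug_mult aug_gz aug_Zs)

text \<open>On a product of elements with augmentation zero, \<open>W\<close> reduces to products of
  values of f and g. By \<open>LP_f_zz\<close> these are the values in \<open>st_VV\<close>, and by
  \<open>LP_W_zz\<close> the latter evaluates \<open>W\<close> on the stuffle product.\<close>

theorem fz_W: "fz_functional (ev (lk W))"
proof
  fix rs ss assume i: "is_index rs" "is_index ss"
  then have ne: "rs \<noteq> []" "ss \<noteq> []" "pos rs" "pos ss" by (auto simp: is_index_def)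
  have iw: "index_word rs \<noteq> []" "index_word ss \<noteq> []" using index_snoc[of rs] index_snoc[of ss] ne by auto
  have "LP W (zz (index_word rs) * zz (index_word ss)) = LP f (zz (index_word rs)) * LP g (zz (index_word ss)) + LP g (zz (index_word rs)) * LP f (zz (index_word ss))"
    by (simp add: LP_W_mult aug_zz iw)
  also have "\<dots> = st (\<lambda>ts. lk VV (index_word ts)) rs ss"
    unfolding st_VV[OF ne] F.LP_f_zz[OF iw(1)] F.LP_f_zz[OF iw(2)] G.LP_f_zz[OF iw(1)] G.LP_f_zz[OF iw(2)] by simp
  also have "\<dots> = st (\<lambda>ts. LP W (zz (index_word ts))) rs ss"
  proof (rule st_cong[OF ne(3,4)])
    fix w assume w: "pos w" "sum_list w = sum_list rs + sum_list ss"
    then have "w \<noteq> []" using ne by (cases rs) auto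
    then have "index_word w \<noteq> []" using index_snoc[of w] by auto
    then show "lk VV (index_word w) = LP W (zz (index_word w))" by (simp add: LP_W_zz)
  qed
  also have "\<dots> = LP W (ZG 0 (stuffle rs ss))"
    using functional_eq_ev[of "\<lambda>p. LP W (ZG 0 p)" "stuffle rs ss"] by (simp add: ev_stuffle)
  finally show "ev (lk W) (shuffle (Zstar (mono_word (index_word rs))) (Zstar (mono_word (index_word ss))) - Zstar (stuffle rs ss)) = 0"
    by (simp add: LP_def unsh_hom Zstar_ZG)
qed simp_all

lemma W_Z: "ev (lk W) (Z ts) = lk W (index_word ts)"
  using LP_W_Zs[of "index_word ts"] by (simp add: LP_def Z_word_Zs)

end

section \<open>Polynomials encoding the parts of depth one and two\<close>

section \<open>Generating functions of the parts of depth at most two\<close>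

text \<open>\<open>t2 A B C\<close> sends x^i y x^j y x^l to A^i B^j C^l and every word with another
  number of y to zero; \<open>t0\<close> and \<open>t1\<close> do the same for no y and one
  y.\<close>

fun t0 :: "rat \<Rightarrow> letter list \<Rightarrow> rat" where
  "t0 A [] = 1" | "t0 A (Lx # w) = A * t0 A w" | "t0 A (Ly # w) = 0"
fun t1 :: "rat \<Rightarrow> rat \<Rightarrow> letter list \<Rightarrow> rat" where
  "t1 A B [] = 0" | "t1 A B (Lx # w) = A * t1 A B w" | "t1 A B (Ly # w) = t0 B w"
fun t2 :: "rat \<Rightarrow> rat \<Rightarrow> rat \<Rightarrow> letter list \<Rightarrow> rat" where
  "t2 A B C [] = 0" | "t2 A B C (Lx # w) = A * t2 A B C w" | "t2 A B C (Ly # w) = t1 B C w"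

lemma t0_append: "t0 A (u @ v) = t0 A u * t0 A v" by (induction A u rule: t0.induct) auto
lemma t1_append: "t1 A B (u @ v) = t0 A u * t1 A B v + t1 A B u * t0 B v"
  by (induction A B u rule: t1.induct) (auto simp: t0_append algebra_simps)
lemma t2_append: "t2 A B C (u @ v) = t0 A u * t2 A B C v + t1 A B u * t1 B C v + t2 A B C u * t0 C v"
  by (induction A B C u rule: t2.induct) (auto simp: t1_append t0_append algebra_simps)

lemma t0_count: "t0 A w \<noteq> 0 \<Longrightarrow> count_list w Ly = 0" by (induction A w rule: t0.induct) auto
lemma t1_count: "t1 A B w \<noteq> 0 \<Longrightarrow> count_list w Ly = 1" by (induction A B w rule: t1.induct) (auto dest: t0_count)
lemma t2_count: "t2 A B C w \<noteq> 0 \<Longrightarrow> count_list w Ly = 2" by (induction A B C w rule: t2.induct) (auto dest: t1_count)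

abbreviation "T0 A \<equiv> ev (t0 A)"
abbreviation "T1 A B \<equiv> ev (t1 A B)"
abbreviation "T2 A B C \<equiv> ev (t2 A B C)"

lemma ev_dpt:
  assumes "dpt d p" "\<And>w. \<phi> w \<noteq> 0 \<Longrightarrow> count_list w Ly < d" shows "ev \<phi> p = 0"
proof -
  have "ev \<phi> p = ev (\<lambda>w. 0) p"
    by (rule ev_cong) (use assms in \<open>fastforce simp: dpt_def in_keys_iff\<close>)
  then show ?thesis by simp
qed
lemma T0_dpt: "dpt 1 p \<Longrightarrow> T0 A p = 0" by (rule ev_dpt) (auto dest: t0_count)
lemma T1_dpt: "dpt 2 p \<Longrightarrow> T1 A B p = 0" by (rule ev_dpt) (auto dest: t1_count)
lemma T0_dpt2: "dpt 2 p \<Longrightarrow> T0 A p = 0" by (rule ev_dpt) (auto dest: t0_count)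
lemma T2_dpt: "dpt 3 p \<Longrightarrow> T2 A B C p = 0" by (rule ev_dpt) (auto dest: t2_count)

lemma T2_mult: "T2 A B C (p * q) = T0 A p * T2 A B C q + T1 A B p * T1 B C q + T2 A B C p * T0 C q"
  by (simp add: ev_mult plus_list_def t2_append ev_fun_add ev_fun_cmult ev_fun_multc)

text \<open>In depth two exactly one y of the depth-one part of g is replaced by the depth-two part
  of [y, f]. The letters x of g then stand outside both y and carry A and C.\<close>

lemma T2_Deriv:
  assumes f: "dpt 1 f" shows "T2 A B C (Deriv f g) = T1 A C g * (T1 B C f - T1 A B f)"
proof -
  have y: "dpt 1 gy" by (rule dpt_mon) simp
  have c2: "dpt 2 (commutator gy f)"
    using dpt_mult[OF y f] dpt_mult[OF f y] by (simp add: commutator_def dpt_diff numeral_2_eq_2)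
  have c: "T2 A B C (commutator gy f) = T1 B C f - T1 A B f"
    unfolding commutator_def ev_diff T2_mult by (simp add: T0_dpt[OF f])
  have w: "T2 A B C (Deriv f (mon w)) = t1 A C w * (T1 B C f - T1 A B f)" for w
  proof (induction w)
    case (Cons l w)
    have d: "dpt 2 (Deriv f (mon w))"
    proof (cases "count_list w Ly = 0")
      case False
      then have "dpt 1 (mon w)" by (intro dpt_mon) simp
      then show ?thesis using dpt_Deriv[OF f] by (simp add: numeral_2_eq_2)
    next
      case True
      then have "Deriv f (mon w) = 0"
      proof (induction w)
        case (Cons a u)
        then show ?case by (cases a) (simp_all add: mon_Cons[of Lx u] Deriv_mult)
      qed (simp add: mon_Nil)
      then show ?thesis by simp
    qed
    show ?case
    proof (cases l)
      case Lx
      have "T2 A B C (Deriv f (mon (l # w))) = T2 A B C (gx * Deriv f (mon w))"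
        by (simp only: Lx mon_Cons[of Lx w] Deriv_mult, simp)
      also have "\<dots> = A * T2 A B C (Deriv f (mon w))" unfolding T2_mult by simp
      finally show ?thesis by (simp add: Cons Lx)
    next
      case Ly
      have "T2 A B C (Deriv f (mon (l # w))) = T2 A B C (commutator gy f * mon w) + T2 A B C (gy * Deriv f (mon w))"
        by (simp only: Ly mon_Cons[of Ly w] Deriv_mult, simp)
      also have "\<dots> = T2 A B C (commutator gy f) * t0 C w"
        unfolding T2_mult T1_dpt[OF c2] T1_dpt[OF d] T0_dpt2[OF c2] by simp
      finally show ?thesis by (simp add: Ly c)
    qed
  qed (simp add: mon_Nil)
  have "T2 A B C (Deriv f g) = ev (\<lambda>w. T2 A B C (Deriv f (mon w))) g"
    by (rule functional_eq_ev) simp_all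
  then show ?thesis by (simp add: w ev_fun_multc)
qed

lemma T2_sf: "dpt 1 f \<Longrightarrow> dpt 1 g \<Longrightarrow> T2 A B C (sf f g) = T1 A B f * T1 B C g + T1 A C g * (T1 B C f - T1 A B f)"
  by (simp add: sf_def T2_mult T2_Deriv T0_dpt)

lemma t0_eq: "t0 A w = (if w = xs (length w) then A ^ length w else 0)"
  by (induction A w rule: t0.induct) auto

lemma t1_eq: "length w = n \<Longrightarrow> t1 A B w = (\<Sum>j<n. if w = xs j @ Ly # xs (n - 1 - j) then A ^ j * B ^ (n - 1 - j) else 0)"
proof (induction w arbitrary: n)
  case (Cons a w)
  then obtain n' where n: "n = Suc n'" "length w = n'" by auto
  show ?case
  proof (cases a)
    case Lx
    show ?thesis unfolding n sum.lessThan_Suc_shift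
      by (simp add: Lx Cons.IH[OF n(2)] sum_distrib_left if_distrib mult.assoc cong: if_cong)
  next
    case Ly
    show ?thesis unfolding n sum.lessThan_Suc_shift by (simp add: Ly t0_eq n(2))
  qed
qed simp

lemma t2_eq: "length w = Suc (Suc n) \<Longrightarrow> t2 A B C w =
   (\<Sum>r\<le>n. \<Sum>s\<le>n - r. if w = xs r @ Ly # xs s @ Ly # xs (n - r - s) then A ^ r * B ^ s * C ^ (n - r - s) else 0)"
proof (induction w arbitrary: n)
  case (Cons a w)
  then have l: "length w = Suc n" by simp
  show ?case
  proof (cases a)
    case Ly
    have "t2 A B C (a # w) = (\<Sum>s\<le>n. if w = xs s @ Ly # xs (n - s) then B ^ s * C ^ (n - s) else 0)"
      using t1_eq[OF l, of B C] by (simp add: Ly lessThan_Suc_atMost cong: if_cong)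
    moreover have "(\<Sum>r\<le>n. \<Sum>s\<le>n - r. if a # w = xs r @ Ly # xs s @ Ly # xs (n - r - s) then A ^ r * B ^ s * C ^ (n - r - s) else 0)
      = (\<Sum>r\<le>n. if r = 0 then (\<Sum>s\<le>n. if w = xs s @ Ly # xs (n - s) then B ^ s * C ^ (n - s) else 0) else 0)"
    proof (intro sum.cong refl)
      fix r show "(\<Sum>s\<le>n - r. if a # w = xs r @ Ly # xs s @ Ly # xs (n - r - s) then A ^ r * B ^ s * C ^ (n - r - s) else 0)
        = (if r = 0 then (\<Sum>s\<le>n. if w = xs s @ Ly # xs (n - s) then B ^ s * C ^ (n - s) else 0) else 0)"
        by (cases r) (simp_all add: Ly cong: if_cong)
    qed
    ultimately show ?thesis by simp
  next
    case Lx
    show ?thesis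
    proof (cases n)
      case 0
      then obtain b where "w = [b]" using l by (cases w) auto
      then show ?thesis by (cases b) (simp_all add: Lx 0)
    next
      case (Suc n')
      show ?thesis using Cons.IH[of n'] l unfolding Suc sum.atMost_Suc_shift[of _ n']
        by (simp add: Lx sum_distrib_left if_distrib mult.assoc cong: if_cong)
    qed
  qed
qed simp

lemma T1_expand: assumes "p \<in> homog n"
  shows "T1 A B p = (\<Sum>j<n. lk p (xs j @ Ly # xs (n - 1 - j)) * (A ^ j * B ^ (n - 1 - j)))"
proof -
  have "T1 A B p = ev (\<lambda>w. \<Sum>j<n. if w = xs j @ Ly # xs (n - 1 - j) then A ^ j * B ^ (n - 1 - j) else 0) p"
    by (rule ev_cong) (use assms in \<open>auto simp: homog_def t1_eq\<close>)
  then show ?thesis by (simp add: ev_fun_sum ev_delta)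
qed

lemma T2_expand: assumes "p \<in> homog (Suc (Suc n))"
  shows "T2 A B C p = (\<Sum>r\<le>n. \<Sum>s\<le>n - r. lk p (xs r @ Ly # xs s @ Ly # xs (n - r - s)) * (A ^ r * B ^ s * C ^ (n - r - s)))"
proof -
  have "T2 A B C p = ev (\<lambda>w. \<Sum>r\<le>n. \<Sum>s\<le>n - r. if w = xs r @ Ly # xs s @ Ly # xs (n - r - s) then A ^ r * B ^ s * C ^ (n - r - s) else 0) p"
    by (rule ev_cong) (use assms in \<open>auto simp: homog_def t2_eq\<close>)
  then show ?thesis by (simp add: ev_fun_sum ev_delta)
qed

lemma T2_zero_coeff:
  assumes h: "p \<in> homog (Suc (Suc n))" and z: "\<And>A B C. T2 A B C p = 0" and rs: "r + s \<le> n"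
  shows "lk p (xs r @ Ly # xs s @ Ly # xs (n - r - s)) = 0"
proof -
  let ?c = "\<lambda>r s. lk p (xs r @ Ly # xs s @ Ly # xs (n - r - s))"
  have "(\<Sum>r\<le>n. (\<Sum>s\<le>n - r. ?c r s * B ^ s) * A ^ r) = 0" for A B
    using z[of A B 1] unfolding T2_expand[OF h] by (simp add: sum_distrib_right sum_distrib_left mult_ac)
  then have "(\<Sum>s\<le>n - r. ?c r s * B ^ s) = 0" for B using poly_coeffs_zero[of "\<lambda>r. \<Sum>s\<le>n - r. ?c r s * B ^ s" n r] rs by simp
  then show ?thesis using poly_coeffs_zero[of "?c r" "n - r" s] rs by simp
qed

lemma count2_form: "count_list w Ly = 2 \<Longrightarrow> \<exists>r s t. w = xs r @ Ly # xs s @ Ly # xs t"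
proof -
  assume c: "count_list w Ly = 2"
  have c0: "\<exists>t. u = xs t" if "count_list u Ly = 0" for u
  proof -
    have "u = replicate (length u) Lx" by (rule replicate_eqI) (use that count_list_0_iff[of u Ly] letter.exhaust in \<open>metis\<close>)+
    then show ?thesis by blast
  qed
  have c1: "\<exists>s t. u = xs s @ Ly # xs t" if "count_list u Ly = 1" for u
    using that
  proof (induction u)
    case (Cons a u)
    show ?case
    proof (cases a)
      case Lx
      then obtain s t where "u = xs s @ Ly # xs t" using Cons by auto
      then have "a # u = xs (Suc s) @ Ly # xs t" using Lx by simp
      then show ?thesis by blast
    next
      case Ly
      then obtain t where "u = xs t" using Cons c0 by auto
      then have "a # u = xs 0 @ Ly # xs t" using Ly by simp
      then show ?thesis by blast
    qed
  qed simp
  from c show ?thesis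
  proof (induction w)
    case (Cons a w)
    show ?case
    proof (cases a)
      case Lx
      then obtain r s t where "w = xs r @ Ly # xs s @ Ly # xs t" using Cons by auto
      then have "a # w = xs (Suc r) @ Ly # xs s @ Ly # xs t" using Lx by simp
      then show ?thesis by blast
    next
      case Ly
      then obtain s t where "w = xs s @ Ly # xs t" using Cons.prems c1[of w] by auto
      then have "a # w = xs 0 @ Ly # xs s @ Ly # xs t" using Ly by simp
      then show ?thesis by blast
    qed
  qed simp
qed

lemma insx_y: "insx \<phi> (xs a @ Ly # xs b) = of_nat (Suc a) * \<phi> (xs (Suc a) @ Ly # xs b) + of_nat (Suc b) * \<phi> (xs a @ Ly # xs (Suc b))"
  using insx_append[of \<phi> "xs a @ [Ly]" "xs b"] pinsx_xs_y[of "\<lambda>z. \<phi> (z @ xs b)" a] by (simp add: insx_xs)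

context odd_ds
begin

text \<open>Vanishing on shuffles with x relates neighbouring coefficients in depth one; the
  recursion is that of the signed binomials in ad_x^(n-1)(y).\<close>

lemma f_depth1: "i < n \<Longrightarrow> lk f (xs (n - 1 - i) @ Ly # xs i) = (-1) ^ i * of_nat ((n - 1) choose i) * lk f (xs (n - 1) @ [Ly])"
proof (induction i)
  case (Suc i)
  define a where "a = n - 1 - Suc i"
  have a: "n - 1 - i = Suc a" "n - 1 = Suc a + i" using Suc.prems by (auto simp: a_def)
  have e: "of_nat (Suc a) * lk f (xs (Suc a) @ Ly # xs i) + of_nat (Suc i) * lk f (xs a @ Ly # xs (Suc i)) = 0"
    using f_insx[of "xs a @ Ly # xs i"] by (simp only: insx_y)
  have l: "lk f (xs (Suc a) @ Ly # xs i) = (-1) ^ i * of_nat ((n - 1) choose i) * lk f (xs (n - 1) @ [Ly])"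
    using Suc a by simp
  have "Suc i * ((n - 1) choose Suc i) = Suc a * ((n - 1) choose i)"
    using binomial_absorption[of i "n - 1"] binomial_absorb_comp[of "n - 1" i] a by simp
  then have c: "of_nat (Suc i) * (of_nat ((n - 1) choose Suc i) :: rat) = of_nat (Suc a) * of_nat ((n - 1) choose i)"
    by (metis of_nat_mult)
  have "of_nat (Suc i) * lk f (xs a @ Ly # xs (Suc i)) = - (of_nat (Suc a) * lk f (xs (Suc a) @ Ly # xs i))"
    using e by (simp add: eq_neg_iff_add_eq_0 add.commute del: of_nat_Suc)
  also have "\<dots> = (-1) ^ Suc i * (of_nat (Suc a) * of_nat ((n - 1) choose i)) * lk f (xs (n - 1) @ [Ly])"
    unfolding l by (simp add: mult_ac del: of_nat_Suc)
  also have "\<dots> = of_nat (Suc i) * ((-1) ^ Suc i * of_nat ((n - 1) choose Suc i) * lk f (xs (n - 1) @ [Ly]))"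
    unfolding c[symmetric] by (simp only: mult_ac)
  finally have M: "of_nat (Suc i) * lk f (xs a @ Ly # xs (Suc i)) = of_nat (Suc i) * ((-1) ^ Suc i * of_nat ((n - 1) choose Suc i) * lk f (xs (n - 1) @ [Ly]))" .
  have "(of_nat (Suc i) :: rat) \<noteq> 0" by (simp del: of_nat_Suc)
  from mult_left_cancel[OF this, THEN iffD1, OF M] show ?case unfolding a_def .
qed simp

lemma T1_f: assumes "lk f (xs (n - 1) @ [Ly]) = 1" shows "T1 A B f = (A - B) ^ (n - 1)"
proof -
  define M where "M = n - 1"
  have n: "n = Suc M" using n3 by (simp add: M_def)
  have fd: "lk f (xs (M - i) @ Ly # xs i) = (-1) ^ i * of_nat (M choose i)" if "i \<le> M" for i
    using f_depth1[of i] assms that by (simp add: n)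
  have "T1 A B f = (\<Sum>j\<le>M. lk f (xs j @ Ly # xs (M - j)) * (A ^ j * B ^ (M - j)))"
    using T1_expand[OF ds_degD(1)[OF f_ds], of A B] by (simp add: n lessThan_Suc_atMost)
  also have "\<dots> = (\<Sum>i\<le>M. lk f (xs (M - i) @ Ly # xs i) * (A ^ (M - i) * B ^ i))"
    by (rule sum.reindex_bij_witness[of _ "\<lambda>i. M - i" "\<lambda>i. M - i"]) auto
  also have "\<dots> = (\<Sum>i\<le>M. of_nat (M choose i) * (- B) ^ i * A ^ (M - i))"
    by (intro sum.cong refl) (simp add: fd power_minus[of B] mult_ac)
  also have "\<dots> = (- B + A) ^ M" by (rule binomial_ring[symmetric])
  finally show ?thesis by (simp add: n)
qed

end

section \<open>Binomial expansions\<close>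

lemma binom_shift: fixes X Y :: "'a::comm_ring_1" assumes "e \<le> N"
  shows "(X + Y) ^ e * Y ^ (N - e) = (\<Sum>j\<le>N. of_nat (e choose j) * X ^ j * Y ^ (N - j))"
proof -
  have "(X + Y) ^ e * Y ^ (N - e) = (\<Sum>j\<le>e. of_nat (e choose j) * X ^ j * Y ^ (e - j) * Y ^ (N - e))"
    by (simp add: binomial_ring sum_distrib_right)
  also have "\<dots> = (\<Sum>j\<le>e. of_nat (e choose j) * X ^ j * Y ^ (N - j))"
    by (intro sum.cong refl) (use assms in \<open>simp add: mult.assoc power_add[symmetric]\<close>)
  also have "\<dots> = (\<Sum>j\<le>N. of_nat (e choose j) * X ^ j * Y ^ (N - j))"
    by (rule sum.mono_neutral_left) (use assms in \<open>auto simp: binomial_eq_0 not_le\<close>)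
  finally show ?thesis .
qed

lemma binom_double: fixes X Y :: rat assumes "e \<le> N"
  shows "of_nat (N choose e) * (X ^ e * (X + Y) ^ (N - e)) = (\<Sum>j\<le>N. of_nat (N choose j) * of_nat (j choose e) * X ^ j * Y ^ (N - j))"
proof -
  have "of_nat (N choose e) * (X ^ e * (X + Y) ^ (N - e)) = (\<Sum>i\<le>N - e. of_nat (N choose e) * of_nat ((N - e) choose i) * X ^ (e + i) * Y ^ (N - e - i))"
    by (simp add: binomial_ring sum_distrib_left power_add mult_ac)
  also have "\<dots> = (\<Sum>j\<in>{e..N}. of_nat (N choose e) * of_nat ((N - e) choose (j - e)) * X ^ j * Y ^ (N - j))"
    by (rule sum.reindex_bij_witness[of _ "\<lambda>j. j - e" "\<lambda>i. e + i"]) (use assms in auto)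
  also have "\<dots> = (\<Sum>j\<in>{e..N}. of_nat (N choose j) * of_nat (j choose e) * X ^ j * Y ^ (N - j))"
    by (intro sum.cong refl) (simp add: choose_mult flip: of_nat_mult)
  also have "\<dots> = (\<Sum>j\<le>N. of_nat (N choose j) * of_nat (j choose e) * X ^ j * Y ^ (N - j))"
    by (rule sum.mono_neutral_left) auto
  finally show ?thesis .
qed

lemma shuffle_depth1: "ev \<phi> (shuffle_word (xs a @ [Ly]) (xs b @ [Ly]))
   = (\<Sum>j\<le>a + b. (of_nat (j choose a) + of_nat (j choose b)) * \<phi> (xs j @ Ly # xs (a + b - j) @ [Ly]))"
proof -
  have base: "ev \<phi> (shuffle_word [Ly] (xs b @ [Ly])) = (\<Sum>j\<le>b. (1 + of_nat (j choose b)) * \<phi> (xs j @ Ly # xs (b - j) @ [Ly]))" for b \<phi>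
  proof (induction b arbitrary: \<phi>)
    case (Suc b)
    have "ev \<phi> (shuffle_word [Ly] (xs (Suc b) @ [Ly])) = \<phi> (Ly # xs (Suc b) @ [Ly]) + ev (\<lambda>w. \<phi> (Lx # w)) (shuffle_word [Ly] (xs b @ [Ly]))"
      by (simp flip: mon_append)
    also have "\<dots> = (\<Sum>j\<le>Suc b. (1 + of_nat (j choose Suc b)) * \<phi> (xs j @ Ly # xs (Suc b - j) @ [Ly]))"
      unfolding Suc.IH sum.atMost_Suc_shift[of _ b]
      by (auto intro!: sum.cong simp: binomial_eq_0)
    finally show ?case .
  qed simp
  show ?thesis
  proof (induction "a + b" arbitrary: a b \<phi>)
    case 0
    then show ?case using base[of \<phi> 0] by simp
  next
    case (Suc n)
    show ?case
    proof (cases "a = 0 \<or> b = 0")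
      case True
      then show ?thesis
      proof
        assume "a = 0"
        then show ?thesis using base[of \<phi> b] by simp
      next
        assume "b = 0"
        then show ?thesis using base[of \<phi> a] shuffle_word_commute[of "xs a @ [Ly]" "[Ly]"] by (simp add: add.commute)
      qed
    next
      case False
      then obtain a' b' where ab: "a = Suc a'" "b = Suc b'" by (metis not0_implies_Suc)
      have "ev \<phi> (shuffle_word (xs a @ [Ly]) (xs b @ [Ly])) = ev (\<lambda>w. \<phi> (Lx # w)) (shuffle_word (xs a' @ [Ly]) (xs b @ [Ly]))
         + ev (\<lambda>w. \<phi> (Lx # w)) (shuffle_word (xs a @ [Ly]) (xs b' @ [Ly]))" by (simp add: ab)
      also have "\<dots> = (\<Sum>j\<le>n. (of_nat (j choose a') + of_nat (j choose b)) * \<phi> (Lx # xs j @ Ly # xs (n - j) @ [Ly]))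
         + (\<Sum>j\<le>n. (of_nat (j choose a) + of_nat (j choose b')) * \<phi> (Lx # xs j @ Ly # xs (n - j) @ [Ly]))"
      proof -
        have "n = a' + b" "n = a + b'" using Suc ab by auto
        then show ?thesis using Suc.hyps(1)[of a' b "\<lambda>w. \<phi> (Lx # w)"] Suc.hyps(1)[of a b' "\<lambda>w. \<phi> (Lx # w)"] by simp
      qed
      also have "\<dots> = (\<Sum>j\<le>Suc n. (of_nat (j choose a) + of_nat (j choose b)) * \<phi> (xs j @ Ly # xs (Suc n - j) @ [Ly]))"
        unfolding sum.atMost_Suc_shift[of _ n] sum.distrib[symmetric]
        by (simp add: ab algebra_simps)
      finally show ?thesis using Suc(2) by simp
    qed
  qed
qed

lemma span_functional:
  assumes "x \<notin> qvec.span (S :: ('a \<Rightarrow>\<^sub>0 rat) set)"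
  shows "\<exists>L. (\<forall>p q. L (p + q) = L p + L q) \<and> (\<forall>c p. L (qscale c p) = c * (L p :: rat)) \<and> (\<forall>s\<in>S. L s = 0) \<and> L x = 1"
proof -
  interpret vector_space_pair "qscale :: rat \<Rightarrow> ('a \<Rightarrow>\<^sub>0 rat) \<Rightarrow> _" "(*) :: rat \<Rightarrow> rat \<Rightarrow> rat"
    by unfold_locales (simp_all add: algebra_simps)
  obtain B where B: "B \<subseteq> S" "\<not> qvec.dependent B" "qvec.span S \<subseteq> qvec.span B"
    using qvec.maximal_independent_subset[of S] qvec.span_minimal qvec.subspace_span by metis
  have xB: "x \<notin> qvec.span B" using assms B(1) qvec.span_mono by blast
  then have "\<not> qvec.dependent (insert x B)" using B(2) qvec.independent_insert[of x B] by (auto split: if_splits)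
  then obtain L where L: "Vector_Spaces.linear qscale (*) L" "\<forall>y\<in>insert x B. L y = (if y = x then 1 else 0)"
    using linear_independent_extend[of "insert x B" "\<lambda>y. if y = x then 1 else 0"] by blast
  interpret L: Vector_Spaces.linear qscale "(*) :: rat \<Rightarrow> rat \<Rightarrow> rat" L by (rule L(1))
  have xnB: "x \<notin> B" using xB qvec.span_base by blast
  have "L y = 0" if "y \<in> qvec.span B" for y
    using that by (rule L.eq_0_on_span[rotated]) (use L(2) xnB in auto)
  then have "\<forall>s\<in>S. L s = 0" using B(3) qvec.span_base by blast
  then show ?thesis using L(2) L.add L.scale by auto
qed

section \<open>Period polynomials and the two spaces of relations\<close>

section \<open>The even period polynomial relations\<close>

lemma sum_fold_half:
  fixes u :: "nat \<Rightarrow> rat"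
  assumes "\<And>i. 2 * i = M + 1 \<Longrightarrow> u i = 0"
  shows "(\<Sum>i = 1..M. u i) = (\<Sum>i = 1..M div 2. u i + u (M + 1 - i))"
proof -
  let ?h = "M div 2"
  have "(\<Sum>i = 1..M. u i) = (\<Sum>i\<in>{1..?h} \<union> {M + 1 - ?h..M}. u i)"
  proof (rule sum.mono_neutral_right)
    show "\<forall>i\<in>{1..M} - ({1..?h} \<union> {M + 1 - ?h..M}). u i = 0"
    proof
      fix i assume "i \<in> {1..M} - ({1..?h} \<union> {M + 1 - ?h..M})"
      then have "\<not> i \<le> ?h" "\<not> M + 1 - ?h \<le> i" "1 \<le> i" "i \<le> M" by auto
      then have "2 * i = M + 1" by presburger
      then show "u i = 0" by (rule assms)
    qed
  qed auto
  also have "\<dots> = (\<Sum>i\<in>{1..?h}. u i) + (\<Sum>i\<in>{M + 1 - ?h..M}. u i)"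
    by (rule sum.union_disjoint) auto
  also have "(\<Sum>i\<in>{M + 1 - ?h..M}. u i) = (\<Sum>i\<in>{1..?h}. u (M + 1 - i))"
    by (rule sum.reindex_bij_witness[of _ "\<lambda>i. M + 1 - i" "\<lambda>i. M + 1 - i"]) auto
  finally show ?thesis by (simp add: sum.distrib)
qed

text \<open>N = k - 2 is the degree of P, and m counts the pairs 2i < N - 2i of positive even
  exponents.\<close>

locale even_pol =
  fixes N m :: nat
  assumes N_even: "even N" and N2: "2 \<le> N" and m_eq: "m = (N div 2 - 1) div 2"
begin

lemma m4: "4 * m < N" using N2 unfolding m_eq by linarith

lemma pow_even: "even n \<Longrightarrow> (- x :: rat) ^ n = x ^ n" by (simp add: power_minus[of x])

definition PA :: "(nat \<Rightarrow> rat) \<Rightarrow> rat \<Rightarrow> rat \<Rightarrow> rat" where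
  "PA a x y = (\<Sum>i = 1..m. a i * (x ^ (2 * i) * y ^ (N - 2 * i) - x ^ (N - 2 * i) * y ^ (2 * i)))"

lemma PA_minus: "PA a (- x) y = PA a x y" "PA a x (- y) = PA a x y"
  by (simp_all add: PA_def pow_even N_even)
lemma PA_flip: "PA a (x - y) z = PA a (y - x) z" using PA_minus(1)[of a "y - x" z] by simp
lemma PA_sym: "PA a y x = - PA a x y"
  by (simp add: PA_def sum_negf[symmetric] algebra_simps)

text \<open>\<open>cf a j\<close> is the number q_(j+1) attached to P: the coefficient of P(X+Y, Y)
  at X^j Y^(N-j), divided by the binomial (\<open>Qg_PA\<close>).\<close>

definition cf :: "(nat \<Rightarrow> rat) \<Rightarrow> nat \<Rightarrow> rat" where
  "cf a j = (\<Sum>i = 1..m. a i * (of_nat ((2 * i) choose j) - of_nat ((N - 2 * i) choose j))) / of_nat (N choose j)"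

definition Qg :: "(nat \<Rightarrow> rat) \<Rightarrow> rat \<Rightarrow> rat \<Rightarrow> rat" where
  "Qg c x y = (\<Sum>j\<le>N. of_nat (N choose j) * c j * x ^ j * y ^ (N - j))"

lemma Qg_add: "Qg (\<lambda>j. c j + d j) x y = Qg c x y + Qg d x y"
  by (simp add: Qg_def sum.distrib algebra_simps)
lemma Qg_diff: "Qg (\<lambda>j. c j - d j) x y = Qg c x y - Qg d x y"
  by (simp add: Qg_def sum_subtractf algebra_simps)
lemma Qg_cmult: "Qg (\<lambda>j. t * c j) x y = t * Qg c x y"
  by (simp add: Qg_def sum_distrib_left mult_ac)
lemma Qg_neg: "Qg (\<lambda>j. (-1) ^ j * c j) x y = Qg c (- x) y"
  by (simp add: Qg_def power_minus[of x] mult_ac)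
lemma Qg_cong: "(\<And>j. j \<le> N \<Longrightarrow> c j = d j) \<Longrightarrow> Qg c x y = Qg d x y"
  by (simp add: Qg_def)
lemma Qg_rev: "Qg (\<lambda>j. c (N - j)) x y = Qg c y x"
  unfolding Qg_def
  by (rule sum.reindex_bij_witness[of _ "\<lambda>j. N - j" "\<lambda>j. N - j"])
    (auto simp: binomial_symmetric[symmetric] mult_ac)
text \<open>The binomial sums in the shuffle product of two depth-one words become the substitution
  y -> x + y on normalized generating polynomials.\<close>

lemma Qg_double: "Qg (\<lambda>j. \<Sum>e\<le>N. of_nat (j choose e) * g e) x y = Qg g x (x + y)"
proof -
  have "Qg g x (x + y) = (\<Sum>e\<le>N. g e * (of_nat (N choose e) * (x ^ e * (x + y) ^ (N - e))))"
    by (simp add: Qg_def mult_ac)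
  also have "\<dots> = (\<Sum>e\<le>N. g e * (\<Sum>j\<le>N. of_nat (N choose j) * of_nat (j choose e) * x ^ j * y ^ (N - j)))"
    by (intro sum.cong refl) (simp add: binom_double)
  also have "\<dots> = (\<Sum>e\<le>N. \<Sum>j\<le>N. of_nat (N choose j) * (of_nat (j choose e) * g e) * x ^ j * y ^ (N - j))"
    by (simp add: sum_distrib_left mult_ac)
  also have "\<dots> = Qg (\<lambda>j. \<Sum>e\<le>N. of_nat (j choose e) * g e) x y"
    unfolding Qg_def by (subst sum.swap) (simp add: sum_distrib_left sum_distrib_right mult_ac)
  finally show ?thesis by simp
qed

lemma Qg_inj: assumes "\<And>x y. Qg c x y = Qg d x y" "j \<le> N" shows "c j = d j"
proof -
  have "(\<Sum>j\<le>N. (of_nat (N choose j) * (c j - d j)) * x ^ j) = 0" for x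
    using assms(1)[of x 1] by (simp add: Qg_def algebra_simps sum_subtractf)
  then have "of_nat (N choose j) * (c j - d j) = 0" using assms(2) by (rule poly_coeffs_zero)
  then show ?thesis using assms(2) by (simp add: binomial_eq_0_iff)
qed

lemma Qg_PA: "Qg (cf a) x y = PA a (x + y) y"
proof -
  have s: "(x + y) ^ (2 * i) * y ^ (N - 2 * i) - (x + y) ^ (N - 2 * i) * y ^ (2 * i)
      = (\<Sum>j\<le>N. (of_nat ((2 * i) choose j) - of_nat ((N - 2 * i) choose j)) * x ^ j * y ^ (N - j))" if "i \<in> {1..m}" for i
  proof -
    have "2 * i \<le> N" "N - (N - 2 * i) = 2 * i" using that m4 by auto
    then show ?thesis using binom_shift[of "2 * i" N x y] binom_shift[of "N - 2 * i" N x y]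
      by (simp add: sum_subtractf left_diff_distrib)
  qed
  have "PA a (x + y) y = (\<Sum>i = 1..m. a i * (\<Sum>j\<le>N. (of_nat ((2 * i) choose j) - of_nat ((N - 2 * i) choose j)) * x ^ j * y ^ (N - j)))"
    unfolding PA_def by (intro sum.cong refl) (simp only: s)
  also have "\<dots> = (\<Sum>j\<le>N. \<Sum>i = 1..m. a i * (of_nat ((2 * i) choose j) - of_nat ((N - 2 * i) choose j)) * (x ^ j * y ^ (N - j)))"
    unfolding sum_distrib_left by (subst sum.swap) (simp only: mult.assoc)
  also have "\<dots> = Qg (cf a) x y"
    unfolding Qg_def cf_def
    by (intro sum.cong refl) (simp add: sum_distrib_right[symmetric] binomial_eq_0_iff)
  finally show ?thesis by simp
qed

lemma cf_0: "cf a 0 = 0" by (simp add: cf_def)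
lemma cf_N: "cf a N = 0"
  unfolding cf_def using m4 by (simp add: binomial_eq_0)

definition Ef :: "(nat \<Rightarrow> rat) \<Rightarrow> rat \<Rightarrow> rat \<Rightarrow> rat" where
  "Ef a x y = PA a (x - y) y + PA a y x - PA a (x - y) x"

lemma Ef_eq: assumes "\<And>x y. Ef a x y = 0"
  shows "PA a (x - y) y = PA a x y + PA a (x - y) x" "PA a (x + y) y = PA a x y + PA a (x + y) x"
  using assms[of x y] assms[of x "- y"] PA_sym[of a y x] by (simp_all add: Ef_def PA_minus)

text \<open>With weights (-1)^b \<open>cf a b\<close>, the stuffle side of the double shuffle
  relations has coefficients g and the shuffle side their binomial transform. The factor on the
  right is 3 for even j and -1 for odd j.\<close>

lemma cf_rel:
  assumes E: "\<And>x y. Ef a x y = 0" and j: "j \<le> N"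
  defines "g \<equiv> \<lambda>j. (-1) ^ j * (cf a j + cf a (N - j))"
  shows "g j - (\<Sum>e\<le>N. of_nat (j choose e) * g e) = (2 * (-1) ^ j + 1) * cf a j"
proof (rule Qg_inj[OF _ j, where c = "\<lambda>j. g j - (\<Sum>e\<le>N. of_nat (j choose e) * g e)" and d = "\<lambda>j. (2 * (-1) ^ j + 1) * cf a j"])
  fix x y
  have g: "Qg g x y = PA a (x - y) y + PA a (x - y) x" for x y
    unfolding g_def Qg_neg Qg_add Qg_rev Qg_PA using PA_flip[of a x y y] PA_flip[of a x y x] by (simp add: PA_minus)
  have "Qg (\<lambda>j. g j - (\<Sum>e\<le>N. of_nat (j choose e) * g e)) x y = PA a (x - y) y + PA a (x - y) x - (PA a y (x + y) + PA a y x)"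
    unfolding Qg_diff Qg_double g by (simp add: PA_minus)
  also have "\<dots> = 2 * PA a (x - y) y + PA a (x + y) y"
    using Ef_eq[OF E, of x y] PA_sym[of a y "x + y"] PA_sym[of a y x] by simp
  also have "\<dots> = Qg (\<lambda>j. 2 * ((-1) ^ j * cf a j) + cf a j) x y"
    unfolding Qg_add Qg_cmult Qg_neg Qg_PA using PA_flip[of a x y y] by simp
  also have "\<dots> = Qg (\<lambda>j. (2 * (-1) ^ j + 1) * cf a j) x y"
    by (rule Qg_cong) (simp add: algebra_simps)
  finally show "Qg (\<lambda>j. g j - (\<Sum>e\<le>N. of_nat (j choose e) * g e)) x y = Qg (\<lambda>j. (2 * (-1) ^ j + 1) * cf a j) x y" .
qed

text \<open>Subtracting the two forms in \<open>Ef_eq\<close> shows that the part of P(x+y, y) odd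
  in x is symmetric in x and y.\<close>

lemma cf_odd:
  assumes E: "\<And>x y. Ef a x y = 0" and j: "j \<le> N" "odd j"
  shows "cf a j = cf a (N - j)"
proof -
  have "cf a j - (-1) ^ j * cf a j = cf a (N - j) - (-1) ^ j * cf a (N - j)"
  proof (rule Qg_inj[OF _ j(1), where c = "\<lambda>j. cf a j - (-1) ^ j * cf a j" and d = "\<lambda>j. cf a (N - j) - (-1) ^ j * cf a (N - j)"])
    fix x y
    show "Qg (\<lambda>j. cf a j - (-1) ^ j * cf a j) x y = Qg (\<lambda>j. cf a (N - j) - (-1) ^ j * cf a (N - j)) x y"
      unfolding Qg_diff Qg_neg Qg_rev Qg_PA
      using Ef_eq[OF E, of x y] PA_flip[of a x y y] PA_flip[of a x y x] by (simp add: PA_minus add.commute)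
  qed
  then show ?thesis using j(2) by simp
qed

lemma Qg_cf_even: "Qg (\<lambda>j. cf a j + (-1) ^ j * cf a j) x y = PA a (x + y) y + PA a (x - y) y"
  unfolding Qg_add Qg_neg Qg_PA using PA_flip[of a x y y] by simp

lemma PA_inj: assumes z: "\<And>x. PA a x 1 = 0" and i: "i \<in> {1..m}" shows "a i = 0"
proof -
  let ?c = "\<lambda>j. \<Sum>l = 1..m. a l * ((if j = 2 * l then 1 else 0) - (if j = N - 2 * l then 1 else 0))"
  have "(\<Sum>j\<le>N. ?c j * x ^ j) = 0" for x
  proof -
    have "(\<Sum>j\<le>N. ?c j * x ^ j) = (\<Sum>l = 1..m. \<Sum>j\<le>N. a l * ((if j = 2 * l then 1 else 0) - (if j = N - 2 * l then 1 else 0)) * x ^ j)"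
      unfolding sum_distrib_right by (rule sum.swap)
    also have "\<dots> = (\<Sum>l = 1..m. a l * (x ^ (2 * l) - x ^ (N - 2 * l)))"
    proof (intro sum.cong refl)
      fix l assume "l \<in> {1..m}"
      then have l: "2 * l \<le> N" using m4 by auto
      have "(\<Sum>j\<le>N. a l * ((if j = 2 * l then 1 else 0) - (if j = N - 2 * l then 1 else 0)) * x ^ j)
        = (\<Sum>j\<le>N. (if j = 2 * l then a l * x ^ j else 0) - (if j = N - 2 * l then a l * x ^ j else 0))"
        by (intro sum.cong refl) auto
      also have "\<dots> = a l * (x ^ (2 * l) - x ^ (N - 2 * l))"
        using l by (simp add: sum_subtractf right_diff_distrib)
      finally show "(\<Sum>j\<le>N. a l * ((if j = 2 * l then 1 else 0) - (if j = N - 2 * l then 1 else 0)) * x ^ j) = a l * (x ^ (2 * l) - x ^ (N - 2 * l))" .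
    qed
    also have "\<dots> = 0" using z[of x] by (simp add: PA_def)
    finally show ?thesis .
  qed
  then have "?c (2 * i) = 0" by (rule poly_coeffs_zero) (use i m4 in auto)
  moreover have "?c (2 * i) = (\<Sum>l = 1..m. if l = i then a l else 0)"
  proof (intro sum.cong refl)
    fix l assume "l \<in> {1..m}"
    then have "2 * i \<noteq> N - 2 * l" using i m4 by auto
    then show "a l * ((if 2 * i = 2 * l then 1 else 0) - (if 2 * i = N - 2 * l then 1 else 0)) = (if l = i then a l else 0)" by simp
  qed
  ultimately show ?thesis using i by simp
qed

text \<open>By \<open>Ef_eq\<close>, antisymmetrizing P(x+y, y) + P(x-y, y) in x and y gives 2 P(x,
  y). So the even-indexed coefficients determine P.\<close>

lemma cf_inj:
  assumes E: "\<And>x y. Ef a x y = 0" and z: "\<And>j. even j \<Longrightarrow> 2 \<le> j \<Longrightarrow> j \<le> N - 2 \<Longrightarrow> cf a j = 0" and i: "i \<in> {1..m}"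
  shows "a i = 0"
proof -
  have c: "cf a j + (-1) ^ j * cf a j = 0" if "j \<le> N" for j
  proof (cases "even j")
    case True
    then have "j = 0 \<or> j = N \<or> 2 \<le> j \<and> j \<le> N - 2" using that N_even by presburger
    then show ?thesis using z[of j] True cf_0 cf_N by auto
  qed simp
  have q: "PA a (x + y) y + PA a (x - y) y = 0" for x y
    unfolding Qg_cf_even[symmetric] unfolding Qg_def using c by simp
  have "PA a x y = 0" for x y
    using q[of x y] q[of y x] Ef_eq[OF E, of x y] PA_flip[of a x y x] by (simp add: add.commute)
  then show ?thesis using PA_inj i by blast
qed

text \<open>The hypothesis on the sums says that c is orthogonal to the depth-two coefficients of
  the elements \<open>sf\<close> (\<open>sf_coeffs\<close> at even indices). With C =
  \<open>Qg c\<close>, the candidate is P(x, y) = C(x, y) - C(y, x), whose coefficients are the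
  given a.\<close>

lemma cf_surj:
  assumes c0: "\<And>j. \<not> (even j \<and> 2 \<le> j \<and> j \<le> N - 2) \<Longrightarrow> c j = 0"
    and S: "\<And>e. even e \<Longrightarrow> 2 \<le> e \<Longrightarrow> e \<le> N - 2 \<Longrightarrow>
      (\<Sum>j\<le>N. c j * (of_nat (e choose j) + (if j = N - e then 1 else 0) - (if N - e \<le> j then of_nat (e choose (j - (N - e))) else 0))) = 0"
  defines "a \<equiv> \<lambda>i. of_nat (N choose (2 * i)) * (c (2 * i) - c (N - 2 * i))"
  shows "Ef a x y = 0" "even j \<Longrightarrow> j \<le> N \<Longrightarrow> cf a j = c j"
proof -
  define v where "v e j = (of_nat (e choose j) + (if j = N - e then 1 else 0) - (if N - e \<le> j then of_nat (e choose (j - (N - e))) else 0) :: rat)" for e j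
  define s where "s e = (\<Sum>j\<le>N. c j * v e j)" for e
  have c00: "c 0 = 0" "c N = 0"
  proof -
    have "\<not> N \<le> N - 2" using N2 by linarith
    then show "c 0 = 0" "c N = 0" using c0[of 0] c0[of N] by auto
  qed
  have s0: "s e = 0" if "even e" "e \<le> N" for e
  proof -
    have "e = 0 \<or> e = N \<or> 2 \<le> e \<and> e \<le> N - 2" using that N_even by presburger
    moreover have "s 0 = 0" unfolding s_def
    proof (intro sum.neutral ballI)
      fix j assume "j \<in> {..N}"
      then show "c j * v 0 j = 0" using c00 by (cases "j = 0"; cases "j = N") (auto simp: v_def)
    qed
    moreover have "s N = 0" unfolding s_def
    proof (intro sum.neutral ballI)
      fix j assume "j \<in> {..N}"
      then show "c j * v N j = 0" using c00 by (cases "j = 0") (auto simp: v_def)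
    qed
    ultimately show ?thesis using S[of e] that by (auto simp: s_def v_def)
  qed
  \<comment> \<open>The sums over all e form one polynomial; each of the three summands of
    \<open>v\<close> becomes a substitution in C.\<close>
  have H: "Qg s x y = Qg c x (x + y) + Qg c y x - Qg c (x + y) x" for x y
  proof -
    define h where "h b = (\<Sum>j\<le>N. if b \<le> j then of_nat ((N - b) choose (j - b)) * c j else 0)" for b
    have "Qg s x y = Qg (\<lambda>e. (\<Sum>j\<le>N. of_nat (e choose j) * c j) + c (N - e) - h (N - e)) x y"
    proof (rule Qg_cong)
      fix e assume "e \<le> N"
      then have e: "N - (N - e) = e" by simp
      have "s e = (\<Sum>j\<le>N. of_nat (e choose j) * c j + (if j = N - e then c j else 0) - (if N - e \<le> j then of_nat (e choose (j - (N - e))) * c j else 0))"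
        unfolding s_def v_def by (intro sum.cong refl) (simp add: algebra_simps)
      also have "\<dots> = (\<Sum>j\<le>N. of_nat (e choose j) * c j) + c (N - e) - h (N - e)"
        unfolding h_def e by (simp add: sum.distrib sum_subtractf)
      finally show "s e = (\<Sum>j\<le>N. of_nat (e choose j) * c j) + c (N - e) - h (N - e)" .
    qed
    also have "\<dots> = Qg c x (x + y) + Qg c y x - Qg h y x"
      unfolding Qg_diff Qg_add Qg_double Qg_rev ..
    also have "Qg h y x = Qg c (x + y) x"
    proof -
      have "Qg h y x = (\<Sum>b\<le>N. \<Sum>j\<le>N. of_nat (N choose j) * c j * (of_nat (j choose b) * y ^ b * x ^ (N - b)))"
        unfolding Qg_def
      proof (intro sum.cong refl)
        fix b assume "b \<in> {..N}"
        have "of_nat (N choose b) * h b = (\<Sum>j\<le>N. of_nat (N choose j) * c j * of_nat (j choose b))"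
          unfolding h_def sum_distrib_left
        proof (intro sum.cong refl)
          fix j assume j: "j \<in> {..N}"
          show "of_nat (N choose b) * (if b \<le> j then of_nat ((N - b) choose (j - b)) * c j else 0) = of_nat (N choose j) * c j * of_nat (j choose b)"
          proof (cases "b \<le> j")
            case True
            then have "(N choose j) * (j choose b) = (N choose b) * ((N - b) choose (j - b))" using j by (intro choose_mult) auto
            then have "(of_nat (N choose j) :: rat) * of_nat (j choose b) = of_nat (N choose b) * of_nat ((N - b) choose (j - b))"
              by (metis of_nat_mult)
            then show ?thesis using True by (simp add: mult_ac)
          qed (simp add: binomial_eq_0)
        qed
        then have "of_nat (N choose b) * h b * y ^ b * x ^ (N - b) = (\<Sum>j\<le>N. of_nat (N choose j) * c j * of_nat (j choose b)) * y ^ b * x ^ (N - b)" by simp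
        then show "of_nat (N choose b) * h b * y ^ b * x ^ (N - b) = (\<Sum>j\<le>N. of_nat (N choose j) * c j * (of_nat (j choose b) * y ^ b * x ^ (N - b)))"
          by (simp add: sum_distrib_right mult.assoc)
      qed
      also have "\<dots> = (\<Sum>j\<le>N. of_nat (N choose j) * c j * (\<Sum>b\<le>N. of_nat (j choose b) * y ^ b * x ^ (N - b)))"
        by (subst sum.swap) (simp only: sum_distrib_left)
      also have "\<dots> = (\<Sum>j\<le>N. of_nat (N choose j) * c j * ((y + x) ^ j * x ^ (N - j)))"
        by (intro sum.cong refl) (simp add: binom_shift)
      finally show ?thesis by (simp add: Qg_def mult_ac add.commute)
    qed
    finally show ?thesis .
  qed
  have ce: "Qg c (- x) y = Qg c x y" for x y
    unfolding Qg_neg[symmetric]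
  proof (rule Qg_cong)
    fix j show "(- 1) ^ j * c j = c j" using c0[of j] by (cases "even j") auto
  qed
  \<comment> \<open>The hypothesis concerns even e only. As N is even, it kills just the part of
    \<open>Qg s\<close> that is even in y.\<close>
  have H0: "Qg s x y + Qg s x (- y) = 0" for x y
  proof -
    have "Qg s x y + Qg s x (- y) = (\<Sum>j\<le>N. of_nat (N choose j) * s j * x ^ j * (y ^ (N - j) + (- y) ^ (N - j)))"
      by (simp add: Qg_def sum.distrib algebra_simps)
    also have "\<dots> = 0"
    proof (intro sum.neutral ballI)
      fix j assume j: "j \<in> {..N}"
      show "of_nat (N choose j) * s j * x ^ j * (y ^ (N - j) + (- y) ^ (N - j)) = 0"
      proof (cases "even j")
        case True then show ?thesis using s0[of j] j by simp
      next
        case False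
        then have "odd (N - j)" using j N_even by simp
        then show ?thesis by (simp add: power_minus[of y])
      qed
    qed
    finally show ?thesis .
  qed
  have P: "PA a x y = Qg c x y - Qg c y x" for x y
  proof -
    define d where "d j = of_nat (N choose j) * (c j - c (N - j))" for j
    define M where "M = N div 2 - 1"
    have M: "N = 2 * (M + 1)" using N_even N2 by (auto simp: M_def)
    define u where "u i = d (2 * i) * (x ^ (2 * i) * y ^ (N - 2 * i))" for i
    have "Qg c x y - Qg c y x = Qg (\<lambda>j. c j - c (N - j)) x y" unfolding Qg_diff Qg_rev ..
    also have "\<dots> = (\<Sum>j\<le>N. d j * (x ^ j * y ^ (N - j)))" by (simp add: Qg_def d_def mult_ac)
    also have "\<dots> = (\<Sum>j\<in>(\<lambda>i. 2 * i) ` {1..M}. d j * (x ^ j * y ^ (N - j)))"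
    proof (rule sum.mono_neutral_right)
      show "\<forall>j\<in>{..N} - (\<lambda>i. 2 * i) ` {1..M}. d j * (x ^ j * y ^ (N - j)) = 0"
      proof
        fix j assume j: "j \<in> {..N} - (\<lambda>i. 2 * i) ` {1..M}"
        have "d j = 0"
        proof (cases "even j")
          case True
          then obtain i where i: "j = 2 * i" by blast
          then have "i = 0 \<or> i = M + 1" using j M by force
          then show ?thesis using c00 M i by (auto simp: d_def)
        next
          case False
          then have "odd (N - j)" using j N_even by simp
          then show ?thesis using False c0[of j] c0[of "N - j"] by (simp add: d_def)
        qed
        then show "d j * (x ^ j * y ^ (N - j)) = 0" by simp
      qed
    qed (auto simp: M)
    also have "\<dots> = (\<Sum>i = 1..M. u i)" by (subst sum.reindex) (auto simp: inj_on_def u_def)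
    also have "\<dots> = (\<Sum>i = 1..M div 2. u i + u (M + 1 - i))"
    proof (rule sum_fold_half)
      fix i assume i: "2 * i = M + 1"
      have "N = 2 * (2 * i)" unfolding i by (rule M)
      then have "N - 2 * i = 2 * i" by simp
      then show "u i = 0" by (simp add: u_def d_def)
    qed
    also have "\<dots> = PA a x y"
    proof -
      have "m = M div 2" by (simp add: m_eq M_def)
      moreover have "u i + u (M + 1 - i) = a i * (x ^ (2 * i) * y ^ (N - 2 * i) - x ^ (N - 2 * i) * y ^ (2 * i))" if "i \<in> {1..M div 2}" for i
      proof -
        have i: "2 * (M + 1 - i) = N - 2 * i" "N - (N - 2 * i) = 2 * i" "2 * i \<le> N" using that M by auto
        have "(N choose (N - 2 * i)) = (N choose (2 * i))" using binomial_symmetric[OF i(3)] by simp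
        then have nd: "d (N - 2 * i) = - d (2 * i)" unfolding d_def i(2) by (simp add: algebra_simps)
        have da: "d (2 * i) = a i" by (simp add: d_def a_def)
        show ?thesis unfolding u_def i(1) i(2) nd da by (simp add: right_diff_distrib)
      qed
      ultimately show ?thesis unfolding PA_def by simp
    qed
    finally show ?thesis by simp
  qed
  \<comment> \<open>\<open>H0\<close> with x and y exchanged, with C eliminated in favour of P
    through \<open>P\<close> and the evenness \<open>ce\<close>.\<close>
  have Q2: "2 * Qg c x y = PA a (x + y) y + PA a (x - y) y" for x y
  proof -
    have "(Qg c y (y + x) + Qg c x y - Qg c (y + x) y) + (Qg c y (y - x) + Qg c (- x) y - Qg c (y - x) y) = 0"
      using H0[of y x] unfolding H by simp
    then show ?thesis unfolding ce P using ce[of "x - y" y] ce[of "y - x" y] P[of "x - y" y] P[of "y - x" y] PA_flip[of a x y y]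
      by (simp add: add.commute)
  qed
  show "cf a j = c j" if "even j" "j \<le> N"
  proof -
    have "cf a j + (-1) ^ j * cf a j = 2 * c j"
    proof (rule Qg_inj[OF _ that(2), where c = "\<lambda>j. cf a j + (-1) ^ j * cf a j" and d = "\<lambda>j. 2 * c j"])
      fix x y show "Qg (\<lambda>j. cf a j + (-1) ^ j * cf a j) x y = Qg (\<lambda>j. 2 * c j) x y"
        unfolding Qg_cf_even Qg_cmult Q2 ..
    qed
    then show ?thesis using that(1) by simp
  qed
  \<comment> \<open>Up to the sign of y and the symmetries of P this is \<open>Ef a\<close>. The
    antisymmetry \<open>Ea\<close> and the relation \<open>Et\<close> hold for every even
    antisymmetric P; the oddness \<open>Eo\<close> is where \<open>Q2\<close> enters.\<close>
  define E where "E x y = PA a x y - PA a (x + y) y + PA a (x + y) x" for x y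
  have P2: "2 * PA a x y = PA a (x + y) y + PA a (x - y) y - PA a (x + y) x - PA a (x - y) x" for x y
    using Q2[of x y] Q2[of y x] P[of x y] PA_flip[of a x y x] by (simp add: add.commute)
  have Eo: "E x (- y) = - E x y" for x y using P2[of x y] by (simp add: E_def PA_minus)
  have Ea: "E y x = - E x y" for x y using PA_sym[of a y x] by (simp add: E_def add.commute)
  have Et: "E x (- (x + y)) = - E x y" for x y
  proof -
    have "x + - (x + y) = - y" by simp
    then show ?thesis unfolding E_def PA_minus
      using PA_sym[of a x "x + y"] PA_sym[of a y x] PA_sym[of a y "x + y"] by (simp only: PA_minus)
  qed
  \<comment> \<open>Oddness turns \<open>Et\<close> into a period x in the variable y; with the zero
    at y = 0 this gives infinitely many zeros of a polynomial.\<close>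
  have Ep: "E x (x + y) = E x y" for x y using Et[of x y] Eo[of x "x + y"] by simp
  have E0: "E x 0 = 0" for x using Eo[of x 0] by simp
  have En: "E x (of_nat n * x) = 0" for x n
  proof (induction n)
    case (Suc n)
    have "E x (of_nat (Suc n) * x) = E x (x + of_nat n * x)" by (simp add: algebra_simps)
    then show ?case using Suc Ep[of x "of_nat n * x"] by simp
  qed (simp add: E0)
  have EE: "E x y = 0" for x y
  proof (cases "x = 0")
    case True
    then show ?thesis using E0[of y] Ea[of y 0] by simp
  next
    case False
    have "polyfun (\<lambda>y. E x y)" unfolding E_def PA_def
      by (intro polyfun_add polyfun_diff polyfun_sum polyfun_mult polyfun_power polyfun_const polyfun_id)
    then show ?thesis by (rule polyfun_zero[OF _ infinite_multiples[OF False]]) (use En in blast)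
  qed
  show "Ef a x y = 0"
    using EE[of x "- y"] PA_sym[of a y x] by (simp add: E_def Ef_def PA_minus)
qed

end

section \<open>The correspondence\<close>

text \<open>Here e j stands for the value of Z(j+1, N-j+1) and s b for that of Z(b+1) Z(N-b+1).
  Weighting stuffle minus shuffle by (-1)^b \<open>cf a b\<close> gives, by \<open>cf_rel\<close>,
  three times the even part minus the odd part.\<close>

lemma (in even_pol) even_sum_zero:
  assumes E: "\<And>x y. Ef a x y = 0"
    and st: "\<And>b. 1 \<le> b \<Longrightarrow> b < N \<Longrightarrow> s b = e b + e (N - b)"
    and sh: "\<And>b. 1 \<le> b \<Longrightarrow> b < N \<Longrightarrow> s b = (\<Sum>j\<le>N. (of_nat (j choose b) + of_nat (j choose (N - b))) * e j)"
    and od: "\<And>b. 1 \<le> b \<Longrightarrow> b < N \<Longrightarrow> odd b \<Longrightarrow> s b = (0 :: rat)"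
  shows "(\<Sum>j | even j \<and> 2 \<le> j \<and> j \<le> N - 2. cf a j * e j) = 0"
proof -
  let ?c = "cf a"
  define w where "w b = (-1) ^ b * ?c b" for b
  define g where "g b = (-1) ^ b * (?c b + ?c (N - b))" for b
  have sg: "(-1 :: rat) ^ (N - b) = (-1) ^ b" if "b \<le> N" for b
    using that N_even by (cases "even b") auto
  have g: "g b = w b + w (N - b)" if "b \<le> N" for b
    using sg[OF that] by (simp add: g_def w_def algebra_simps)
  have w0: "w 0 = 0" "w N = 0" by (simp_all add: w_def cf_0 cf_N)
  have rv: "(\<Sum>b\<le>N. h (N - b)) = (\<Sum>b\<le>N. h b)" for h :: "nat \<Rightarrow> rat"
    by (rule sum_atMost_rev[symmetric])
  have L: "(\<Sum>b\<le>N. w b * (e b + e (N - b))) = (\<Sum>b\<le>N. g b * e b)"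
  proof -
    have "(\<Sum>b\<le>N. w b * (e b + e (N - b))) = (\<Sum>b\<le>N. w b * e b) + (\<Sum>b\<le>N. w b * e (N - b))"
      by (simp add: distrib_left sum.distrib)
    also have "(\<Sum>b\<le>N. w b * e (N - b)) = (\<Sum>b\<le>N. w (N - b) * e b)"
      using rv[of "\<lambda>b. w (N - b) * e b"] by simp
    finally show ?thesis by (simp add: g distrib_right sum.distrib)
  qed
  have R: "(\<Sum>b\<le>N. w b * (\<Sum>j\<le>N. (of_nat (j choose b) + of_nat (j choose (N - b))) * e j))
      = (\<Sum>j\<le>N. (\<Sum>b\<le>N. of_nat (j choose b) * g b) * e j)"
  proof -
    have "(\<Sum>b\<le>N. w b * (\<Sum>j\<le>N. (of_nat (j choose b) + of_nat (j choose (N - b))) * e j))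
      = (\<Sum>j\<le>N. (\<Sum>b\<le>N. w b * (of_nat (j choose b) + of_nat (j choose (N - b)))) * e j)"
      unfolding sum_distrib_left sum_distrib_right by (subst sum.swap) (simp only: mult.assoc)
    moreover have "(\<Sum>b\<le>N. w b * (of_nat (j choose b) + of_nat (j choose (N - b)))) = (\<Sum>b\<le>N. of_nat (j choose b) * g b)" for j
    proof -
      have "(\<Sum>b\<le>N. w b * (of_nat (j choose b) + of_nat (j choose (N - b))))
        = (\<Sum>b\<le>N. of_nat (j choose b) * w b) + (\<Sum>b\<le>N. w b * of_nat (j choose (N - b)))"
        by (simp add: distrib_left sum.distrib mult.commute)
      also have "(\<Sum>b\<le>N. w b * of_nat (j choose (N - b))) = (\<Sum>b\<le>N. of_nat (j choose b) * w (N - b))"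
        using rv[of "\<lambda>b. of_nat (j choose b) * w (N - b)"] by (simp add: mult.commute)
      finally show ?thesis
        by (simp add: g distrib_left sum.distrib)
    qed
    ultimately show ?thesis by simp
  qed
  have "(\<Sum>b\<le>N. w b * (e b + e (N - b))) = (\<Sum>b\<le>N. w b * (\<Sum>j\<le>N. (of_nat (j choose b) + of_nat (j choose (N - b))) * e j))"
  proof (intro sum.cong refl)
    \<comment> \<open>The products at b = 0 and b = N involve a divergent factor, but their weights
      \<open>cf a 0\<close> and \<open>cf a N\<close> are zero.\<close>
    fix b assume "b \<in> {..N}"
    then consider "b = 0" | "b = N" | "1 \<le> b" "b < N" by force
    then show "w b * (e b + e (N - b)) = w b * (\<Sum>j\<le>N. (of_nat (j choose b) + of_nat (j choose (N - b))) * e j)"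
      by cases (use w0 st sh in auto)
  qed
  then have "(\<Sum>j\<le>N. (g j - (\<Sum>b\<le>N. of_nat (j choose b) * g b)) * e j) = 0"
    unfolding L R by (simp add: left_diff_distrib sum_subtractf)
  moreover have "g j - (\<Sum>b\<le>N. of_nat (j choose b) * g b) = (2 * (-1) ^ j + 1) * ?c j" if "j \<le> N" for j
    unfolding g_def by (rule cf_rel[OF E that])
  ultimately have 1: "(\<Sum>j\<le>N. (2 * (-1) ^ j + 1) * ?c j * e j) = 0" by simp
  \<comment> \<open>The odd part vanishes by itself: \<open>cf_odd\<close> pairs j with N - j, and e
    j + e (N - j) = s j is zero for odd j.\<close>
  define u where "u j = (if odd j then ?c j * e j else 0)" for j
  have 2: "(\<Sum>j\<le>N. u j) = 0"
  proof -
    have "(\<Sum>j\<le>N. u j) + (\<Sum>j\<le>N. u (N - j)) = (\<Sum>j\<le>N. if odd j then ?c j * (e j + e (N - j)) else 0)"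
      unfolding sum.distrib[symmetric]
    proof (intro sum.cong refl)
      fix j assume j: "j \<in> {..N}"
      show "u j + u (N - j) = (if odd j then ?c j * (e j + e (N - j)) else 0)"
        using j N_even cf_odd[OF E, of j] by (auto simp: u_def algebra_simps)
    qed
    also have "\<dots> = 0"
    proof (intro sum.neutral ballI)
      fix j assume j: "j \<in> {..N}"
      show "(if odd j then ?c j * (e j + e (N - j)) else 0) = 0"
      proof (cases "odd j")
        case True
        then have "j \<noteq> 0" "j \<noteq> N" using True N_even by (metis even_zero, metis)
        then have "1 \<le> j" "j < N" using j by auto
        then have "e j + e (N - j) = 0" using st[of j] od[of j] True by simp
        then show ?thesis by simp
      qed simp
    qed
    finally show ?thesis unfolding rv[of u] by simp
  qed
  have "(\<Sum>j\<le>N. 3 * (if even j then ?c j * e j else 0)) = (\<Sum>j\<le>N. (2 * (-1) ^ j + 1) * ?c j * e j) + (\<Sum>j\<le>N. u j)"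
    unfolding sum.distrib[symmetric] by (intro sum.cong refl) (auto simp: u_def)
  then have 3: "(\<Sum>j\<le>N. if even j then ?c j * e j else 0) = 0"
    unfolding 1 2 sum_distrib_left[symmetric] by simp
  have "(\<Sum>j\<le>N. if even j then ?c j * e j else 0) = (\<Sum>j | even j \<and> 2 \<le> j \<and> j \<le> N - 2. ?c j * e j)"
  proof (rule sum.mono_neutral_cong_right)
    show "\<forall>j\<in>{..N} - {j. even j \<and> 2 \<le> j \<and> j \<le> N - 2}. (if even j then ?c j * e j else 0) = 0"
    proof
      fix j assume j: "j \<in> {..N} - {j. even j \<and> 2 \<le> j \<and> j \<le> N - 2}"
      show "(if even j then ?c j * e j else 0) = 0"
      proof (cases "even j")
        case True
        then have "\<not> (2 \<le> j \<and> j \<le> N - 2)" "j \<le> N" using j by auto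
        then have "j = 0 \<or> j = N" using True N_even by presburger
        then show ?thesis using cf_0 cf_N by auto
      qed simp
    qed
  qed auto
  then show ?thesis using 3 by simp
qed

lemma index_word_1: "index_word [Suc i] = xs i @ [Ly]" and index_word_2: "index_word [Suc i, Suc j] = xs i @ Ly # xs j @ [Ly]"
  by (simp_all add: index_Cons y_word_def)

context fz_functional
begin

lemma L_Z: "L (Z ts) = LS (Zs (index_word ts))" by (simp add: LS_def Z_word_Zs)

lemma LS_Zs_Zs: "LS (Zs u * Zs v) = ev (\<lambda>w. LS (Zs w)) (shuffle_word u v)"
proof -
  have "Zs u * Zs v = rS (Sh (shuffle_word u v))"
    by (simp only: Zs_def rS_hom[symmetric] Sh_hom(6)[symmetric] shuffle_mon)
  moreover have "LS (rS (Sh p)) = ev (\<lambda>w. LS (Zs w)) p" for p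
    unfolding Zs_def by (rule functional_eq_ev) (simp_all add: Sh_hom rS_lin LS_lin)
  ultimately show ?thesis by (simp only:)
qed

text \<open>For 1 <= b < N both factors are convergent, so Z* and Z agree on them. The stuffle term
  Z(k) disappears because L kills it, and odd b means even arguments b + 1, to which
  \<open>euler\<close> applies.\<close>

lemma depth2:
  assumes Lk: "L (Z [Suc (Suc N)]) = 0" and b: "1 \<le> b" "b < N"
  defines "e \<equiv> \<lambda>j. LS (Zs (xs j @ Ly # xs (N - j) @ [Ly]))"
    and "s \<equiv> \<lambda>b. LS (zz (index_word [Suc b]) * zz (index_word [Suc (N - b)]))"
  shows "s b = e b + e (N - b)"
    and "s b = (\<Sum>j\<le>N. (of_nat (j choose b) + of_nat (j choose (N - b))) * e j)"
    and "even N \<Longrightarrow> odd b \<Longrightarrow> s b = 0"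
proof -
  have z1: "zz (xs i @ [Ly]) = Zs (xs i @ [Ly])" if "1 \<le> i" for i using that by (cases i) simp_all
  have z2: "zz (xs i @ Ly # w) = Zs (xs i @ Ly # w)" if "1 \<le> i" for i w using that by (cases i) simp_all
  have lk0: "lz [Suc (Suc N)] = 0" using Lk z1[of "Suc N"] by (simp add: LS_def Z_word_Zs lz_def index_word_1)
  have Nb: "1 \<le> N - b" "N - (N - b) = b" "b + (N - b) = N" using b by auto
  have "s b = st lz [Suc b] [Suc (N - b)]" unfolding s_def by (rule LS_zz_zz) auto
  also have "\<dots> = lz [Suc b, Suc (N - b)] + lz [Suc (N - b), Suc b] + lz [Suc (Suc N)]"
    using Nb by simp
  also have "\<dots> = e b + e (N - b)"
    unfolding lk0 unfolding lz_def index_word_2 e_def z2[OF b(1)] z2[OF Nb(1)] Nb(2) by simp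
  finally show "s b = e b + e (N - b)" .
  have "s b = LS (Zs (xs b @ [Ly]) * Zs (xs (N - b) @ [Ly]))"
    unfolding s_def index_word_1 z1[OF b(1)] z1[OF Nb(1)] ..
  also have "\<dots> = (\<Sum>j\<le>N. (of_nat (j choose b) + of_nat (j choose (N - b))) * e j)"
    unfolding LS_Zs_Zs shuffle_depth1 Nb(3) e_def ..
  finally show "s b = (\<Sum>j\<le>N. (of_nat (j choose b) + of_nat (j choose (N - b))) * e j)" .
  assume "even N" "odd b"
  moreover have "Suc (Suc N) - Suc b = Suc (N - b)" using b by simp
  ultimately show "s b = 0" using euler[of "Suc (Suc N)" "Suc b"] lk0 b by (simp add: s_def)
qed

end

lemma ds_deg_subspace: "0 \<in> ds_deg n" "p \<in> ds_deg n \<Longrightarrow> q \<in> ds_deg n \<Longrightarrow> p + q \<in> ds_deg n" "p \<in> ds_deg n \<Longrightarrow> qscale c p \<in> ds_deg n"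
proof -
  have "ev (lk (p + q)) r = ev (lk p) r + ev (lk q) r" for p q r :: qxy by (metis ev_lk_commute ev_add)
  moreover have "ev (lk (qscale c p)) r = c * ev (lk p) r" for c and p r :: qxy by (metis ev_lk_commute ev_qscale)
  moreover have "ev (lk 0) r = 0" for r :: qxy by (simp add: ev_def)
  ultimately show "0 \<in> ds_deg n" "p \<in> ds_deg n \<Longrightarrow> q \<in> ds_deg n \<Longrightarrow> p + q \<in> ds_deg n" "p \<in> ds_deg n \<Longrightarrow> qscale c p \<in> ds_deg n"
    by (auto simp: ds_deg_def ds_def Lie_ge3_def pairing_ev homog_add homog_qscale qvec.span_add qvec.span_scale qvec.span_zero)
qed

lemma dpt3_depth: "dpt d p \<longleftrightarrow> p = 0 \<or> d \<le> depth p"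
proof (cases "p = 0")
  case False
  then have "Poly_Mapping.keys p \<noteq> {}" by simp
  then show ?thesis using False by (simp add: dpt_def depth_def Min_ge_iff in_keys_iff[symmetric]) blast
qed (simp add: dpt_def)

lemma keys_subset_iff: "Poly_Mapping.keys p \<subseteq> S \<longleftrightarrow> (\<forall>i. i \<notin> S \<longrightarrow> lk p i = 0)"
  by (auto simp: in_keys_iff)

lemma T2_sf_odd:
  assumes "odd_ds f n" "odd_ds g n'" "lk f (xs (n - 1) @ [Ly]) = 1" "lk g (xs (n' - 1) @ [Ly]) = 1"
  shows "T2 A B C (sf f g) = (A - B) ^ (n - 1) * (B - C) ^ (n' - 1) + (A - C) ^ (n' - 1) * ((B - C) ^ (n - 1) - (A - B) ^ (n - 1))"
  unfolding T2_sf[OF odd_ds.dpt_f[OF assms(1)] odd_ds.dpt_f[OF assms(2)]]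
    odd_ds.T1_f[OF assms(1,3)] odd_ds.T1_f[OF assms(2,4)] by simp

text \<open>Setting C = 0 keeps only depth-two words ending in y, and with B = 1 the remaining
  variable A records the number of leading x.\<close>

lemma sf_coeffs:
  assumes o: "odd_ds f (Suc al)" "odd_ds g (Suc be)" "lk f (xs al @ [Ly]) = 1" "lk g (xs be @ [Ly]) = 1"
    and N: "al + be = N" and j: "j \<le> N"
  shows "lk (sf f g) (xs j @ Ly # xs (N - j) @ [Ly])
    = (-1) ^ j * of_nat (al choose j) + (if j = be then 1 else 0) - (if be \<le> j then (-1) ^ (j - be) * of_nat (al choose (j - be)) else 0)"
proof -
  interpret two_ds f "Suc al" g "Suc be" using o(1,2) by (simp add: two_ds_def)
  define v where "v j = lk (sf f g) (xs j @ Ly # xs (N - j) @ [Ly])" for j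
  define t where "t j = (-1) ^ j * of_nat (al choose j) + (if j = be then 1 else 0) - (if be \<le> j then (-1) ^ (j - be) * of_nat (al choose (j - be)) else 0 :: rat)" for j
  have h: "sf f g \<in> homog (Suc (Suc N))" using W_homog N by simp
  have ev: "even al" using F.n_odd by simp
  have "(\<Sum>j\<le>N. (v j - t j) * A ^ j) = 0" for A
  proof -
    have p: "(A - 1) ^ al = (\<Sum>i\<le>al. (-1) ^ i * of_nat (al choose i) * A ^ i)"
    proof -
      have "(A - 1) ^ al = (- 1) ^ al * (A - 1) ^ al" using ev by simp
      also have "\<dots> = (- A + 1) ^ al" by (simp flip: power_mult_distrib)
      also have "\<dots> = (\<Sum>i\<le>al. of_nat (al choose i) * (- A) ^ i * 1 ^ (al - i))" by (rule binomial_ring)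
      finally show ?thesis by (simp add: power_minus[of A] mult_ac)
    qed
    have "T2 A 1 0 (sf f g) = (\<Sum>r\<le>N. v r * A ^ r)"
      unfolding T2_expand[OF h]
    proof (intro sum.cong refl)
      fix r assume "r \<in> {..N}"
      have "(\<Sum>s\<le>N - r. lk (sf f g) (xs r @ Ly # xs s @ Ly # xs (N - r - s)) * (A ^ r * 1 ^ s * 0 ^ (N - r - s)))
        = (\<Sum>s\<le>N - r. if s = N - r then v r * A ^ r else 0)"
        by (intro sum.cong refl) (auto simp: v_def)
      then show "(\<Sum>s\<le>N - r. lk (sf f g) (xs r @ Ly # xs s @ Ly # xs (N - r - s)) * (A ^ r * 1 ^ s * 0 ^ (N - r - s))) = v r * A ^ r"
        by simp
    qed
    moreover have "T2 A 1 0 (sf f g) = (A - 1) ^ al + A ^ be - A ^ be * (A - 1) ^ al"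
      using T2_sf_odd[OF o(1,2), of A 1 0] o(3,4) by (simp add: right_diff_distrib)
    moreover have "(A - 1) ^ al = (\<Sum>j\<le>N. (-1) ^ j * of_nat (al choose j) * A ^ j)"
      unfolding p by (rule sum.mono_neutral_left) (use N in \<open>auto simp: binomial_eq_0\<close>)
    moreover have "A ^ be * (A - 1) ^ al = (\<Sum>j\<le>N. (if be \<le> j then (-1) ^ (j - be) * of_nat (al choose (j - be)) else 0) * A ^ j)"
    proof -
      have "A ^ be * (A - 1) ^ al = (\<Sum>i\<le>al. (-1) ^ i * of_nat (al choose i) * A ^ (be + i))"
        unfolding p by (simp add: sum_distrib_left power_add mult_ac)
      also have "\<dots> = (\<Sum>j\<in>{be..N}. (-1) ^ (j - be) * of_nat (al choose (j - be)) * A ^ j)"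
        by (rule sum.reindex_bij_witness[of _ "\<lambda>j. j - be" "\<lambda>i. be + i"]) (use N in auto)
      also have "\<dots> = (\<Sum>j\<le>N. (if be \<le> j then (-1) ^ (j - be) * of_nat (al choose (j - be)) else 0) * A ^ j)"
        by (rule sum.mono_neutral_cong_left) auto
      finally show ?thesis .
    qed
    moreover have "A ^ be = (\<Sum>j\<le>N. (if j = be then 1 else 0) * A ^ j)"
    proof -
      have "(\<Sum>j\<le>N. (if j = be then 1 else 0) * A ^ j) = (\<Sum>j\<le>N. if j = be then A ^ j else 0)"
        by (intro sum.cong refl) auto
      then show ?thesis using N by simp
    qed
    ultimately have "(\<Sum>r\<le>N. v r * A ^ r) = (\<Sum>j\<le>N. t j * A ^ j)"
      by (simp add: t_def distrib_right left_diff_distrib sum.distrib sum_subtractf)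
    then show ?thesis by (simp add: left_diff_distrib sum_subtractf)
  qed
  then have "v j - t j = 0" using j by (rule poly_coeffs_zero)
  then show ?thesis by (simp add: v_def t_def)
qed

locale odd_generators =
  fixes k :: nat and f :: "nat \<Rightarrow> qxy"
  assumes k12: "12 \<le> k" and k_even: "even k"
    and f_ds: "\<And>n. odd n \<Longrightarrow> 3 \<le> n \<Longrightarrow> f n \<in> ds_deg n"
    and f_1: "\<And>n. odd n \<Longrightarrow> 3 \<le> n \<Longrightarrow> lk (f n) (xs (n - 1) @ [Ly]) = 1"
begin

abbreviation "N \<equiv> k - 2"
abbreviation "m \<equiv> (k - 4) div 4"
abbreviation "I \<equiv> {r \<in> {3..k - 3}. odd r}"

sublocale even_pol N m
proof
  show "even N" "2 \<le> N" using k12 k_even by auto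
  show "m = (N div 2 - 1) div 2" using k12 k_even by presburger
qed

lemma odd_f: "odd n \<Longrightarrow> 3 \<le> n \<Longrightarrow> odd_ds (f n) n" by (simp add: odd_ds_def f_ds)

lemma pair_ok:
  assumes "i \<in> {1..m}"
  shows "odd (2 * i + 1)" "3 \<le> 2 * i + 1" "odd (k - 2 * i - 1)" "3 \<le> k - 2 * i - 1" "2 * i + 1 + (k - 2 * i - 1) = k"
    "k - 2 * i - 1 - 1 = N - 2 * i"
proof -
  have "1 \<le> i" "2 * i + 4 \<le> k" using assms m4 by auto
  then show "odd (2 * i + 1)" "3 \<le> 2 * i + 1" "odd (k - 2 * i - 1)" "3 \<le> k - 2 * i - 1" "2 * i + 1 + (k - 2 * i - 1) = k"
    "k - 2 * i - 1 - 1 = N - 2 * i" using k_even by auto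
qed

definition comb :: "(nat \<Rightarrow> rat) \<Rightarrow> qxy" where
  "comb a = (\<Sum>i = 1..m. qscale (a i) (poisson (f (2 * i + 1)) (f (k - 2 * i - 1))))"

lemma T2_comb: "T2 A B C (comb a) = Ef a (A - C) (B - C)"
proof -
  define p where "p i x y = x ^ (2 * i) * y ^ (N - 2 * i) - x ^ (N - 2 * i) * y ^ (2 * i)" for i and x y :: rat
  have P: "PA a x y = (\<Sum>i = 1..m. a i * p i x y)" for x y by (simp add: PA_def p_def)
  have q: "T2 A B C (poisson (f (2 * i + 1)) (f (k - 2 * i - 1))) = p i ((A - C) - (B - C)) (B - C) + p i (B - C) (A - C) - p i ((A - C) - (B - C)) (A - C)"
    if "i \<in> {1..m}" for i
  proof -
    note o = pair_ok[OF that]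
    have 1: "odd_ds (f (2 * i + 1)) (2 * i + 1)" "odd_ds (f (k - 2 * i - 1)) (k - 2 * i - 1)"
      by (rule odd_f[OF o(1,2)], rule odd_f[OF o(3,4)])
    have e: "2 * i + 1 - 1 = 2 * i" "(A - C) - (B - C) = A - B" by simp_all
    show ?thesis
      unfolding poisson_sf ev_diff T2_sf_odd[OF 1 f_1[OF o(1,2)] f_1[OF o(3,4)]] T2_sf_odd[OF 1(2,1) f_1[OF o(3,4)] f_1[OF o(1,2)]] o(6) e p_def
      by (simp add: algebra_simps)
  qed
  have "T2 A B C (comb a) = (\<Sum>i = 1..m. a i * T2 A B C (poisson (f (2 * i + 1)) (f (k - 2 * i - 1))))"
    unfolding comb_def ev_sum ev_qscale ..
  also have "\<dots> = (\<Sum>i = 1..m. a i * p i ((A - C) - (B - C)) (B - C) + a i * p i (B - C) (A - C) - a i * p i ((A - C) - (B - C)) (A - C))"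
    by (intro sum.cong refl) (simp only: q right_diff_distrib distrib_left)
  also have "\<dots> = Ef a (A - C) (B - C)" by (simp only: Ef_def P sum.distrib sum_subtractf)
  finally show ?thesis .
qed

lemma comb_ds: "comb a \<in> ds_deg k"
proof -
  have s: "(\<Sum>i\<in>J. g i) \<in> ds_deg k" if "\<And>i. i \<in> J \<Longrightarrow> g i \<in> ds_deg k" for J :: "nat set" and g
    using that by (induction J rule: infinite_finite_induct) (auto intro: ds_deg_subspace)
  show ?thesis unfolding comb_def
  proof (rule s, rule ds_deg_subspace(3))
    fix i assume i: "i \<in> {1..m}"
    show "poisson (f (2 * i + 1)) (f (k - 2 * i - 1)) \<in> ds_deg k"
      using poisson_ds[OF odd_f[OF pair_ok(1,2)[OF i]] odd_f[OF pair_ok(3,4)[OF i]]] unfolding pair_ok(5)[OF i] .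
  qed
qed

lemma comb_dpt2: "dpt 2 (comb a)"
  unfolding comb_def
proof (rule dpt_sum)
  fix i assume i: "i \<in> {1..m}"
  have "dpt 2 (poisson (f (2 * i + 1)) (f (k - 2 * i - 1)))"
    unfolding poisson_sf
    by (intro dpt_diff sf_dpt[OF odd_f[OF pair_ok(1,2)[OF i]] odd_f[OF pair_ok(3,4)[OF i]]] sf_dpt[OF odd_f[OF pair_ok(3,4)[OF i]] odd_f[OF pair_ok(1,2)[OF i]]])
  then show "dpt 2 (qscale (a i) (poisson (f (2 * i + 1)) (f (k - 2 * i - 1))))" by (simp add: dpt_def)
qed

lemma comb_dpt3: "dpt 3 (comb a) \<longleftrightarrow> (\<forall>x y. Ef a x y = 0)"
proof
  assume "dpt 3 (comb a)"
  then show "\<forall>x y. Ef a x y = 0" using T2_comb[of _ _ 0 a] T2_dpt by simp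
next
  assume E: "\<forall>x y. Ef a x y = 0"
  have h: "comb a \<in> homog (Suc (Suc N))" using ds_degD(1)[OF comb_ds[of a]] k12 by (simp add: Suc_diff_Suc numeral_2_eq_2)
  show "dpt 3 (comb a)" unfolding dpt_def
  proof (intro allI impI)
    fix w assume w: "lk (comb a) w \<noteq> 0"
    then have "2 \<le> count_list w Ly" using comb_dpt2[of a] by (simp add: dpt_def)
    moreover have "count_list w Ly \<noteq> 2"
    proof
      assume "count_list w Ly = 2"
      then obtain r s t where rst: "w = xs r @ Ly # xs s @ Ly # xs t" using count2_form by blast
      have "length w = Suc (Suc N)" using h w by (simp add: homog_def in_keys_iff)
      then have "t = N - r - s" "r + s \<le> N" using rst by auto
      then show False using T2_zero_coeff[OF h, of r s] w rst E by (simp add: T2_comb)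
    qed
    ultimately show "3 \<le> count_list w Ly" by simp
  qed
qed

lemma R_Lie_iff: "a \<in> R_Lie f k \<longleftrightarrow> Poly_Mapping.keys a \<subseteq> {1..m} \<and> (\<forall>x y. Ef (lk a) x y = 0)"
  unfolding R_Lie_def comb_def[symmetric] ds_deg_depth_def comb_dpt3[symmetric] dpt3_depth using comb_ds[of "lk a"] by simp

lemma PA_lin: "PA (lk (a + b)) x y = PA (lk a) x y + PA (lk b) x y" "PA (lk (qscale c a)) x y = c * PA (lk a) x y" "PA (lk 0) x y = 0"
  by (simp_all add: PA_def lookup_add distrib_right sum.distrib sum_distrib_left mult.assoc)
lemma cf_lin: "cf (lk (a + b)) j = cf (lk a) j + cf (lk b) j" "cf (lk (qscale c a)) j = c * cf (lk a) j"
  by (simp_all add: cf_def lookup_add distrib_right sum.distrib sum_distrib_left mult.assoc add_divide_distrib)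

lemma Ef_lin: "Ef (lk (a + b)) x y = Ef (lk a) x y + Ef (lk b) x y" "Ef (lk (qscale c a)) x y = c * Ef (lk a) x y" "Ef (lk 0) x y = 0"
  by (simp_all add: Ef_def PA_lin algebra_simps)

lemma subspace_R_Lie: "qvec.subspace (R_Lie f k)"
  by (rule qvec.subspaceI) (auto simp: R_Lie_iff keys_subset_iff Ef_lin lookup_add)

definition Phi :: "(nat \<Rightarrow>\<^sub>0 rat) \<Rightarrow> (nat \<Rightarrow>\<^sub>0 rat)" where
  "Phi a = (\<Sum>r\<in>I. Poly_Mapping.single r (cf (lk a) (r - 1)))"

lemma lk_Phi: "lk (Phi a) r = (if r \<in> I then cf (lk a) (r - 1) else 0)"
  by (simp add: Phi_def lk_sum lookup_single when_def)

lemma Phi_lin: "Phi (a + b) = Phi a + Phi b" "Phi (qscale c a) = qscale c (Phi a)"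
  by (rule poly_mapping_eqI; simp add: lk_Phi lookup_add cf_lin)+

lemma linear_Phi: "Vector_Spaces.linear qscale qscale Phi"
  by unfold_locales (simp_all add: Phi_lin qvec.scale_right_distrib qvec.scale_left_distrib)

lemma P_poly_expand: "P_poly k a (U + V) V = (\<Sum>j\<le>N. polC (of_nat (N choose j) * cf (lk a) j) * U ^ j * V ^ (N - j))"
proof -
  have s: "(U + V) ^ (2 * i) * V ^ (N - 2 * i) - (U + V) ^ (N - 2 * i) * V ^ (2 * i)
      = (\<Sum>j\<le>N. (of_nat ((2 * i) choose j) - of_nat ((N - 2 * i) choose j)) * U ^ j * V ^ (N - j))" if "i \<in> {1..m}" for i
  proof -
    have "2 * i \<le> N" "N - (N - 2 * i) = 2 * i" using that m4 by auto
    then show ?thesis using binom_shift[of "2 * i" N U V] binom_shift[of "N - 2 * i" N U V]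
      by (simp add: sum_subtractf left_diff_distrib)
  qed
  have pc: "polC c * (of_nat p - of_nat q) = polC (c * (of_nat p - of_nat q))" for c p q
    by (simp add: of_nat_poly)
  have ps: "polC (\<Sum>i\<in>J. h i) = (\<Sum>i\<in>J. polC (h i))" for J :: "nat set" and h
  proof (induction J rule: infinite_finite_induct)
    case (insert x F)
    have "polC (u + v) = polC u + polC v" for u v by simp
    then show ?case unfolding sum.insert[OF insert.hyps] by (simp only: insert.IH)
  qed simp_all
  have "P_poly k a (U + V) V = (\<Sum>i = 1..m. polC (lk a i) * (\<Sum>j\<le>N. (of_nat ((2 * i) choose j) - of_nat ((N - 2 * i) choose j)) * U ^ j * V ^ (N - j)))"
    unfolding P_poly_def by (intro sum.cong refl) (simp only: s)
  also have "\<dots> = (\<Sum>i = 1..m. \<Sum>j\<le>N. polC (lk a i * (of_nat ((2 * i) choose j) - of_nat ((N - 2 * i) choose j))) * (U ^ j * V ^ (N - j)))"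
    unfolding sum_distrib_left by (simp only: pc[symmetric] mult.assoc)
  also have "\<dots> = (\<Sum>j\<le>N. polC (\<Sum>i = 1..m. lk a i * (of_nat ((2 * i) choose j) - of_nat ((N - 2 * i) choose j))) * (U ^ j * V ^ (N - j)))"
    by (subst sum.swap) (simp only: ps sum_distrib_right)
  also have "\<dots> = (\<Sum>j\<le>N. polC (of_nat (N choose j) * cf (lk a) j) * U ^ j * V ^ (N - j))"
    by (intro sum.cong refl) (simp add: cf_def binomial_eq_0_iff mult.assoc)
  finally show ?thesis .
qed

text \<open>All exponents 2i and N - 2i are at most N - 2. So ending the expansion at r = k - 3,
  that is j = N - 2, loses no term.\<close>

lemma cf_N1: "cf a (N - 1) = 0"
proof -
  have "(2 * i) choose (N - 1) = 0 \<and> (N - 2 * i) choose (N - 1) = 0" if "i \<in> {1..m}" for i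
    using that m4 by (auto intro!: binomial_eq_0)
  then have "(\<Sum>i = 1..m. a i * (of_nat ((2 * i) choose (N - 1)) - of_nat ((N - 2 * i) choose (N - 1)))) = 0"
    by (intro sum.neutral ballI) (simp only: of_nat_0 diff_self mult_zero_right)
  then show ?thesis by (simp only: cf_def div_0)
qed

lemma P_poly_q:
  "P_poly k a (polX + polY) polY = (\<Sum>r = 1..k - 3. polC (of_nat ((k - 2) choose (r - 1)) * cf (lk a) (r - 1)) * polX ^ (r - 1) * polY ^ (k - r - 1))"
proof -
  have "(\<Sum>j\<le>N. polC (of_nat (N choose j) * cf (lk a) j) * U ^ j * V ^ (N - j))
     = (\<Sum>r = 1..k - 3. polC (of_nat ((k - 2) choose (r - 1)) * cf (lk a) (r - 1)) * U ^ (r - 1) * V ^ (k - r - 1))" for U V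
  proof -
    have "(\<Sum>j\<le>N. polC (of_nat (N choose j) * cf (lk a) j) * U ^ j * V ^ (N - j)) = (\<Sum>j\<le>k - 4. polC (of_nat (N choose j) * cf (lk a) j) * U ^ j * V ^ (N - j))"
    proof (rule sum.mono_neutral_right)
      show "\<forall>j\<in>{..N} - {..k - 4}. polC (of_nat (N choose j) * cf (lk a) j) * U ^ j * V ^ (N - j) = 0"
      proof
        fix j assume "j \<in> {..N} - {..k - 4}"
        then have "j = N \<or> j = N - 1" using k12 by auto
        then show "polC (of_nat (N choose j) * cf (lk a) j) * U ^ j * V ^ (N - j) = 0" using cf_N cf_N1 by auto
      qed
    qed auto
    also have "\<dots> = (\<Sum>r = 1..k - 3. polC (of_nat ((k - 2) choose (r - 1)) * cf (lk a) (r - 1)) * U ^ (r - 1) * V ^ (k - r - 1))"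
      by (rule sum.reindex_bij_witness[of _ "\<lambda>r. r - 1" "\<lambda>j. j + 1"]) (use k12 in auto)
    finally show ?thesis .
  qed
  then show ?thesis unfolding P_poly_expand .
qed

lemma Z_h0: "Z ts \<in> h0" unfolding Z_word_Zs Zs_def by (rule h0_rS)

text \<open>Duality: the unspecified multiple of Z(k) is absorbed by adding Z(k) to the generators
  of the relations, and membership in a span is tested by the functionals that vanish on its
  generators.\<close>

lemma R_zeta_iff: "q \<in> R_zeta k \<longleftrightarrow> Poly_Mapping.keys q \<subseteq> I \<and>
    (\<forall>L. fz_functional L \<longrightarrow> L (Z [k]) = 0 \<longrightarrow> (\<Sum>r\<in>I. lk q r * L (Z [r, k - r])) = 0)"
proof -
  define G where "G = {shuffle (Zstar (mono_word (index_word rs))) (Zstar (mono_word (index_word ss)))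
        - Zstar (stuffle rs ss) | rs ss. is_index rs \<and> is_index ss}"
  define S where "S = (\<Sum>r\<in>I. qscale (lk q r) (Z [r, k - r]))"
  have L: "L S = (\<Sum>r\<in>I. lk q r * L (Z [r, k - r]))"
    if "\<And>p q. L (p + q) = L p + L q" "\<And>c p. L (qscale c p) = c * L p" for L :: "qxy \<Rightarrow> rat"
  proof -
    have "L S = ev (\<lambda>w. L (mon w)) S" by (rule functional_eq_ev) (rule that)+
    also have "\<dots> = (\<Sum>r\<in>I. lk q r * ev (\<lambda>w. L (mon w)) (Z [r, k - r]))" by (simp add: S_def ev_sum)
    also have "\<dots> = (\<Sum>r\<in>I. lk q r * L (Z [r, k - r]))"       by (simp only: functional_eq_ev[of L, OF that, symmetric])
    finally show ?thesis .
  qed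
  have "S \<in> h0" unfolding S_def h0_def
    by (intro qvec.span_sum qvec.span_scale) (use Z_h0 in \<open>simp add: h0_def\<close>)
  moreover have "qscale c (Z [k]) \<in> h0" for c
    using Z_h0[of "[k]"] unfolding h0_def by (rule qvec.span_scale)
  ultimately have "(\<exists>c. fz_eq S (qscale c (Z [k]))) \<longleftrightarrow> (\<exists>c. S - qscale c (Z [k]) \<in> qvec.span G)"
    unfolding fz_eq_def fz_rel_def G_def by simp
  also have "\<dots> \<longleftrightarrow> S \<in> qvec.span (insert (Z [k]) G)" unfolding qvec.span_insert by simp
  also have "\<dots> \<longleftrightarrow> (\<forall>L. fz_functional L \<longrightarrow> L (Z [k]) = 0 \<longrightarrow> L S = 0)"
  proof
    assume S: "S \<in> qvec.span (insert (Z [k]) G)"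
    show "\<forall>L. fz_functional L \<longrightarrow> L (Z [k]) = 0 \<longrightarrow> L S = 0"
    proof (intro allI impI)
      fix L assume "fz_functional L" and k0: "L (Z [k]) = 0"
      then interpret fz_functional L by simp
      have "L 0 = 0" using L_sc[of 0 0] by simp
      then have "qvec.subspace {p. L p = 0}" by (intro qvec.subspaceI) (auto simp: L_add L_sc)
      then have "qvec.span (insert (Z [k]) G) \<subseteq> {p. L p = 0}"
        by (intro qvec.span_minimal) (auto simp: G_def k0 L_rel)
      then show "L S = 0" using S by blast
    qed
  next
    assume a: "\<forall>L. fz_functional L \<longrightarrow> L (Z [k]) = 0 \<longrightarrow> L S = 0"
    show "S \<in> qvec.span (insert (Z [k]) G)"
    proof (rule ccontr)
      assume "S \<notin> qvec.span (insert (Z [k]) G)"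
      then obtain L where L: "\<forall>p q. L (p + q) = L p + L q" "\<forall>c p. L (qscale c p) = c * (L p :: rat)"
        "\<forall>s\<in>insert (Z [k]) G. L s = 0" "L S = 1" using span_functional by blast
      have "fz_functional L"
      proof
        fix rs ss assume "is_index rs" "is_index ss"
        then have "shuffle (Zstar (mono_word (index_word rs))) (Zstar (mono_word (index_word ss))) - Zstar (stuffle rs ss) \<in> G"
          unfolding G_def by blast
        then show "L (shuffle (Zstar (mono_word (index_word rs))) (Zstar (mono_word (index_word ss))) - Zstar (stuffle rs ss)) = 0"
          using L(3) by blast
      qed (use L in auto)
      then show False using a L by auto
    qed
  qed
  also have "\<dots> \<longleftrightarrow> (\<forall>L. fz_functional L \<longrightarrow> L (Z [k]) = 0 \<longrightarrow> (\<Sum>r\<in>I. lk q r * L (Z [r, k - r])) = 0)"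
  proof -
    have LL: "L S = (\<Sum>r\<in>I. lk q r * L (Z [r, k - r]))" if "fz_functional L" for L
      by (rule L) (rule fz_functional.L_add[OF that], rule fz_functional.L_sc[OF that])
    show ?thesis
    proof (intro iffI allI impI)
      fix L assume "\<forall>L. fz_functional L \<longrightarrow> L (Z [k]) = 0 \<longrightarrow> L S = 0" and h: "fz_functional L" "L (Z [k]) = 0"
      then have "L S = 0" by blast
      then show "(\<Sum>r\<in>I. lk q r * L (Z [r, k - r])) = 0" unfolding LL[OF h(1)] .
    next
      fix L assume "\<forall>L. fz_functional L \<longrightarrow> L (Z [k]) = 0 \<longrightarrow> (\<Sum>r\<in>I. lk q r * L (Z [r, k - r])) = 0"
        and h: "fz_functional L" "L (Z [k]) = 0"
      then have "(\<Sum>r\<in>I. lk q r * L (Z [r, k - r])) = 0" by blast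
      then show "L S = 0" unfolding LL[OF h(1)] .
    qed
  qed
  finally show ?thesis unfolding R_zeta_def S_def by simp
qed

lemma subspace_R_zeta: "qvec.subspace (R_zeta k)"
  by (rule qvec.subspaceI)
    (auto simp: R_zeta_iff keys_subset_iff lookup_add distrib_right sum.distrib mult.assoc simp flip: sum_distrib_left)

lemma sum_I: "(\<Sum>r\<in>I. h (r - 1)) = (\<Sum>j | even j \<and> 2 \<le> j \<and> j \<le> N - 2. h j)" for h :: "nat \<Rightarrow> rat"
  by (rule sum.reindex_bij_witness[of _ "\<lambda>j. j + 1" "\<lambda>r. r - 1"]) (use k12 in auto)

lemma Z_pair: "r \<in> I \<Longrightarrow> index_word [r, k - r] = xs (r - 1) @ Ly # xs (N - (r - 1)) @ [Ly]"
proof -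
  assume r: "r \<in> I"
  then have "r = Suc (r - 1)" "k - r = Suc (N - (r - 1))" using k12 by auto
  then show ?thesis using index_word_2[of "r - 1" "N - (r - 1)"] by simp
qed

lemma Phi_into: assumes a: "a \<in> R_Lie f k" shows "Phi a \<in> R_zeta k"
  unfolding R_zeta_iff
proof (intro conjI allI impI)
  show "Poly_Mapping.keys (Phi a) \<subseteq> I" by (auto simp: keys_subset_iff lk_Phi)
  fix L assume "fz_functional L" and L0: "L (Z [k]) = 0"
  then interpret fz_functional L by simp
  have k: "Suc (Suc N) = k" using k12 by simp
  note d = depth2[of N, unfolded k, OF L0]
  define e where "e = (\<lambda>j. LS (Zs (xs j @ Ly # xs (N - j) @ [Ly])))"
  define s where "s = (\<lambda>b. LS (zz (index_word [Suc b]) * zz (index_word [Suc (N - b)])))"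
  have E: "Ef (lk a) x y = 0" for x y using a by (simp add: R_Lie_iff)
  have "(\<Sum>r\<in>I. lk (Phi a) r * L (Z [r, k - r])) = (\<Sum>r\<in>I. cf (lk a) (r - 1) * e (r - 1))"
    by (intro sum.cong refl) (simp only: lk_Phi L_Z e_def if_True, simp only: Z_pair)
  also have "\<dots> = (\<Sum>j | even j \<and> 2 \<le> j \<and> j \<le> N - 2. cf (lk a) j * e j)" by (rule sum_I)
  also have "\<dots> = 0"
  proof (rule even_sum_zero[OF E, of s])
    fix b assume b: "1 \<le> b" "b < N"
    show "s b = e b + e (N - b)" "s b = (\<Sum>j\<le>N. (of_nat (j choose b) + of_nat (j choose (N - b))) * e j)"
      unfolding s_def e_def by (rule d(1)[OF b], rule d(2)[OF b])
    show "s b = 0" if "odd b" unfolding s_def by (rule d(3)[OF b N_even that])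
  qed
  finally show "(\<Sum>r\<in>I. lk (Phi a) r * L (Z [r, k - r])) = 0" .
qed

lemma Phi_inj: "inj_on Phi (R_Lie f k)"
proof (rule inj_onI)
  fix a b assume ab: "a \<in> R_Lie f k" "b \<in> R_Lie f k" "Phi a = Phi b"
  define d where "d = a + qscale (-1) b"
  have d: "d \<in> R_Lie f k" unfolding d_def using ab subspace_R_Lie qvec.subspace_add qvec.subspace_scale by blast
  have "Phi d = 0" unfolding d_def Phi_lin ab(3) by (rule poly_mapping_eqI) (simp add: lookup_add)
  then have z: "cf (lk d) j = 0" if "even j" "2 \<le> j" "j \<le> N - 2" for j
  proof -
    have "Suc j \<in> I" using that k12 by auto
    then show ?thesis using lk_Phi[of d "Suc j"] \<open>Phi d = 0\<close> by simp
  qed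
  have "lk d i = 0" for i
  proof (cases "i \<in> {1..m}")
    case True
    then show ?thesis using cf_inj[of "lk d" i] d z by (auto simp: R_Lie_iff)
  next
    case False
    then show ?thesis using d by (auto simp: R_Lie_iff keys_subset_iff)
  qed
  moreover have "lk d i = lk a i + (- 1) * lk b i" for i by (simp only: d_def lookup_add lookup_qscale)
  ultimately have "lk a i = lk b i" for i by (simp add: eq_neg_iff_add_eq_0)
  then show "a = b" by (rule poly_mapping_eqI)
qed

text \<open>For each even al, the functional of f_(al+1) and f_(be+1) with al + be = N kills Z(k),
  since \<open>W\<close> has depth at least two. Testing the relation q on all of them gives the
  hypothesis of \<open>cf_surj\<close>.\<close>

lemma Phi_surj: assumes q: "q \<in> R_zeta k" shows "\<exists>a\<in>R_Lie f k. Phi a = q"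
proof -
  define c where "c j = (if even j \<and> 2 \<le> j \<and> j \<le> N - 2 then lk q (j + 1) else 0)" for j
  have S: "(\<Sum>j\<le>N. c j * (of_nat (al choose j) + (if j = N - al then 1 else 0) - (if N - al \<le> j then of_nat (al choose (j - (N - al))) else 0))) = 0"
    if al: "even al" "2 \<le> al" "al \<le> N - 2" for al
  proof -
    define be where "be = N - al"
    have be: "even be" "2 \<le> be" "al + be = N" "Suc al + Suc be = k" using al N_even k12 by (auto simp: be_def)
    have o: "odd_ds (f (Suc al)) (Suc al)" "odd_ds (f (Suc be)) (Suc be)" using al be by (auto intro!: odd_f)
    have f1: "lk (f (Suc al)) (xs al @ [Ly]) = 1" "lk (f (Suc be)) (xs be @ [Ly]) = 1"
      using f_1[of "Suc al"] f_1[of "Suc be"] al be by auto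
    interpret two_ds "f (Suc al)" "Suc al" "f (Suc be)" "Suc be" using o by (simp add: two_ds_def)
    have k1: "index_word [k] = xs (k - 1) @ [Ly]" using index_word_1[of "k - 1"] k12 by simp
    have "count_list (xs (k - 1) @ [Ly]) Ly < 2" by simp
    then have "ev (lk W) (Z [k]) = 0" unfolding W_Z unfolding k1 by (rule W_depth)
    then have "(\<Sum>r\<in>I. lk q r * ev (lk W) (Z [r, k - r])) = 0" using q fz_W unfolding R_zeta_iff by blast
    moreover have "(\<Sum>r\<in>I. lk q r * ev (lk W) (Z [r, k - r])) = (\<Sum>r\<in>I. c (r - 1) * lk W (xs (r - 1) @ Ly # xs (N - (r - 1)) @ [Ly]))"
      unfolding W_Z
    proof (intro sum.cong refl)
      fix r assume r: "r \<in> I"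
      then have "c (r - 1) = lk q r" using k12 by (auto simp: c_def)
      then show "lk q r * lk W (index_word [r, k - r]) = c (r - 1) * lk W (xs (r - 1) @ Ly # xs (N - (r - 1)) @ [Ly])"
        using Z_pair[OF r] by simp
    qed
    moreover have "\<dots> = (\<Sum>j | even j \<and> 2 \<le> j \<and> j \<le> N - 2. c j * lk W (xs j @ Ly # xs (N - j) @ [Ly]))" by (rule sum_I)
    moreover have "\<dots> = (\<Sum>j\<le>N. c j * (of_nat (al choose j) + (if j = be then 1 else 0) - (if be \<le> j then of_nat (al choose (j - be)) else 0)))"
    proof (rule sum.mono_neutral_cong_left)
      fix j assume "j \<in> {j. even j \<and> 2 \<le> j \<and> j \<le> N - 2}"
      then have j: "even j" "j \<le> N" by auto
      show "c j * lk W (xs j @ Ly # xs (N - j) @ [Ly]) = c j * (of_nat (al choose j) + (if j = be then 1 else 0) - (if be \<le> j then of_nat (al choose (j - be)) else 0))"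
        unfolding sf_coeffs[OF o f1 be(3) j(2)] using j(1) be(1) by auto
    qed (auto simp: c_def)
    ultimately show ?thesis unfolding be_def by simp
  qed
  define a' where "a' i = of_nat (N choose (2 * i)) * (c (2 * i) - c (N - 2 * i))" for i
  define a where "a = (\<Sum>i\<in>{1..m}. Poly_Mapping.single i (a' i))"
  have la: "lk a i = (if i \<in> {1..m} then a' i else 0)" for i
    by (simp add: a_def lk_sum lookup_single when_def)
  have c0: "c j = 0" if "\<not> (even j \<and> 2 \<le> j \<and> j \<le> N - 2)" for j using that by (auto simp: c_def)
  have P: "PA (lk a) x y = PA a' x y" for x y unfolding PA_def by (intro sum.cong refl) (simp add: la)
  have C: "cf (lk a) j = cf a' j" for j unfolding cf_def by (intro arg_cong2[where f = "(/)"] sum.cong refl) (simp add: la)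
  have E: "Ef (lk a) x y = 0" for x y using cf_surj(1)[OF c0 S, of x y] unfolding Ef_def P a'_def[abs_def] by simp
  have cc: "cf (lk a) j = c j" if "even j" "j \<le> N" for j using cf_surj(2)[OF c0 S that] unfolding C a'_def[abs_def] by simp
  have "a \<in> R_Lie f k" using E by (simp add: R_Lie_iff keys_subset_iff la)
  moreover have "Phi a = q"
  proof (rule poly_mapping_eqI)
    fix r
    show "lk (Phi a) r = lk q r"
    proof (cases "r \<in> I")
      case True
      then have "cf (lk a) (r - 1) = c (r - 1)" by (intro cc) auto
      also have "\<dots> = lk q r" using True by (auto simp: c_def)
      finally show ?thesis using True by (simp only: lk_Phi if_True)
    next
      case False
      then have "lk q r = 0" using q unfolding R_zeta_iff keys_subset_iff by blast
      then show ?thesis using False by (simp only: lk_Phi if_False)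
    qed
  qed
  ultimately show ?thesis by blast
qed

lemma bij_Phi: "bij_betw Phi (R_Lie f k) (R_zeta k)"
  unfolding bij_betw_def using Phi_inj Phi_into Phi_surj by blast

end

theorem theorem3p1:
  fixes k :: nat and f :: "nat \<Rightarrow> qxy"
  assumes "k \<ge> 12" and "even k"
    and "\<And>n. odd n \<Longrightarrow> n \<ge> 3 \<Longrightarrow>
           f n \<in> ds_deg n \<and> depth (f n) = 1 \<and> Poly_Mapping.lookup (f n) (replicate (n - 1) Lx @ [Ly]) = 1"
  shows "qvec.subspace (R_Lie f k) \<and> qvec.subspace (R_zeta k) \<and>
    (\<exists>\<Phi> :: (nat \<Rightarrow>\<^sub>0 rat) \<Rightarrow> (nat \<Rightarrow>\<^sub>0 rat).
       Vector_Spaces.linear qscale qscale \<Phi> \<and>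
       bij_betw \<Phi> (R_Lie f k) (R_zeta k) \<and>
       (\<forall>a\<in>R_Lie f k. \<exists>q :: nat \<Rightarrow> rat.
          P_poly k a (polX + polY) polY =
            (\<Sum>r = 1..k - 3. polC (of_nat ((k - 2) choose (r - 1)) * q r)
                               * polX ^ (r - 1) * polY ^ (k - r - 1)) \<and>
          (\<forall>r\<in>{3..k - 3}. odd r \<longrightarrow> Poly_Mapping.lookup (\<Phi> a) r = q r)))"
proof -
  interpret odd_generators k f using assms by unfold_locales auto
  have "\<exists>q. P_poly k a (polX + polY) polY =
            (\<Sum>r = 1..k - 3. polC (of_nat ((k - 2) choose (r - 1)) * q r) * polX ^ (r - 1) * polY ^ (k - r - 1)) \<and>
          (\<forall>r\<in>{3..k - 3}. odd r \<longrightarrow> lk (Phi a) r = q r)" for a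
    by (rule exI[of _ "\<lambda>r. cf (lk a) (r - 1)"], rule conjI[OF P_poly_q]) (simp add: lk_Phi)
  then show ?thesis using subspace_R_Lie subspace_R_zeta linear_Phi bij_Phi by blast
qed

end
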